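(* $(1+\varepsilon)$-Approximate Directed All-Pairs Shortest Paths can be solved in strongly polynomial time $\tilde{\mathcal{O}}(n^{\frac{\omega+3}{2}}/\varepsilon)$.
   Context: Input: a directed graph $G$ on $n$ nodes with edge weights in $\mathbb{R}_+=\{a\in\mathbb{R}:a\ge1\}\cup\{\infty\}$, and $0<\varepsilon<1/10$; $W$ is the largest finite weight. Output: values $\tilde d(u,v)$ for all nodes $u,v$ with $d_G(u,v)\le\tilde d(u,v)\le(1+\varepsilon)d_G(u,v)$, where $d_G(u,v)$ is the shortest-path distance from $u$ to $v$. "Strongly polynomial time $T$" means the number of arithmetic operations (on a RAM / Word RAM with input weights in floating-point representation, unit-cost arithmetic) is at most $T$, independent of $W$. $\tilde{\mathcal{O}}$ hides polylogarithmic factors in $n$ and $1/\varepsilon$, but never $\log W$. $\omega$ is the matrix multiplication exponent. *)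

theory Defs
  imports Complex_Main "HOL-Library.Extended_Real"
begin

section \<open>Word RAM\<close>

text \<open>
  A deterministic Word RAM with word size \<open>w\<close>: registers and memory cells hold naturals below
  \<open>2 ^ w\<close>, every instruction has unit cost, and a program has to work uniformly in \<open>w\<close>.
  The bound on the word size matters: with unit-cost arithmetic on unbounded integers one could
  pack whole matrices into single numbers.
\<close>

datatype binop = Add | Sub | Mul | Div | Mod | And | Or | Xor | Shl | Shr

fun eval_binop :: "nat \<Rightarrow> binop \<Rightarrow> nat \<Rightarrow> nat \<Rightarrow> nat" where
  "eval_binop w Add x y = (x + y) mod 2 ^ w"
| "eval_binop w Sub x y = (if y \<le> x then x - y else 2 ^ w + x - y)"
| "eval_binop w Mul x y = (x * y) mod 2 ^ w"
| "eval_binop w Div x y = x div y"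
| "eval_binop w Mod x y = x mod y"
| "eval_binop w And x y = semiring_bit_operations_class.and x y"
| "eval_binop w Or x y = semiring_bit_operations_class.or x y"
| "eval_binop w Xor x y = semiring_bit_operations_class.xor x y"
| "eval_binop w Shl x y = (x * 2 ^ y) mod 2 ^ w"
| "eval_binop w Shr x y = x div 2 ^ y"

datatype instr =
    Imm nat nat               \<comment> \<open>\<open>Imm r k\<close>: \<open>r := k mod 2 ^ w\<close>\<close>
  | Op binop nat nat nat      \<comment> \<open>\<open>Op f r a b\<close>: \<open>r := f a b\<close>\<close>
  | Load nat nat              \<comment> \<open>\<open>Load r a\<close>: \<open>r := mem[a]\<close>\<close>
  | Store nat nat             \<comment> \<open>\<open>Store a r\<close>: \<open>mem[a] := r\<close>\<close>
  | Jump nat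
  | JumpLess nat nat nat      \<comment> \<open>\<open>JumpLess a b l\<close>: if \<open>a < b\<close> goto \<open>l\<close>\<close>

type_synonym prog = "instr list"

record state =
  pc :: nat
  reg :: "nat \<Rightarrow> nat"
  mem :: "nat \<Rightarrow> nat"

fun exec :: "nat \<Rightarrow> instr \<Rightarrow> state \<Rightarrow> state" where
  "exec w (Imm r k) s = s\<lparr>pc := pc s + 1, reg := (reg s)(r := k mod 2 ^ w)\<rparr>"
| "exec w (Op f r a b) s =
     s\<lparr>pc := pc s + 1, reg := (reg s)(r := eval_binop w f (reg s a) (reg s b))\<rparr>"
| "exec w (Load r a) s = s\<lparr>pc := pc s + 1, reg := (reg s)(r := mem s (reg s a))\<rparr>"
| "exec w (Store a r) s = s\<lparr>pc := pc s + 1, mem := (mem s)(reg s a := reg s r)\<rparr>"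
| "exec w (Jump l) s = s\<lparr>pc := l\<rparr>"
| "exec w (JumpLess a b l) s = s\<lparr>pc := (if reg s a < reg s b then l else pc s + 1)\<rparr>"

definition halted :: "prog \<Rightarrow> state \<Rightarrow> bool" where
  "halted P s \<longleftrightarrow> length P \<le> pc s"

definition step :: "nat \<Rightarrow> prog \<Rightarrow> state \<Rightarrow> state" where
  "step w P s = (if halted P s then s else exec w (P ! pc s) s)"

definition halts_within :: "nat \<Rightarrow> prog \<Rightarrow> real \<Rightarrow> state \<Rightarrow> state \<Rightarrow> bool" where
  "halts_within w P T s s' \<longleftrightarrow>
     (\<exists>t. real t \<le> T \<and> (step w P ^^ t) s = s' \<and> halted P s')"

section \<open>The matrix multiplication exponent\<close>

definition matmul_input :: "nat \<Rightarrow> nat \<Rightarrow> (nat \<Rightarrow> nat \<Rightarrow> nat) \<Rightarrow> (nat \<Rightarrow> nat \<Rightarrow> nat) \<Rightarrow> state \<Rightarrow> bool" where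
  "matmul_input w n A B s \<longleftrightarrow>
     pc s = 0 \<and>
     reg s = (\<lambda>r. if r = 0 then w else if r = 1 then n else 0) \<and>
     (\<forall>i<n. \<forall>j<n. mem s (i * n + j) = A i j \<and> mem s (n * n + i * n + j) = B i j) \<and>
     (\<forall>a\<ge>2 * n * n. mem s a = 0)"

definition matmul_output :: "nat \<Rightarrow> (nat \<Rightarrow> nat \<Rightarrow> nat) \<Rightarrow> state \<Rightarrow> bool" where
  "matmul_output n D s \<longleftrightarrow> (\<forall>i<n. \<forall>j<n. mem s (2 * n * n + i * n + j) = D i j)"

text \<open>
  Multiplication of \<open>n \<times> n\<close> integer matrices in \<open>O(n\<^sup>\<tau>)\<close> operations. The word size is any number
  that is at least a constant factor times the bit length of the input numbers; the number of
  operations does not depend on it.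
\<close>

definition matmul_in_time :: "real \<Rightarrow> bool" where
  "matmul_in_time \<tau> \<longleftrightarrow>
     (\<exists>P C c. c > 0 \<and>
       (\<forall>n w K A B s.
          n \<ge> 1 \<longrightarrow> (\<forall>i<n. \<forall>j<n. A i j \<le> K \<and> B i j \<le> K) \<longrightarrow>
          c * log 2 (real n + real K + 1) \<le> real w \<longrightarrow>
          matmul_input w n A B s \<longrightarrow>
          (\<exists>s'. halts_within w P (C * real n powr \<tau>) s s' \<and>
                matmul_output n (\<lambda>i j. \<Sum>k<n. A i k * B k j) s')))"

text \<open>
  The infimum need not be attained. A bound in terms of \<open>\<omega>\<close> therefore means: the bound with \<open>\<omega>\<close> itself if
  matrix multiplication is possible in \<open>O(n\<^sup>\<omega>)\<close>, and the bound with \<open>\<omega> + \<delta>\<close> for every \<open>\<delta> > 0\<close>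
  in any case.
\<close>

definition omega :: real ("\<omega>") where
  "\<omega> = Inf {\<tau>. matmul_in_time \<tau>}"

section \<open>Weighted directed graphs\<close>

text \<open>
  The nodes are \<open>0, \<dots>, n - 1\<close>; the weight \<open>\<infinity>\<close> stands for a missing edge.
\<close>

definition weighted_digraph :: "nat \<Rightarrow> (nat \<Rightarrow> nat \<Rightarrow> ereal) \<Rightarrow> bool" where
  "weighted_digraph n G \<longleftrightarrow> n \<ge> 1 \<and> (\<forall>u<n. \<forall>v<n. 1 \<le> G u v)"

definition walks :: "nat \<Rightarrow> nat \<Rightarrow> nat \<Rightarrow> nat list set" where
  "walks n u v = {p. p \<noteq> [] \<and> hd p = u \<and> last p = v \<and> set p \<subseteq> {..<n}}"

definition walk_weight :: "(nat \<Rightarrow> nat \<Rightarrow> ereal) \<Rightarrow> nat list \<Rightarrow> ereal" where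
  "walk_weight G p = (\<Sum>i<length p - 1. G (p ! i) (p ! Suc i))"

definition distance :: "nat \<Rightarrow> (nat \<Rightarrow> nat \<Rightarrow> ereal) \<Rightarrow> nat \<Rightarrow> nat \<Rightarrow> ereal" where
  "distance n G u v = (INF p\<in>walks n u v. walk_weight G p)"

text \<open>The additional \<open>1\<close> only matters if there is no finite weight at all.\<close>

definition max_weight :: "nat \<Rightarrow> (nat \<Rightarrow> nat \<Rightarrow> ereal) \<Rightarrow> real" where
  "max_weight n G =
     Max (insert 1 {real_of_ereal (G u v) |u v. u < n \<and> v < n \<and> G u v \<noteq> \<infinity>})"

section \<open>Floating-point representation\<close>

text \<open>
  A real \<open>x > 0\<close> is represented by its exponent \<open>e = \<lfloor>log 2 x\<rfloor>\<close> and the \<open>w\<close>-bit mantissa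
  \<open>m \<in> {2 ^ (w - 1)..<2 ^ w}\<close> with \<open>x = m * 2 ^ e / 2 ^ (w - 1)\<close>. The mantissa is truncated if
  \<open>x\<close> has a longer binary expansion, so that arbitrary real inputs are covered and inputs that are
  \<open>w\<close>-bit floating-point numbers are represented exactly.
\<close>

definition fl_exponent :: "real \<Rightarrow> int" where
  "fl_exponent x = \<lfloor>log 2 x\<rfloor>"

definition fl_mantissa :: "nat \<Rightarrow> real \<Rightarrow> nat" where
  "fl_mantissa w x = nat \<lfloor>x * 2 powr (real w - 1 - real_of_int (fl_exponent x))\<rfloor>"

text \<open>
  Weights and distances are \<open>0\<close>, at least \<open>1\<close>, or infinite, hence their exponents are natural
  numbers. Mantissa \<open>0\<close> encodes \<open>0\<close> or, with a nonzero exponent word, infinity.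
\<close>

definition fl_encode :: "nat \<Rightarrow> ereal \<Rightarrow> nat \<times> nat" where
  "fl_encode w x =
     (if x = \<infinity> then (0, 1)
      else (fl_mantissa w (real_of_ereal x), nat (fl_exponent (real_of_ereal x))))"

definition fl_decode :: "nat \<Rightarrow> nat \<times> nat \<Rightarrow> ereal" where
  "fl_decode w me = (case me of (m, e) \<Rightarrow>
     if m = 0 then (if e = 0 then 0 else \<infinity>)
     else ereal (real m * 2 ^ e / 2 ^ (w - 1)))"

section \<open>Approximate all-pairs shortest paths\<close>

text \<open>Since \<open>\<epsilon> < 1\<close>, its exponent is negative and register 3 holds the absolute value.\<close>

definition apsp_input :: "nat \<Rightarrow> nat \<Rightarrow> (nat \<Rightarrow> nat \<Rightarrow> ereal) \<Rightarrow> real \<Rightarrow> state \<Rightarrow> bool" where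
  "apsp_input w n G \<epsilon> s \<longleftrightarrow>
     pc s = 0 \<and>
     reg s = (\<lambda>r. if r = 0 then w else if r = 1 then n
                  else if r = 2 then fl_mantissa w \<epsilon>
                  else if r = 3 then nat (- fl_exponent \<epsilon>) else 0) \<and>
     (\<forall>u<n. \<forall>v<n.
        (mem s (2 * (u * n + v)), mem s (2 * (u * n + v) + 1)) = fl_encode w (G u v)) \<and>
     (\<forall>a\<ge>2 * n * n. mem s a = 0)"

definition apsp_output :: "nat \<Rightarrow> nat \<Rightarrow> state \<Rightarrow> nat \<Rightarrow> nat \<Rightarrow> ereal" where
  "apsp_output w n s u v =
     fl_decode w (mem s (2 * (u * n + v)), mem s (2 * (u * n + v) + 1))"

text \<open>
  Solvability of \<open>(1 + \<epsilon>)\<close>-approximate directed all-pairs shortest paths in strongly polynomial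
  time \<open>T n \<epsilon>\<close>, up to a factor polylogarithmic in \<open>n / \<epsilon>\<close>. The numbers of the input fit into
  a constant number of words of \<open>O(log (n / \<epsilon>) + log log W)\<close> bits; the number of operations
  depends neither on the word size nor on \<open>W\<close>.
\<close>

definition approx_apsp_in_soft_time :: "(nat \<Rightarrow> real \<Rightarrow> real) \<Rightarrow> bool" where
  "approx_apsp_in_soft_time T \<longleftrightarrow>
     (\<exists>P C (k::nat) c. c > 0 \<and>
       (\<forall>n G \<epsilon> w s.
          weighted_digraph n G \<longrightarrow> 0 < \<epsilon> \<longrightarrow> \<epsilon> < 1 / 10 \<longrightarrow>
          c * (log 2 (real n / \<epsilon>) + log 2 (2 + log 2 (max_weight n G))) \<le> real w \<longrightarrow>
          apsp_input w n G \<epsilon> s \<longrightarrow>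
          (\<exists>s'. halts_within w P (C * T n \<epsilon> * ln (real n / \<epsilon>) ^ k) s s' \<and>
                (\<forall>u<n. \<forall>v<n.
                   distance n G u v \<le> apsp_output w n s' u v \<and>
                   apsp_output w n s' u v \<le> ereal (1 + \<epsilon>) * distance n G u v))))"

end

theory Submission
  imports Defs
begin

text \<open>
  Distances are obtained by \<open>\<lceil>log 2 n\<rceil>\<close> approximate min-plus squarings. A distance is stored as an integer
  multiple of a small logarithmic unit, so its key has only \<open>O(log (n / \<epsilon>) + log log W)\<close> bits and no
  scaling over the weights is needed. On this scale \<open>x + y\<close> with \<open>y \<le> x\<close> is \<open>x (1 + t / U)\<close> up to a factor
  \<open>1 + O(1 / U)\<close>, where \<open>t\<close> is the least number with \<open>y \<le> x t / U\<close>. Hence one squaring amounts, for every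
  \<open>t \<le> U = O(log n / \<epsilon>)\<close>, to finding the least \<open>D i k\<close> with \<open>D k j + l\<^sub>t \<le> D i k\<close>, and symmetrically:
  a dominance problem that does not depend on the size of the keys.

  The dominance problem is solved in the style of Matousek. All entries are sorted, rows and columns are cut into
  blocks of \<open>q\<close> entries, the entries are processed in groups of \<open>n q\<close> consecutive ranks, and each of the \<open>n / q\<close>
  groups costs one Boolean product of dimension \<open>O(n)\<close>; what is left inside the blocks is scanned in
  \<open>O(n\<^sup>2 q)\<close> steps. Balancing gives \<open>n q\<^sup>2 = n\<^sup>\<tau>\<close>, that is \<open>O(n powr ((\<tau> + 3) / 2))\<close>. Since \<open>\<tau>\<close> need not be
  computable, the matrix multiplication program is run with a budget of \<open>n q\<^sup>2\<close> steps and \<open>q\<close> is doubled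
  whenever a run does not finish.
\<close>

section \<open>A structured language\<close>

datatype aexp = N nat | V nat | Bin binop aexp aexp | Read nat aexp aexp  ("_\<langle>_,/ _\<rangle>" [1000, 0, 0] 1000)

abbreviation (input) plus_aexp (infixl "\<oplus>" 65) where "a \<oplus> b \<equiv> Bin Add a b"
abbreviation (input) minus_aexp (infixl "\<ominus>" 65) where "a \<ominus> b \<equiv> Bin Sub a b"
abbreviation (input) times_aexp (infixl "\<otimes>" 70) where "a \<otimes> b \<equiv> Bin Mul a b"
abbreviation (input) div_aexp (infixl "\<oslash>" 70) where "a \<oslash> b \<equiv> Bin Div a b"
abbreviation (input) mod_aexp (infixl "\<odot>" 70) where "a \<odot> b \<equiv> Bin Mod a b"

datatype com =
    SKIP
  | Assign nat aexp  ("_ ::= _" [1000, 61] 61)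
  | Write nat aexp aexp aexp  ("_\<langle>_,/ _\<rangle> \<leftarrow> _" [1000, 0, 0, 61] 61)
  | Seq com com  (infixr ";;" 60)
  | Cond aexp aexp com com  ("(IF _/ \<prec> _/ THEN _/ ELSE _)" [0, 0, 0, 61] 61)
  | While aexp aexp com  ("(WHILE _/ \<prec> _/ DO _)" [0, 0, 61] 61)
  | Simulate

definition For :: "nat \<Rightarrow> nat \<Rightarrow> com \<Rightarrow> com"  ("(FOR _/ \<prec> _/ DO _)" [1000, 1000, 61] 61) where
  "FOR x \<prec> h DO c = x ::= N 0 ;; WHILE V x \<prec> V h DO (c ;; x ::= V x \<oplus> N 1)"

type_synonym matrix = "nat \<Rightarrow> nat \<Rightarrow> nat"

record store =
  var :: "nat \<Rightarrow> nat"
  arr :: "nat \<Rightarrow> matrix"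

lemma store_update_commute [simp]: "s\<lparr>arr := A, var := f\<rparr> = s\<lparr>var := f, arr := A\<rparr>"
  by simp

fun binop_val :: "binop \<Rightarrow> nat \<Rightarrow> nat \<Rightarrow> nat" where
  "binop_val Add x y = x + y"
| "binop_val Sub x y = x - y"
| "binop_val Mul x y = x * y"
| "binop_val Div x y = x div y"
| "binop_val Mod x y = x mod y"
| "binop_val Shl x y = x * 2 ^ y"
| "binop_val Shr x y = x div 2 ^ y"
| "binop_val _ x y = 0"

fun no_overflow :: "nat \<Rightarrow> binop \<Rightarrow> nat \<Rightarrow> nat \<Rightarrow> bool" where
  "no_overflow W Add x y \<longleftrightarrow> x + y < W"
| "no_overflow W Sub x y \<longleftrightarrow> y \<le> x"
| "no_overflow W Mul x y \<longleftrightarrow> x * y < W"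
| "no_overflow W Div x y \<longleftrightarrow> True"
| "no_overflow W Mod x y \<longleftrightarrow> True"
| "no_overflow W Shl x y \<longleftrightarrow> x * 2 ^ y < W"
| "no_overflow W Shr x y \<longleftrightarrow> True"
| "no_overflow W _ x y \<longleftrightarrow> False"

lemma eval_binop_eq_binop_val: "no_overflow (2 ^ w) f x y \<Longrightarrow> eval_binop w f x y = binop_val f x y"
  by (cases f) auto

fun aval :: "aexp \<Rightarrow> store \<Rightarrow> nat" where
  "aval (N k) s = k"
| "aval (V x) s = var s x"
| "aval (Bin f a b) s = binop_val f (aval a s) (aval b s)"
| "aval (Read a e1 e2) s = arr s a (aval e1 s) (aval e2 s)"

definition arr_upd :: "(nat \<Rightarrow> matrix) \<Rightarrow> nat \<Rightarrow> nat \<Rightarrow> nat \<Rightarrow> nat \<Rightarrow> nat \<Rightarrow> matrix" where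
  "arr_upd f a i j v = (\<lambda>a' i' j'. if a' = a \<and> i' = i \<and> j' = j then v else f a' i' j')"

lemma arr_upd_other [simp]: "a' \<noteq> a \<Longrightarrow> arr_upd f a i j v a' = f a'"
  by (auto simp: arr_upd_def)

lemma arr_upd_same [simp]: "arr_upd f a i j v a = (\<lambda>i' j'. if i' = i \<and> j' = j then v else f a i' j')"
  by (auto simp: arr_upd_def)

text \<open>
  \<open>Simulate\<close> runs a guest program (later: matrix multiplication) for \<open>vbudget\<close> steps on the memory
  \<open>arr s aguest (var s vslot)\<close>. The variables \<open>vws\<close> and \<open>vdim\<close> hold its two input registers, and
  \<open>vhalted\<close> receives whether it halted.
\<close>

abbreviation (input) "vn \<equiv> 2 :: nat"
abbreviation (input) "vws \<equiv> 3 :: nat"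
abbreviation (input) "vinf \<equiv> 4 :: nat"
abbreviation (input) "vdim \<equiv> 5 :: nat"
abbreviation (input) "vslot \<equiv> 6 :: nat"
abbreviation (input) "vbudget \<equiv> 7 :: nat"
abbreviation (input) "vhalted \<equiv> 8 :: nat"
abbreviation (input) "aguest \<equiv> 2 :: nat"

definition guest_start :: "store \<Rightarrow> state" where
  "guest_start s = \<lparr>pc = 0, reg = (\<lambda>r. if r = 0 then var s vws else if r = 1 then var s vdim else 0),
     mem = arr s aguest (var s vslot)\<rparr>"

definition guest_return :: "prog \<Rightarrow> store \<Rightarrow> state \<Rightarrow> store" where
  "guest_return P s \<sigma> = s\<lparr>var := (var s)(vhalted := if halted P \<sigma> then 1 else 0),
     arr := (arr s)(aguest := (arr s aguest)(var s vslot := mem \<sigma>))\<rparr>"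

fun assigned :: "com \<Rightarrow> nat set" where
  "assigned SKIP = {}"
| "assigned (x ::= e) = {x}"
| "assigned (Write a e1 e2 e3) = {}"
| "assigned (c1 ;; c2) = assigned c1 \<union> assigned c2"
| "assigned (Cond e1 e2 c1 c2) = assigned c1 \<union> assigned c2"
| "assigned (While e1 e2 c) = assigned c"
| "assigned Simulate = {vhalted}"

fun written :: "com \<Rightarrow> nat set" where
  "written SKIP = {}"
| "written (x ::= e) = {}"
| "written (Write a e1 e2 e3) = {a}"
| "written (c1 ;; c2) = written c1 \<union> written c2"
| "written (Cond e1 e2 c1 c2) = written c1 \<union> written c2"
| "written (While e1 e2 c) = written c"
| "written Simulate = {aguest}"

fun loop_free :: "com \<Rightarrow> bool" where
  "loop_free (c1 ;; c2) \<longleftrightarrow> loop_free c1 \<and> loop_free c2"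
| "loop_free (Cond e1 e2 c1 c2) \<longleftrightarrow> loop_free c1 \<and> loop_free c2"
| "loop_free (While e1 e2 c) \<longleftrightarrow> False"
| "loop_free Simulate \<longleftrightarrow> False"
| "loop_free _ \<longleftrightarrow> True"

lemma assigned_For [simp]: "assigned (FOR x \<prec> h DO c) = insert x (assigned c)"
  and written_For [simp]: "written (FOR x \<prec> h DO c) = written c"
  and not_loop_free_For [simp]: "\<not> loop_free (FOR x \<prec> h DO c)"
  by (auto simp: For_def)

definition frame :: "nat set \<Rightarrow> nat set \<Rightarrow> store \<Rightarrow> store \<Rightarrow> bool" where
  "frame X A s s' \<longleftrightarrow> (\<forall>y. y \<notin> X \<longrightarrow> var s' y = var s y) \<and> (\<forall>a. a \<notin> A \<longrightarrow> arr s' a = arr s a)"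

abbreviation "frame_of c \<equiv> frame (assigned c) (written c)"

lemma frame_refl: "frame X A s s" by (simp add: frame_def)

lemma frame_trans: "frame X A s s1 \<Longrightarrow> frame X' A' s1 s2 \<Longrightarrow> frame (X \<union> X') (A \<union> A') s s2"
  by (auto simp: frame_def)

lemma frame_trans_same: "frame X A s s1 \<Longrightarrow> frame X A s1 s2 \<Longrightarrow> frame X A s s2"
  by (auto simp: frame_def)

text \<open>
  Host words are four times as long as the guest words of \<open>ws\<close> bits, so the address
  \<open>(a * R + i) * R + j\<close> of a cell with \<open>a, i, j < R = 2 ^ ws\<close> fits into a word.
\<close>

locale ram =
  fixes w :: nat and P :: prog and W R ws :: nat
  assumes W_def: "W = 2 ^ w" and R_def: "R = 2 ^ ws" and ws_def: "ws = w div 4" and R_ge: "1000 \<le> R"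
begin

lemma R_cubed_le_W: "R * R * R \<le> W"
proof -
  have "R * R * R = 2 ^ (ws + ws + ws)" unfolding R_def by (simp only: power_add)
  also have "\<dots> \<le> 2 ^ w" by (rule power_increasing) (auto simp: ws_def)
  finally show ?thesis by (simp add: W_def)
qed

lemma word_bounds: "R < W" "3 < R" "3 * R < W" "100 < W" "1 < W" "0 < W"
proof -
  have "1000 * R * 1 \<le> R * R * R" using R_ge by (intro mult_le_mono) auto
  then have "1000 * R \<le> W" using R_cubed_le_W by linarith
  then show "R < W" "3 < R" "3 * R < W" "100 < W" "1 < W" "0 < W" using R_ge by linarith+
qed

fun safe :: "aexp \<Rightarrow> store \<Rightarrow> bool" where
  "safe (N k) s \<longleftrightarrow> k < W"
| "safe (V x) s \<longleftrightarrow> True"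
| "safe (Bin f a b) s \<longleftrightarrow> safe a s \<and> safe b s \<and> no_overflow W f (aval a s) (aval b s)"
| "safe (Read a e1 e2) s \<longleftrightarrow> safe e1 s \<and> safe e2 s \<and> a < 1000 \<and> aval e1 s < R \<and> aval e2 s < R"

definition guest_ready :: "store \<Rightarrow> bool" where
  "guest_ready s \<longleftrightarrow> var s vbudget < W \<and> var s vslot < R \<and> var s vws = ws \<and> var s vdim < R \<and> (\<forall>j. arr s aguest (var s vslot) j < R)"

definition guest_final :: "store \<Rightarrow> state" where
  "guest_final s = (step ws P ^^ var s vbudget) (guest_start s)"

text \<open>
  The number in the middle counts loop iterations and guest steps only; the size of the compiled
  program pays for everything in between.
\<close>

inductive big_step :: "com \<Rightarrow> store \<Rightarrow> nat \<Rightarrow> store \<Rightarrow> bool" where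
  Skip: "big_step SKIP s 0 s"
| Assign: "safe e s \<Longrightarrow> big_step (x ::= e) s 0 (s\<lparr>var := (var s)(x := aval e s)\<rparr>)"
| Write: "safe e1 s \<Longrightarrow> safe e2 s \<Longrightarrow> safe e3 s \<Longrightarrow> a < 1000 \<Longrightarrow> aval e1 s < R \<Longrightarrow> aval e2 s < R \<Longrightarrow>
    big_step (Write a e1 e2 e3) s 0 (s\<lparr>arr := arr_upd (arr s) a (aval e1 s) (aval e2 s) (aval e3 s)\<rparr>)"
| Seq: "big_step c1 s t1 s1 \<Longrightarrow> big_step c2 s1 t2 s2 \<Longrightarrow> big_step (c1 ;; c2) s (t1 + t2) s2"
| CondTrue: "safe e1 s \<Longrightarrow> safe e2 s \<Longrightarrow> aval e1 s < aval e2 s \<Longrightarrow> big_step c1 s t s' \<Longrightarrow> big_step (Cond e1 e2 c1 c2) s t s'"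
| CondFalse: "safe e1 s \<Longrightarrow> safe e2 s \<Longrightarrow> \<not> aval e1 s < aval e2 s \<Longrightarrow> big_step c2 s t s' \<Longrightarrow> big_step (Cond e1 e2 c1 c2) s t s'"
| WhileTrue: "safe e1 s \<Longrightarrow> safe e2 s \<Longrightarrow> aval e1 s < aval e2 s \<Longrightarrow> big_step c s t1 s1 \<Longrightarrow>
    big_step (While e1 e2 c) s1 t2 s2 \<Longrightarrow> big_step (While e1 e2 c) s (Suc (t1 + t2)) s2"
| WhileFalse: "safe e1 s \<Longrightarrow> safe e2 s \<Longrightarrow> \<not> aval e1 s < aval e2 s \<Longrightarrow> big_step (While e1 e2 c) s 0 s"
| Simulate: "guest_ready s \<Longrightarrow> big_step Simulate s (var s vbudget) (guest_return P s (guest_final s))"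

inductive_cases SkipE: "big_step SKIP s t s'"
inductive_cases AssignE: "big_step (x ::= e) s t s'"
inductive_cases WriteE: "big_step (Write a e1 e2 e3) s t s'"
inductive_cases SeqE: "big_step (c1 ;; c2) s t s'"
inductive_cases CondE: "big_step (Cond e1 e2 c1 c2) s t s'"

lemma big_step_frame: "big_step c s t s' \<Longrightarrow> frame_of c s s'"
proof (induction rule: big_step.induct)
  case (Seq c1 s t1 s1 c2 t2 s2)
  then show ?case by (simp add: frame_trans)
next
  case (WhileTrue e1 s e2 c t1 s1 t2 s2)
  then show ?case by (auto intro: frame_trans_same)
qed (auto simp: frame_def guest_return_def)

lemma big_step_loop_free: "big_step c s t s' \<Longrightarrow> loop_free c \<Longrightarrow> t = 0"
  by (induction rule: big_step.induct) auto

definition ensures :: "com \<Rightarrow> store \<Rightarrow> nat \<Rightarrow> (store \<Rightarrow> bool) \<Rightarrow> bool" where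
  "ensures c s T Q \<longleftrightarrow> (\<exists>t s'. big_step c s t s' \<and> t \<le> T \<and> Q s')"

lemma ensuresI: "big_step c s t s' \<Longrightarrow> t \<le> T \<Longrightarrow> Q s' \<Longrightarrow> ensures c s T Q"
  by (auto simp: ensures_def)

lemma ensures_weaken: "ensures c s T Q \<Longrightarrow> T \<le> T' \<Longrightarrow> (\<And>s'. Q s' \<Longrightarrow> frame_of c s s' \<Longrightarrow> Q' s') \<Longrightarrow> ensures c s T' Q'"
  unfolding ensures_def using big_step_frame le_trans by blast

lemma ensures_le: "ensures c s T Q \<Longrightarrow> T \<le> T' \<Longrightarrow> ensures c s T' Q"
  unfolding ensures_def using le_trans by blast

lemma ensures_SKIP [simp]: "ensures SKIP s T Q \<longleftrightarrow> Q s"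
  by (auto simp: ensures_def intro: big_step.intros elim: SkipE)

lemma ensures_Assign [simp]: "ensures (x ::= e) s T Q \<longleftrightarrow> safe e s \<and> Q (s\<lparr>var := (var s)(x := aval e s)\<rparr>)"
proof
  assume "safe e s \<and> Q (s\<lparr>var := (var s)(x := aval e s)\<rparr>)"
  then show "ensures (x ::= e) s T Q" unfolding ensures_def using big_step.Assign by blast
qed (auto simp: ensures_def elim!: AssignE)

lemma ensures_Write [simp]:
  "ensures (Write a e1 e2 e3) s T Q \<longleftrightarrow> safe e1 s \<and> safe e2 s \<and> safe e3 s \<and> a < 1000 \<and> aval e1 s < R \<and>
    aval e2 s < R \<and> Q (s\<lparr>arr := arr_upd (arr s) a (aval e1 s) (aval e2 s) (aval e3 s)\<rparr>)" (is "?lhs \<longleftrightarrow> ?rhs")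
proof
  assume ?rhs
  then show ?lhs unfolding ensures_def using big_step.Write[of e1 s e2 e3 a] by blast
qed (auto simp: ensures_def elim!: WriteE)

lemma ensures_Cond [simp]: "ensures (Cond e1 e2 c1 c2) s T Q \<longleftrightarrow> safe e1 s \<and> safe e2 s \<and>
    (if aval e1 s < aval e2 s then ensures c1 s T Q else ensures c2 s T Q)"
proof -
  have "big_step (Cond e1 e2 c1 c2) s t s' \<longleftrightarrow> safe e1 s \<and> safe e2 s \<and>
      (if aval e1 s < aval e2 s then big_step c1 s t s' else big_step c2 s t s')" for t s'
    by (auto elim!: CondE intro: big_step.CondTrue big_step.CondFalse)
  then show ?thesis by (auto simp: ensures_def)
qed

lemma ensures_Seq_loop_free [simp]:
  assumes "loop_free c1"
  shows "ensures (c1 ;; c2) s T Q \<longleftrightarrow> ensures c1 s 0 (\<lambda>s1. ensures c2 s1 T Q)"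
proof -
  have "big_step (c1 ;; c2) s t s2 \<longleftrightarrow> (\<exists>s1. big_step c1 s 0 s1 \<and> big_step c2 s1 t s2)" for t s2
  proof
    assume "big_step (c1 ;; c2) s t s2"
    then show "\<exists>s1. big_step c1 s 0 s1 \<and> big_step c2 s1 t s2"
      using big_step_loop_free[OF _ assms] by (elim SeqE) fastforce
  next
    assume "\<exists>s1. big_step c1 s 0 s1 \<and> big_step c2 s1 t s2"
    then show "big_step (c1 ;; c2) s t s2" using big_step.Seq[of c1 s 0 _ c2 t s2] by auto
  qed
  then show ?thesis unfolding ensures_def by auto
qed

lemma ensures_Seq:
  assumes "ensures c1 s Ta Q1"
    and "\<And>s1. Q1 s1 \<Longrightarrow> frame_of c1 s s1 \<Longrightarrow> ensures c2 s1 Tb Q"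
    and "Ta + Tb \<le> T"
  shows "ensures (c1 ;; c2) s T Q"
proof -
  obtain t1 s1 where first: "big_step c1 s t1 s1" "t1 \<le> Ta" "Q1 s1" using assms(1) by (auto simp: ensures_def)
  then obtain t2 s2 where second: "big_step c2 s1 t2 s2" "t2 \<le> Tb" "Q s2"
    using assms(2) big_step_frame by (force simp: ensures_def)
  show ?thesis by (rule ensuresI[OF big_step.Seq[OF first(1) second(1)]]) (use first second assms(3) in auto)
qed

lemma ensures_Simulate:
  assumes "guest_ready s" "Q (guest_return P s (guest_final s))" "var s vbudget \<le> T"
  shows "ensures Simulate s T Q"
  using big_step.Simulate[OF assms(1)] assms(3,2) by (rule ensuresI)

lemma ensures_While:
  assumes init: "I F s"
    and guard: "\<And>f s1. I f s1 \<Longrightarrow> frame_of c s s1 \<Longrightarrow> safe e1 s1 \<and> safe e2 s1"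
    and step: "\<And>f s1. I f s1 \<Longrightarrow> frame_of c s s1 \<Longrightarrow> aval e1 s1 < aval e2 s1 \<Longrightarrow>
       ensures c s1 b (\<lambda>s2. \<exists>f'<f. I f' s2)"
    and exit: "\<And>f s1. I f s1 \<Longrightarrow> frame_of c s s1 \<Longrightarrow> \<not> aval e1 s1 < aval e2 s1 \<Longrightarrow> Q s1"
    and time: "F * Suc b \<le> T"
  shows "ensures (While e1 e2 c) s T Q"
proof -
  have "I f s1 \<Longrightarrow> frame_of c s s1 \<Longrightarrow> ensures (While e1 e2 c) s1 (f * Suc b) Q" for f s1
  proof (induction f arbitrary: s1 rule: less_induct)
    case (less f s1)
    note inv = less.prems
    show ?case
    proof (cases "aval e1 s1 < aval e2 s1")
      case False
      then show ?thesis using guard[OF inv] exit[OF inv] by (blast intro: ensuresI big_step.WhileFalse)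
    next
      case True
      from step[OF inv True] obtain t2 s2 f' where
        body: "big_step c s1 t2 s2" "t2 \<le> b" and f': "f' < f" "I f' s2" by (auto simp: ensures_def)
      have "frame_of c s s2" using frame_trans_same[OF inv(2) big_step_frame[OF body(1)]] .
      from less.IH[OF f' this] obtain t3 s3 where
        rest: "big_step (While e1 e2 c) s2 t3 s3" "t3 \<le> f' * Suc b" "Q s3" by (auto simp: ensures_def)
      have "Suc f' * Suc b \<le> f * Suc b" using f'(1) by (intro mult_right_mono) auto
      then show ?thesis using body(2) rest(2,3) guard[OF inv]
        by (intro ensuresI[OF big_step.WhileTrue[OF _ _ True body(1) rest(1)]]) auto
    qed
  qed
  from this[OF init frame_refl] show ?thesis by (rule ensures_le) (rule time)
qed

lemma ensures_For:
  assumes vars: "{x, h} \<inter> assigned c = {} \<and> h \<noteq> x \<and> var s h = m \<and> m < W"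
    and init: "I 0 (s\<lparr>var := (var s)(x := 0)\<rparr>)"
    and step: "\<And>i s1. i < m \<Longrightarrow> var s1 x = i \<Longrightarrow> I i s1 \<Longrightarrow> frame (insert x (assigned c)) (written c) s s1 \<Longrightarrow>
      ensures c s1 b (\<lambda>s2. I (Suc i) (s2\<lparr>var := (var s2)(x := Suc i)\<rparr>))"
    and exit: "\<And>s1. I m s1 \<Longrightarrow> frame (insert x (assigned c)) (written c) s s1 \<Longrightarrow> Q s1"
    and time: "m * Suc b \<le> T"
  shows "ensures (FOR x \<prec> h DO c) s T Q"
proof -
  let ?c = "c ;; x ::= V x \<oplus> N 1" and ?s = "s\<lparr>var := (var s)(x := 0)\<rparr>"
  have run: "\<exists>t s'. big_step (WHILE V x \<prec> V h DO ?c) s1 t s' \<and> t \<le> k * Suc b \<and> Q s'"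
    if "i + k = m" "var s1 x = i" "I i s1" "frame (insert x (assigned c)) (written c) s s1" for k i s1
    using that
  proof (induction k arbitrary: i s1)
    case 0
    then have "\<not> var s1 x < var s1 h" using vars by (auto simp: frame_def)
    then show ?case using 0 exit[of s1] by (auto intro!: exI[of _ 0] exI[of _ s1] big_step.WhileFalse)
  next
    case (Suc k)
    have i: "i < m" using Suc.prems(1) by linarith
    have guard: "aval (V x) s1 < aval (V h) s1" using vars i Suc.prems(2,4) by (auto simp: frame_def)
    from step[OF i Suc.prems(2-4)] obtain t2 s2 where body: "big_step c s1 t2 s2" "t2 \<le> b"
      "I (Suc i) (s2\<lparr>var := (var s2)(x := Suc i)\<rparr>)" by (auto simp: ensures_def)
    let ?s3 = "s2\<lparr>var := (var s2)(x := Suc i)\<rparr>"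
    have "var s2 x = i" using big_step_frame[OF body(1)] vars Suc.prems(2) by (auto simp: frame_def)
    then have "big_step (x ::= V x \<oplus> N 1) s2 0 ?s3"
      using big_step.Assign[of "V x \<oplus> N 1" s2 x] i vars word_bounds(5) by simp
    then have incr: "big_step ?c s1 t2 ?s3" using big_step.Seq[OF body(1)] by fastforce
    have "frame (insert x (assigned c)) (written c) s ?s3"
      using Suc.prems(4) big_step_frame[OF body(1)] by (auto simp: frame_def)
    with Suc.IH[of "Suc i" ?s3] Suc.prems(1) body(3) obtain t4 s4 where
      rest: "big_step (WHILE V x \<prec> V h DO ?c) ?s3 t4 s4" "t4 \<le> k * Suc b" "Q s4" by auto
    have "big_step (WHILE V x \<prec> V h DO ?c) s1 (Suc (t2 + t4)) s4"
      by (rule big_step.WhileTrue[OF _ _ guard incr rest(1)]) auto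
    then show ?case using body(2) rest(2,3) by (intro exI[of _ "Suc (t2 + t4)"] exI[of _ s4]) auto
  qed
  have "frame (insert x (assigned c)) (written c) s ?s" by (auto simp: frame_def)
  with run[of 0 m ?s] init have "ensures (WHILE V x \<prec> V h DO ?c) ?s (m * Suc b) Q" by (auto simp: ensures_def)
  then show ?thesis using time word_bounds(6) by (simp add: For_def ensures_le)
qed

lemma ensures_For_For:
  assumes vars: "x \<noteq> y \<and> {x, y} \<inter> ({h, k} \<union> assigned c) = {} \<and> {h, k} \<inter> assigned c = {} \<and> var s h = m \<and> var s k = l \<and> m < W \<and> l < W"
    and init: "I 0 0 (arr s)"
    and row: "\<And>i A. i < m \<Longrightarrow> I i l A \<Longrightarrow> I (Suc i) 0 A"
    and step: "\<And>i j s1. i < m \<Longrightarrow> j < l \<Longrightarrow> var s1 x = i \<Longrightarrow> var s1 y = j \<Longrightarrow> I i j (arr s1) \<Longrightarrow>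
      frame ({x, y} \<union> assigned c) (written c) s s1 \<Longrightarrow> ensures c s1 b (\<lambda>s2. I i (Suc j) (arr s2))"
    and exit: "\<And>s1. I m 0 (arr s1) \<Longrightarrow> frame ({x, y} \<union> assigned c) (written c) s s1 \<Longrightarrow> Q s1"
    and time: "m * Suc (l * Suc b) \<le> T"
  shows "ensures (FOR x \<prec> h DO FOR y \<prec> k DO c) s T Q"
proof (rule ensures_For[where I = "\<lambda>i s1. I i 0 (arr s1)" and b = "l * Suc b" and m = m], goal_cases vars init step exit time)
  case (step i s1)
  note outer = step
  show ?case
  proof (rule ensures_For[where I = "\<lambda>j s1. I i j (arr s1)" and b = b and m = l], goal_cases vars init step exit time)
    case (step j s2)
    have fr: "frame ({x, y} \<union> assigned c) (written c) s s2"
      using outer(4) step(4) by (auto simp: frame_def)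
    have "var s2 x = i" using outer(2) step(4) vars by (auto simp: frame_def)
    then show ?case using assms(4)[OF outer(1) step(1) _ step(2,3) fr] by simp
  qed (use outer vars row in \<open>auto simp: frame_def\<close>)
qed (use assms in \<open>auto simp: insert_commute\<close>)

lemma ensures_For_For_cells:
  assumes vars: "x \<noteq> y \<and> {x, y} \<inter> ({h, k} \<union> assigned c) = {} \<and> {h, k} \<inter> assigned c = {} \<and> var s h = m \<and> var s k = l \<and> m < W \<and> l < W"
    and step: "\<And>i j s1. i < m \<Longrightarrow> j < l \<Longrightarrow> var s1 x = i \<Longrightarrow> var s1 y = j \<Longrightarrow> frame ({x, y} \<union> assigned c) (written c) s s1 \<Longrightarrow>
      ensures c s1 b (\<lambda>s2. cell i j (arr s2) \<and> (\<forall>i'<m. \<forall>j'<l. (i', j') \<noteq> (i, j) \<longrightarrow> cell i' j' (arr s1) \<longrightarrow> cell i' j' (arr s2)))"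
    and exit: "\<And>s1. \<forall>i<m. \<forall>j<l. cell i j (arr s1) \<Longrightarrow> frame ({x, y} \<union> assigned c) (written c) s s1 \<Longrightarrow> Q s1"
    and time: "m * Suc (l * Suc b) \<le> T"
  shows "ensures (FOR x \<prec> h DO FOR y \<prec> k DO c) s T Q"
proof (rule ensures_For_For[OF vars, where b = b and I = "\<lambda>i j A. \<forall>i'<m. \<forall>j'<l. i' < i \<or> i' = i \<and> j' < j \<longrightarrow> cell i' j' A"],
    goal_cases init row step exit time)
  case (step i j s1)
  show ?case by (rule ensures_weaken[OF assms(2)[OF step(1-4,6)]]) (use step(5) in \<open>auto simp: less_Suc_eq\<close>)
qed (use exit time in \<open>auto simp: less_Suc_eq\<close>)

end

section \<open>Compilation to the Word RAM\<close>

lemma mult_add_eq_iff: "j < m \<Longrightarrow> j' < m \<Longrightarrow> i * m + j = i' * m + j' \<longleftrightarrow> i = i' \<and> j = (j'::nat)"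
  by (metis add.commute add.right_neutral div_less div_mult_self1 less_nat_zero_code mod_less mod_mult_self1)

lemma mult_add_less: "i < k \<Longrightarrow> j < m \<Longrightarrow> i * m + j < k * (m::nat)"
proof -
  assume "i < k" "j < m"
  then have "Suc i * m \<le> k * m" by (intro mult_le_mono1) simp
  then show ?thesis using \<open>j < m\<close> by simp
qed

definition reaches :: "nat \<Rightarrow> prog \<Rightarrow> nat \<Rightarrow> state \<Rightarrow> state \<Rightarrow> bool" where
  "reaches w p K m m' \<longleftrightarrow> (\<exists>k\<le>K. (step w p ^^ k) m = m')"

lemma reaches_refl: "reaches w p K m m"
  by (auto simp: reaches_def intro!: exI[of _ 0])

lemma reaches_mono: "reaches w p K m m' \<Longrightarrow> K \<le> K' \<Longrightarrow> reaches w p K' m m'"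
  unfolding reaches_def using le_trans by blast

lemma reaches_trans: "reaches w p K m m' \<Longrightarrow> reaches w p K' m' m'' \<Longrightarrow> reaches w p (K + K') m m''"
proof -
  assume "reaches w p K m m'" "reaches w p K' m' m''"
  then obtain k k' where "k \<le> K" "(step w p ^^ k) m = m'" "k' \<le> K'" "(step w p ^^ k') m' = m''"
    by (auto simp: reaches_def)
  then have "k + k' \<le> K + K'" "(step w p ^^ (k' + k)) m = m''" by (simp_all add: funpow_add)
  then show ?thesis unfolding reaches_def by (metis add.commute)
qed

lemma reaches_step: "pc m < length p \<Longrightarrow> exec w (p ! pc m) m = m' \<Longrightarrow> reaches w p 1 m m'"
  unfolding reaches_def step_def halted_def by (intro exI[of _ 1]) auto

lemma funpow_step_halted: "halted p m \<Longrightarrow> (step v p ^^ k) m = m"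
  by (induction k) (auto simp: step_def)

fun nonjump :: "instr \<Rightarrow> bool" where
  "nonjump (Jump l) = False"
| "nonjump (JumpLess a b l) = False"
| "nonjump _ = True"

definition code_at :: "prog \<Rightarrow> nat \<Rightarrow> instr list \<Rightarrow> bool" where
  "code_at p off is \<longleftrightarrow> (\<forall>i<length is. off + i < length p \<and> p ! (off + i) = is ! i)"

lemma code_at_Nil [simp]: "code_at p off []"
  by (simp add: code_at_def)

lemma code_at_Cons [simp]: "code_at p off (i # is) \<longleftrightarrow> off < length p \<and> p ! off = i \<and> code_at p (Suc off) is"
  unfolding code_at_def by (auto simp: less_Suc_eq_0_disj)

lemma code_at_append [simp]: "code_at p off (xs @ ys) \<longleftrightarrow> code_at p off xs \<and> code_at p (off + length xs) ys"
  by (induction xs arbitrary: off) auto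

lemma code_at_concat:
  assumes "code_at p off (concat (map f [0..<n]))" "\<And>k. length (f k) = l" "k < n"
  shows "code_at p (off + l * k) (f k)"
proof -
  have len: "length (concat (map f xs)) = l * length xs" for xs
    by (induction xs) (auto simp: assms(2))
  have "[0..<n] = [0..<k] @ k # [Suc k..<n]"
    using assms(3) by (metis le_add1 less_imp_le plus_nat.add_0 upt_add_eq_append upt_conv_Cons le_add_diff_inverse)
  then show ?thesis using assms(1) by (simp add: len)
qed

lemma reaches_nonjump:
  assumes "code_at p (pc m) is" "list_all nonjump is" "fold (exec w) is m = m'" "length is = K"
  shows "reaches w p K m m'"
  using assms
proof (induction "is" arbitrary: m K)
  case (Cons i "is")
  have "pc (exec w i m) = Suc (pc m)" using Cons.prems(2) by (cases i) auto
  then have "reaches w p (length is) (exec w i m) m'" using Cons by simp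
  moreover have "reaches w p 1 m (exec w i m)" by (rule reaches_step) (use Cons.prems(1) in auto)
  ultimately show ?case using reaches_trans Cons.prems(4) by fastforce
qed (simp add: reaches_refl)

text \<open>
  Register 0 holds \<open>R\<close>, register 1 the address of the guest memory, register 2 the number of guest
  steps so far, and register 3 addresses and constants. The remaining registers hold the variables,
  the temporary values of expressions, and the guest registers.
\<close>

definition var_reg :: "nat \<Rightarrow> nat" where "var_reg x = 3 * x + 4"
definition tmp_reg :: "nat \<Rightarrow> nat" where "tmp_reg d = 3 * d + 5"
definition guest_reg :: "nat \<Rightarrow> nat" where "guest_reg r = 3 * r + 6"

lemma reg_eq_iff [simp]:
  "var_reg x = var_reg y \<longleftrightarrow> x = y" "tmp_reg x = tmp_reg y \<longleftrightarrow> x = y" "guest_reg x = guest_reg y \<longleftrightarrow> x = y"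
  by (auto simp: var_reg_def tmp_reg_def guest_reg_def)

lemma reg_kinds_distinct [simp]:
  "var_reg x \<noteq> tmp_reg y" "var_reg x \<noteq> guest_reg y" "tmp_reg x \<noteq> guest_reg y"
  "tmp_reg y \<noteq> var_reg x" "guest_reg y \<noteq> var_reg x" "guest_reg y \<noteq> tmp_reg x"
  unfolding var_reg_def tmp_reg_def guest_reg_def by presburger+

lemma reg_not_reserved [simp]:
  "r < 4 \<Longrightarrow> var_reg x \<noteq> r" "r < 4 \<Longrightarrow> tmp_reg x \<noteq> r" "r < 4 \<Longrightarrow> guest_reg x \<noteq> r"
  "r < 4 \<Longrightarrow> r \<noteq> var_reg x" "r < 4 \<Longrightarrow> r \<noteq> tmp_reg x" "r < 4 \<Longrightarrow> r \<noteq> guest_reg x"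
  by (auto simp: var_reg_def tmp_reg_def guest_reg_def)

definition compile_address :: "nat \<Rightarrow> nat \<Rightarrow> instr list" where
  "compile_address a d = [Imm 3 a, Op Mul 3 3 0, Op Add 3 3 (tmp_reg d), Op Mul 3 3 0, Op Add 3 3 (tmp_reg (Suc d))]"

fun compile_aexp :: "aexp \<Rightarrow> nat \<Rightarrow> instr list" where
  "compile_aexp (N k) d = [Imm (tmp_reg d) k]"
| "compile_aexp (V x) d = [Op Or (tmp_reg d) (var_reg x) (var_reg x)]"
| "compile_aexp (Bin f a b) d = compile_aexp a d @ compile_aexp b (Suc d) @ [Op f (tmp_reg d) (tmp_reg d) (tmp_reg (Suc d))]"
| "compile_aexp (Read a e1 e2) d = compile_aexp e1 d @ compile_aexp e2 (Suc d) @ compile_address a d @ [Load (tmp_reg d) 3]"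

definition guard_length :: "aexp \<Rightarrow> aexp \<Rightarrow> nat" where
  "guard_length e1 e2 = length (compile_aexp e1 0) + length (compile_aexp e2 1) + 2"

definition compile_guard :: "aexp \<Rightarrow> aexp \<Rightarrow> nat \<Rightarrow> nat \<Rightarrow> instr list" where
  "compile_guard e1 e2 off l = compile_aexp e1 0 @ compile_aexp e2 1 @
     [JumpLess (tmp_reg 0) (tmp_reg 1) (off + guard_length e1 e2), Jump l]"

fun regs :: "instr \<Rightarrow> nat list" where
  "regs (Imm r k) = [r]"
| "regs (Op f r a b) = [r, a, b]"
| "regs (Load r a) = [r, a]"
| "regs (Store a r) = [a, r]"
| "regs (Jump l) = []"
| "regs (JumpLess a b l) = [a, b]"

text \<open>An upper bound; the exact number is not needed.\<close>

definition num_regs :: "prog \<Rightarrow> nat" where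
  "num_regs P = 2 + sum_list (concat (map regs P))"

lemma regs_less_num_regs: "i \<in> set P \<Longrightarrow> r \<in> set (regs i) \<Longrightarrow> r < num_regs P"
  unfolding num_regs_def using member_le_sum_list[of r "concat (map regs P)"] by fastforce

text \<open>Every guest instruction becomes two host instructions; \<open>t\<close> translates jump targets.\<close>

fun guest_instr :: "(nat \<Rightarrow> nat) \<Rightarrow> nat \<Rightarrow> instr \<Rightarrow> instr list" where
  "guest_instr t nx (Imm r k) = [Imm (guest_reg r) k, Op Mod (guest_reg r) (guest_reg r) 0]"
| "guest_instr t nx (Op f r a b) = [Op f (guest_reg r) (guest_reg a) (guest_reg b), Op Mod (guest_reg r) (guest_reg r) 0]"
| "guest_instr t nx (Load r a) = [Op Add 3 (guest_reg a) 1, Load (guest_reg r) 3]"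
| "guest_instr t nx (Store a r) = [Op Add 3 (guest_reg a) 1, Store 3 (guest_reg r)]"
| "guest_instr t nx (Jump l) = [Jump (t l), Jump nx]"
| "guest_instr t nx (JumpLess a b l) = [JumpLess (guest_reg a) (guest_reg b) (t l), Jump nx]"

definition guest_prelude :: "prog \<Rightarrow> instr list" where
  "guest_prelude P = map (\<lambda>r. Imm (guest_reg r) 0) [0..<num_regs P] @
    [Op Or (guest_reg 0) (var_reg vws) (var_reg vws), Op Or (guest_reg 1) (var_reg vdim) (var_reg vdim),
     Imm 1 aguest, Op Mul 1 1 0, Op Add 1 1 (var_reg vslot), Op Mul 1 1 0, Imm 2 0]"

definition guest_block :: "prog \<Rightarrow> nat \<Rightarrow> nat \<Rightarrow> instr list" where
  "guest_block P B k = [JumpLess 2 (var_reg vbudget) (B + 6 * k + 2), Jump (B + 6 * length P + 2), Imm 3 1, Op Add 2 2 3] @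
     guest_instr (\<lambda>l. B + 6 * min l (length P)) (B + 6 * k + 6) (P ! k)"

definition guest_code :: "prog \<Rightarrow> nat \<Rightarrow> instr list" where
  "guest_code P off = (let B = off + length (guest_prelude P) in
     guest_prelude P @ concat (map (guest_block P B) [0..<length P]) @
     [Imm (var_reg vhalted) 1, Jump (B + 6 * length P + 3), Imm (var_reg vhalted) 0])"

lemma length_guest_block [simp]: "length (guest_block P B k) = 6"
  by (cases "P ! k") (auto simp: guest_block_def)

lemma length_guest_blocks: "length (concat (map (guest_block P B) xs)) = 6 * length xs"
  by (induction xs) auto

lemma length_guest_code: "length (guest_code P off) = length (guest_prelude P) + 6 * length P + 3"
  by (simp add: guest_code_def Let_def length_guest_blocks)

fun compile :: "prog \<Rightarrow> com \<Rightarrow> nat \<Rightarrow> instr list" where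
  "compile P SKIP off = []"
| "compile P (x ::= e) off = compile_aexp e 0 @ [Op Or (var_reg x) (tmp_reg 0) (tmp_reg 0)]"
| "compile P (Write a e1 e2 e3) off =
    compile_aexp e1 0 @ compile_aexp e2 1 @ compile_aexp e3 2 @ compile_address a 0 @ [Store 3 (tmp_reg 2)]"
| "compile P (c1 ;; c2) off = compile P c1 off @ compile P c2 (off + length (compile P c1 off))"
| "compile P (Cond e1 e2 c1 c2) off =
    (let t = off + guard_length e1 e2; d1 = compile P c1 t; f = t + length d1 + 1; d2 = compile P c2 f
     in compile_guard e1 e2 off f @ d1 @ [Jump (f + length d2)] @ d2)"
| "compile P (While e1 e2 c) off =
    (let t = off + guard_length e1 e2; d = compile P c t
     in compile_guard e1 e2 off (t + length d + 1) @ d @ [Jump off])"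
| "compile P Simulate off = guest_code P off"

fun step_factor :: "prog \<Rightarrow> com \<Rightarrow> nat" where
  "step_factor P (c1 ;; c2) = step_factor P c1 + step_factor P c2"
| "step_factor P (Cond e1 e2 c1 c2) = guard_length e1 e2 + 1 + step_factor P c1 + step_factor P c2"
| "step_factor P (While e1 e2 c) = guard_length e1 e2 + 1 + step_factor P c"
| "step_factor P c = length (compile P c 0) + 6"

lemma length_compile_guard [simp]: "length (compile_guard e1 e2 off l) = guard_length e1 e2"
  by (simp add: compile_guard_def guard_length_def)

lemma nonjump_compile_aexp: "list_all nonjump (compile_aexp e d)"
  by (induction e arbitrary: d) (auto simp: compile_address_def)

subsection \<open>Expressions\<close>

definition sets_tmp :: "nat \<Rightarrow> nat \<Rightarrow> nat \<Rightarrow> state \<Rightarrow> state \<Rightarrow> bool" where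
  "sets_tmp d v l m m' \<longleftrightarrow> reg m' (tmp_reg d) = v \<and> (\<forall>r. (\<forall>d'\<ge>d. r \<noteq> tmp_reg d') \<longrightarrow> r \<noteq> 3 \<longrightarrow> reg m' r = reg m r) \<and>
     mem m' = mem m \<and> pc m' = pc m + l"

context ram
begin

definition represents :: "store \<Rightarrow> state \<Rightarrow> bool" where
  "represents s m \<longleftrightarrow> reg m 0 = R \<and> (\<forall>x. reg m (var_reg x) = var s x) \<and>
     (\<forall>a i j. a < R \<longrightarrow> i < R \<longrightarrow> j < R \<longrightarrow> mem m ((a * R + i) * R + j) = arr s a i j)"

lemma represents_pc [simp]: "represents s (m\<lparr>pc := k\<rparr>) \<longleftrightarrow> represents s m"
  by (simp add: represents_def)

lemma sets_tmp_represents: "sets_tmp d v l m m' \<Longrightarrow> represents s m \<Longrightarrow> represents s m'"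
  by (auto simp: represents_def sets_tmp_def)

lemma address_less:
  assumes "a < R" "i < R" "j < R"
  shows "a * R < W" "a * R + i < W" "(a * R + i) * R < W" "(a * R + i) * R + j < W"
proof -
  have "(a * R + i) * R + j < R * R * R" using assms by (intro mult_add_less)
  then show "(a * R + i) * R + j < W" using R_cubed_le_W by linarith
  then show "(a * R + i) * R < W" by (rule add_lessD1)
  moreover have "a * R + i \<le> (a * R + i) * R" using assms(1) by simp
  ultimately show "a * R + i < W" by (rule le_less_trans[rotated])
  then show "a * R < W" by (rule add_lessD1)
qed

lemma address_eq_iff:
  "i < R \<Longrightarrow> j < R \<Longrightarrow> i' < R \<Longrightarrow> j' < R \<Longrightarrow> (a * R + i) * R + j = (a' * R + i') * R + j' \<longleftrightarrow> a = a' \<and> i = i' \<and> j = j'"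
  by (auto simp: mult_add_eq_iff)

lemma eval_binop_safe: "no_overflow W f x y \<Longrightarrow> eval_binop w f x y = binop_val f x y"
  using eval_binop_eq_binop_val W_def by simp

lemma exec_compile_address:
  assumes "reg m 0 = R" "a < R" "reg m (tmp_reg d) < R" "reg m (tmp_reg (Suc d)) < R"
  shows "fold (exec w) (compile_address a d) m =
    m\<lparr>pc := pc m + 5, reg := (reg m)(3 := (a * R + reg m (tmp_reg d)) * R + reg m (tmp_reg (Suc d)))\<rparr>"
  using address_less[OF assms(2-4)] assms word_bounds by (simp add: compile_address_def flip: W_def)

lemma exec_compile_aexp:
  assumes "safe e s" "represents s m"
  shows "sets_tmp d (aval e s) (length (compile_aexp e d)) m (fold (exec w) (compile_aexp e d) m)"
  using assms
proof (induction e arbitrary: d m)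
  case (N k)
  then show ?case by (auto simp: sets_tmp_def simp flip: W_def)
next
  case (V x)
  then show ?case by (auto simp: sets_tmp_def represents_def)
next
  case (Bin f e1 e2)
  let ?m1 = "fold (exec w) (compile_aexp e1 d) m"
  have first: "sets_tmp d (aval e1 s) (length (compile_aexp e1 d)) m ?m1" using Bin.IH(1) Bin.prems by simp
  then have "sets_tmp (Suc d) (aval e2 s) (length (compile_aexp e2 (Suc d))) ?m1 (fold (exec w) (compile_aexp e2 (Suc d)) ?m1)"
    using Bin.IH(2) Bin.prems sets_tmp_represents by simp
  then show ?case using first Bin.prems(1) by (auto simp: sets_tmp_def eval_binop_safe)
next
  case (Read a e1 e2)
  let ?m1 = "fold (exec w) (compile_aexp e1 d) m"
  let ?m2 = "fold (exec w) (compile_aexp e2 (Suc d)) ?m1"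
  have first: "sets_tmp d (aval e1 s) (length (compile_aexp e1 d)) m ?m1" using Read.IH(1) Read.prems by simp
  then have rep1: "represents s ?m1" using Read.prems(2) sets_tmp_represents by blast
  then have second: "sets_tmp (Suc d) (aval e2 s) (length (compile_aexp e2 (Suc d))) ?m1 ?m2"
    using Read.IH(2) Read.prems by simp
  then have rep2: "represents s ?m2" using rep1 sets_tmp_represents by blast
  have cell: "a < R" "aval e1 s < R" "aval e2 s < R" using Read.prems(1) R_ge by auto
  have tmps: "reg ?m2 (tmp_reg d) = aval e1 s" "reg ?m2 (tmp_reg (Suc d)) = aval e2 s"
    using first second by (auto simp: sets_tmp_def)
  have "fold (exec w) (compile_address a d) ?m2 = ?m2\<lparr>pc := pc ?m2 + 5, reg := (reg ?m2)(3 := (a * R + aval e1 s) * R + aval e2 s)\<rparr>"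
    using exec_compile_address[of ?m2 a d] rep2 cell tmps by (simp add: represents_def)
  then show ?case using first second rep2 cell by (auto simp: sets_tmp_def represents_def compile_address_def)
qed

lemma compile_aexp_run:
  assumes "safe e s" "represents s m" "code_at p (pc m) (compile_aexp e d)"
  obtains m' where "reaches w p (length (compile_aexp e d)) m m'" "reg m' (tmp_reg d) = aval e s" "represents s m'"
    "pc m' = pc m + length (compile_aexp e d)" "\<And>d'. d' < d \<Longrightarrow> reg m' (tmp_reg d') = reg m (tmp_reg d')"
proof
  note sets = exec_compile_aexp[OF assms(1,2), of d]
  let ?m = "fold (exec w) (compile_aexp e d) m"
  show "reaches w p (length (compile_aexp e d)) m ?m" by (rule reaches_nonjump[OF assms(3) nonjump_compile_aexp refl refl])
  show "represents s ?m" by (rule sets_tmp_represents[OF sets assms(2)])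
qed (use exec_compile_aexp[OF assms(1,2), of d] in \<open>auto simp: sets_tmp_def\<close>)

lemma compile_guard_run:
  assumes "represents s m" "safe e1 s" "safe e2 s" "code_at p (pc m) (compile_guard e1 e2 (pc m) l)"
  obtains m' where "reaches w p (guard_length e1 e2) m m'" "represents s m'"
    "pc m' = (if aval e1 s < aval e2 s then pc m + guard_length e1 e2 else l)"
proof -
  from assms(4) have code: "code_at p (pc m) (compile_aexp e1 0)" "code_at p (pc m + length (compile_aexp e1 0)) (compile_aexp e2 1)"
    "code_at p (pc m + (length (compile_aexp e1 0) + length (compile_aexp e2 1)))
      [JumpLess (tmp_reg 0) (tmp_reg 1) (pc m + guard_length e1 e2), Jump l]"
    by (auto simp: compile_guard_def add.assoc)
  obtain m1 where m1: "reaches w p (length (compile_aexp e1 0)) m m1" "reg m1 (tmp_reg 0) = aval e1 s" "represents s m1"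
    "pc m1 = pc m + length (compile_aexp e1 0)" using compile_aexp_run[OF assms(2,1) code(1)] by metis
  obtain m2 where m2: "reaches w p (length (compile_aexp e2 1)) m1 m2" "reg m2 (tmp_reg 1) = aval e2 s" "represents s m2"
    "pc m2 = pc m1 + length (compile_aexp e2 1)" "reg m2 (tmp_reg 0) = reg m1 (tmp_reg 0)"
    using compile_aexp_run[OF assms(3) m1(3), of p 1] code(2) m1(4) by (metis less_one)
  have test: "reaches w p 1 m2 (m2\<lparr>pc := if aval e1 s < aval e2 s then pc m + guard_length e1 e2 else Suc (pc m2)\<rparr>)"
    by (rule reaches_step) (use code(3) m1 m2 in \<open>simp_all add: add.assoc\<close>)
  have jump: "reaches w p 1 (m2\<lparr>pc := Suc (pc m2)\<rparr>) (m2\<lparr>pc := l\<rparr>)"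
    by (rule reaches_step) (use code(3) m1 m2 in \<open>simp_all add: add.assoc\<close>)
  let ?m = "m2\<lparr>pc := if aval e1 s < aval e2 s then pc m + guard_length e1 e2 else l\<rparr>"
  have "reaches w p (1 + 1) m2 ?m" using test reaches_trans[OF test] jump reaches_refl[of w p 1] by (auto split: if_splits)
  then have "reaches w p (guard_length e1 e2) m ?m"
    using reaches_trans[OF reaches_trans[OF m1(1) m2(1)]] by (fastforce simp: guard_length_def)
  then show ?thesis by (rule that) (use m2(3) in auto)
qed

end

subsection \<open>The guest program\<close>

lemma and_or_xor_less:
  fixes x y :: nat
  assumes "x < 2 ^ n" "y < 2 ^ n"
  shows "and x y < 2 ^ n" "or x y < 2 ^ n" "xor x y < 2 ^ n"
proof -
  have "take_bit n x = x" "take_bit n y = y" using assms by (auto simp: take_bit_nat_eq_self_iff)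
  then have "take_bit n (and x y) = and x y" "take_bit n (or x y) = or x y" "take_bit n (xor x y) = xor x y"
    by simp_all
  then show "and x y < 2 ^ n" "or x y < 2 ^ n" "xor x y < 2 ^ n"
    by (metis take_bit_nat_less_exp)+
qed

lemma eval_binop_less:
  assumes "x < 2 ^ n" "y < 2 ^ n"
  shows "eval_binop n f x y < 2 ^ n"
  using and_or_xor_less[OF assms] le_less_trans[OF div_le_dividend assms(1)] le_less_trans[OF mod_less_eq_dividend assms(1)]
  by (cases f) (use assms in auto)

lemma eval_binop_mod:
  assumes "x < 2 ^ n" "y < 2 ^ n" "n \<le> w"
  shows "eval_binop w f x y mod 2 ^ n = eval_binop n f x y"
proof -
  have dvd: "(2::nat) ^ n dvd 2 ^ w" using assms(3) by (rule le_imp_power_dvd)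
  have less: "eval_binop n f x y < 2 ^ n" by (rule eval_binop_less[OF assms(1,2)])
  have "(2 ^ w + x - y) mod 2 ^ n = (2 ^ n + x - y) mod 2 ^ n" if "\<not> y \<le> x"
  proof -
    obtain k where k: "(2::nat) ^ w = 2 ^ n * Suc k" using dvd by (metis dvdE mult_0_right not0_implies_Suc power_not_zero zero_neq_numeral)
    then have "2 ^ w + x - y = (2 ^ n + x - y) + 2 ^ n * k" using that assms(2) by simp
    then show ?thesis by simp
  qed
  then show ?thesis using less dvd by (cases f) (auto simp: mod_mod_cancel)
qed

context ram
begin

definition guest_address :: "store \<Rightarrow> nat" where
  "guest_address s = (aguest * R + var s vslot) * R"

definition hosts :: "store \<Rightarrow> state \<Rightarrow> state \<Rightarrow> bool" where
  "hosts s \<sigma> m \<longleftrightarrow> reg m 0 = R \<and> reg m 1 = guest_address s \<and> (\<forall>x. reg m (var_reg x) = var s x) \<and>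
     (\<forall>r<num_regs P. reg m (guest_reg r) = reg \<sigma> r) \<and>
     (\<forall>a i j. a < R \<longrightarrow> i < R \<longrightarrow> j < R \<longrightarrow> mem m ((a * R + i) * R + j) =
        (if a = aguest \<and> i = var s vslot then mem \<sigma> j else arr s a i j)) \<and>
     (\<forall>r. reg \<sigma> r < R) \<and> (\<forall>j. mem \<sigma> j < R)"

definition at_guest_pc :: "nat \<Rightarrow> state \<Rightarrow> nat \<Rightarrow> state \<Rightarrow> bool" where
  "at_guest_pc B \<sigma> c m \<longleftrightarrow> pc m = B + 6 * min (pc \<sigma>) (length P) \<and> reg m 2 = c"

lemma hosts_scratch: "hosts s \<sigma> m \<Longrightarrow> hosts s \<sigma> (m\<lparr>pc := l, reg := (reg m)(3 := v, 2 := c)\<rparr>)"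
  by (simp add: hosts_def)

lemma hosts_mem_less: "hosts s \<sigma> m \<Longrightarrow> var s vslot < R \<Longrightarrow> guest_address s + reg \<sigma> r < W"
  using address_less(4)[of aguest "var s vslot" "reg \<sigma> r"] R_ge by (simp add: hosts_def guest_address_def)

lemma exec_guest_instr:
  fixes t :: "nat \<Rightarrow> nat" and nx :: nat
  assumes h: "hosts s \<sigma> m" "reg m 3 = 1" "var s vslot < R" and i: "nonjump i" "\<And>r. r \<in> set (regs i) \<Longrightarrow> r < num_regs P"
  defines "m' \<equiv> fold (exec w) (guest_instr t nx i) m"
  shows "hosts s (exec ws i \<sigma>) m'" "reg m' 2 = reg m 2" "pc m' = pc m + 2"
proof -
  have "hosts s (exec ws i \<sigma>) m' \<and> reg m' 2 = reg m 2 \<and> pc m' = pc m + 2"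
  proof (cases i)
    case (Imm r x)
    have "x mod 2 ^ w mod R = x mod 2 ^ ws" unfolding R_def
      by (rule mod_mod_cancel) (simp add: le_imp_power_dvd ws_def)
    moreover have "x mod 2 ^ ws < R" by (simp add: R_def)
    ultimately show ?thesis using h i by (auto simp: m'_def hosts_def Imm)
  next
    case (Op f r a b)
    have small: "reg \<sigma> a < R" "reg \<sigma> b < R" using h(1) by (auto simp: hosts_def)
    have "eval_binop w f (reg \<sigma> a) (reg \<sigma> b) mod R = eval_binop ws f (reg \<sigma> a) (reg \<sigma> b)"
      unfolding R_def using small[unfolded R_def] by (rule eval_binop_mod) (simp add: ws_def)
    moreover have "eval_binop ws f (reg \<sigma> a) (reg \<sigma> b) < R" unfolding R_def using small[unfolded R_def] by (rule eval_binop_less)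
    ultimately show ?thesis using h i by (auto simp: m'_def hosts_def Op)
  next
    case (Load r a)
    have "aguest < R" using R_ge by simp
    then have "mem m (guest_address s + reg \<sigma> a) = mem \<sigma> (reg \<sigma> a)" using h by (simp add: hosts_def guest_address_def)
    then show ?thesis using h i hosts_mem_less[OF h(1,3), of a]
      by (auto simp: m'_def hosts_def Load add.commute simp flip: W_def)
  next
    case (Store a r)
    let ?a = "guest_address s + reg \<sigma> a"
    have "m' = m\<lparr>pc := pc m + 2, reg := (reg m)(3 := ?a), mem := (mem m)(?a := reg \<sigma> r)\<rparr>"
      using h i hosts_mem_less[OF h(1,3), of a] by (simp add: m'_def hosts_def Store add.commute flip: W_def)
    moreover have "(x * R + y) * R + z = ?a \<longleftrightarrow> x = aguest \<and> y = var s vslot \<and> z = reg \<sigma> a" if "y < R" "z < R" for x y z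
      using address_eq_iff[OF that h(3), of "reg \<sigma> a"] h(1) unfolding guest_address_def hosts_def by auto
    ultimately show ?thesis using h by (simp add: hosts_def Store)
  qed (use i in auto)
  then show "hosts s (exec ws i \<sigma>) m'" "reg m' 2 = reg m 2" "pc m' = pc m + 2" by blast+
qed

lemma exec_guest_jump:
  assumes h: "hosts s \<sigma> m" and i: "\<not> nonjump i" "\<And>r. r \<in> set (regs i) \<Longrightarrow> r < num_regs P"
    and code: "code_at p (pc m) (guest_instr t (t (Suc (pc \<sigma>))) i)"
  shows "reaches w p 2 m (m\<lparr>pc := t (pc (exec ws i \<sigma>))\<rparr>)" "hosts s (exec ws i \<sigma>) (m\<lparr>pc := l\<rparr>)"
proof -
  have first: "reaches w p 1 m (exec w (p ! pc m) m)" by (rule reaches_step) (use code in \<open>cases i; simp\<close>, rule refl)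
  have "reaches w p 1 (m\<lparr>pc := Suc (pc m)\<rparr>) (m\<lparr>pc := t (Suc (pc \<sigma>))\<rparr>)"
    by (rule reaches_step) (use i code in \<open>cases i; simp\<close>)+
  then have second: "reaches w p 2 m (m\<lparr>pc := t (Suc (pc \<sigma>))\<rparr>)" if "exec w (p ! pc m) m = m\<lparr>pc := Suc (pc m)\<rparr>"
    using reaches_trans[of w p 1 m _ 1] first that by (simp add: numeral_2_eq_2)
  show "reaches w p 2 m (m\<lparr>pc := t (pc (exec ws i \<sigma>))\<rparr>)"
  proof (cases i)
    case (Jump l)
    then show ?thesis using first code by (auto intro: reaches_mono)
  next
    case (JumpLess a b l)
    then have "exec w (p ! pc m) m = m\<lparr>pc := if reg \<sigma> a < reg \<sigma> b then t l else Suc (pc m)\<rparr>"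
      using code h i by (simp add: hosts_def)
    then show ?thesis using first second JumpLess by (auto intro: reaches_mono)
  qed (use i in auto)
  show "hosts s (exec ws i \<sigma>) (m\<lparr>pc := l\<rparr>)" using h i by (cases i) (auto simp: hosts_def)
qed

lemma guest_step:
  assumes h: "hosts s \<sigma> m" "at_guest_pc B \<sigma> c m" and run: "\<not> halted P \<sigma>" "c < var s vbudget" "var s vbudget < W" "var s vslot < R"
    and code: "code_at p B (concat (map (guest_block P B) [0..<length P]))"
  shows "\<exists>m'. reaches w p 5 m m' \<and> hosts s (step ws P \<sigma>) m' \<and> at_guest_pc B (step ws P \<sigma>) (Suc c) m'"
proof -
  let ?k = "pc \<sigma>"
  let ?i = "P ! ?k"
  let ?t = "\<lambda>l. B + 6 * min l (length P)"
  have k: "?k < length P" using run(1) by (simp add: halted_def)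
  have step: "step ws P \<sigma> = exec ws ?i \<sigma>" using run(1) by (simp add: step_def)
  have regs: "r < num_regs P" if "r \<in> set (regs ?i)" for r using regs_less_num_regs[OF nth_mem[OF k] that] .
  have m: "pc m = B + 6 * ?k" "reg m 2 = c" "reg m (var_reg vbudget) = var s vbudget"
    using h k by (auto simp: at_guest_pc_def hosts_def min_def)
  have t: "?t (Suc ?k) = B + 6 * ?k + 6" using k by simp
  have block: "code_at p (pc m) (guest_block P B ?k)" using code_at_concat[OF code, of 6 ?k] k m(1) by simp
  define m3 where "m3 = m\<lparr>pc := pc m + 4, reg := (reg m)(3 := 1, 2 := Suc c)\<rparr>"
  have "reaches w p 1 m (m\<lparr>pc := pc m + 2\<rparr>)"
    by (rule reaches_step) (use block m run(2) in \<open>simp_all add: guest_block_def\<close>)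
  moreover have "reaches w p 2 (m\<lparr>pc := pc m + 2\<rparr>) m3"
    by (rule reaches_nonjump[of _ _ "[Imm 3 1, Op Add 2 2 3]"])
      (use block m(2) run(2,3) word_bounds(5) in \<open>simp_all add: guest_block_def m3_def flip: W_def\<close>)
  ultimately have tick: "reaches w p (1 + 2) m m3" by (rule reaches_trans)
  have scratched: "hosts s \<sigma> m3" "reg m3 3 = 1" "reg m3 2 = Suc c" unfolding m3_def using hosts_scratch[OF h(1)] by auto
  have code3: "code_at p (pc m3) (guest_instr ?t (?t (Suc ?k)) ?i)"
    using block unfolding t by (simp add: guest_block_def m3_def m(1) eval_nat_numeral)
  have "\<exists>m'. reaches w p 2 m3 m' \<and> hosts s (exec ws ?i \<sigma>) m' \<and> at_guest_pc B (exec ws ?i \<sigma>) (Suc c) m'"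
  proof (cases "nonjump ?i")
    case True
    let ?m' = "fold (exec w) (guest_instr ?t (?t (Suc ?k)) ?i) m3"
    have two: "length (guest_instr ?t (?t (Suc ?k)) ?i) = 2" "list_all nonjump (guest_instr ?t (?t (Suc ?k)) ?i)" "pc (exec ws ?i \<sigma>) = Suc ?k"
      using True by (cases ?i; simp)+
    note exec = exec_guest_instr[OF scratched(1,2) run(4) True regs, of ?t "?t (Suc ?k)"]
    have "reaches w p 2 m3 ?m'" by (rule reaches_nonjump[OF code3 two(2) refl two(1)])
    then show ?thesis using exec scratched(3) two(3) t m(1) by (intro exI[of _ ?m']) (auto simp: at_guest_pc_def m3_def)
  next
    case False
    note exec_guest_jump[OF scratched(1) False regs code3]
    then show ?thesis using scratched(3) by (intro exI[of _ "m3\<lparr>pc := ?t (pc (exec ws ?i \<sigma>))\<rparr>"]) (auto simp: at_guest_pc_def)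
  qed
  then show ?thesis using reaches_trans[OF tick] unfolding step by fastforce
qed

lemma guest_steps:
  assumes "hosts s \<sigma> m" "at_guest_pc B \<sigma> c m" "c + l = var s vbudget" "var s vbudget < W" "var s vslot < R"
    and code: "code_at p B (concat (map (guest_block P B) [0..<length P]))"
  shows "\<exists>m' c'. reaches w p (5 * l) m m' \<and> hosts s ((step ws P ^^ l) \<sigma>) m' \<and> at_guest_pc B ((step ws P ^^ l) \<sigma>) c' m' \<and>
     (halted P ((step ws P ^^ l) \<sigma>) \<or> c' = var s vbudget)"
  using assms(1-3)
proof (induction l arbitrary: \<sigma> c m)
  case 0
  then show ?case by (auto intro: reaches_refl)
next
  case (Suc l)
  show ?case
  proof (cases "halted P \<sigma>")
    case True
    then show ?thesis using Suc.prems funpow_step_halted[OF True, where v = ws and k = "Suc l"] by (auto intro: reaches_refl)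
  next
    case False
    from guest_step[OF Suc.prems(1,2) False _ assms(4,5) code] Suc.prems(3) obtain m1 where
      first: "reaches w p 5 m m1" "hosts s (step ws P \<sigma>) m1" "at_guest_pc B (step ws P \<sigma>) (Suc c) m1" by auto
    from Suc.IH[OF first(2,3)] Suc.prems(3) show ?thesis
      using reaches_trans[OF first(1)] by (fastforce simp: funpow_swap1)
  qed
qed

lemma guest_prelude_run:
  assumes "represents s m" "guest_ready s" "code_at p (pc m) (guest_prelude P)"
  obtains m' where "reaches w p (length (guest_prelude P)) m m'" "hosts s (guest_start s) m'"
    "at_guest_pc (pc m + length (guest_prelude P)) (guest_start s) 0 m'"
proof
  have zero: "fold (exec w) (map (\<lambda>r. Imm (guest_reg r) 0) [0..<k]) m =
     m\<lparr>pc := pc m + k, reg := (\<lambda>x. if \<exists>r<k. x = guest_reg r then 0 else reg m x)\<rparr>" for k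
  proof (induction k)
    case (Suc k)
    have "(\<lambda>x. if \<exists>r<k. x = guest_reg r then 0 else reg m x)(guest_reg k := 0) = (\<lambda>x. if \<exists>r<Suc k. x = guest_reg r then 0 else reg m x)"
      by (auto simp: fun_eq_iff less_Suc_eq)
    with Suc show ?case by simp
  qed simp
  let ?m = "fold (exec w) (guest_prelude P) m"
  show "reaches w p (length (guest_prelude P)) m ?m"
    by (rule reaches_nonjump[OF assms(3) _ refl refl]) (auto simp: guest_prelude_def list_all_iff)
  have small: "aguest < R" "aguest < W" "0 < R" "ws < R" "2 \<le> num_regs P"
    using R_ge word_bounds by (auto simp: num_regs_def R_def)
  have row: "var s vslot < R" using assms(2) by (simp add: guest_ready_def)
  have m': "pc ?m = pc m + length (guest_prelude P)" "mem ?m = mem m"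
    "reg ?m = (\<lambda>x. if \<exists>r<num_regs P. x = guest_reg r then 0 else reg m x)
      (guest_reg 0 := var s vws, guest_reg 1 := var s vdim, 1 := guest_address s, 2 := 0)"
    using assms(1) address_less(1-3)[OF small(1) row small(3)] small
    by (auto simp: guest_prelude_def zero represents_def guest_address_def fun_eq_iff simp flip: W_def)
  show "hosts s (guest_start s) ?m"
    using assms(1,2) small unfolding hosts_def m' by (auto simp: guest_start_def represents_def guest_ready_def)
  show "at_guest_pc (pc m + length (guest_prelude P)) (guest_start s) 0 ?m"
    by (simp add: at_guest_pc_def m' guest_start_def)
qed

lemma guest_exit_run:
  assumes h: "hosts s \<sigma> m" "at_guest_pc B \<sigma> c m" "halted P \<sigma> \<or> c = var s vbudget"
    and blocks: "code_at p B (concat (map (guest_block P B) [0..<length P]))"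
    and exit: "code_at p (B + 6 * length P) [Imm (var_reg vhalted) 1, Jump (B + 6 * length P + 3), Imm (var_reg vhalted) 0]"
  shows "\<exists>m'. reaches w p 3 m m' \<and> pc m' = B + 6 * length P + 3 \<and> represents (guest_return P s \<sigma>) m'"
proof -
  let ?E = "B + 6 * length P"
  let ?m = "\<lambda>v. m\<lparr>pc := ?E + 3, reg := (reg m)(var_reg vhalted := v)\<rparr>"
  have "represents (guest_return P s \<sigma>) (?m (if halted P \<sigma> then 1 else 0))"
    using h(1) by (auto simp: hosts_def represents_def guest_return_def)
  moreover have "reaches w p 3 m (?m (if halted P \<sigma> then 1 else 0))"
  proof (cases "halted P \<sigma>")
    case True
    then have pc: "pc m = ?E" using h(2) by (simp add: at_guest_pc_def halted_def min_def)
    let ?m1 = "m\<lparr>pc := Suc ?E, reg := (reg m)(var_reg vhalted := 1)\<rparr>"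
    have "reaches w p 1 m ?m1" by (rule reaches_step) (use pc exit word_bounds(5) in \<open>simp_all flip: W_def\<close>)
    moreover have "reaches w p 1 ?m1 (?m 1)" by (rule reaches_step) (use exit in auto)
    ultimately show ?thesis using True reaches_trans reaches_mono by fastforce
  next
    case False
    then have k: "pc \<sigma> < length P" by (simp add: halted_def)
    then have pc: "pc m = B + 6 * pc \<sigma>" using h(2) by (simp add: at_guest_pc_def min_def)
    have block: "code_at p (pc m) (guest_block P B (pc \<sigma>))" using code_at_concat[OF blocks, of 6 "pc \<sigma>"] k pc by simp
    have "reg m 2 = var s vbudget" "reg m (var_reg vbudget) = var s vbudget"
      using h False by (auto simp: at_guest_pc_def hosts_def)
    with block have "reaches w p 1 m (m\<lparr>pc := Suc (pc m)\<rparr>)" by (intro reaches_step) (simp_all add: guest_block_def)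
    moreover have "reaches w p 1 (m\<lparr>pc := Suc (pc m)\<rparr>) (m\<lparr>pc := ?E + 2\<rparr>)"
      by (rule reaches_step) (use block in \<open>simp_all add: guest_block_def\<close>)
    moreover have "reaches w p 1 (m\<lparr>pc := ?E + 2\<rparr>) (?m 0)"
      by (rule reaches_step) (use exit in auto)
    ultimately have "reaches w p (1 + 1 + 1) m (?m 0)" using reaches_trans by blast
    then show ?thesis using False by (simp add: numeral_3_eq_3)
  qed
  ultimately show ?thesis by force
qed

lemma guest_code_run:
  assumes "represents s m" "guest_ready s" and code: "code_at p (pc m) (guest_code P (pc m))"
  shows "\<exists>m'. reaches w p (length (guest_code P (pc m)) + 5 * var s vbudget) m m' \<and>
    pc m' = pc m + length (guest_code P (pc m)) \<and> represents (guest_return P s (guest_final s)) m'"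
proof -
  let ?B = "pc m + length (guest_prelude P)"
  have code: "code_at p (pc m) (guest_prelude P)" and blocks: "code_at p ?B (concat (map (guest_block P ?B) [0..<length P]))"
    and exit: "code_at p (?B + 6 * length P) [Imm (var_reg vhalted) 1, Jump (?B + 6 * length P + 3), Imm (var_reg vhalted) 0]"
    using code by (simp_all add: guest_code_def Let_def length_guest_blocks)
  have ready: "var s vbudget < W" "var s vslot < R" using assms(2) by (auto simp: guest_ready_def)
  obtain m1 where m1: "reaches w p (length (guest_prelude P)) m m1" "hosts s (guest_start s) m1" "at_guest_pc ?B (guest_start s) 0 m1"
    by (rule guest_prelude_run[OF assms(1,2) code])
  from guest_steps[OF m1(2,3) _ ready blocks] obtain m2 c where
    m2: "reaches w p (5 * var s vbudget) m1 m2" "hosts s (guest_final s) m2" "at_guest_pc ?B (guest_final s) c m2"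
      "halted P (guest_final s) \<or> c = var s vbudget" unfolding guest_final_def by auto
  from guest_exit_run[OF m2(2-4) blocks exit] obtain m3 where
    m3: "reaches w p 3 m2 m3" "pc m3 = ?B + 6 * length P + 3" "represents (guest_return P s (guest_final s)) m3" by blast
  have "reaches w p (length (guest_code P (pc m)) + 5 * var s vbudget) m m3"
    using reaches_trans[OF reaches_trans[OF m1(1) m2(1)] m3(1)] by (rule reaches_mono) (simp add: length_guest_code)
  then show ?thesis using m3 by (auto simp: length_guest_code)
qed

end

subsection \<open>Commands\<close>

context ram
begin

definition realizes :: "com \<Rightarrow> store \<Rightarrow> nat \<Rightarrow> store \<Rightarrow> bool" where
  "realizes c s T s' \<longleftrightarrow> (\<forall>p m. represents s m \<longrightarrow> code_at p (pc m) (compile P c (pc m)) \<longrightarrow>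
     (\<exists>m'. reaches w p T m m' \<and> pc m' = pc m + length (compile P c (pc m)) \<and> represents s' m'))"

lemma realizesD:
  assumes "realizes c s T s'" "represents s m" "code_at p (pc m) (compile P c (pc m))"
  obtains m' where "reaches w p T m m'" "pc m' = pc m + length (compile P c (pc m))" "represents s' m'"
  using assms unfolding realizes_def by blast

lemma realizes_Assign:
  assumes "safe e s"
  shows "realizes (x ::= e) s (length (compile_aexp e 0) + 1) (s\<lparr>var := (var s)(x := aval e s)\<rparr>)"
  unfolding realizes_def
proof (intro allI impI)
  fix p m assume m: "represents s m" "code_at p (pc m) (compile P (x ::= e) (pc m))"
  obtain m1 where m1: "reaches w p (length (compile_aexp e 0)) m m1" "reg m1 (tmp_reg 0) = aval e s" "represents s m1"
    "pc m1 = pc m + length (compile_aexp e 0)" using compile_aexp_run[OF assms m(1), of p 0] m(2) by auto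
  let ?m = "m1\<lparr>pc := Suc (pc m1), reg := (reg m1)(var_reg x := aval e s)\<rparr>"
  have "reaches w p 1 m1 ?m" by (rule reaches_step) (use m(2) m1 in auto)
  then have "reaches w p (length (compile_aexp e 0) + 1) m ?m" by (rule reaches_trans[OF m1(1)])
  then show "\<exists>m'. reaches w p (length (compile_aexp e 0) + 1) m m' \<and> pc m' = pc m + length (compile P (x ::= e) (pc m)) \<and>
      represents (s\<lparr>var := (var s)(x := aval e s)\<rparr>) m'"
    using m1(3,4) by (intro exI[of _ ?m]) (auto simp: represents_def)
qed

lemma represents_Write:
  assumes "represents s m" "a < R" "i < R" "j < R"
  shows "represents (s\<lparr>arr := arr_upd (arr s) a i j v\<rparr>) (m\<lparr>pc := l, reg := (reg m)(3 := x), mem := (mem m)((a * R + i) * R + j := v)\<rparr>)"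
proof -
  have "(a' * R + i') * R + j' = (a * R + i) * R + j \<longleftrightarrow> a' = a \<and> i' = i \<and> j' = j" if "i' < R" "j' < R" for a' i' j'
    using address_eq_iff[OF that assms(3,4)] .
  then show ?thesis using assms by (simp add: represents_def arr_upd_def)
qed

lemma realizes_Write:
  assumes e: "safe e1 s" "safe e2 s" "safe e3 s" and cell: "a < R" "aval e1 s < R" "aval e2 s < R"
  shows "realizes (Write a e1 e2 e3) s (length (compile P (Write a e1 e2 e3) 0))
    (s\<lparr>arr := arr_upd (arr s) a (aval e1 s) (aval e2 s) (aval e3 s)\<rparr>)"
  unfolding realizes_def
proof (intro allI impI)
  fix p m assume m: "represents s m" "code_at p (pc m) (compile P (Write a e1 e2 e3) (pc m))"
  let ?l1 = "length (compile_aexp e1 0)" and ?l2 = "length (compile_aexp e2 1)" and ?l3 = "length (compile_aexp e3 2)"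
  have code: "code_at p (pc m) (compile_aexp e1 0)" "code_at p (pc m + ?l1) (compile_aexp e2 1)"
    "code_at p (pc m + ?l1 + ?l2) (compile_aexp e3 2)"
    "code_at p (pc m + ?l1 + ?l2 + ?l3) (compile_address a 0 @ [Store 3 (tmp_reg 2)])"
    using m(2) by (simp_all add: add.assoc)
  obtain m1 where m1: "reaches w p ?l1 m m1" "reg m1 (tmp_reg 0) = aval e1 s" "represents s m1" "pc m1 = pc m + ?l1"
    using compile_aexp_run[OF e(1) m(1) code(1)] by metis
  obtain m2 where m2: "reaches w p ?l2 m1 m2" "reg m2 (tmp_reg 1) = aval e2 s" "represents s m2" "pc m2 = pc m1 + ?l2"
    "reg m2 (tmp_reg 0) = aval e1 s"
    using compile_aexp_run[OF e(2) m1(3), of p 1] code(2) m1(2,4) by (metis less_one)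
  obtain m3 where m3: "reaches w p ?l3 m2 m3" "reg m3 (tmp_reg 2) = aval e3 s" "represents s m3" "pc m3 = pc m2 + ?l3"
    "reg m3 (tmp_reg 0) = aval e1 s" "reg m3 (tmp_reg 1) = aval e2 s"
    using compile_aexp_run[OF e(3) m2(3), of p 2] code(3) m1(4) m2(2,4,5) by (metis one_less_numeral_iff semiring_norm(76) zero_less_numeral)
  let ?a = "(a * R + aval e1 s) * R + aval e2 s" and ?store = "compile_address a 0 @ [Store 3 (tmp_reg 2)]"
  let ?m = "m3\<lparr>pc := pc m3 + 6, reg := (reg m3)(3 := ?a), mem := (mem m3)(?a := aval e3 s)\<rparr>"
  have exec: "fold (exec w) ?store m3 = ?m"
    using exec_compile_address[of m3 a 0] cell m3 by (simp add: represents_def)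
  have "reaches w p 6 m3 ?m"
    by (rule reaches_nonjump[OF _ _ exec]) (use code(4) m1(4) m2(4) m3(4) in \<open>simp_all add: compile_address_def\<close>)
  then have "reaches w p (?l1 + ?l2 + ?l3 + 6) m ?m" by (rule reaches_trans[OF reaches_trans[OF reaches_trans[OF m1(1) m2(1)] m3(1)]])
  then have "reaches w p (length (compile P (Write a e1 e2 e3) 0)) m ?m" by (rule reaches_mono) (simp add: compile_address_def)
  then show "\<exists>m'. reaches w p (length (compile P (Write a e1 e2 e3) 0)) m m' \<and> pc m' = pc m + length (compile P (Write a e1 e2 e3) (pc m)) \<and>
      represents (s\<lparr>arr := arr_upd (arr s) a (aval e1 s) (aval e2 s) (aval e3 s)\<rparr>) m'"
    using represents_Write[OF m3(3) cell] m1(4) m2(4) m3(4) by (intro exI[of _ ?m]) (simp add: compile_address_def)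
qed

lemma realizes_Seq:
  assumes "realizes c1 s T1 s1" "realizes c2 s1 T2 s2"
  shows "realizes (c1 ;; c2) s (T1 + T2) s2"
  unfolding realizes_def
proof (intro allI impI)
  fix p m assume m: "represents s m" "code_at p (pc m) (compile P (c1 ;; c2) (pc m))"
  obtain m1 where m1: "reaches w p T1 m m1" "pc m1 = pc m + length (compile P c1 (pc m))" "represents s1 m1"
    by (rule realizesD[OF assms(1) m(1), of p]) (use m(2) in auto)
  obtain m2 where m2: "reaches w p T2 m1 m2" "pc m2 = pc m1 + length (compile P c2 (pc m1))" "represents s2 m2"
    by (rule realizesD[OF assms(2) m1(3), of p]) (use m(2) m1(2) in auto)
  show "\<exists>m'. reaches w p (T1 + T2) m m' \<and> pc m' = pc m + length (compile P (c1 ;; c2) (pc m)) \<and> represents s2 m'"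
    using reaches_trans[OF m1(1) m2(1)] m1(2) m2(2,3) by auto
qed

lemma realizes_CondTrue:
  assumes "safe e1 s" "safe e2 s" "aval e1 s < aval e2 s" "realizes c1 s T s'"
  shows "realizes (Cond e1 e2 c1 c2) s (guard_length e1 e2 + T + 1) s'"
  unfolding realizes_def
proof (intro allI impI)
  fix p m assume m: "represents s m" "code_at p (pc m) (compile P (Cond e1 e2 c1 c2) (pc m))"
  obtain m1 where m1: "reaches w p (guard_length e1 e2) m m1" "represents s m1" "pc m1 = pc m + guard_length e1 e2"
    using compile_guard_run[OF m(1) assms(1,2), of p] m(2) assms(3) by (force simp: Let_def)
  obtain m2 where m2: "reaches w p T m1 m2" "pc m2 = pc m1 + length (compile P c1 (pc m1))" "represents s' m2"
    by (rule realizesD[OF assms(4) m1(2), of p]) (use m(2) m1(3) in \<open>auto simp: Let_def\<close>)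
  let ?m = "m2\<lparr>pc := pc m + length (compile P (Cond e1 e2 c1 c2) (pc m))\<rparr>"
  have "reaches w p 1 m2 ?m" by (rule reaches_step) (use m(2) m1(3) m2(2) in \<open>simp_all add: Let_def add.assoc\<close>)
  then have "reaches w p (guard_length e1 e2 + T + 1) m ?m" by (rule reaches_trans[OF reaches_trans[OF m1(1) m2(1)]])
  then show "\<exists>m'. reaches w p (guard_length e1 e2 + T + 1) m m' \<and> pc m' = pc m + length (compile P (Cond e1 e2 c1 c2) (pc m)) \<and> represents s' m'"
    using m2(3) by (intro exI[of _ ?m]) simp
qed

lemma realizes_CondFalse:
  assumes "safe e1 s" "safe e2 s" "\<not> aval e1 s < aval e2 s" "realizes c2 s T s'"
  shows "realizes (Cond e1 e2 c1 c2) s (guard_length e1 e2 + T) s'"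
  unfolding realizes_def
proof (intro allI impI)
  fix p m assume m: "represents s m" "code_at p (pc m) (compile P (Cond e1 e2 c1 c2) (pc m))"
  let ?f = "pc m + guard_length e1 e2 + length (compile P c1 (pc m + guard_length e1 e2)) + 1"
  obtain m1 where m1: "reaches w p (guard_length e1 e2) m m1" "represents s m1" "pc m1 = ?f"
    using compile_guard_run[OF m(1) assms(1,2), of p ?f] m(2) assms(3) by (force simp: Let_def add.assoc)
  obtain m2 where m2: "reaches w p T m1 m2" "pc m2 = pc m1 + length (compile P c2 (pc m1))" "represents s' m2"
    by (rule realizesD[OF assms(4) m1(2), of p]) (use m(2) m1(3) in \<open>auto simp: Let_def add.assoc\<close>)
  show "\<exists>m'. reaches w p (guard_length e1 e2 + T) m m' \<and> pc m' = pc m + length (compile P (Cond e1 e2 c1 c2) (pc m)) \<and> represents s' m'"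
    using reaches_trans[OF m1(1) m2(1)] m1(3) m2(2,3) by (auto simp: Let_def add.assoc)
qed

lemma realizes_WhileTrue:
  assumes "safe e1 s" "safe e2 s" "aval e1 s < aval e2 s" "realizes c s T1 s1" "realizes (While e1 e2 c) s1 T2 s2"
  shows "realizes (While e1 e2 c) s (guard_length e1 e2 + T1 + 1 + T2) s2"
  unfolding realizes_def
proof (intro allI impI)
  fix p m assume m: "represents s m" "code_at p (pc m) (compile P (While e1 e2 c) (pc m))"
  obtain m1 where m1: "reaches w p (guard_length e1 e2) m m1" "represents s m1" "pc m1 = pc m + guard_length e1 e2"
    using compile_guard_run[OF m(1) assms(1,2), of p] m(2) assms(3) by (force simp: Let_def)
  obtain m2 where m2: "reaches w p T1 m1 m2" "pc m2 = pc m1 + length (compile P c (pc m1))" "represents s1 m2"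
    by (rule realizesD[OF assms(4) m1(2), of p]) (use m(2) m1(3) in \<open>auto simp: Let_def\<close>)
  have jump: "reaches w p 1 m2 (m2\<lparr>pc := pc m\<rparr>)" by (rule reaches_step) (use m(2) m1(3) m2(2) in \<open>simp_all add: Let_def add.assoc\<close>)
  obtain m3 where m3: "reaches w p T2 (m2\<lparr>pc := pc m\<rparr>) m3" "pc m3 = pc m + length (compile P (While e1 e2 c) (pc m))" "represents s2 m3"
    by (rule realizesD[OF assms(5), of "m2\<lparr>pc := pc m\<rparr>" p]) (use m(2) m2(3) in auto)
  show "\<exists>m'. reaches w p (guard_length e1 e2 + T1 + 1 + T2) m m' \<and> pc m' = pc m + length (compile P (While e1 e2 c) (pc m)) \<and> represents s2 m'"
    using reaches_trans[OF reaches_trans[OF reaches_trans[OF m1(1) m2(1)] jump] m3(1)] m3(2,3) by blast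
qed

lemma realizes_WhileFalse:
  assumes "safe e1 s" "safe e2 s" "\<not> aval e1 s < aval e2 s"
  shows "realizes (While e1 e2 c) s (guard_length e1 e2) s"
  unfolding realizes_def
proof (intro allI impI)
  fix p m assume m: "represents s m" "code_at p (pc m) (compile P (While e1 e2 c) (pc m))"
  have "code_at p (pc m) (compile_guard e1 e2 (pc m) (pc m + length (compile P (While e1 e2 c) (pc m))))"
    using m(2) by (simp add: Let_def add.assoc)
  then obtain m' where "reaches w p (guard_length e1 e2) m m'" "represents s m'"
    "pc m' = (if aval e1 s < aval e2 s then pc m + guard_length e1 e2 else pc m + length (compile P (While e1 e2 c) (pc m)))"
    by (rule compile_guard_run[OF m(1) assms(1,2)])
  then show "\<exists>m'. reaches w p (guard_length e1 e2) m m' \<and> pc m' = pc m + length (compile P (While e1 e2 c) (pc m)) \<and> represents s m'"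
    using assms(3) by auto
qed

lemma realizes_mono: "realizes c s T s' \<Longrightarrow> T \<le> T' \<Longrightarrow> realizes c s T' s'"
  unfolding realizes_def using reaches_mono by blast

theorem compile_correct: "big_step c s t s' \<Longrightarrow> realizes c s (step_factor P c * Suc t) s'"
proof (induction rule: big_step.induct)
  case (Skip s)
  then show ?case by (auto simp: realizes_def intro: reaches_refl)
next
  case (Assign e s x)
  then show ?case by (auto intro: realizes_mono[OF realizes_Assign])
next
  case (Write e1 s e2 e3 a)
  then show ?case using R_ge by (intro realizes_mono[OF realizes_Write]) auto
next
  case (Seq c1 s t1 s1 c2 t2 s2)
  show ?case by (rule realizes_mono[OF realizes_Seq[OF Seq.IH]]) (simp add: algebra_simps)
next
  case (CondTrue e1 s e2 c1 t s' c2)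
  show ?case by (rule realizes_mono[OF realizes_CondTrue[OF CondTrue(1-3) CondTrue.IH]]) (simp add: algebra_simps)
next
  case (CondFalse e1 s e2 c2 t s' c1)
  show ?case by (rule realizes_mono[OF realizes_CondFalse[OF CondFalse(1-3) CondFalse.IH]]) (simp add: algebra_simps)
next
  case (WhileTrue e1 s e2 c t1 s1 t2 s2)
  show ?case by (rule realizes_mono[OF realizes_WhileTrue[OF WhileTrue(1-3) WhileTrue.IH]]) (simp add: algebra_simps)
next
  case (WhileFalse e1 s e2 c)
  then show ?case by (auto intro: realizes_mono[OF realizes_WhileFalse])
next
  case (Simulate s)
  have time: "length (guest_code P off) + 5 * var s vbudget \<le> step_factor P Simulate * Suc (var s vbudget)" for off
    by (simp add: length_guest_code algebra_simps)
  show ?case unfolding realizes_def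
    using guest_code_run[OF _ Simulate] reaches_mono[OF _ time] by (metis compile.simps(7))
qed

end

subsection \<open>Complete programs\<close>

abbreviation (input) "vwidth \<equiv> 25 :: nat"
abbreviation (input) "vexp \<equiv> 26 :: nat"
abbreviation (input) "aio \<equiv> 0 :: nat"

definition prologue :: prog where
  "prologue = [Op Or (var_reg vwidth) 0 0, Op Or (var_reg vn) 1 1, Op Or (var_reg vexp) 3 3,
     Imm 3 4, Op Div (var_reg vws) 0 3, Imm 3 1, Op Shl 0 3 (var_reg vws), Op Or (var_reg vinf) 0 0]"

definition program :: "prog \<Rightarrow> com \<Rightarrow> prog" where
  "program P c = prologue @ compile P c 8"

definition initial_store :: "nat \<Rightarrow> nat \<Rightarrow> nat \<Rightarrow> (nat \<Rightarrow> nat) \<Rightarrow> store" where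
  "initial_store w n e f = \<lparr>var = (\<lambda>x. if x = vn then n else if x = vws then w div 4 else if x = vinf then 2 ^ (w div 4)
       else if x = vwidth then w else if x = vexp then e else 0),
     arr = (\<lambda>a i j. if a = aio \<and> i = 0 then f j else 0)\<rparr>"

context ram
begin

lemma prologue_run:
  assumes "pc s = 0" "reg s 0 = w" "reg s 1 = n" "reg s 3 = e" "\<And>r. 4 \<le> r \<Longrightarrow> reg s r = 0" and zero: "\<And>a. R \<le> a \<Longrightarrow> mem s a = 0"
  obtains m where "reaches w (program P c) 8 s m" "pc m = 8" "represents (initial_store w n e (mem s)) m"
proof
  let ?m = "fold (exec w) prologue s"
  have mods: "4 mod 2 ^ w = (4::nat)" "1 mod 2 ^ w = (1::nat)" "2 ^ (w div 4) mod 2 ^ w = R"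
    using word_bounds R_def ws_def W_def by simp_all
  have m: "pc ?m = 8" "mem ?m = mem s"
    "reg ?m = (reg s)(var_reg vwidth := w, var_reg vn := n, var_reg vexp := e, var_reg vws := w div 4, 3 := 1, 0 := R, var_reg vinf := R)"
    using assms mods by (auto simp: prologue_def fun_eq_iff)
  show "reaches w (program P c) 8 s ?m"
    by (rule reaches_nonjump[OF _ _ refl]) (auto simp: prologue_def program_def assms(1))
  show "pc ?m = 8" by (rule m(1))
  have "mem s ((a * R + i) * R + j) = 0" if "a \<noteq> 0 \<or> i \<noteq> 0" for a i j
  proof (rule zero)
    have "1 * R \<le> (a * R + i) * R" using that R_ge by (intro mult_right_mono) (auto simp: Suc_le_eq)
    then show "R \<le> (a * R + i) * R + j" by linarith
  qed
  moreover have "reg s (var_reg x) = 0" for x by (rule assms(5)) (simp add: var_reg_def)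
  ultimately show "represents (initial_store w n e (mem s)) ?m"
    unfolding represents_def m by (auto simp: initial_store_def R_def ws_def)
qed

lemma program_run:
  assumes s: "pc s = 0" "reg s 0 = w" "reg s 1 = n" "reg s 3 = e" "\<And>r. 4 \<le> r \<Longrightarrow> reg s r = 0" "\<And>a. R \<le> a \<Longrightarrow> mem s a = 0"
    and big: "big_step c (initial_store w n e (mem s)) t s'"
  shows "\<exists>m. halts_within w (program P c) (real (8 + step_factor P c * Suc t)) s m \<and> (\<forall>j<R. mem m j = arr s' aio 0 j)"
proof -
  obtain m1 where m1: "reaches w (program P c) 8 s m1" "pc m1 = 8" "represents (initial_store w n e (mem s)) m1"
    by (rule prologue_run[OF s])
  have len: "length prologue = 8" by (simp add: prologue_def)
  have "code_at (program P c) (pc m1) (compile P c (pc m1))"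
    unfolding m1(2) by (auto simp: program_def code_at_def len nth_append)
  with compile_correct[OF big] m1(3) obtain m2 where
    m2: "reaches w (program P c) (step_factor P c * Suc t) m1 m2" "pc m2 = pc m1 + length (compile P c (pc m1))" "represents s' m2"
    by (rule realizesD)
  have "halted (program P c) m2" by (simp add: m1(2) m2(2) halted_def program_def len)
  moreover obtain k where "k \<le> 8 + step_factor P c * Suc t" "(step w (program P c) ^^ k) s = m2"
    using reaches_trans[OF m1(1) m2(1)] unfolding reaches_def by blast
  ultimately have "halts_within w (program P c) (real (8 + step_factor P c * Suc t)) s m2"
    unfolding halts_within_def by (intro exI[of _ k] conjI of_nat_mono)
  moreover have "mem m2 j = arr s' aio 0 j" if "j < R" for j
  proof -
    have "\<forall>a i j. a < R \<longrightarrow> i < R \<longrightarrow> j < R \<longrightarrow> mem m2 ((a * R + i) * R + j) = arr s' a i j"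
      using m2(3) by (simp add: represents_def)
    from this[rule_format, of 0 0 j] show ?thesis using that R_ge by simp
  qed
  ultimately show ?thesis by blast
qed

end

section \<open>Matrix multiplication\<close>

abbreviation (input) "vi \<equiv> 30 :: nat"
abbreviation (input) "vj \<equiv> 31 :: nat"
abbreviation (input) "vk \<equiv> 32 :: nat"
abbreviation (input) "vacc \<equiv> 33 :: nat"
abbreviation (input) "flat i j \<equiv> V i \<otimes> V vn \<oplus> V j"

definition naive_product :: com where
  "naive_product = FOR vk \<prec> vn DO
     vacc ::= V vacc \<oplus> aio\<langle>N 0, flat vi vk\<rangle> \<otimes> aio\<langle>N 0, V vn \<otimes> V vn \<oplus> flat vk vj\<rangle>"

definition naive_mul :: com where
  "naive_mul = FOR vi \<prec> vn DO FOR vj \<prec> vn DO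
     (vacc ::= N 0 ;; naive_product ;; aio\<langle>N 0, N 2 \<otimes> (V vn \<otimes> V vn) \<oplus> flat vi vj\<rangle> \<leftarrow> V vacc)"

lemma halts_within_mono: "halts_within w P T s s' \<Longrightarrow> T \<le> T' \<Longrightarrow> halts_within w P T' s s'"
  unfolding halts_within_def using order_trans by blast

lemma power_le_guest_modulus:
  fixes X :: real
  assumes "real (4 * k + 4) * log 2 X \<le> real w" "2 \<le> X"
  shows "X ^ k \<le> 2 ^ (w div 4)"
proof -
  have "w \<le> 4 * (w div 4) + 3" by presburger
  then have "real w \<le> real (4 * (w div 4) + 3)" by (simp only: of_nat_le_iff)
  moreover have "1 \<le> log 2 X" using assms(2) by simp
  ultimately have "real k * log 2 X \<le> real (w div 4)" using assms(1) by (simp add: algebra_simps)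
  then have "2 powr (log 2 X * real k) \<le> 2 powr real (w div 4)" by (simp add: mult.commute)
  then show ?thesis using assms(2) by (simp add: powr_powr[symmetric] powr_realpow)
qed

locale naive_mul_input = ram w P W R ws for w P W R ws +
  fixes n K :: nat and A B :: "nat \<Rightarrow> nat \<Rightarrow> nat"
  assumes n_less: "3 * n * n < R" and K_less: "n * (K * K) < R"
    and entries: "\<And>i j. i < n \<Longrightarrow> j < n \<Longrightarrow> A i j \<le> K \<and> B i j \<le> K"
begin

definition holds_input :: "(nat \<Rightarrow> nat) \<Rightarrow> bool" where
  "holds_input f \<longleftrightarrow> (\<forall>i<n. \<forall>j<n. f (i * n + j) = A i j \<and> f (n * n + (i * n + j)) = B i j)"

lemma index_bounds:
  assumes "i < n" "j < n"
  shows "i * n + j < n * n" "i * n < W" "i * n + j < R" "i * n + j < W" "n * n < W" "n * n + (i * n + j) < R" "n * n + (i * n + j) < W"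
    "2 * (n * n) < W" "2 * (n * n) + (i * n + j) < R" "2 * (n * n) + (i * n + j) < W"
proof -
  show "i * n + j < n * n" using assms by (rule mult_add_less)
  then show "i * n < W" "i * n + j < R" "i * n + j < W" "n * n < W" "n * n + (i * n + j) < R" "n * n + (i * n + j) < W"
    "2 * (n * n) < W" "2 * (n * n) + (i * n + j) < R" "2 * (n * n) + (i * n + j) < W"
    using n_less word_bounds(1) by linarith+
qed

lemma n_less_W: "n < W"
  using le_square[of n] n_less word_bounds(1) by linarith

lemma partial_product_less:
  assumes "i < n" "j < n" "k \<le> n"
  shows "(\<Sum>k<k. A i k * B k j) < W"
proof -
  have "(\<Sum>k<k. A i k * B k j) \<le> (\<Sum>k<k. K * K)" using entries assms by (intro sum_mono mult_le_mono) auto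
  also have "\<dots> \<le> n * (K * K)" using assms(3) by simp
  finally show ?thesis using K_less word_bounds(1) by linarith
qed

lemma naive_product_correct:
  assumes "var s vn = n" "var s vi = i" "var s vj = j" "var s vacc = 0" "i < n" "j < n" "holds_input (arr s aio 0)"
  shows "ensures naive_product s n (\<lambda>s'. var s' vacc = (\<Sum>k<n. A i k * B k j))"
  unfolding naive_product_def
proof (rule ensures_For[where m = n and b = 0 and I = "\<lambda>k s'. var s' vacc = (\<Sum>k<k. A i k * B k j)"], goal_cases vars init step exit time)
  case (step k s1)
  have same: "var s1 vi = i" "var s1 vj = j" "var s1 vn = n" "arr s1 aio = arr s aio" using step(4) assms by (auto simp: frame_def)
  have factors: "arr s aio 0 (i * n + k) = A i k" "arr s aio 0 (n * n + (k * n + j)) = B k j"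
    using assms step(1) by (auto simp: holds_input_def)
  have sum: "(\<Sum>k<k. A i k * B k j) + A i k * B k j < W" using partial_product_less[OF assms(5,6), of "Suc k"] step(1) by simp
  then have "A i k * B k j < W" by linarith
  then show ?case
    using step same factors sum index_bounds[OF assms(5) step(1)] index_bounds[OF step(1) assms(6)] word_bounds by simp
qed (use assms n_less_W in auto)

lemma naive_mul_correct:
  assumes "var s vn = n" "holds_input (arr s aio 0)"
  shows "ensures naive_mul s (n * Suc (n * Suc n)) (\<lambda>s'. \<forall>i<n. \<forall>j<n. arr s' aio 0 (2 * (n * n) + (i * n + j)) = (\<Sum>k<n. A i k * B k j))"
  unfolding naive_mul_def
proof (rule ensures_For_For[where m = n and l = n and b = n and I = "\<lambda>i j f. holds_input (f aio 0) \<and>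
     (\<forall>i'<n. \<forall>j'<n. i' < i \<or> i' = i \<and> j' < j \<longrightarrow> f aio 0 (2 * (n * n) + (i' * n + j')) = (\<Sum>k<n. A i' k * B k j'))"],
    goal_cases vars init row step exit time)
  case (step i j s1)
  define s2 where "s2 = s1\<lparr>var := (var s1)(vacc := 0)\<rparr>"
  have same: "var s2 vn = n" "var s2 vi = i" "var s2 vj = j" "var s2 vacc = 0" "holds_input (arr s2 aio 0)"
    using step(3-6) assms by (auto simp: frame_def naive_product_def s2_def)
  note product = naive_product_correct[OF same(1-4) step(1,2) same(5)]
  have "ensures (naive_product ;; aio\<langle>N 0, N 2 \<otimes> (V vn \<otimes> V vn) \<oplus> flat vi vj\<rangle> \<leftarrow> V vacc) s2 n
    (\<lambda>s'. holds_input (arr s' aio 0) \<and> (\<forall>i'<n. \<forall>j'<n. i' < i \<or> i' = i \<and> j' < Suc j \<longrightarrow>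
      arr s' aio 0 (2 * (n * n) + (i' * n + j')) = (\<Sum>k<n. A i' k * B k j')))"
  proof (rule ensures_Seq[OF product, where Tb = 0])
    fix s3 assume acc: "var s3 vacc = (\<Sum>k<n. A i k * B k j)" and "frame_of naive_product s2 s3"
    then have same3: "var s3 vn = n" "var s3 vi = i" "var s3 vj = j" "arr s3 aio = arr s1 aio"
      using same by (auto simp: frame_def naive_product_def s2_def)
    have "i' * n + j' \<noteq> 2 * (n * n) + (i * n + j)" "i' * n + j' \<noteq> n * n + (i * n + j)" if "i' < n" "j' < n" for i' j'
      using index_bounds(1)[OF that] by linarith+
    then show "ensures (aio\<langle>N 0, N 2 \<otimes> (V vn \<otimes> V vn) \<oplus> flat vi vj\<rangle> \<leftarrow> V vacc) s3 0
      (\<lambda>s'. holds_input (arr s' aio 0) \<and> (\<forall>i'<n. \<forall>j'<n. i' < i \<or> i' = i \<and> j' < Suc j \<longrightarrow>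
        arr s' aio 0 (2 * (n * n) + (i' * n + j')) = (\<Sum>k<n. A i' k * B k j')))"
      using acc same3 step(5) index_bounds[OF step(1,2)] word_bounds
      by (auto simp: holds_input_def mult_add_eq_iff step(2) less_Suc_eq)
  qed simp
  then show ?case using word_bounds by (simp add: s2_def)
qed (use assms n_less_W in \<open>auto simp: naive_product_def less_Suc_eq\<close>)

end

lemma naive_mul_run:
  assumes n: "1 \<le> n" and entries: "\<forall>i<n. \<forall>j<n. A i j \<le> K \<and> B i j \<le> K"
    and w: "44 * log 2 (real n + real K + 1) \<le> real w" and input: "matmul_input w n A B s"
  obtains s' t where "halts_within w (program [] naive_mul) (real (8 + step_factor [] naive_mul * Suc t)) s s'"
    "t \<le> n * Suc (n * Suc n)" "matmul_output n (\<lambda>i j. \<Sum>k<n. A i k * B k j) s'"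
proof -
  define X where "X = n + K + 1"
  define R where "R = (2::nat) ^ (w div 4)"
  have X: "2 \<le> X" "n \<le> X" "K \<le> X" using n by (auto simp: X_def)
  have "real X ^ 10 \<le> 2 ^ (w div 4)"
    by (rule power_le_guest_modulus) (use w X in \<open>auto simp: X_def algebra_simps\<close>)
  then have XR: "X ^ 10 \<le> R" by (metis R_def of_nat_le_iff of_nat_numeral of_nat_power)
  have "X ^ 4 < X ^ 10" "2 ^ 10 \<le> X ^ 10" using X(1) power_mono[OF X(1), of 10] by (auto intro: power_strict_increasing)
  then have X4: "X ^ 4 < R" and R1000: "1000 \<le> R" using XR by simp_all
  have "3 * n * n \<le> (2 * 2) * (n * n)" by simp
  also have "\<dots> \<le> (X * X) * (X * X)" using X by (intro mult_le_mono) auto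
  finally have n_less: "3 * n * n < R" using X4 by (simp add: power4_eq_xxxx mult.assoc)
  have "1 * (n * (K * K)) \<le> X * (X * (X * X))" using X by (intro mult_le_mono) auto
  then have K_less: "n * (K * K) < R" using X4 by (simp add: power4_eq_xxxx mult.assoc)
  interpret naive_mul_input w "[]" "2 ^ w" R "w div 4" n K A B
    by unfold_locales (use R1000 n_less K_less entries in \<open>auto simp: R_def\<close>)
  have "holds_input (arr (initial_store w n 0 (mem s)) aio 0)"
    using input by (auto simp: initial_store_def matmul_input_def holds_input_def add.assoc)
  from naive_mul_correct[OF _ this] obtain t st where
    big: "big_step naive_mul (initial_store w n 0 (mem s)) t st" and t: "t \<le> n * Suc (n * Suc n)" and
    st: "\<forall>i<n. \<forall>j<n. arr st aio 0 (2 * (n * n) + (i * n + j)) = (\<Sum>k<n. A i k * B k j)"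
    by (auto simp: ensures_def initial_store_def)
  have "\<exists>s'. halts_within w (program [] naive_mul) (real (8 + step_factor [] naive_mul * Suc t)) s s' \<and> (\<forall>j<R. mem s' j = arr st aio 0 j)"
    by (rule program_run[OF _ _ _ _ _ _ big]) (use input n_less in \<open>auto simp: matmul_input_def\<close>)
  then obtain s' where run: "halts_within w (program [] naive_mul) (real (8 + step_factor [] naive_mul * Suc t)) s s'"
    and mem: "\<forall>j<R. mem s' j = arr st aio 0 j" by blast
  have "matmul_output n (\<lambda>i j. \<Sum>k<n. A i k * B k j) s'"
    using mem st index_bounds(9) by (auto simp: matmul_output_def add.assoc mult.assoc)
  with run t show ?thesis by (rule that)
qed

theorem matmul_in_time_3: "matmul_in_time 3"
proof -
  define C where "C = real (8 + step_factor [] naive_mul * 4)"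
  have "\<exists>s'. halts_within w (program [] naive_mul) (C * real n powr 3) s s' \<and> matmul_output n (\<lambda>i j. \<Sum>k<n. A i k * B k j) s'"
    if input: "1 \<le> n" "\<forall>i<n. \<forall>j<n. A i j \<le> K \<and> B i j \<le> K" "44 * log 2 (real n + real K + 1) \<le> real w" "matmul_input w n A B s"
    for n w K A B s
  proof -
    obtain s' t where run: "halts_within w (program [] naive_mul) (real (8 + step_factor [] naive_mul * Suc t)) s s'"
      "t \<le> n * Suc (n * Suc n)" "matmul_output n (\<lambda>i j. \<Sum>k<n. A i k * B k j) s'"
      by (rule naive_mul_run[OF input])
    have "1 \<le> n ^ 3" "n \<le> n ^ 3" "n * n \<le> n ^ 3" "n * Suc (n * Suc n) = n ^ 3 + n * n + n"
      using \<open>1 \<le> n\<close> by (auto simp: power3_eq_cube algebra_simps)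
    then have "Suc t \<le> 4 * n ^ 3" "1 \<le> n ^ 3" using run(2) by linarith+
    then have "8 + step_factor [] naive_mul * Suc t \<le> 8 * n ^ 3 + step_factor [] naive_mul * (4 * n ^ 3)"
      by (intro add_mono mult_le_mono2) auto
    also have "\<dots> = (8 + step_factor [] naive_mul * 4) * n ^ 3" by (simp add: algebra_simps)
    finally have "real (8 + step_factor [] naive_mul * Suc t) \<le> C * real n ^ 3"
      unfolding C_def by (metis of_nat_le_iff of_nat_mult of_nat_power)
    also have "real n ^ 3 = real n powr 3" using \<open>1 \<le> n\<close> by (simp add: powr_numeral)
    finally show ?thesis using run halts_within_mono by blast
  qed
  then show ?thesis unfolding matmul_in_time_def
    by (intro exI[of _ "program [] naive_mul"] exI[of _ C] exI[of _ 44]) auto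
qed

lemma card_changed_cells_le:
  "finite {a. mem ((step w P ^^ t) s) a \<noteq> mem s a} \<and> card {a. mem ((step w P ^^ t) s) a \<noteq> mem s a} \<le> t"
proof (induction t)
  case (Suc t)
  let ?s = "(step w P ^^ t) s" and ?C = "\<lambda>t. {a. mem ((step w P ^^ t) s) a \<noteq> mem s a}"
  have "\<exists>x. \<forall>a. a \<noteq> x \<longrightarrow> mem (step w P ?s) a = mem ?s a"
    by (cases "P ! pc ?s") (auto simp: step_def)
  then obtain x where "\<forall>a. a \<noteq> x \<longrightarrow> mem (step w P ?s) a = mem ?s a" by blast
  then have sub: "?C (Suc t) \<subseteq> insert x (?C t)" by auto
  then have "card (?C (Suc t)) \<le> card (insert x (?C t))" using Suc by (intro card_mono) auto
  also have "\<dots> \<le> Suc t" using Suc card_insert_le_m1[of "Suc t" "?C t" x] by simp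
  finally show ?case using finite_subset[OF sub] Suc by auto
qed auto

lemma matmul_output_time_ge:
  assumes input: "matmul_input w n A B s" and halts: "halts_within w P T s s'"
    and out: "matmul_output n D s'" and D: "\<And>i j. i < n \<Longrightarrow> j < n \<Longrightarrow> D i j \<noteq> 0"
  shows "real n * real n \<le> T"
proof -
  obtain t where t: "real t \<le> T" "(step w P ^^ t) s = s'" using halts by (auto simp: halts_within_def)
  have "{2 * n * n..<2 * n * n + n * n} \<subseteq> {a. mem s' a \<noteq> mem s a}"
  proof
    fix a assume a: "a \<in> {2 * n * n..<2 * n * n + n * n}"
    define b where "b = a - 2 * n * n"
    have b: "a = 2 * n * n + b" "b < n * n" using a by (auto simp: b_def)
    then have "0 < n" by (cases n) auto
    then have cell: "b div n < n" "b mod n < n" using b(2) by (auto simp: less_mult_imp_div_less)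
    have "mem s' (2 * n * n + b div n * n + b mod n) = D (b div n) (b mod n)"
      using out cell unfolding matmul_output_def by blast
    moreover have "2 * n * n + b div n * n + b mod n = a" unfolding b(1) add.assoc div_mult_mod_eq ..
    ultimately have "mem s' a \<noteq> 0" using D[OF cell] by simp
    then show "a \<in> {a. mem s' a \<noteq> mem s a}" using input b(1) by (simp add: matmul_input_def)
  qed
  then have "card {2 * n * n..<2 * n * n + n * n} \<le> card {a. mem s' a \<noteq> mem s a}"
    using card_changed_cells_le[where w = w and P = P and t = t and s = s] t(2) by (intro card_mono) auto
  also have "\<dots> \<le> t" using card_changed_cells_le[where w = w and P = P and t = t and s = s] t(2) by auto
  finally have "real (n * n) \<le> real t" by (simp only: of_nat_le_iff) simp
  then show ?thesis using t(1) by simp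
qed

lemma powr_le_const_imp_nonpos:
  assumes "\<And>n::nat. 1 \<le> n \<Longrightarrow> real n powr a \<le> C"
  shows "a \<le> 0"
proof (rule ccontr)
  assume "\<not> a \<le> 0"
  then have a: "0 < a" by simp
  obtain n :: nat where n: "(\<bar>C\<bar> + 1) powr (1 / a) \<le> real n" using real_arch_simple by blast
  have "0 < (\<bar>C\<bar> + 1) powr (1 / a)" by simp
  then have "1 \<le> n" using n by (cases n) auto
  have "\<bar>C\<bar> + 1 = ((\<bar>C\<bar> + 1) powr (1 / a)) powr a" using a by (simp add: powr_powr)
  also have "\<dots> \<le> real n powr a" using n a by (intro powr_mono2) auto
  finally show False using assms[OF \<open>1 \<le> n\<close>] by linarith
qed

lemma matmul_in_time_ge_2:
  assumes "matmul_in_time \<tau>"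
  shows "2 \<le> \<tau>"
proof -
  from assms obtain P C c where matmul: "\<And>n w K A B s.
      n \<ge> 1 \<Longrightarrow> (\<forall>i<n. \<forall>j<n. A i j \<le> K \<and> B i j \<le> K) \<Longrightarrow> c * log 2 (real n + real K + 1) \<le> real w \<Longrightarrow> matmul_input w n A B s \<Longrightarrow>
      (\<exists>s'. halts_within w P (C * real n powr \<tau>) s s' \<and> matmul_output n (\<lambda>i j. \<Sum>k<n. A i k * B k j) s')"
    unfolding matmul_in_time_def by blast
  have "real n powr (2 - \<tau>) \<le> C" if n: "1 \<le> n" for n
  proof -
    obtain w :: nat where w: "c * log 2 (real n + real 1 + 1) \<le> real w" using real_arch_simple by blast
    let ?s = "\<lparr>pc = 0, reg = (\<lambda>r. if r = 0 then w else if r = 1 then n else 0), mem = (\<lambda>a. if a < 2 * n * n then 1 else 0)\<rparr>"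
    have input: "matmul_input w n (\<lambda>_ _. 1) (\<lambda>_ _. 1) ?s"
      using mult_add_less[of _ n _ n] by (fastforce simp: matmul_input_def)
    obtain s' where "halts_within w P (C * real n powr \<tau>) ?s s'" "matmul_output n (\<lambda>i j. n) s'"
      using matmul[OF n _ w input] by auto
    then have "real n * real n \<le> C * real n powr \<tau>" by (rule matmul_output_time_ge[OF input]) auto
    then show ?thesis using n by (simp add: powr_diff powr_numeral power2_eq_square divide_le_eq)
  qed
  then have "2 - \<tau> \<le> 0" by (rule powr_le_const_imp_nonpos)
  then show ?thesis by simp
qed

section \<open>Sorting the entries of a matrix\<close>

abbreviation (input) "vnn \<equiv> 9 :: nat"
abbreviation (input) "vrun \<equiv> 23 :: nat"
abbreviation (input) "vtwice \<equiv> 24 :: nat"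
abbreviation (input) "vx \<equiv> 30 :: nat"
abbreviation (input) "va \<equiv> 31 :: nat"
abbreviation (input) "vb \<equiv> 32 :: nat"
abbreviation (input) "vmid \<equiv> 33 :: nat"
abbreviation (input) "vend \<equiv> 34 :: nat"
abbreviation (input) "vright \<equiv> 35 :: nat"
abbreviation (input) "aQ \<equiv> 5 :: nat"
abbreviation (input) "aord \<equiv> 6 :: nat"
abbreviation (input) "amerged \<equiv> 7 :: nat"
abbreviation (input) "akey \<equiv> 8 :: nat"

subsection \<open>Merging\<close>

definition block_sorted :: "(nat \<Rightarrow> nat) \<Rightarrow> nat \<Rightarrow> nat \<Rightarrow> (nat \<Rightarrow> nat) \<Rightarrow> bool" where
  "block_sorted k h m p \<longleftrightarrow> (\<forall>x y. x \<le> y \<longrightarrow> y < m \<longrightarrow> x div h = y div h \<longrightarrow> k (p x) \<le> k (p y))"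

text \<open>
  The runs \<open>{lo..<mid}\<close> and \<open>{mid..<hi}\<close> of \<open>p\<close> are merged into \<open>t\<close>; the elements from \<open>a\<close> and from
  \<open>b\<close> on are left, and \<open>x\<close> is the next position to be filled.
\<close>

definition unmerged :: "nat \<Rightarrow> nat \<Rightarrow> nat \<Rightarrow> nat \<Rightarrow> nat set" where
  "unmerged a mid b hi = {a..<mid} \<union> {b..<hi}"

definition merging :: "(nat \<Rightarrow> nat) \<Rightarrow> (nat \<Rightarrow> nat) \<Rightarrow> nat \<Rightarrow> nat \<Rightarrow> nat \<Rightarrow> nat \<Rightarrow> nat \<Rightarrow> nat \<Rightarrow> nat \<Rightarrow> nat \<Rightarrow> (nat \<Rightarrow> nat) \<Rightarrow> bool" where
  "merging k p h m x lo a b mid hi t \<longleftrightarrow> lo mod (2 * h) = 0 \<and> lo \<le> x \<and> mid = min (lo + h) m \<and> hi = min (lo + 2 * h) m \<and>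
     lo \<le> a \<and> a \<le> mid \<and> mid \<le> b \<and> b \<le> hi \<and> a + b = x + mid \<and> t ` {..<x} = p ` ({..<a} \<union> {mid..<b}) \<and>
     block_sorted k (2 * h) x t \<and> (\<forall>x'\<in>{lo..<x}. \<forall>y\<in>unmerged a mid b hi. k (t x') \<le> k (p y))"

lemma merging_start:
  assumes "x mod (2 * h) = 0" "x < m" "t ` {..<x} = p ` {..<x}" "block_sorted k (2 * h) x t"
  shows "merging k p h m x x x (min (x + h) m) (min (x + h) m) (min (x + 2 * h) m) t"
  using assms by (auto simp: merging_def)

lemma div_eq_in_block: "lo mod h = 0 \<Longrightarrow> lo \<le> x \<Longrightarrow> x < lo + h \<Longrightarrow> x div h = lo div (h::nat)"
  by (intro div_nat_eqI) (auto simp: mod_0_imp_dvd)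

lemma block_sorted_snoc:
  assumes "block_sorted k H x t" "lo mod H = 0" "lo \<le> x" "x < lo + H" "\<And>x'. x' \<in> {lo..<x} \<Longrightarrow> k (t x') \<le> k v"
  shows "block_sorted k H (Suc x) (t(x := v))"
  unfolding block_sorted_def
proof (intro allI impI)
  fix x' y assume x'y: "x' \<le> y" "y < Suc x" "x' div H = y div H"
  show "k ((t(x := v)) x') \<le> k ((t(x := v)) y)"
  proof (cases "y = x")
    case True
    then have "x' div H = lo div H" using x'y(3) div_eq_in_block[OF assms(2-4)] by simp
    then have "lo \<le> x'" using assms(2) by (metis div_times_less_eq_dividend mod_0_imp_dvd dvd_div_mult_self)
    then show ?thesis using True x'y(1) assms(5)[of x'] by auto
  qed (use x'y assms(1) in \<open>auto simp: block_sorted_def\<close>)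
qed

lemma merging_take:
  assumes m: "merging k p h m x lo a b mid hi t" and c: "c \<in> unmerged a mid b hi" "\<And>y. y \<in> unmerged a mid b hi \<Longrightarrow> k (p c) \<le> k (p y)"
    and advance: "c = a \<and> a < mid \<and> a' = Suc a \<and> b' = b \<or> c = b \<and> a' = a \<and> b' = Suc b"
  shows "merging k p h m (Suc x) lo a' b' mid hi (t(x := p c))"
proof -
  have inv: "lo mod (2 * h) = 0" "lo \<le> x" "mid = min (lo + h) m" "hi = min (lo + 2 * h) m" "lo \<le> a" "a \<le> mid" "mid \<le> b" "b \<le> hi"
    "a + b = x + mid" "t ` {..<x} = p ` ({..<a} \<union> {mid..<b})" "block_sorted k (2 * h) x t"
    and less: "\<And>x' y. x' \<in> {lo..<x} \<Longrightarrow> y \<in> unmerged a mid b hi \<Longrightarrow> k (t x') \<le> k (p y)"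
    using m unfolding merging_def by auto
  have "b' \<le> hi" "a' \<le> mid" using advance inv c(1) by (auto simp: unmerged_def)
  then have "x < lo + 2 * h" using inv advance by linarith
  then have sorted: "block_sorted k (2 * h) (Suc x) (t(x := p c))"
    by (rule block_sorted_snoc[OF inv(11,1,2)]) (rule less[OF _ c(1)])
  have "(t(x := p c)) ` {..<Suc x} = insert (p c) (t ` {..<x})" by (auto simp: lessThan_Suc image_iff)
  also have "\<dots> = p ` ({..<a'} \<union> {mid..<b'})" unfolding inv(10) using advance inv(6,7) by (auto simp: less_Suc_eq)
  finally have image: "(t(x := p c)) ` {..<Suc x} = p ` ({..<a'} \<union> {mid..<b'})" .
  have "unmerged a' mid b' hi \<subseteq> unmerged a mid b hi" using advance by (auto simp: unmerged_def)
  then have "\<forall>x'\<in>{lo..<Suc x}. \<forall>y\<in>unmerged a' mid b' hi. k ((t(x := p c)) x') \<le> k (p y)"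
    using less c(2) by (auto simp: less_Suc_eq)
  then show ?thesis unfolding merging_def using inv sorted image \<open>b' \<le> hi\<close> \<open>a' \<le> mid\<close> advance by auto
qed

lemma merging_min:
  assumes m: "merging k p h m x lo a b mid hi t" and p: "block_sorted k h m p"
    and c: "c = a \<and> a < mid \<and> (b < hi \<longrightarrow> k (p a) \<le> k (p b)) \<or> c = b \<and> b < hi \<and> (a < mid \<longrightarrow> k (p b) \<le> k (p a))"
    and y: "y \<in> unmerged a mid b hi"
  shows "k (p c) \<le> k (p y)"
proof -
  have inv: "lo mod (2 * h) = 0" "mid = min (lo + h) m" "hi = min (lo + 2 * h) m" "lo \<le> a" "mid \<le> b" "b \<le> hi"
    using m unfolding merging_def by auto
  have start: "lo mod h = 0" "(lo + h) mod h = 0"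
    using inv(1) by (metis mod_mult_self2_is_0 mod_mod_cancel dvd_triv_right mod_0 mod_add_self2)+
  have left: "k (p z) \<le> k (p y)" if "lo \<le> z" "z \<le> y" "y < mid" for z y
  proof -
    have "z div h = lo div h" "y div h = lo div h" using that inv by (auto intro!: div_eq_in_block start)
    then show ?thesis using p that inv unfolding block_sorted_def by auto
  qed
  have right: "k (p z) \<le> k (p y)" if "mid \<le> z" "z \<le> y" "y < hi" for z y
  proof -
    have "mid = lo + h" using that inv by auto
    then have "z div h = (lo + h) div h" "y div h = (lo + h) div h" using that inv by (auto intro!: div_eq_in_block start)
    then show ?thesis using p that inv unfolding block_sorted_def by auto
  qed
  consider "a \<le> y" "y < mid" | "b \<le> y" "y < hi" using y by (auto simp: unmerged_def)
  then show ?thesis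
  proof cases
    case 1
    then have "k (p a) \<le> k (p y)" using inv(4) by (intro left)
    then show ?thesis using c 1 by (auto intro: order_trans)
  next
    case 2
    then have "k (p b) \<le> k (p y)" using inv(5) by (intro right)
    then show ?thesis using c 2 by (auto intro: order_trans)
  qed
qed

definition merge_bounds :: com where
  "merge_bounds = IF V vx \<odot> V vtwice \<prec> N 1
     THEN (va ::= V vx ;; vmid ::= V vx \<oplus> V vrun ;; (IF V vnn \<prec> V vmid THEN vmid ::= V vnn ELSE SKIP) ;; vb ::= V vmid ;;
       vend ::= V vx \<oplus> V vtwice ;; IF V vnn \<prec> V vend THEN vend ::= V vnn ELSE SKIP)
     ELSE SKIP"

definition merge_take :: com where
  "merge_take = vright ::= N 0 ;;
     (IF V va \<prec> V vmid
      THEN (IF V vb \<prec> V vend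
        THEN (IF akey\<langle>N 0, aord\<langle>N 0, V vb\<rangle>\<rangle> \<prec> akey\<langle>N 0, aord\<langle>N 0, V va\<rangle>\<rangle> THEN vright ::= N 1 ELSE SKIP)
        ELSE SKIP)
      ELSE vright ::= N 1) ;;
     IF V vright \<prec> N 1
     THEN (amerged\<langle>N 0, V vx\<rangle> \<leftarrow> aord\<langle>N 0, V va\<rangle> ;; va ::= V va \<oplus> N 1)
     ELSE (amerged\<langle>N 0, V vx\<rangle> \<leftarrow> aord\<langle>N 0, V vb\<rangle> ;; vb ::= V vb \<oplus> N 1)"

definition merge_pass :: com where
  "merge_pass = FOR vx \<prec> vnn DO (merge_bounds ;; merge_take)"

definition in_block :: "(nat \<Rightarrow> nat) \<Rightarrow> (nat \<Rightarrow> nat) \<Rightarrow> nat \<Rightarrow> nat \<Rightarrow> nat \<Rightarrow> store \<Rightarrow> bool" where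
  "in_block k p h m x s \<longleftrightarrow> x < var s vend \<and>
     (\<exists>lo. merging k p h m x lo (var s va) (var s vb) (var s vmid) (var s vend) (arr s amerged 0))"

definition at_block_end :: "(nat \<Rightarrow> nat) \<Rightarrow> (nat \<Rightarrow> nat) \<Rightarrow> nat \<Rightarrow> nat \<Rightarrow> nat \<Rightarrow> store \<Rightarrow> bool" where
  "at_block_end k p h m x s \<longleftrightarrow> arr s amerged 0 ` {..<x} = p ` {..<x} \<and> block_sorted k (2 * h) x (arr s amerged 0) \<and>
     (x mod (2 * h) = 0 \<or> x = m)"

lemma merging_at_end:
  assumes "merging k p h m x lo a b mid hi t" "x = hi"
  shows "t ` {..<x} = p ` {..<x} \<and> block_sorted k (2 * h) x t \<and> (x mod (2 * h) = 0 \<or> x = m)"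
proof -
  have inv: "lo mod (2 * h) = 0" "hi = min (lo + 2 * h) m" "a \<le> mid" "mid \<le> b" "b \<le> hi" "a + b = x + mid"
    "t ` {..<x} = p ` ({..<a} \<union> {mid..<b})" "block_sorted k (2 * h) x t" using assms(1) unfolding merging_def by auto
  then have "a = mid" "b = x" using assms(2) by linarith+
  then have "{..<a} \<union> {mid..<b} = {..<x}" using inv(4) by auto
  then show ?thesis using inv assms(2) by (auto simp: min_def)
qed

lemma in_block_bounds:
  assumes "in_block k p h m x s"
  shows "var s va \<le> var s vmid" "var s vmid \<le> m" "var s vmid \<le> var s vb" "var s vb \<le> var s vend" "var s vend \<le> m"
    "var s va + var s vb = x + var s vmid"
  using assms unfolding in_block_def merging_def by auto

context ram
begin

lemma merge_bounds_correct:
  assumes inv: "at_block_end k p h m x s \<or> in_block k p h m x s" and x: "var s vx = x" "x < m"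
    and h: "1 \<le> h" "h < m" "3 * m < R" and vars: "var s vnn = m" "var s vrun = h" "var s vtwice = 2 * h"
  shows "ensures merge_bounds s 0 (in_block k p h m x)"
proof (cases "x mod (2 * h) = 0")
  case True
  have "at_block_end k p h m x s"
    using inv
  proof
    assume "in_block k p h m x s"
    then obtain lo where lo: "merging k p h m x lo (var s va) (var s vb) (var s vmid) (var s vend) (arr s amerged 0)" "x < var s vend"
      by (auto simp: in_block_def)
    then have "lo mod (2 * h) = 0" "lo \<le> x" "x < lo + 2 * h" by (auto simp: merging_def)
    then have "x = lo" using True by (metis div_eq_in_block div_mult_mod_eq)
    then have "{..<var s va} \<union> {var s vmid..<var s vb} = {..<x}" using lo(1) unfolding merging_def by auto
    then show ?thesis using lo(1) True by (auto simp: at_block_end_def merging_def)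
  qed
  then have "merging k p h m x x x (min (x + h) m) (min (x + h) m) (min (x + 2 * h) m) (arr s amerged 0)"
    using True x(2) by (intro merging_start) (auto simp: at_block_end_def)
  moreover have "x < min (x + 2 * h) m" using x(2) h(1) by simp
  ultimately show ?thesis using True x h vars word_bounds unfolding merge_bounds_def by (auto simp: in_block_def min_def)
next
  case False
  then show ?thesis using inv x vars word_bounds unfolding merge_bounds_def by (auto simp: at_block_end_def)
qed

lemma in_block_take:
  assumes "in_block k p h m x s" and p: "block_sorted k h m p"
    and c: "c = var s va \<and> a = Suc c \<and> b = var s vb \<and> c < var s vmid \<and> (var s vb < var s vend \<longrightarrow> k (p c) \<le> k (p (var s vb))) \<or>
      c = var s vb \<and> a = var s va \<and> b = Suc c \<and> c < var s vend \<and> (var s va < var s vmid \<longrightarrow> k (p c) \<le> k (p (var s va)))"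
    and s': "var s' va = a" "var s' vb = b" "var s' vmid = var s vmid" "var s' vend = var s vend" "arr s' amerged 0 = (arr s amerged 0)(x := p c)"
  shows "at_block_end k p h m (Suc x) s' \<or> in_block k p h m (Suc x) s'"
proof -
  obtain lo where lo: "x < var s vend" "merging k p h m x lo (var s va) (var s vb) (var s vmid) (var s vend) (arr s amerged 0)"
    using assms(1) by (auto simp: in_block_def)
  have "c \<in> unmerged (var s va) (var s vmid) (var s vb) (var s vend)" using c by (auto simp: unmerged_def)
  moreover have "k (p c) \<le> k (p y)" if "y \<in> unmerged (var s va) (var s vmid) (var s vb) (var s vend)" for y
    by (rule merging_min[OF lo(2) p _ that]) (use c in auto)
  ultimately have "merging k p h m (Suc x) lo a b (var s vmid) (var s vend) (arr s' amerged 0)"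
    unfolding s' by (rule merging_take[OF lo(2)]) (use c in auto)
  moreover from this have "at_block_end k p h m (Suc x) s'" if "Suc x = var s vend"
    using merging_at_end that unfolding at_block_end_def by blast
  ultimately show ?thesis using lo(1) s' unfolding in_block_def by (cases "Suc x = var s vend") auto
qed

lemma merge_take_correct:
  assumes b: "in_block k p h m x s" and p: "block_sorted k h m p" "\<And>x. x < m \<Longrightarrow> p x < m" and vars: "var s vx = x" "3 * m < R"
    and arrs: "arr s akey 0 = k" "arr s aord 0 = p"
  shows "ensures merge_take s 0 (\<lambda>s'. at_block_end k p h m (Suc x) (s'\<lparr>var := (var s')(vx := Suc x)\<rparr>) \<or>
    in_block k p h m (Suc x) (s'\<lparr>var := (var s')(vx := Suc x)\<rparr>))" (is "ensures _ _ _ ?Q")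
proof -
  note bounds = in_block_bounds[OF b]
  have x: "x < var s vend" using b by (simp add: in_block_def)
  show ?thesis
  proof (cases "var s va < var s vmid \<and> (var s vb < var s vend \<longrightarrow> k (p (var s va)) \<le> k (p (var s vb)))")
    case True
    have "?Q (s\<lparr>var := (var s)(vright := 0, va := Suc (var s va)), arr := arr_upd (arr s) amerged 0 x (p (var s va))\<rparr>)"
      by (rule in_block_take[OF b p(1), of "var s va"]) (use True in \<open>auto simp: fun_upd_def\<close>)
    then show ?thesis using True bounds x p(2)[of "var s va"] p(2)[of "var s vb"] vars arrs word_bounds
      unfolding merge_take_def by (auto simp: not_less)
  next
    case False
    then have right: "var s vb < var s vend" using bounds x by linarith
    have "?Q (s\<lparr>var := (var s)(vright := 1, vb := Suc (var s vb)), arr := arr_upd (arr s) amerged 0 x (p (var s vb))\<rparr>)"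
      by (rule in_block_take[OF b p(1), of "var s vb"]) (use False right in \<open>auto simp: fun_upd_def\<close>)
    then show ?thesis using False right bounds x p(2)[of "var s va"] p(2)[of "var s vb"] vars arrs word_bounds
      unfolding merge_take_def by (auto simp: not_less)
  qed
qed

lemma merge_pass_correct:
  assumes s: "var s vnn = m" "var s vrun = h" "var s vtwice = 2 * h" "1 \<le> h" "h < m" "3 * m < R"
    and p: "arr s aord 0 ` {..<m} = {..<m}" "block_sorted (arr s akey 0) h m (arr s aord 0)"
  shows "ensures merge_pass s m (\<lambda>s'. arr s' amerged 0 ` {..<m} = {..<m} \<and> block_sorted (arr s akey 0) (2 * h) m (arr s' amerged 0))"
proof -
  let ?k = "arr s akey 0" and ?p = "arr s aord 0"
  have less: "?p x < m" if "x < m" for x using p(1) that by blast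
  show ?thesis unfolding merge_pass_def
  proof (rule ensures_For[where m = m and b = 0 and I = "\<lambda>x s'. at_block_end ?k ?p h m x s' \<or> in_block ?k ?p h m x s'"],
      goal_cases vars init step exit time)
    case (step x s1)
    have same: "var s1 vnn = m" "var s1 vrun = h" "var s1 vtwice = 2 * h" "arr s1 akey = arr s akey" "arr s1 aord = arr s aord"
      using step(4) s by (auto simp: frame_def merge_bounds_def merge_take_def)
    show ?case
    proof (rule ensures_Seq[OF merge_bounds_correct[OF step(3,2,1) s(4-6) same(1-3)], where Tb = 0])
      fix s2 assume "in_block ?k ?p h m x s2" and fr: "frame_of merge_bounds s1 s2"
      moreover have "var s2 vx = x" "arr s2 akey 0 = ?k" "arr s2 aord 0 = ?p"
        using fr step(2) same by (auto simp: frame_def merge_bounds_def)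
      ultimately show "ensures merge_take s2 0 (\<lambda>s'. at_block_end ?k ?p h m (Suc x) (s'\<lparr>var := (var s')(vx := Suc x)\<rparr>) \<or>
          in_block ?k ?p h m (Suc x) (s'\<lparr>var := (var s')(vx := Suc x)\<rparr>))"
        using p(2) less s(6) by (intro merge_take_correct)
    qed simp
  next
    case (exit s1)
    then show ?case using p(1) by (auto simp: at_block_end_def in_block_def merging_def)
  qed (use s word_bounds in \<open>auto simp: at_block_end_def block_sorted_def merge_bounds_def merge_take_def\<close>)
qed

end

subsection \<open>Merge sort\<close>

definition sort_init :: com where
  "sort_init = FOR vx \<prec> vnn DO (akey\<langle>N 0, V vx\<rangle> \<leftarrow> aQ\<langle>V vx \<oslash> V vn, V vx \<odot> V vn\<rangle> ;; aord\<langle>N 0, V vx\<rangle> \<leftarrow> V vx)"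

definition adopt_merged :: com where
  "adopt_merged = FOR vx \<prec> vnn DO aord\<langle>N 0, V vx\<rangle> \<leftarrow> amerged\<langle>N 0, V vx\<rangle>"

definition double_runs :: com where
  "double_runs = vtwice ::= V vrun \<oplus> V vrun ;; merge_pass ;; adopt_merged ;; vrun ::= V vtwice"

definition sort_entries :: com where
  "sort_entries = sort_init ;; vrun ::= N 1 ;; WHILE V vrun \<prec> V vnn DO double_runs"

lemmas sort_defs = sort_init_def adopt_merged_def double_runs_def merge_pass_def merge_bounds_def merge_take_def sort_entries_def

definition sorts_entries :: "nat \<Rightarrow> matrix \<Rightarrow> (nat \<Rightarrow> nat) \<Rightarrow> bool" where
  "sorts_entries n Q p \<longleftrightarrow> p ` {..<n * n} = {..<n * n} \<and>
     (\<forall>x y. x \<le> y \<longrightarrow> y < n * n \<longrightarrow> Q (p x div n) (p x mod n) \<le> Q (p y div n) (p y mod n))"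

context ram
begin

definition runs_sorted :: "nat \<Rightarrow> (nat \<Rightarrow> nat) \<Rightarrow> nat \<Rightarrow> store \<Rightarrow> bool" where
  "runs_sorted m k f s \<longleftrightarrow> 1 \<le> var s vrun \<and> m \<le> var s vrun * 2 ^ f \<and> var s vnn = m \<and> (\<forall>x<m. arr s akey 0 x = k x) \<and>
     arr s aord 0 ` {..<m} = {..<m} \<and> block_sorted (arr s akey 0) (var s vrun) m (arr s aord 0)"

lemma double_runs_correct:
  assumes inv: "runs_sorted m k f s" and more: "var s vrun < m" and m: "4 * m < R"
  shows "ensures double_runs s (2 * m) (\<lambda>s'. \<exists>f'<f. runs_sorted m k f' s')"
proof -
  let ?h = "var s vrun"
  define s1 where "s1 = s\<lparr>var := (var s)(vtwice := 2 * ?h)\<rparr>"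
  have pass: "ensures merge_pass s1 m (\<lambda>s'. arr s' amerged 0 ` {..<m} = {..<m} \<and> block_sorted (arr s1 akey 0) (2 * ?h) m (arr s' amerged 0))"
    by (rule merge_pass_correct) (use inv more m in \<open>auto simp: runs_sorted_def s1_def\<close>)
  have adopt: "ensures adopt_merged s2 m (\<lambda>s'. \<forall>x<m. arr s' aord 0 x = arr s2 amerged 0 x)" if "var s2 vnn = m" for s2
    unfolding adopt_merged_def
  proof (rule ensures_For[where m = m and b = 0 and I = "\<lambda>y s'. \<forall>x<y. arr s' aord 0 x = arr s2 amerged 0 x"], goal_cases vars init step exit time)
    case (step x s3)
    have "arr s3 amerged = arr s2 amerged" using step(4) by (auto simp: frame_def)
    then show ?case using step m word_bounds by (auto simp: less_Suc_eq)
  qed (use that m word_bounds in auto)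
  have "ensures (merge_pass ;; adopt_merged ;; vrun ::= V vtwice) s1 (2 * m) (\<lambda>s'. \<exists>f'<f. runs_sorted m k f' s')"
  proof (rule ensures_Seq[OF pass, where Tb = m])
    fix s2 assume merged: "arr s2 amerged 0 ` {..<m} = {..<m} \<and> block_sorted (arr s1 akey 0) (2 * ?h) m (arr s2 amerged 0)"
      and fr: "frame_of merge_pass s1 s2"
    have s2: "var s2 vnn = m" "var s2 vtwice = 2 * ?h" "arr s2 akey = arr s akey"
      using fr inv by (auto simp: frame_def s1_def sort_defs runs_sorted_def)
    show "ensures (adopt_merged ;; vrun ::= V vtwice) s2 m (\<lambda>s'. \<exists>f'<f. runs_sorted m k f' s')"
    proof (rule ensures_Seq[OF adopt[OF s2(1)], where Tb = 0])
      fix s3 assume copied: "\<forall>x<m. arr s3 aord 0 x = arr s2 amerged 0 x" and "frame_of adopt_merged s2 s3"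
      then have s3: "var s3 vnn = m" "var s3 vtwice = 2 * ?h" "arr s3 akey = arr s akey"
        using s2 by (auto simp: frame_def adopt_merged_def)
      have "arr s3 aord 0 ` {..<m} = {..<m}" using merged copied by (metis (no_types, lifting) image_cong lessThan_iff)
      moreover have "block_sorted (arr s akey 0) (2 * ?h) m (arr s3 aord 0)"
        using merged copied unfolding block_sorted_def s1_def by auto
      moreover obtain f' where "f = Suc f'" using inv more by (cases f) (auto simp: runs_sorted_def)
      ultimately show "ensures (vrun ::= V vtwice) s3 0 (\<lambda>s'. \<exists>f'<f. runs_sorted m k f' s')"
        using inv s3 by (auto simp: runs_sorted_def intro!: exI[of _ f'])
    qed simp
  qed simp
  then show ?thesis using more m word_bounds by (simp add: double_runs_def s1_def mult_2)
qed

lemma sort_entries_correct: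
  assumes s: "var s vn = n" "var s vnn = n * n" "4 * (n * n) < R" and F: "n * n \<le> 2 ^ F"
  shows "ensures sort_entries s (n * n + Suc F * Suc (2 * (n * n))) (\<lambda>s'. sorts_entries n (arr s aQ) (arr s' aord 0))"
proof -
  let ?m = "n * n" and ?k = "\<lambda>x. arr s aQ (x div n) (x mod n)"
  have init: "ensures sort_init s ?m (\<lambda>s'. \<forall>x<?m. arr s' akey 0 x = ?k x \<and> arr s' aord 0 x = x)"
    unfolding sort_init_def
  proof (rule ensures_For[where m = ?m and b = 0 and I = "\<lambda>y s'. \<forall>x<y. arr s' akey 0 x = ?k x \<and> arr s' aord 0 x = x"],
      goal_cases vars init step exit time)
    case (step x s1)
    have same: "var s1 vn = n" "arr s1 aQ = arr s aQ" using step(4) s by (auto simp: frame_def)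
    have "0 < n" using step(1) by (cases n) auto
    then have "x div n < n" "x mod n < n" "n \<le> ?m" using step(1) by (auto simp: less_mult_imp_div_less)
    then have "x div n < R" "x mod n < R" "x < R" using s step(1) by linarith+
    then show ?case using step same word_bounds by (auto simp: less_Suc_eq)
  qed (use s word_bounds in auto)
  show ?thesis unfolding sort_entries_def
  proof (rule ensures_Seq[OF init, where Tb = "Suc F * Suc (2 * ?m)"])
    fix s1 assume "\<forall>x<?m. arr s1 akey 0 x = ?k x \<and> arr s1 aord 0 x = x" and "frame_of sort_init s s1"
    then have "runs_sorted ?m ?k F (s1\<lparr>var := (var s1)(vrun := 1)\<rparr>)"
      using s F by (auto simp: frame_def sort_init_def runs_sorted_def block_sorted_def)
    then have "ensures (WHILE V vrun \<prec> V vnn DO double_runs) (s1\<lparr>var := (var s1)(vrun := 1)\<rparr>) (Suc F * Suc (2 * ?m))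
      (\<lambda>s'. sorts_entries n (arr s aQ) (arr s' aord 0))"
    proof (rule ensures_While[where I = "runs_sorted ?m ?k" and b = "2 * ?m"], goal_cases guard step exit time)
      case (step f s2)
      then show ?case using s(3) by (intro double_runs_correct) (auto simp: runs_sorted_def)
    next
      case (exit f s2)
      then have "?m \<le> var s2 vrun" by (simp add: runs_sorted_def)
      then have "x div var s2 vrun = 0" if "x < ?m" for x using that by simp
      then have "arr s2 akey 0 (arr s2 aord 0 x) \<le> arr s2 akey 0 (arr s2 aord 0 y)" if "x \<le> y" "y < ?m" for x y
        using exit(1) that unfolding runs_sorted_def block_sorted_def by auto
      moreover have "arr s2 akey 0 (arr s2 aord 0 x) = ?k (arr s2 aord 0 x)" if "x < ?m" for x
        using exit(1) that unfolding runs_sorted_def by blast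
      ultimately show ?case using exit(1) by (auto simp: sorts_entries_def runs_sorted_def)
    qed auto
    then show "ensures (vrun ::= N 1 ;; WHILE V vrun \<prec> V vnn DO double_runs) s1 (Suc F * Suc (2 * ?m)) (\<lambda>s'. sorts_entries n (arr s aQ) (arr s' aord 0))"
      using word_bounds by simp
  qed simp
qed

end

subsection \<open>Ranks within rows and columns\<close>

definition count_below :: "(nat \<Rightarrow> nat) \<Rightarrow> nat \<Rightarrow> nat \<Rightarrow> nat" where
  "count_below f i x = card {y. y < x \<and> f y = i}"

lemma count_below_0 [simp]: "count_below f i 0 = 0" by (simp add: count_below_def)

lemma count_below_Suc: "count_below f i (Suc x) = count_below f i x + (if f x = i then 1 else 0)"
proof -
  have "{y. y < Suc x \<and> f y = i} = (if f x = i then insert x {y. y < x \<and> f y = i} else {y. y < x \<and> f y = i})"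
    by (auto simp: less_Suc_eq)
  then show ?thesis by (simp add: count_below_def)
qed

lemma count_below_mono: "x \<le> y \<Longrightarrow> count_below f i x \<le> count_below f i y"
  unfolding count_below_def by (intro card_mono) auto

lemma count_below_strict_mono: "x < y \<Longrightarrow> f x = i \<Longrightarrow> count_below f i x < count_below f i y"
  using count_below_mono[of "Suc x" y f i] by (simp add: count_below_Suc)

lemma count_below_attained: "p < count_below f i m \<Longrightarrow> \<exists>x<m. f x = i \<and> count_below f i x = p"
proof (induction m)
  case (Suc m)
  then show ?case by (cases "p < count_below f i m") (auto simp: count_below_Suc less_Suc_eq split: if_splits)
qed simp

lemma sum_count_below: "(\<And>y. y < x \<Longrightarrow> f y < n) \<Longrightarrow> (\<Sum>i<n. count_below f i x) = x"
proof (induction x)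
  case (Suc x)
  have "(\<Sum>i<n. if f x = i then 1 else 0) = (1::nat)" using Suc.prems[of x] by simp
  then show ?case using Suc by (simp add: count_below_Suc sum.distrib)
qed simp

text \<open>
  The \<open>x\<close>-th entry in increasing order lies in line \<open>f x\<close>, at place \<open>g x\<close> of this line; lines are
  rows or columns. \<open>pos i k\<close> is the rank of entry \<open>k\<close> within line \<open>i\<close>, and \<open>elem i\<close> is the inverse map.
\<close>

definition line_ranks :: "nat \<Rightarrow> (nat \<Rightarrow> nat) \<Rightarrow> (nat \<Rightarrow> nat) \<Rightarrow> matrix \<Rightarrow> matrix \<Rightarrow> matrix \<Rightarrow> bool" where
  "line_ranks n f g Q pos elem \<longleftrightarrow> (\<forall>x<n * n. pos (f x) (g x) = count_below f (f x) x) \<and>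
     (\<forall>i<n. \<forall>k<n. pos i k < n \<and> elem i (pos i k) = k \<and> elem i k < n \<and> pos i (elem i k) = k) \<and>
     (\<forall>i<n. \<forall>k<n. \<forall>k'<n. pos i k \<le> pos i k' \<longrightarrow> Q i k \<le> Q i k')"

lemma count_below_line:
  assumes bij: "bij_betw (\<lambda>x. (f x, g x)) {..<n * n} ({..<n} \<times> {..<n})" and "i < n"
  shows "count_below f i (n * n) = n"
proof -
  have "(\<lambda>x. (f x, g x)) ` {x. x < n * n \<and> f x = i} = (\<lambda>x. (f x, g x)) ` {..<n * n} \<inter> {i} \<times> UNIV" by auto
  also have "\<dots> = {i} \<times> {..<n}" using bij \<open>i < n\<close> by (auto simp: bij_betw_def)
  finally have "bij_betw (\<lambda>x. (f x, g x)) {x. x < n * n \<and> f x = i} ({i} \<times> {..<n})"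
    by (intro bij_betw_subset[OF bij]) auto
  then show ?thesis using bij_betw_same_card by (fastforce simp: count_below_def)
qed

lemma line_ranksI:
  assumes bij: "bij_betw (\<lambda>x. (f x, g x)) {..<n * n} ({..<n} \<times> {..<n})"
    and sorted: "\<And>x y. x \<le> y \<Longrightarrow> y < n * n \<Longrightarrow> Q (f x) (g x) \<le> Q (f y) (g y)"
    and elem: "\<And>x. x < n * n \<Longrightarrow> elem (f x) (count_below f (f x) x) = g x"
    and pos: "\<And>x. x < n * n \<Longrightarrow> pos (f x) (g x) = count_below f (f x) x"
  shows "line_ranks n f g Q pos elem"
proof -
  have entry: "\<exists>x<n * n. f x = i \<and> g x = k" if "i < n" "k < n" for i k
  proof -
    have "(i, k) \<in> (\<lambda>x. (f x, g x)) ` {..<n * n}" using bij that by (simp add: bij_betw_def)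
    then show ?thesis by auto
  qed
  have less: "f x < n" "g x < n" if "x < n * n" for x using bij_betwE[OF bij] that by auto
  have "pos i k < n \<and> elem i (pos i k) = k" if ik: "i < n" "k < n" for i k
  proof -
    obtain x where x: "x < n * n" "f x = i" "g x = k" using entry[OF ik] by blast
    then show ?thesis using pos elem count_below_strict_mono[of x "n * n" f i] count_below_line[OF bij ik(1)] by force
  qed
  moreover have "elem i p < n \<and> pos i (elem i p) = p" if ip: "i < n" "p < n" for i p
  proof -
    obtain x where "x < n * n" "f x = i" "count_below f i x = p"
      using count_below_attained[of p f i "n * n"] count_below_line[OF bij ip(1)] ip(2) by auto
    then show ?thesis using pos elem less by force
  qed
  moreover have "Q i k \<le> Q i k'" if ranks: "i < n" "k < n" "k' < n" "pos i k \<le> pos i k'" for i k k'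
  proof -
    obtain x x' where x: "x < n * n" "f x = i" "g x = k" and x': "x' < n * n" "f x' = i" "g x' = k'"
      using entry[OF ranks(1,2)] entry[OF ranks(1,3)] by blast
    have "\<not> x' < x" using count_below_strict_mono[of x' x f i] x x' pos[of x] pos[of x'] ranks(4) by auto
    then show ?thesis using sorted[of x x'] x x' by auto
  qed
  ultimately show ?thesis using pos by (simp add: line_ranks_def)
qed

definition line_ranks_upto :: "nat \<Rightarrow> (nat \<Rightarrow> nat) \<Rightarrow> (nat \<Rightarrow> nat) \<Rightarrow> (nat \<Rightarrow> nat) \<Rightarrow> matrix \<Rightarrow> matrix \<Rightarrow> nat \<Rightarrow> bool" where
  "line_ranks_upto n f g num pos elem x \<longleftrightarrow> (\<forall>i<n. num i = count_below f i x) \<and>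
     (\<forall>y<x. elem (f y) (count_below f (f y) y) = g y \<and> pos (f y) (g y) = count_below f (f y) y)"

lemma line_ranks_upto_Suc:
  assumes "line_ranks_upto n f g num pos elem x" and inj: "\<And>y. y < x \<Longrightarrow> (f y, g y) \<noteq> (f x, g x)"
  defines "c \<equiv> count_below f (f x) x"
  shows "line_ranks_upto n f g (\<lambda>i. if i = f x then Suc c else num i) (\<lambda>i k. if i = f x \<and> k = g x then c else pos i k)
    (\<lambda>i p. if i = f x \<and> p = c then g x else elem i p) (Suc x)"
proof -
  have "count_below f (f x) y \<noteq> c" if "y < x" "f y = f x" for y
    using count_below_strict_mono[of y x f "f x"] that by (simp add: c_def)
  then show ?thesis using assms(1) inj unfolding line_ranks_upto_def
    by (auto simp: less_Suc_eq count_below_Suc c_def)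
qed

definition ranked :: "nat \<Rightarrow> matrix \<Rightarrow> (nat \<Rightarrow> nat) \<Rightarrow> matrix \<Rightarrow> matrix \<Rightarrow>
    matrix \<Rightarrow> matrix \<Rightarrow> bool" where
  "ranked n Q ord row_pos row_at col_pos col_at \<longleftrightarrow> bij_betw (\<lambda>x. (ord x div n, ord x mod n)) {..<n * n} ({..<n} \<times> {..<n}) \<and>
     line_ranks n (\<lambda>x. ord x div n) (\<lambda>x. ord x mod n) Q row_pos row_at \<and>
     line_ranks n (\<lambda>x. ord x mod n) (\<lambda>x. ord x div n) (\<lambda>k i. Q i k) col_pos col_at"

lemma bij_betw_div_mod:
  assumes "ord ` {..<n * n} = {..<n * (n::nat)}"
  shows "bij_betw (\<lambda>x. (ord x div n, ord x mod n)) {..<n * n} ({..<n} \<times> {..<n})"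
proof -
  have "inj_on ord {..<n * n}" using assms by (intro eq_card_imp_inj_on) auto
  then have "bij_betw ord {..<n * n} {..<n * n}" using assms by (simp add: bij_betw_def)
  moreover have "bij_betw (\<lambda>z. (z div n, z mod n)) {..<n * n} ({..<n} \<times> {..<n})"
  proof (rule bij_betw_byWitness[where f' = "\<lambda>(i, k). i * n + k"])
    show "(\<lambda>z. (z div n, z mod n)) ` {..<n * n} \<subseteq> {..<n} \<times> {..<n}"
      by (cases "n = 0") (auto simp: less_mult_imp_div_less)
    show "(\<lambda>(i, k). i * n + k) ` ({..<n} \<times> {..<n}) \<subseteq> {..<n * n}" using mult_add_less by auto
  qed auto
  ultimately have "bij_betw ((\<lambda>z. (z div n, z mod n)) \<circ> ord) {..<n * n} ({..<n} \<times> {..<n})" by (rule bij_betw_trans)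
  then show ?thesis by (simp add: comp_def)
qed

lemma bij_betw_swap: "bij_betw (\<lambda>x. (f x, g x)) X (A \<times> B) \<Longrightarrow> bij_betw (\<lambda>x. (g x, f x)) X (B \<times> A)"
  by (auto simp: bij_betw_def inj_on_def image_iff set_eq_iff) (metis prod.inject)+

abbreviation (input) "ventry \<equiv> 31 :: nat"
abbreviation (input) "vrow \<equiv> 32 :: nat"
abbreviation (input) "vcol \<equiv> 33 :: nat"
abbreviation (input) "vrow_num \<equiv> 34 :: nat"
abbreviation (input) "vcol_num \<equiv> 35 :: nat"
abbreviation (input) "arow_at \<equiv> 9 :: nat"
abbreviation (input) "acol_at \<equiv> 10 :: nat"
abbreviation (input) "arow_pos \<equiv> 11 :: nat"
abbreviation (input) "acol_pos \<equiv> 12 :: nat"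
abbreviation (input) "arow_num \<equiv> 13 :: nat"
abbreviation (input) "acol_num \<equiv> 14 :: nat"

definition rank_clear :: com where
  "rank_clear = FOR vx \<prec> vn DO (arow_num\<langle>N 0, V vx\<rangle> \<leftarrow> N 0 ;; acol_num\<langle>N 0, V vx\<rangle> \<leftarrow> N 0)"

definition rank_entry :: com where
  "rank_entry = ventry ::= aord\<langle>N 0, V vx\<rangle> ;; vrow ::= V ventry \<oslash> V vn ;; vcol ::= V ventry \<odot> V vn ;;
     vrow_num ::= arow_num\<langle>N 0, V vrow\<rangle> ;; vcol_num ::= acol_num\<langle>N 0, V vcol\<rangle> ;;
     arow_at\<langle>V vrow, V vrow_num\<rangle> \<leftarrow> V vcol ;; arow_pos\<langle>V vrow, V vcol\<rangle> \<leftarrow> V vrow_num ;; arow_num\<langle>N 0, V vrow\<rangle> \<leftarrow> V vrow_num \<oplus> N 1 ;;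
     acol_at\<langle>V vcol, V vcol_num\<rangle> \<leftarrow> V vrow ;; acol_pos\<langle>V vcol, V vrow\<rangle> \<leftarrow> V vcol_num ;; acol_num\<langle>N 0, V vcol\<rangle> \<leftarrow> V vcol_num \<oplus> N 1"

definition rank_entries :: com where
  "rank_entries = rank_clear ;; FOR vx \<prec> vnn DO rank_entry"

definition rank_inv :: "nat \<Rightarrow> (nat \<Rightarrow> nat) \<Rightarrow> nat \<Rightarrow> store \<Rightarrow> bool" where
  "rank_inv n p x s \<longleftrightarrow>
     line_ranks_upto n (\<lambda>x. p x div n) (\<lambda>x. p x mod n) (arr s arow_num 0) (arr s arow_pos) (arr s arow_at) x \<and>
     line_ranks_upto n (\<lambda>x. p x mod n) (\<lambda>x. p x div n) (arr s acol_num 0) (arr s acol_pos) (arr s acol_at) x"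

context ram
begin

lemma rank_entry_correct:
  assumes inv: "rank_inv n p x s" and x: "var s vx = x" "x < n * n" and s: "var s vn = n" "arr s aord 0 = p" "4 * (n * n) < R"
    and p: "p ` {..<n * n} = {..<n * n}"
  shows "ensures rank_entry s 0 (\<lambda>s'. rank_inv n p (Suc x) (s'\<lparr>var := (var s')(vx := Suc x)\<rparr>))"
proof -
  let ?f = "\<lambda>x. p x div n" and ?g = "\<lambda>x. p x mod n"
  note bij = bij_betw_div_mod[OF p]
  note swapped = bij_betw_swap[OF bij]
  let ?c = "count_below ?f (?f x) x" and ?d = "count_below ?g (?g x) x"
  have line: "?f x < n" "?g x < n" using bij_betwE[OF bij] x(2) by auto
  have "?c < n" "?d < n"
    using count_below_strict_mono[of x "n * n" ?f "?f x"] count_below_line[OF bij line(1)]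
      count_below_strict_mono[of x "n * n" ?g "?g x"] count_below_line[OF swapped line(2)] x(2) by simp_all
  then have bounds: "?f x < R" "?g x < R" "?c < R" "?d < R" "x < R" using line s(3) x(2) le_square[of n] by linarith+
  have num: "arr s arow_num 0 (?f x) = ?c" "arr s acol_num 0 (?g x) = ?d"
    using inv line by (auto simp: rank_inv_def line_ranks_upto_def)
  have "(?f y, ?g y) \<noteq> (?f x, ?g x)" if "y < x" for y using bij that x(2) by (force simp: bij_betw_def inj_on_def)
  then have inj: "(?f y, ?g y) \<noteq> (?f x, ?g x)" "(?g y, ?f y) \<noteq> (?g x, ?f x)" if "y < x" for y using that by auto
  let ?s = "s\<lparr>var := (var s)(ventry := p x, vrow := ?f x, vcol := ?g x, vrow_num := ?c, vcol_num := ?d, vx := Suc x),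
    arr := arr_upd (arr_upd (arr_upd (arr_upd (arr_upd (arr_upd (arr s) arow_at (?f x) ?c (?g x)) arow_pos (?f x) (?g x) ?c)
      arow_num 0 (?f x) (Suc ?c)) acol_at (?g x) ?d (?f x)) acol_pos (?g x) (?f x) ?d) acol_num 0 (?g x) (Suc ?d)\<rparr>"
  have "rank_inv n p (Suc x) ?s"
    using inv line_ranks_upto_Suc[where f = ?f and g = ?g and x = x, OF _ inj(1)] line_ranks_upto_Suc[where f = ?g and g = ?f and x = x, OF _ inj(2)]
    by (simp add: rank_inv_def)
  then show ?thesis using x(1) s(1,2) num bounds word_bounds unfolding rank_entry_def by simp
qed

lemma rank_entries_correct:
  assumes s: "var s vn = n" "var s vnn = n * n" "4 * (n * n) < R" and sorted: "sorts_entries n (arr s aQ) (arr s aord 0)"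
  shows "ensures rank_entries s (n + n * n)
    (\<lambda>s'. ranked n (arr s aQ) (arr s aord 0) (arr s' arow_pos) (arr s' arow_at) (arr s' acol_pos) (arr s' acol_at))"
proof -
  let ?p = "arr s aord 0"
  have p: "?p ` {..<n * n} = {..<n * n}" using sorted by (simp add: sorts_entries_def)
  note bij = bij_betw_div_mod[OF p]
  note swapped = bij_betw_swap[OF bij]
  have small: "n < R" "n < W" "n * n < W" using le_square[of n] s(3) word_bounds by linarith+
  have clear: "ensures rank_clear s n (\<lambda>s'. \<forall>i<n. arr s' arow_num 0 i = 0 \<and> arr s' acol_num 0 i = 0)" unfolding rank_clear_def
    by (rule ensures_For[where m = n and b = 0 and I = "\<lambda>i s'. \<forall>i'<i. arr s' arow_num 0 i' = 0 \<and> arr s' acol_num 0 i' = 0"])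
      (use s small word_bounds in \<open>auto simp: less_Suc_eq\<close>)
  show ?thesis unfolding rank_entries_def
  proof (rule ensures_Seq[OF clear, where Tb = "n * n"])
    fix s1 assume zero: "\<forall>i<n. arr s1 arow_num 0 i = 0 \<and> arr s1 acol_num 0 i = 0" and fr: "frame_of rank_clear s s1"
    show "ensures (FOR vx \<prec> vnn DO rank_entry) s1 (n * n)
      (\<lambda>s'. ranked n (arr s aQ) ?p (arr s' arow_pos) (arr s' arow_at) (arr s' acol_pos) (arr s' acol_at))"
    proof (rule ensures_For[where m = "n * n" and b = 0 and I = "rank_inv n ?p"], goal_cases vars init step exit time)
      case (step x s2)
      show ?case by (rule rank_entry_correct[OF step(3,2,1) _ _ s(3) p]) (use step(4) fr s in \<open>auto simp: frame_def rank_clear_def rank_entry_def\<close>)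
    next
      case (exit s2)
      then show ?case using bij swapped sorted unfolding ranked_def rank_inv_def line_ranks_upto_def sorts_entries_def
        by (intro conjI line_ranksI) auto
    qed (use fr zero s small in \<open>auto simp: frame_def rank_clear_def rank_entry_def rank_inv_def line_ranks_upto_def\<close>)
  qed simp
qed

end

section \<open>Dominance products\<close>

abbreviation (input) "vq \<equiv> 15 :: nat"
abbreviation (input) "vblocks \<equiv> 16 :: nat"
abbreviation (input) "vshift \<equiv> 17 :: nat"
abbreviation (input) "vok \<equiv> 18 :: nat"
abbreviation (input) "vgroup_size \<equiv> 19 :: nat"
abbreviation (input) "vrow_blocks \<equiv> 20 :: nat"
abbreviation (input) "vrows \<equiv> 21 :: nat"
abbreviation (input) "vcols \<equiv> 22 :: nat"
abbreviation (input) "vblock \<equiv> 36 :: nat"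
abbreviation (input) "vbest \<equiv> 37 :: nat"
abbreviation (input) "vy \<equiv> 38 :: nat"
abbreviation (input) "vpos \<equiv> 39 :: nat"
abbreviation (input) "vthreshold \<equiv> 40 :: nat"
abbreviation (input) "vmin \<equiv> 41 :: nat"
abbreviation (input) "vgroup \<equiv> 42 :: nat"
abbreviation (input) "vid \<equiv> 43 :: nat"
abbreviation (input) "vlabel \<equiv> 44 :: nat"
abbreviation (input) "amark \<equiv> 15 :: nat"
abbreviation (input) "aresult \<equiv> 16 :: nat"
abbreviation (input) "arow_open \<equiv> 17 :: nat"
abbreviation (input) "arow_id \<equiv> 18 :: nat"
abbreviation (input) "arow_label \<equiv> 19 :: nat"
abbreviation (input) "acol_open \<equiv> 20 :: nat"
abbreviation (input) "acol_id \<equiv> 21 :: nat"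
abbreviation (input) "acol_label \<equiv> 22 :: nat"

subsection \<open>Numbering the blocks met by a group\<close>

text \<open>
  Every line is cut into blocks of \<open>q\<close> consecutive ranks. Among the positions \<open>{x0..<x}\<close>, line \<open>i\<close>
  meets consecutive blocks; \<open>open_block\<close> is one more than the last of them, or \<open>0\<close> if there is none.
\<close>

definition num_blocks :: "nat \<Rightarrow> nat \<Rightarrow> nat" where
  "num_blocks n q = n div q + 1"

definition open_block :: "(nat \<Rightarrow> nat) \<Rightarrow> nat \<Rightarrow> nat \<Rightarrow> nat \<Rightarrow> nat \<Rightarrow> nat" where
  "open_block f q x0 x i = (if count_below f i x = count_below f i x0 then 0 else (count_below f i x - 1) div q + 1)"

definition met_blocks :: "(nat \<Rightarrow> nat) \<Rightarrow> nat \<Rightarrow> nat \<Rightarrow> nat \<Rightarrow> nat \<Rightarrow> nat" where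
  "met_blocks f q x0 x i = open_block f q x0 x i - (if open_block f q x0 x i = 0 then 0 else count_below f i x0 div q)"

lemma open_block_Suc:
  "x0 \<le> x \<Longrightarrow> open_block f q x0 (Suc x) i = (if i = f x then count_below f i x div q + 1 else open_block f q x0 x i)"
  using count_below_mono[of x0 x f i] by (auto simp: open_block_def count_below_Suc)

lemma open_block_le: "open_block f q x0 x i \<le> count_below f i x div q + 1"
  by (auto simp: open_block_def div_le_mono)

lemma open_block_refl [simp]: "open_block f q x x i = 0" and met_blocks_refl [simp]: "met_blocks f q x x i = 0"
  by (auto simp: open_block_def met_blocks_def)

lemma met_blocks_Suc:
  assumes "x0 \<le> x" "0 < q"
  shows "met_blocks f q x0 (Suc x) i =
    met_blocks f q x0 x i + (if i = f x \<and> open_block f q x0 x i < count_below f i x div q + 1 then 1 else 0)"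
proof (cases "i = f x \<and> open_block f q x0 x i \<noteq> 0")
  case True
  let ?c = "count_below f i x" and ?d = "count_below f i x0"
  have c: "?d \<le> ?c - 1" "0 < ?c" using True count_below_mono[OF assms(1), of f i] by (auto simp: open_block_def split: if_splits)
  have "?d div q \<le> (?c - 1) div q" by (rule div_le_mono) (rule c(1))
  moreover have "?c div q = (?c - 1) div q \<or> ?c div q = (?c - 1) div q + 1" using c(2) by (cases ?c) (auto simp: div_Suc)
  ultimately show ?thesis using True open_block_Suc[OF assms(1), of f q i]
    by (auto simp: met_blocks_def open_block_def split: if_splits)
next
  case False
  then show ?thesis using open_block_Suc[OF assms(1), of f q i]
    by (auto simp: met_blocks_def open_block_def count_below_Suc split: if_splits)
qed

lemma met_blocks_le: "0 < q \<Longrightarrow> x0 \<le> x \<Longrightarrow> met_blocks f q x0 x i * q + count_below f i x0 \<le> count_below f i x + 2 * q"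
proof (cases "open_block f q x0 x i = 0")
  case False
  assume q: "0 < q" and x: "x0 \<le> x"
  let ?c = "count_below f i x" and ?d = "count_below f i x0"
  have c: "?d \<le> ?c - 1" using False count_below_mono[OF x, of f i] by (auto simp: open_block_def split: if_splits)
  have "met_blocks f q x0 x i * q = (?c - 1) div q * q + q - ?d div q * q"
    using False by (simp add: met_blocks_def open_block_def diff_mult_distrib split: if_splits)
  moreover have "?d div q * q \<le> (?c - 1) div q * q" by (intro mult_le_mono1 div_le_mono c)
  moreover have "(?c - 1) div q * q \<le> ?c - 1" "?d < ?d div q * q + q"
    using dividend_less_div_times[OF q, of ?d] by simp_all
  ultimately show ?thesis using c by linarith
qed (simp add: met_blocks_def count_below_mono trans_le_add1)

lemma sum_met_blocks_le:
  assumes "x0 \<le> x" "x \<le> x0 + n * q" "0 < q" "\<And>y. y < x \<Longrightarrow> f y < n"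
  shows "(\<Sum>i<n. met_blocks f q x0 x i) \<le> 3 * n"
proof -
  have "(\<Sum>i<n. met_blocks f q x0 x i * q + count_below f i x0) \<le> (\<Sum>i<n. count_below f i x + 2 * q)"
    by (intro sum_mono met_blocks_le assms)
  then have "(\<Sum>i<n. met_blocks f q x0 x i) * q + x0 \<le> x + n * (2 * q)"
    using sum_count_below[of x f n] sum_count_below[of x0 f n] assms by (simp add: sum.distrib sum_distrib_right)
  moreover have "n * (2 * q) = 2 * (n * q)" "3 * n * q = 3 * (n * q)" by simp_all
  ultimately have "(\<Sum>i<n. met_blocks f q x0 x i) * q \<le> 3 * n * q" using assms(2) by linarith
  then show ?thesis using assms(3) by simp
qed

text \<open>
  The blocks met so far are numbered in order of appearance; \<open>ids i\<close> is the number of the last block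
  of line \<open>i\<close>, and block \<open>b\<close> of line \<open>i\<close> is recorded in \<open>lab\<close> as \<open>i * num_blocks n q + b\<close>.
\<close>

definition blocks_numbered :: "nat \<Rightarrow> nat \<Rightarrow> (nat \<Rightarrow> nat) \<Rightarrow> nat \<Rightarrow> nat \<Rightarrow> (nat \<Rightarrow> nat) \<Rightarrow> (nat \<Rightarrow> nat) \<Rightarrow> (nat \<Rightarrow> nat) \<Rightarrow> nat \<Rightarrow> bool" where
  "blocks_numbered n q f x0 x opn ids lab num \<longleftrightarrow>
     (\<forall>i<n. opn i = open_block f q x0 x i) \<and> num = (\<Sum>i<n. met_blocks f q x0 x i) \<and>
     (\<forall>i<n. opn i \<noteq> 0 \<longrightarrow> ids i < num \<and> lab (ids i) = i * num_blocks n q + (opn i - 1)) \<and>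
     (\<forall>p<num. \<exists>i<n. \<exists>b. b * q < n \<and> lab p = i * num_blocks n q + b)"

lemma blocks_numbered_le:
  assumes "blocks_numbered n q f x0 x opn ids lab num" "x0 \<le> x" "x \<le> x0 + n * q" "0 < q" "\<And>y. y < x \<Longrightarrow> f y < n"
  shows "num \<le> 3 * n"
  using sum_met_blocks_le[OF assms(2-5)] assms(1) by (simp add: blocks_numbered_def)

lemma blocks_numbered_Suc:
  assumes inv: "blocks_numbered n q f x0 x opn ids lab num" and x: "x0 \<le> x" "0 < q" "f x < n"
  defines "i \<equiv> f x" and "b \<equiv> count_below f (f x) x div q"
  assumes b: "b * q < n"
  shows "opn i < Suc b \<Longrightarrow> blocks_numbered n q f x0 (Suc x) (\<lambda>i'. if i' = i then Suc b else opn i')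
      (\<lambda>i'. if i' = i then num else ids i') (\<lambda>p. if p = num then i * num_blocks n q + b else lab p) (Suc num)"
    and "\<not> opn i < Suc b \<Longrightarrow> blocks_numbered n q f x0 (Suc x) opn ids lab num \<and> ids i < num \<and> lab (ids i) = i * num_blocks n q + b"
proof -
  have inv': "\<forall>i<n. opn i = open_block f q x0 x i" "num = (\<Sum>i<n. met_blocks f q x0 x i)"
      "\<forall>i<n. opn i \<noteq> 0 \<longrightarrow> ids i < num \<and> lab (ids i) = i * num_blocks n q + (opn i - 1)"
      "\<forall>p<num. \<exists>i<n. \<exists>b. b * q < n \<and> lab p = i * num_blocks n q + b"
    using inv by (auto simp: blocks_numbered_def)
  have opn: "open_block f q x0 (Suc x) i' = (if i' = i then Suc b else opn i')" if "i' < n" for i'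
    using that inv'(1) open_block_Suc[OF x(1), of f q i'] by (simp add: i_def b_def)
  have "(\<Sum>i'<n. if i' = i \<and> opn i < Suc b then 1 else 0) = (if opn i < Suc b then 1 else (0::nat))"
    using x(3) by (auto simp: i_def)
  moreover have "met_blocks f q x0 (Suc x) i' = met_blocks f q x0 x i' + (if i' = i \<and> opn i < Suc b then 1 else 0)" if "i' < n" for i'
    using that inv'(1) met_blocks_Suc[OF x(1,2), of f i'] by (auto simp: i_def b_def)
  ultimately have num: "(\<Sum>i<n. met_blocks f q x0 (Suc x) i) = num + (if opn i < Suc b then 1 else 0)"
    using inv'(2) by (simp add: sum.distrib)
  show "blocks_numbered n q f x0 (Suc x) (\<lambda>i'. if i' = i then Suc b else opn i')
      (\<lambda>i'. if i' = i then num else ids i') (\<lambda>p. if p = num then i * num_blocks n q + b else lab p) (Suc num)" if "opn i < Suc b"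
  proof -
    have "\<exists>i'<n. \<exists>b'. b' * q < n \<and> (if p = num then i * num_blocks n q + b else lab p) = i' * num_blocks n q + b'" if "p < Suc num" for p
      using that inv'(4) x(3) b by (cases "p = num") (auto simp: i_def less_Suc_eq)
    then show ?thesis unfolding blocks_numbered_def using num that inv'(3) by (auto simp: opn less_Suc_eq)
  qed
  assume old: "\<not> opn i < Suc b"
  have "opn i = Suc b" using old x(3) inv'(1) open_block_le[of f q x0 x i] by (force simp: i_def b_def)
  moreover from this have "open_block f q x0 (Suc x) i' = opn i'" if "i' < n" for i' using opn[OF that] by simp
  ultimately show "blocks_numbered n q f x0 (Suc x) opn ids lab num \<and> ids i < num \<and> lab (ids i) = i * num_blocks n q + b"
    using inv'(3,4) x(3) old num unfolding blocks_numbered_def by (simp add: i_def)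
qed

subsection \<open>Hits and marks\<close>

locale ram_matrix = ram w P W R ws for w P W R ws +
  fixes n :: nat
  assumes n_ge_1: "1 \<le> n" and n_less_R: "100 * (n * n) + 100 < R"
begin

lemma dim_bounds: "n \<le> n * n" "n < R" "n < W" "n * n < R" "n * n < W" "3 * n < R" "3 * n < W"
  using le_square[of n] n_less_R word_bounds by linarith+

end

definition is_least :: "nat set \<Rightarrow> nat \<Rightarrow> bool" where
  "is_least S x \<longleftrightarrow> x \<in> S \<and> (\<forall>y\<in>S. x \<le> y)"

definition least_dominating :: "nat \<Rightarrow> nat \<Rightarrow> nat \<Rightarrow> matrix \<Rightarrow> nat \<Rightarrow> nat \<Rightarrow> nat \<Rightarrow> bool" where
  "least_dominating R n l Q i j = is_least (insert R {Q i k |k. k < n \<and> Q k j + l \<le> Q i k})"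

abbreviation "dominance_solution R n l Q A \<equiv> \<forall>i<n. \<forall>j<n. least_dominating R n l Q i j (A i j)"

definition multiplies_bits :: "prog \<Rightarrow> nat \<Rightarrow> nat \<Rightarrow> nat \<Rightarrow> bool" where
  "multiplies_bits P v d T \<longleftrightarrow> (\<forall>A B s. (\<forall>i<d. \<forall>j<d. A i j \<le> 1 \<and> B i j \<le> 1) \<longrightarrow> matmul_input v d A B s \<longrightarrow>
     (\<exists>t\<le>T. halted P ((step v P ^^ t) s) \<and> matmul_output d (\<lambda>i j. \<Sum>k<d. A i k * B k j) ((step v P ^^ t) s)))"

text \<open>
  Entry \<open>(i, k)\<close> dominates entry \<open>(k, j)\<close> if it exceeds it by at least \<open>l\<close>; the least such entry is
  sought for every \<open>i\<close> and \<open>j\<close>. A pair of a row block and a column \<open>j\<close> is a hit if the block contains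
  such an entry.
\<close>

locale dominance = ram_matrix w P W R ws n for w P W R ws n +
  fixes q l Lq :: nat and Q :: matrix and ord :: "nat \<Rightarrow> nat" and row_pos row_at col_pos col_at :: matrix
  assumes ranked: "ranked n Q ord row_pos row_at col_pos col_at" and q_ge_1: "1 \<le> q" and q_less_R: "4 * (n * q * q) < R"
    and Q_le_R: "\<And>i k. i < n \<Longrightarrow> k < n \<Longrightarrow> Q i k \<le> R" and l_le_R: "l \<le> R"
    and multiplies: "multiplies_bits P ws (3 * n) Lq"
begin

abbreviation "nb \<equiv> num_blocks n q"

definition entry_row :: "nat \<Rightarrow> nat" where "entry_row x = ord x div n"
definition entry_col :: "nat \<Rightarrow> nat" where "entry_col x = ord x mod n"
definition row_block :: "nat \<Rightarrow> nat \<Rightarrow> nat" where "row_block i k = row_pos i k div q"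
definition col_block :: "nat \<Rightarrow> nat \<Rightarrow> nat" where "col_block k i = col_pos k i div q"
definition block_min :: "nat \<Rightarrow> nat \<Rightarrow> nat" where "block_min k b = Q (col_at k (b * q)) k"

definition params :: "store \<Rightarrow> bool" where
  "params s \<longleftrightarrow> var s vn = n \<and> var s vnn = n * n \<and> var s vq = q \<and> var s vblocks = nb \<and> var s vshift = l \<and> var s vinf = R \<and>
     var s vgroup_size = n * q \<and> var s vrow_blocks = n * nb \<and> var s vdim = 3 * n \<and> var s vws = ws \<and> var s vbudget = n * q * q \<and>
     arr s aQ = Q \<and> arr s aord 0 = ord \<and> arr s arow_at = row_at \<and> arr s acol_at = col_at \<and> arr s arow_pos = row_pos \<and> arr s acol_pos = col_pos"

lemma params_frame: "params s \<Longrightarrow> frame X A s s' \<Longrightarrow>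
    X \<inter> ({vn, vws, vinf, vdim, vbudget, vnn} \<union> {vq, vblocks, vshift, vgroup_size, vrow_blocks}) = {} \<Longrightarrow>
    A \<inter> {aQ, aord, arow_at, acol_at, arow_pos, acol_pos} = {} \<Longrightarrow> params s'"
  unfolding params_def frame_def by auto

lemma paramsD:
  assumes "params s"
  shows "var s vn = n" "var s vnn = n * n" "var s vq = q" "var s vblocks = nb" "var s vshift = l" "var s vinf = R"
    "var s vgroup_size = n * q" "var s vrow_blocks = n * nb" "var s vdim = 3 * n" "var s vws = ws" "var s vbudget = n * q * q"
    "arr s aQ = Q" "arr s aord 0 = ord" "arr s arow_at = row_at" "arr s acol_at = col_at" "arr s arow_pos = row_pos" "arr s acol_pos = col_pos"
  using assms unfolding params_def by auto

lemma q_bounds: "4 * q < R" "n * q < R" "n * q < W" "n * q * q < W"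
proof -
  have "1 * q * 1 \<le> n * q * q" "n * q * 1 \<le> n * q * q" using n_ge_1 q_ge_1 by (intro mult_le_mono; simp)+
  then show "4 * q < R" "n * q < R" "n * q < W" "n * q * q < W" using q_less_R word_bounds by linarith+
qed

lemma nb_bounds: "nb < R" "nb < W" "n * nb < R" "n * nb < W"
proof -
  have nb: "nb \<le> n + 1" by (simp add: num_blocks_def)
  then have "n * nb \<le> n * n + n" using mult_le_mono2[OF nb, of n] by simp
  then show "nb < R" "nb < W" "n * nb < R" "n * nb < W" using nb dim_bounds n_less_R word_bounds by linarith+
qed

lemma n_less_nb_mult_q: "n < nb * q"
  using q_ge_1 by (simp add: num_blocks_def dividend_less_div_times)

lemma block_less: "b * q < n \<Longrightarrow> b < nb"
  using n_less_nb_mult_q by (meson le_less_trans mult_le_mono1 not_less not_less_iff_gr_or_eq order.asym)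

lemma block_pos_less: "b < nb \<Longrightarrow> y < q \<Longrightarrow> b * q + y < R \<and> b * q + y < W \<and> b * q < R \<and> b * q < W"
proof -
  assume "b < nb" "y < q"
  then have "b * q + y < nb * q" by (rule mult_add_less)
  moreover have "nb * q \<le> n + q" by (simp add: num_blocks_def)
  ultimately show ?thesis using q_bounds(1) dim_bounds n_less_R word_bounds by (intro conjI; linarith)
qed

lemma row_block_address: "i < n \<Longrightarrow> b < nb \<Longrightarrow> i * nb + b < n * nb \<and> i * nb + b < R \<and> i * nb + b < W \<and> i * nb < W"
  using mult_add_less[of i n b nb] nb_bounds by (intro conjI; linarith)

lemma Q_bounds: "i < n \<Longrightarrow> k < n \<Longrightarrow> Q i k + l < W \<and> Q i k < W"
  using Q_le_R[of i k] l_le_R word_bounds by (intro conjI; linarith)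

lemma entry_less: "x < n * n \<Longrightarrow> entry_row x < n" "x < n * n \<Longrightarrow> entry_col x < n"
  and entry_exists: "i < n \<Longrightarrow> k < n \<Longrightarrow> \<exists>x<n * n. entry_row x = i \<and> entry_col x = k"
proof -
  have bij: "bij_betw (\<lambda>x. (entry_row x, entry_col x)) {..<n * n} ({..<n} \<times> {..<n})"
    using ranked by (simp add: ranked_def entry_row_def entry_col_def)
  show "x < n * n \<Longrightarrow> entry_row x < n" "x < n * n \<Longrightarrow> entry_col x < n" using bij_betwE[OF bij] by auto
  assume "i < n" "k < n"
  then have "(i, k) \<in> (\<lambda>x. (entry_row x, entry_col x)) ` {..<n * n}" using bij by (simp add: bij_betw_def)
  then show "\<exists>x<n * n. entry_row x = i \<and> entry_col x = k" by auto
qed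

lemma row_ranks: "line_ranks n entry_row entry_col Q row_pos row_at"
  and col_ranks: "line_ranks n entry_col entry_row (\<lambda>k i. Q i k) col_pos col_at"
  using ranked unfolding ranked_def by (simp_all add: entry_row_def[abs_def] entry_col_def[abs_def])

lemma row_posD: "i < n \<Longrightarrow> k < n \<Longrightarrow> row_pos i k < n" "i < n \<Longrightarrow> k < n \<Longrightarrow> row_at i (row_pos i k) = k"
  and row_atD: "i < n \<Longrightarrow> p < n \<Longrightarrow> row_at i p < n" "i < n \<Longrightarrow> p < n \<Longrightarrow> row_pos i (row_at i p) = p"
  and row_sorted: "i < n \<Longrightarrow> k < n \<Longrightarrow> k' < n \<Longrightarrow> row_pos i k \<le> row_pos i k' \<Longrightarrow> Q i k \<le> Q i k'"
  and row_pos_entry: "x < n * n \<Longrightarrow> row_pos (entry_row x) (entry_col x) = count_below entry_row (entry_row x) x"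
  using row_ranks unfolding line_ranks_def by blast+

lemma col_posD: "k < n \<Longrightarrow> i < n \<Longrightarrow> col_pos k i < n" "k < n \<Longrightarrow> i < n \<Longrightarrow> col_at k (col_pos k i) = i"
  and col_atD: "k < n \<Longrightarrow> p < n \<Longrightarrow> col_at k p < n" "k < n \<Longrightarrow> p < n \<Longrightarrow> col_pos k (col_at k p) = p"
  and col_sorted: "k < n \<Longrightarrow> i < n \<Longrightarrow> i' < n \<Longrightarrow> col_pos k i \<le> col_pos k i' \<Longrightarrow> Q i k \<le> Q i' k"
  and col_pos_entry: "x < n * n \<Longrightarrow> col_pos (entry_col x) (entry_row x) = count_below entry_col (entry_col x) x"
  using col_ranks unfolding line_ranks_def by blast+

lemma row_block_less: "i < n \<Longrightarrow> k < n \<Longrightarrow> row_block i k * q < n" "i < n \<Longrightarrow> k < n \<Longrightarrow> row_block i k < nb"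
  and col_block_less: "k < n \<Longrightarrow> i < n \<Longrightarrow> col_block k i * q < n" "k < n \<Longrightarrow> i < n \<Longrightarrow> col_block k i < nb"
proof -
  show row: "i < n \<Longrightarrow> k < n \<Longrightarrow> row_block i k * q < n" using row_posD(1) div_times_less_eq_dividend unfolding row_block_def by (rule le_less_trans[rotated])
  show col: "k < n \<Longrightarrow> i < n \<Longrightarrow> col_block k i * q < n" using col_posD(1) div_times_less_eq_dividend unfolding col_block_def by (rule le_less_trans[rotated])
  show "i < n \<Longrightarrow> k < n \<Longrightarrow> row_block i k < nb" "k < n \<Longrightarrow> i < n \<Longrightarrow> col_block k i < nb"
    using row col block_less by blast+
qed

lemma block_min_le: "i < n \<Longrightarrow> k < n \<Longrightarrow> block_min k (col_block k i) \<le> Q i k"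
  unfolding block_min_def using col_block_less(1)[of k i] col_atD[of k "col_block k i * q"]
  by (intro col_sorted) (auto simp: col_block_def)

definition dominates :: "nat \<Rightarrow> nat \<Rightarrow> nat \<Rightarrow> bool" where
  "dominates i k j \<longleftrightarrow> Q k j + l \<le> Q i k"

definition hit :: "nat \<Rightarrow> nat \<Rightarrow> nat \<Rightarrow> nat \<times> nat" where
  "hit i k j = (i * nb + row_block i k, j)"

definition hits :: "(nat \<times> nat) set" where
  "hits = {hit i k j |i k j. i < n \<and> k < n \<and> j < n \<and> dominates i k j}"

text \<open>
  Whether \<open>(i, k)\<close> dominates \<open>(k, j)\<close> is already decided by the minimum of the block of \<open>(i, k)\<close> in column
  \<open>k\<close> unless this is the last block whose minimum is below the threshold. For fixed \<open>k\<close> and \<open>j\<close> that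
  block is searched directly; the other hits are found by matrix multiplication.
\<close>

definition boundary_hits :: "nat \<Rightarrow> nat \<Rightarrow> (nat \<times> nat) set" where
  "boundary_hits k j = {hit i k j |i. i < n \<and> dominates i k j \<and> block_min k (col_block k i) < Q k j + l}"

definition high :: "nat \<Rightarrow> nat \<Rightarrow> nat \<Rightarrow> bool" where
  "high k b j \<longleftrightarrow> Q k j + l \<le> block_min k b"

definition interior_hits :: "nat \<Rightarrow> (nat \<times> nat) set" where
  "interior_hits x = {hit (entry_row x) (entry_col x) j |j. j < n \<and> high (entry_col x) (col_block (entry_col x) (entry_row x)) j}"

lemma hits_subset:
  assumes "\<forall>k<n. \<forall>j<n. boundary_hits k j \<subseteq> Z" "\<forall>x<n * n. interior_hits x \<subseteq> Z"
  shows "hits \<subseteq> Z"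
proof
  fix z assume "z \<in> hits"
  then obtain i k j where z: "z = hit i k j" "i < n" "k < n" "j < n" "dominates i k j" unfolding hits_def by blast
  obtain x where x: "x < n * n" "entry_row x = i" "entry_col x = k" using entry_exists[OF z(2,3)] by blast
  show "z \<in> Z"
  proof (cases "high k (col_block k i) j")
    case True
    then have "z \<in> interior_hits x" using x z by (auto simp: interior_hits_def)
    then show ?thesis using assms(2) x(1) by blast
  next
    case False
    then have "z \<in> boundary_hits k j" using z by (auto simp: boundary_hits_def high_def not_le)
    then show ?thesis using assms(1) z(3,4) by blast
  qed
qed

definition marks :: "matrix \<Rightarrow> (nat \<times> nat) set" where
  "marks Z = {(g, j). g < n * nb \<and> j < n \<and> Z g j \<noteq> 0}"

lemma marks_insert: "g < n * nb \<Longrightarrow> j < n \<Longrightarrow> marks (\<lambda>g' j'. if g' = g \<and> j' = j then Suc 0 else Z g' j') = insert (g, j) (marks Z)"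
  by (auto simp: marks_def)

lemma hit_mem: "i < n \<Longrightarrow> k < n \<Longrightarrow> j < n \<Longrightarrow> dominates i k j \<Longrightarrow> hit i k j \<in> hits"
  unfolding hits_def by blast

end

definition clear_marks :: com where
  "clear_marks = FOR vi \<prec> vrow_blocks DO FOR vj \<prec> vn DO amark\<langle>V vi, V vj\<rangle> \<leftarrow> N 0"

definition find_boundary :: com where
  "find_boundary = FOR vblock \<prec> vblocks DO
     IF V vblock \<otimes> V vq \<prec> V vn
     THEN (IF aQ\<langle>acol_at\<langle>V vcol, V vblock \<otimes> V vq\<rangle>, V vcol\<rangle> \<prec> V vthreshold THEN vbest ::= V vblock ELSE SKIP)
     ELSE SKIP"

definition mark_boundary :: com where
  "mark_boundary = FOR vy \<prec> vq DO (vpos ::= V vbest \<otimes> V vq \<oplus> V vy ;;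
     IF V vpos \<prec> V vn
     THEN (vrow ::= acol_at\<langle>V vcol, V vpos\<rangle> ;;
       IF aQ\<langle>V vrow, V vcol\<rangle> \<prec> V vthreshold THEN SKIP
       ELSE amark\<langle>V vrow \<otimes> V vblocks \<oplus> arow_pos\<langle>V vrow, V vcol\<rangle> \<oslash> V vq, V vj\<rangle> \<leftarrow> N 1)
     ELSE SKIP)"

definition mark_boundaries :: com where
  "mark_boundaries = FOR vcol \<prec> vn DO FOR vj \<prec> vn DO (vthreshold ::= aQ\<langle>V vcol, V vj\<rangle> \<oplus> V vshift ;; vbest ::= V vblocks ;;
     find_boundary ;; IF V vbest \<prec> V vblocks THEN mark_boundary ELSE SKIP)"

lemmas mark_boundaries_defs = find_boundary_def mark_boundary_def mark_boundaries_def

context dominance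
begin

lemma clear_marks_correct:
  assumes "params s"
  shows "ensures clear_marks s (n * nb * (n + 1)) (\<lambda>s'. marks (arr s' amark) = {})"
  unfolding clear_marks_def
  by (rule ensures_For_For_cells[where m = "n * nb" and l = n and b = 0 and cell = "\<lambda>g j A. A amark g j = 0"])
    (use assms nb_bounds dim_bounds word_bounds in \<open>auto simp: paramsD marks_def\<close>)

definition last_below :: "nat \<Rightarrow> nat \<Rightarrow> nat \<Rightarrow> nat \<Rightarrow> bool" where
  "last_below k v b best \<longleftrightarrow> best \<le> nb \<and> (best < nb \<longrightarrow> best < b \<and> best * q < n \<and> block_min k best < v) \<and>
     (\<forall>b'<b. (best = nb \<or> best < b') \<longrightarrow> b' * q < n \<longrightarrow> v \<le> block_min k b')"

lemma find_boundary_correct: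
  assumes s: "params s" "var s vcol = k" "k < n" "var s vthreshold = v" "var s vbest = nb"
  shows "ensures find_boundary s nb (\<lambda>s'. last_below k v nb (var s' vbest))"
  unfolding find_boundary_def
proof (rule ensures_For[where m = nb and b = 0 and I = "\<lambda>b s'. last_below k v b (var s' vbest)"], goal_cases vars init step exit time)
  case (step b s1)
  have params: "params s1" by (rule params_frame[OF s(1) step(4)]) auto
  have same: "var s1 vcol = k" "var s1 vthreshold = v" using step(4) s by (auto simp: frame_def)
  have at: "col_at k (b * q) < R" if "b * q < n" using col_atD(1)[OF s(3) that] dim_bounds by linarith
  show ?case using step(1-3) same params block_pos_less[OF step(1), of 0] q_ge_1 at s(3) dim_bounds
    unfolding last_below_def by (auto simp: paramsD less_Suc_eq block_min_def)
qed (use s nb_bounds in \<open>auto simp: paramsD last_below_def\<close>)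

definition scanned_hits :: "nat \<Rightarrow> nat \<Rightarrow> nat \<Rightarrow> nat \<Rightarrow> (nat \<times> nat) set" where
  "scanned_hits k j b p = {hit i k j |i. i < n \<and> dominates i k j \<and> col_block k i = b \<and> col_pos k i < p}"

lemma scanned_hits_Suc:
  assumes "k < n"
  shows "scanned_hits k j b (Suc p) \<subseteq> scanned_hits k j b p \<union> (if p < n \<and> dominates (col_at k p) k j then {hit (col_at k p) k j} else {})"
proof
  fix z assume "z \<in> scanned_hits k j b (Suc p)"
  then obtain i where i: "z = hit i k j" "i < n" "dominates i k j" "col_block k i = b" "col_pos k i < Suc p"
    unfolding scanned_hits_def by blast
  then show "z \<in> scanned_hits k j b p \<union> (if p < n \<and> dominates (col_at k p) k j then {hit (col_at k p) k j} else {})"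
    using col_posD[OF assms i(2)] unfolding scanned_hits_def by (cases "col_pos k i = p") auto
qed

lemma scanned_hits_start: "scanned_hits k j b (b * q) = {}"
  by (auto simp: scanned_hits_def col_block_def simp flip: not_le)

lemma boundary_hits_subset:
  assumes "last_below k (Q k j + l) nb best" "k < n"
  shows "boundary_hits k j \<subseteq> (if best < nb then scanned_hits k j best (best * q + q) else {})"
proof
  fix z assume "z \<in> boundary_hits k j"
  then obtain i where i: "z = hit i k j" "i < n" "dominates i k j" "block_min k (col_block k i) < Q k j + l"
    unfolding boundary_hits_def by blast
  have less: "best < nb" and le: "col_block k i \<le> best"
    using assms(1) i(4) col_block_less[OF assms(2) i(2)] unfolding last_below_def by (meson le_neq_implies_less not_le)+
  have min: "best * q < n" "block_min k best < Q k j + l" using assms(1) less unfolding last_below_def by auto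
  have pos: "col_pos k i < col_block k i * q + q"
    using q_ge_1 dividend_less_div_times[of q "col_pos k i"] by (simp add: col_block_def)
  have "\<not> col_block k i < best"
  proof
    assume "col_block k i < best"
    then have "col_block k i * q + q \<le> best * q" using mult_le_mono1[of "Suc (col_block k i)" best q] by simp
    then have "Q i k \<le> block_min k best" unfolding block_min_def
      using pos col_atD[OF assms(2) min(1)] assms(2) i(2) by (intro col_sorted) auto
    then show False using i(3) min(2) by (simp add: dominates_def)
  qed
  then have "col_block k i = best" using le by simp
  then show "z \<in> (if best < nb then scanned_hits k j best (best * q + q) else {})"
    using less i pos unfolding scanned_hits_def by auto
qed

lemma mark_boundary_correct:
  assumes s: "params s" "var s vcol = k" "k < n" "var s vj = j" "j < n" "var s vthreshold = Q k j + l" "var s vbest = best" "best < nb"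
    and hits: "marks (arr s amark) \<subseteq> hits"
  shows "ensures mark_boundary s q (\<lambda>s'. marks (arr s amark) \<union> scanned_hits k j best (best * q + q) \<subseteq> marks (arr s' amark) \<and>
    marks (arr s' amark) \<subseteq> hits)"
  unfolding mark_boundary_def
proof (rule ensures_For[where m = q and b = 0 and I = "\<lambda>y s'. marks (arr s amark) \<union> scanned_hits k j best (best * q + y) \<subseteq> marks (arr s' amark) \<and>
    marks (arr s' amark) \<subseteq> hits"], goal_cases vars init step exit time)
  case (step y s1)
  let ?p = "best * q + y"
  let ?i = "col_at k ?p"
  have params: "params s1" by (rule params_frame[OF s(1) step(4)]) auto
  have same: "var s1 vcol = k" "var s1 vj = j" "var s1 vthreshold = Q k j + l" "var s1 vbest = best"
    using step(4) s by (auto simp: frame_def)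
  note p = block_pos_less[OF s(8) step(1)]
  note found = scanned_hits_Suc[OF s(3), of j best ?p]
  show ?case
  proof (cases "?p < n")
    case True
    have i: "?i < n" "?i < R" using col_atD(1)[OF s(3) True] dim_bounds by auto
    note address = row_block_address[OF i(1) row_block_less(2)[OF i(1) s(3)]]
    show ?thesis
    proof (cases "dominates ?i k j")
      case dom: True
      have "hit ?i k j \<in> hits" "hit ?i k j = (?i * nb + row_block ?i k, j)"
        using hit_mem[OF i(1) s(3,5) dom] by (simp_all add: hit_def)
      then show ?thesis using step(2,3) found params same p i(2) address True dom s(3,5) dim_bounds word_bounds
        by (auto simp: paramsD dominates_def marks_insert simp flip: row_block_def)
    next
      case False
      then show ?thesis using step(2,3) found params same p i(2) True s(3,5) dim_bounds word_bounds
        by (auto simp: paramsD dominates_def)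
    qed
  next
    case False
    then show ?thesis using step(2,3) found params same p word_bounds by (auto simp: paramsD)
  qed
qed (use s hits q_bounds word_bounds in \<open>auto simp: paramsD scanned_hits_start\<close>)

lemma boundary_correct:
  assumes s: "params s" "var s vcol = k" "k < n" "var s vj = j" "j < n" "var s vthreshold = Q k j + l" "var s vbest = nb"
    and hits: "marks (arr s amark) \<subseteq> hits"
  shows "ensures (find_boundary ;; IF V vbest \<prec> V vblocks THEN mark_boundary ELSE SKIP) s (nb + q)
    (\<lambda>s'. marks (arr s amark) \<union> boundary_hits k j \<subseteq> marks (arr s' amark) \<and> marks (arr s' amark) \<subseteq> hits)"
proof (rule ensures_Seq[OF find_boundary_correct[OF s(1-3,6,7)], where Tb = q])
  fix s1 assume last: "last_below k (Q k j + l) nb (var s1 vbest)" and fr: "frame_of find_boundary s s1"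
  have params: "params s1" by (rule params_frame[OF s(1) fr]) (auto simp: find_boundary_def)
  have same: "var s1 vcol = k" "var s1 vj = j" "var s1 vthreshold = Q k j + l" "arr s1 amark = arr s amark"
    using fr s by (auto simp: frame_def find_boundary_def)
  note subset = boundary_hits_subset[OF last s(3)]
  show "ensures (IF V vbest \<prec> V vblocks THEN mark_boundary ELSE SKIP) s1 q
    (\<lambda>s'. marks (arr s amark) \<union> boundary_hits k j \<subseteq> marks (arr s' amark) \<and> marks (arr s' amark) \<subseteq> hits)"
  proof (cases "var s1 vbest < nb")
    case True
    have "ensures mark_boundary s1 q (\<lambda>s'. marks (arr s1 amark) \<union> scanned_hits k j (var s1 vbest) (var s1 vbest * q + q) \<subseteq> marks (arr s' amark) \<and>
        marks (arr s' amark) \<subseteq> hits)"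
      using params same s(3,5) True hits by (intro mark_boundary_correct) auto
    then have "ensures mark_boundary s1 q (\<lambda>s'. marks (arr s amark) \<union> boundary_hits k j \<subseteq> marks (arr s' amark) \<and> marks (arr s' amark) \<subseteq> hits)"
      by (rule ensures_weaken) (use subset True same in auto)
    then show ?thesis using True params by (simp add: paramsD)
  qed (use subset params same hits in \<open>auto simp: paramsD\<close>)
qed simp

abbreviation "boundaries_marked s \<equiv> marks (arr s amark) \<subseteq> hits \<and> (\<forall>k<n. \<forall>j<n. boundary_hits k j \<subseteq> marks (arr s amark))"

lemma mark_boundaries_correct:
  assumes s: "params s" "marks (arr s amark) = {}"
  shows "ensures mark_boundaries s (n * (n * (nb + q + 1) + 1)) boundaries_marked"
  unfolding mark_boundaries_def
proof (rule ensures_For_For[where m = n and l = n and b = "nb + q" and I = "\<lambda>k j A. marks (A amark) \<subseteq> hits \<and>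
    (\<forall>k'<n. \<forall>j'<n. k' < k \<or> k' = k \<and> j' < j \<longrightarrow> boundary_hits k' j' \<subseteq> marks (A amark))"], goal_cases vars init row step exit time)
  case (step k j s1)
  let ?s = "s1\<lparr>var := (var s1)(vthreshold := Q k j + l, vbest := nb)\<rparr>"
  have "params s1" by (rule params_frame[OF s(1) step(6)]) (auto simp: mark_boundaries_defs)
  then have params: "params s1" "params ?s" by (auto simp: params_def)
  have "ensures (find_boundary ;; IF V vbest \<prec> V vblocks THEN mark_boundary ELSE SKIP) ?s (nb + q)
      (\<lambda>s'. marks (arr ?s amark) \<union> boundary_hits k j \<subseteq> marks (arr s' amark) \<and> marks (arr s' amark) \<subseteq> hits)"
    using params step by (intro boundary_correct) auto
  then have "ensures (find_boundary ;; IF V vbest \<prec> V vblocks THEN mark_boundary ELSE SKIP) ?s (nb + q)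
      (\<lambda>s'. marks (arr s' amark) \<subseteq> hits \<and> (\<forall>k'<n. \<forall>j'<n. k' < k \<or> k' = k \<and> j' < Suc j \<longrightarrow> boundary_hits k' j' \<subseteq> marks (arr s' amark)))"
  proof (rule ensures_weaken)
    fix s' assume after: "marks (arr ?s amark) \<union> boundary_hits k j \<subseteq> marks (arr s' amark) \<and> marks (arr s' amark) \<subseteq> hits"
    have "boundary_hits k' j' \<subseteq> marks (arr s' amark)" if "k' < n" "j' < n" "k' < k \<or> k' = k \<and> j' < Suc j" for k' j'
    proof (cases "k' = k \<and> j' = j")
      case False
      then have "boundary_hits k' j' \<subseteq> marks (arr s1 amark)" using step(5) that by (metis less_SucE)
      then show ?thesis using after by auto
    qed (use after in simp)
    then show "marks (arr s' amark) \<subseteq> hits \<and>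
      (\<forall>k'<n. \<forall>j'<n. k' < k \<or> k' = k \<and> j' < Suc j \<longrightarrow> boundary_hits k' j' \<subseteq> marks (arr s' amark))" using after by blast
  qed simp
  then show ?case using params(1) step(1-4) Q_bounds[OF step(1,2)] dim_bounds by (simp add: paramsD)
qed (use s dim_bounds in \<open>auto simp: paramsD mark_boundaries_defs less_Suc_eq\<close>)

end

subsection \<open>Groups of consecutive entries\<close>

definition number_block :: "nat \<Rightarrow> nat \<Rightarrow> nat \<Rightarrow> nat \<Rightarrow> nat \<Rightarrow> nat \<Rightarrow> nat \<Rightarrow> com" where
  "number_block pos opn ids lab num line other = vblock ::= pos\<langle>V line, V other\<rangle> \<oslash> V vq ;;
     IF opn\<langle>N 0, V line\<rangle> \<prec> V vblock \<oplus> N 1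
     THEN (opn\<langle>N 0, V line\<rangle> \<leftarrow> V vblock \<oplus> N 1 ;; ids\<langle>N 0, V line\<rangle> \<leftarrow> V num ;;
       lab\<langle>N 0, V num\<rangle> \<leftarrow> V line \<otimes> V vblocks \<oplus> V vblock ;; num ::= V num \<oplus> N 1)
     ELSE SKIP"

definition number_row :: com where
  "number_row = number_block arow_pos arow_open arow_id arow_label vrows vrow vcol"

definition number_col :: com where
  "number_col = number_block acol_pos acol_open acol_id acol_label vcols vcol vrow"

definition group_entry :: com where
  "group_entry = (ventry ::= aord\<langle>N 0, V vx\<rangle> ;; vrow ::= V ventry \<oslash> V vn ;; vcol ::= V ventry \<odot> V vn) ;; number_row ;; number_col ;;
     aguest\<langle>V vslot, arow_id\<langle>N 0, V vrow\<rangle> \<otimes> V vdim \<oplus> acol_id\<langle>N 0, V vcol\<rangle>\<rangle> \<leftarrow> N 1"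

definition group_clear :: com where
  "group_clear = FOR vi \<prec> vn DO (arow_open\<langle>N 0, V vi\<rangle> \<leftarrow> N 0 ;; acol_open\<langle>N 0, V vi\<rangle> \<leftarrow> N 0)"

definition group_fill :: com where
  "group_fill = FOR vy \<prec> vgroup_size DO (vx ::= V vgroup \<otimes> V vgroup_size \<oplus> V vy ;; IF V vx \<prec> V vnn THEN group_entry ELSE SKIP)"

definition group_right :: com where
  "group_right = FOR vid \<prec> vcols DO FOR vj \<prec> vn DO (vlabel ::= acol_label\<langle>N 0, V vid\<rangle> ;;
     vcol ::= V vlabel \<oslash> V vblocks ;; vblock ::= V vlabel \<odot> V vblocks ;;
     IF aQ\<langle>acol_at\<langle>V vcol, V vblock \<otimes> V vq\<rangle>, V vcol\<rangle> \<prec> aQ\<langle>V vcol, V vj\<rangle> \<oplus> V vshift THEN SKIP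
     ELSE aguest\<langle>V vslot, V vdim \<otimes> V vdim \<oplus> (V vid \<otimes> V vdim \<oplus> V vj)\<rangle> \<leftarrow> N 1)"

definition group_out :: com where
  "group_out = FOR vid \<prec> vrows DO FOR vj \<prec> vn DO
     IF N 0 \<prec> aguest\<langle>V vslot, N 2 \<otimes> (V vdim \<otimes> V vdim) \<oplus> (V vid \<otimes> V vdim \<oplus> V vj)\<rangle>
     THEN amark\<langle>arow_label\<langle>N 0, V vid\<rangle>, V vj\<rangle> \<leftarrow> N 1 ELSE SKIP"

definition group_prepare :: com where
  "group_prepare = (vrows ::= N 0 ;; vcols ::= N 0) ;; group_clear ;; group_fill ;; group_right"

definition group_multiply :: com where
  "group_multiply = Simulate ;; (IF V vhalted \<prec> N 1 THEN vok ::= N 0 ELSE SKIP) ;; group_out ;; vslot ::= V vslot \<oplus> N 1"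

definition mark_group :: com where
  "mark_group = group_prepare ;; group_multiply"

definition mark_groups :: com where
  "mark_groups = FOR vgroup \<prec> vblocks DO mark_group"

lemmas mark_group_defs = number_block_def number_row_def number_col_def group_entry_def group_clear_def group_fill_def
  group_right_def group_out_def group_prepare_def group_multiply_def mark_group_def mark_groups_def

definition unused_slots :: "nat \<Rightarrow> store \<Rightarrow> bool" where
  "unused_slots k s \<longleftrightarrow> (\<forall>r\<ge>k. \<forall>z. arr s aguest r z = 0)"

context dominance
begin

abbreviation "m \<equiv> 3 * n"

lemma guest_address:
  assumes "p < m" "c < m"
  shows "p * m + c < m * m \<and> p * m + c < R \<and> p * m + c < W \<and> p * m < W \<and> m * m < W \<and> m * m + (p * m + c) < R \<and> m * m + (p * m + c) < W \<and>
    2 * (m * m) < W \<and> 2 * (m * m) + (p * m + c) < R \<and> 2 * (m * m) + (p * m + c) < W"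
proof -
  have "p * m + c < m * m" using assms by (rule mult_add_less)
  moreover have "m * m = 9 * (n * n)" by simp
  ultimately show ?thesis using n_less_R word_bounds by (intro conjI; linarith)
qed

definition numbers_block :: "(nat \<Rightarrow> nat) \<Rightarrow> nat \<Rightarrow> nat \<Rightarrow> nat \<Rightarrow> nat \<Rightarrow> (nat \<Rightarrow> nat) \<Rightarrow> nat \<Rightarrow> (nat \<Rightarrow> nat) \<Rightarrow> (nat \<Rightarrow> nat) \<Rightarrow> (nat \<Rightarrow> nat) \<Rightarrow> nat \<Rightarrow> bool" where
  "numbers_block f x0 x i b lab num opn' ids' lab' num' \<longleftrightarrow> blocks_numbered n q f x0 (Suc x) opn' ids' lab' num' \<and>
     num \<le> num' \<and> (\<forall>p<num. lab' p = lab p) \<and> ids' i < num' \<and> lab' (ids' i) = i * nb + b"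

lemma number_block_correct:
  assumes s: "params s" "arr s pos (f x) (g x) = p" "var s line = f x" "var s other = g x"
    and line: "f x < n" "g x < n" "p < n" "p = count_below f (f x) x"
    and arrays: "distinct [opn, ids, lab]" "pos < 1000" "opn < 1000" "ids < 1000" "lab < 1000"
    and vars: "distinct [num, line, other, vblock]" "vblocks \<notin> {num, line, other}" "vq \<notin> {num, line, other}"
    and inv: "blocks_numbered n q f x0 x (arr s opn 0) (arr s ids 0) (arr s lab 0) (var s num)" "x0 \<le> x" "x < x0 + n * q"
    and lines: "\<And>y. y \<le> x \<Longrightarrow> f y < n"
  shows "ensures (number_block pos opn ids lab num line other) s 0 (\<lambda>s'.
    numbers_block f x0 x (f x) (p div q) (arr s lab 0) (var s num) (arr s' opn 0) (arr s' ids 0) (arr s' lab 0) (var s' num))"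
proof -
  let ?b = "p div q"
  have b: "?b * q < n" "?b < nb" using line(3) le_less_trans[OF div_times_less_eq_dividend line(3)] block_less by blast+
  then have b_less: "Suc ?b < W" using nb_bounds word_bounds by linarith
  note address = row_block_address[OF line(1) b(2)]
  note Suc_inv = blocks_numbered_Suc[OF inv(1,2), folded line(4), OF _ line(1) b(1)]
  have q: "0 < q" using q_ge_1 by simp
  show ?thesis
  proof (cases "arr s opn 0 (f x) < Suc ?b")
    case True
    note inv' = Suc_inv(1)[OF q True]
    have "Suc (var s num) \<le> m" by (rule blocks_numbered_le[OF inv']) (use inv(2,3) lines q in auto)
    then have "var s num < R" "Suc (var s num) < W" using dim_bounds word_bounds by linarith+
    then show ?thesis using True inv' s line(1-3) arrays vars address dim_bounds word_bounds unfolding number_block_def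
      by (auto simp: numbers_block_def paramsD cong: if_cong) (simp (no_asm) only: s(2) b_less)
  next
    case False
    then show ?thesis using Suc_inv(2)[OF q False] s line(1-3) arrays vars address dim_bounds word_bounds unfolding number_block_def
      by (auto simp: numbers_block_def paramsD cong: if_cong) (simp (no_asm) only: s(2) b_less)
  qed
qed

definition labelled :: "(nat \<Rightarrow> nat) \<Rightarrow> (nat \<Rightarrow> nat) \<Rightarrow> nat \<Rightarrow> nat \<Rightarrow> nat \<Rightarrow> nat \<Rightarrow> bool" where
  "labelled rl cl p c i k \<longleftrightarrow> rl p = i * nb + row_block i k \<and> cl c = k * nb + col_block k i"

definition incidence :: "(nat \<Rightarrow> nat) \<Rightarrow> (nat \<Rightarrow> nat) \<Rightarrow> nat \<Rightarrow> nat \<Rightarrow> nat set \<Rightarrow> (nat \<Rightarrow> nat) \<Rightarrow> bool" where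
  "incidence rl cl np nc X M \<longleftrightarrow>
     (\<forall>p<m. \<forall>c<m. M (p * m + c) \<noteq> 0 \<longrightarrow> p < np \<and> c < nc \<and> (\<exists>i<n. \<exists>k<n. labelled rl cl p c i k)) \<and>
     (\<forall>x\<in>X. \<exists>p<np. \<exists>c<nc. M (p * m + c) \<noteq> 0 \<and> labelled rl cl p c (entry_row x) (entry_col x)) \<and>
     (\<forall>z. M z \<le> 1) \<and> (\<forall>z\<ge>m * m. M z = 0)"

lemma incidence_insert:
  assumes inc: "incidence rl cl np nc X M" and num: "np \<le> np'" "nc \<le> nc'" "np' \<le> m" "nc' \<le> m"
    and labels: "\<forall>p<np. rl' p = rl p" "\<forall>c<nc. cl' c = cl c"
    and x: "p < np'" "c < nc'" "labelled rl' cl' p c (entry_row x) (entry_col x)" "x < n * n"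
  shows "incidence rl' cl' np' nc' (insert x X) (\<lambda>z. if z = p * m + c then Suc 0 else M z)"
proof -
  have pc: "p < m" "c < m" using x num by auto
  define M' where "M' = (\<lambda>z. if z = p * m + c then Suc 0 else M z)"
  have old: "labelled rl' cl' p' c' i k" if "labelled rl cl p' c' i k" "p' < np" "c' < nc" for p' c' i k
    using that labels by (simp add: labelled_def)
  have left: "p' < np' \<and> c' < nc' \<and> (\<exists>i<n. \<exists>k<n. labelled rl' cl' p' c' i k)"
    if "p' < m" "c' < m" "M' (p' * m + c') \<noteq> 0" for p' c'
  proof (cases "p' * m + c' = p * m + c")
    case True
    then have "p' = p" "c' = c" using mult_add_eq_iff[OF that(2) pc(2)] by auto
    then show ?thesis using x entry_less[OF x(4)] by auto
  next
    case False
    then have "M (p' * m + c') \<noteq> 0" using that(3) by (simp add: M'_def)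
    then show ?thesis using inc that(1,2) num old unfolding incidence_def by (meson order_less_le_trans)
  qed
  have right: "\<exists>p'<np'. \<exists>c'<nc'. M' (p' * m + c') \<noteq> 0 \<and> labelled rl' cl' p' c' (entry_row y) (entry_col y)" if "y \<in> insert x X" for y
  proof (cases "y = x")
    case True
    have "M' (p * m + c) \<noteq> 0" by (simp add: M'_def)
    then show ?thesis using x True by blast
  next
    case False
    then obtain p' c' where "p' < np" "c' < nc" "M (p' * m + c') \<noteq> 0" "labelled rl cl p' c' (entry_row y) (entry_col y)"
      using inc \<open>y \<in> insert x X\<close> unfolding incidence_def by blast
    moreover from this have "M' (p' * m + c') \<noteq> 0" by (simp add: M'_def)
    ultimately show ?thesis using num old by (meson order_less_le_trans)
  qed
  have "p * m + c < m * m" using guest_address[OF pc] by blast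
  then have "\<forall>z. M' z \<le> 1" "\<forall>z\<ge>m * m. M' z = 0" using inc by (auto simp: incidence_def M'_def)
  then have "incidence rl' cl' np' nc' (insert x X) M'" unfolding incidence_def using left right by blast
  then show ?thesis unfolding M'_def .
qed

definition group_state :: "nat \<Rightarrow> nat \<Rightarrow> store \<Rightarrow> bool" where
  "group_state x0 x s \<longleftrightarrow>
     blocks_numbered n q entry_row x0 x (arr s arow_open 0) (arr s arow_id 0) (arr s arow_label 0) (var s vrows) \<and>
     blocks_numbered n q entry_col x0 x (arr s acol_open 0) (arr s acol_id 0) (arr s acol_label 0) (var s vcols) \<and>
     incidence (arr s arow_label 0) (arr s acol_label 0) (var s vrows) (var s vcols) {x0..<x} (arr s aguest (var s vslot)) \<and>
     unused_slots (Suc (var s vslot)) s"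

lemma group_state_var: "y \<notin> {vslot, vrows, vcols} \<Longrightarrow> group_state x0 x (s\<lparr>var := (var s)(y := v)\<rparr>) \<longleftrightarrow> group_state x0 x s"
  by (simp add: group_state_def unused_slots_def)

lemma group_state_le:
  assumes "group_state x0 x s" "x0 \<le> x" "x \<le> x0 + n * q" "x \<le> n * n"
  shows "var s vrows \<le> m" "var s vcols \<le> m"
  using assms q_ge_1 entry_less unfolding group_state_def by (auto elim!: blocks_numbered_le)

lemma incidence_numbers_block:
  assumes rows: "numbers_block entry_row x0 x (entry_row x) (row_block (entry_row x) (entry_col x)) rl np ro ri rl' np'"
    and cols: "numbers_block entry_col x0 x (entry_col x) (col_block (entry_col x) (entry_row x)) cl nc co ci cl' nc'"
    and inc: "incidence rl cl np nc {x0..<x} M" and x: "x0 \<le> x" "x < x0 + n * q" "x < n * n"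
    and pc: "p = ri (entry_row x)" "c = ci (entry_col x)"
  shows "p < m" "c < m" "incidence rl' cl' np' nc' {x0..<Suc x} (\<lambda>z. if z = p * m + c then Suc 0 else M z)"
proof -
  have num: "np' \<le> m" "nc' \<le> m" using rows cols x q_ge_1 entry_less unfolding numbers_block_def by (auto elim!: blocks_numbered_le)
  then show "p < m" "c < m" using rows cols pc by (auto simp: numbers_block_def)
  have "incidence rl' cl' np' nc' (insert x {x0..<x}) (\<lambda>z. if z = p * m + c then Suc 0 else M z)"
    by (rule incidence_insert[OF inc]) (use rows cols num x(3) pc in \<open>auto simp: numbers_block_def labelled_def\<close>)
  moreover have "insert x {x0..<x} = {x0..<Suc x}" using x(1) by auto
  ultimately show "incidence rl' cl' np' nc' {x0..<Suc x} (\<lambda>z. if z = p * m + c then Suc 0 else M z)" by simp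
qed

lemma group_entry_correct:
  assumes s: "params s" "var s vx = x" "var s vslot < R" and inv: "group_state x0 x s" and x: "x0 \<le> x" "x < x0 + n * q" "x < n * n"
  shows "ensures group_entry s 0 (group_state x0 (Suc x))"
proof -
  let ?i = "entry_row x" and ?k = "entry_col x"
  define s1 where "s1 = s\<lparr>var := (var s)(ventry := ord x, vrow := ?i, vcol := ?k)\<rparr>"
  have s1: "params s1" "var s1 vrow = ?i" "var s1 vcol = ?k" "arr s1 arow_pos = row_pos" "arr s1 acol_pos = col_pos" "group_state x0 x s1"
    "var s1 vslot = var s vslot" using s(1) inv by (auto simp: s1_def params_def group_state_def unused_slots_def)
  note line = entry_less[OF x(3)]
  let ?rows = "\<lambda>s'. numbers_block entry_row x0 x ?i (row_block ?i ?k) (arr s1 arow_label 0) (var s1 vrows)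
      (arr s' arow_open 0) (arr s' arow_id 0) (arr s' arow_label 0) (var s' vrows)"
  let ?cols = "\<lambda>s'. numbers_block entry_col x0 x ?k (col_block ?k ?i) (arr s1 acol_label 0) (var s1 vcols)
      (arr s' acol_open 0) (arr s' acol_id 0) (arr s' acol_label 0) (var s' vcols)"
  let ?write = "aguest\<langle>V vslot, arow_id\<langle>N 0, V vrow\<rangle> \<otimes> V vdim \<oplus> acol_id\<langle>N 0, V vcol\<rangle>\<rangle> \<leftarrow> N 1"
  have pos: "row_pos ?i ?k < n" "col_pos ?k ?i < n" using row_posD(1) col_posD(1) line by auto
  have row: "ensures number_row s1 0 ?rows" unfolding number_row_def row_block_def
    by (rule number_block_correct[where f = entry_row and g = entry_col and p = "row_pos ?i ?k"])
      (use s1 line x pos row_pos_entry[OF x(3)] entry_less in \<open>auto simp: group_state_def\<close>)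
  have "ensures (number_row ;; number_col ;; ?write) s1 0 (group_state x0 (Suc x))"
  proof (rule ensures_Seq[OF row, where Tb = 0])
    fix s2 assume rows: "?rows s2" and fr: "frame_of number_row s1 s2"
    have params2: "params s2" by (rule params_frame[OF s1(1) fr]) (auto simp: number_row_def number_block_def)
    have same: "var s2 vrow = ?i" "var s2 vcol = ?k" "arr s2 acol_pos = col_pos" "var s2 vslot = var s vslot" "var s2 vcols = var s1 vcols"
      "arr s2 aguest = arr s1 aguest" "arr s2 acol_open = arr s1 acol_open" "arr s2 acol_id = arr s1 acol_id" "arr s2 acol_label = arr s1 acol_label"
      using fr s1 by (auto simp: frame_def number_row_def number_block_def)
    have col: "ensures number_col s2 0 ?cols" unfolding number_col_def col_block_def same(5,9)[symmetric]
      by (rule number_block_correct[where f = entry_col and g = entry_row and p = "col_pos ?k ?i"])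
        (use s1 same params2 line x pos col_pos_entry[OF x(3)] entry_less in \<open>auto simp: group_state_def\<close>)
    show "ensures (number_col ;; ?write) s2 0 (group_state x0 (Suc x))"
    proof (rule ensures_Seq[OF col, where Tb = 0])
      fix s3 assume cols: "?cols s3" and fr3: "frame_of number_col s2 s3"
      have params3: "params s3" by (rule params_frame[OF params2 fr3]) (auto simp: number_col_def number_block_def)
      have same3: "var s3 vrow = ?i" "var s3 vcol = ?k" "var s3 vslot = var s1 vslot" "arr s3 aguest = arr s1 aguest"
        and rows3: "?rows s3" using fr3 same s1(7) rows by (auto simp: frame_def number_col_def number_block_def)
      have "incidence (arr s1 arow_label 0) (arr s1 acol_label 0) (var s1 vrows) (var s1 vcols) {x0..<x} (arr s1 aguest (var s1 vslot))"
        using s1(6) by (simp add: group_state_def)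
      note incidence = incidence_numbers_block[OF rows3 cols this x refl refl]
      then have "group_state x0 (Suc x) (s3\<lparr>arr := arr_upd (arr s3) aguest (var s3 vslot) (arr s3 arow_id 0 ?i * m + arr s3 acol_id 0 ?k) (Suc 0)\<rparr>)"
        using rows3 cols same3 s1(6) by (simp add: group_state_def numbers_block_def unused_slots_def cong: if_cong)
      then show "ensures ?write s3 0 (group_state x0 (Suc x))"
        using params3 same3 s(3) s1(7) line guest_address[OF incidence(1,2)] dim_bounds word_bounds by (simp add: paramsD)
    qed simp
  qed simp
  moreover have "x < R" using x(3) dim_bounds by linarith
  ultimately show ?thesis using s(1,2) word_bounds unfolding group_entry_def
    by (simp add: paramsD s1_def entry_row_def entry_col_def)
qed

lemma group_clear_correct:
  assumes s: "params s" "var s vrows = 0" "var s vcols = 0" "unused_slots (var s vslot) s"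
  shows "ensures group_clear s n (group_state x0 x0)"
  unfolding group_clear_def
proof (rule ensures_For[where m = n and b = 0 and I = "\<lambda>i s'. \<forall>i'<i. arr s' arow_open 0 i' = 0 \<and> arr s' acol_open 0 i' = 0"],
    goal_cases vars init step exit time)
  case (step i s1)
  then show ?case using dim_bounds word_bounds by (auto simp: less_Suc_eq)
next
  case (exit s1)
  then show ?case using s by (auto simp: frame_def group_state_def blocks_numbered_def incidence_def unused_slots_def)
qed (use s dim_bounds in \<open>auto simp: paramsD\<close>)

lemma group_start_le: "r < nb \<Longrightarrow> r * (n * q) \<le> n * n"
proof -
  assume "r < nb"
  then have "r \<le> n div q" by (simp add: num_blocks_def)
  then have "r * q \<le> n" using mult_le_mono1[of r "n div q" q] div_times_less_eq_dividend[of n q] by linarith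
  then show ?thesis using mult_le_mono2[of "r * q" n n] by (simp add: mult.left_commute)
qed

lemma group_fill_correct:
  assumes s: "params s" "var s vgroup = r" "r < nb" "var s vslot < R" and inv: "group_state (r * (n * q)) (r * (n * q)) s"
  shows "ensures group_fill s (n * q) (group_state (r * (n * q)) (min (Suc r * (n * q)) (n * n)))"
  unfolding group_fill_def
proof (rule ensures_For[where m = "n * q" and b = 0 and I = "\<lambda>y. group_state (r * (n * q)) (min (r * (n * q) + y) (n * n))"],
    goal_cases vars init step exit time)
  case init
  then show ?case using inv group_start_le[OF s(3)] by (simp add: group_state_var)
next
  case (step y s1)
  let ?x = "r * (n * q) + y" and ?s = "\<lambda>x. s1\<lparr>var := (var s1)(vx := x)\<rparr>"
  have params: "params s1" by (rule params_frame[OF s(1) step(4)]) (auto simp: mark_group_defs)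
  have same: "var s1 vgroup = r" "var s1 vslot < R" using step(4) s by (auto simp: frame_def mark_group_defs)
  have less: "?x < W" "r * (n * q) < W" using group_start_le[OF s(3)] step(1) dim_bounds q_bounds word_bounds by linarith+
  show ?case
  proof (cases "?x < n * n")
    case True
    have "ensures group_entry (?s ?x) 0 (group_state (r * (n * q)) (Suc ?x))"
      by (rule group_entry_correct) (use params same True step(1,3) in \<open>auto simp: params_def group_state_var\<close>)
    then have "ensures group_entry (?s ?x) 0
        (\<lambda>s'. group_state (r * (n * q)) (min (r * (n * q) + Suc y) (n * n)) (s'\<lparr>var := (var s')(vy := Suc y)\<rparr>))"
      by (rule ensures_weaken) (use True in \<open>auto simp: group_state_var\<close>)
    then show ?thesis using True params same step(2) less by (simp add: paramsD)
  next
    case False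
    then have "min (r * (n * q) + Suc y) (n * n) = min ?x (n * n)" by simp
    then show ?thesis using False params same step(2,3) less by (simp add: paramsD group_state_var)
  qed
next
  case (exit s1)
  then show ?case by (simp add: add.commute)
qed (use s q_bounds in \<open>auto simp: paramsD mark_group_defs\<close>)

definition set_ones :: "nat set \<Rightarrow> (nat \<Rightarrow> nat) \<Rightarrow> nat \<Rightarrow> nat" where
  "set_ones S M z = (if z \<in> S then 1 else M z)"

lemma set_ones_empty [simp]: "set_ones {} M = M"
  by (simp add: set_ones_def fun_eq_iff)

definition right_ones :: "(nat \<Rightarrow> nat) \<Rightarrow> nat \<Rightarrow> nat \<Rightarrow> nat set" where
  "right_ones cl c j = {m * m + (c' * m + j') |c' j'. (c' < c \<or> c' = c \<and> j' < j) \<and> j' < n \<and> high (cl c' div nb) (cl c' mod nb) j'}"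

lemma right_ones_0 [simp]: "right_ones cl 0 0 = {}" and right_ones_row: "right_ones cl c n = right_ones cl (Suc c) 0"
  by (auto simp: right_ones_def less_Suc_eq)

lemma right_ones_Suc:
  "j < n \<Longrightarrow> right_ones cl c (Suc j) =
    (if high (cl c div nb) (cl c mod nb) j then insert (m * m + (c * m + j)) (right_ones cl c j) else right_ones cl c j)"
  by (auto simp: right_ones_def less_Suc_eq)

lemma right_ones_iff:
  assumes "c < m" "j < m"
  shows "m * m + (c * m + j) \<in> right_ones cl nc 0 \<longleftrightarrow> c < nc \<and> j < n \<and> high (cl c div nb) (cl c mod nb) j"
proof
  assume "m * m + (c * m + j) \<in> right_ones cl nc 0"
  then obtain c' j' where c': "c * m + j = c' * m + j'" "c' < nc" "j' < n" "high (cl c' div nb) (cl c' mod nb) j'"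
    unfolding right_ones_def by auto
  moreover from this have "c = c'" "j = j'" using mult_add_eq_iff[OF assms(2), of j' c c'] by auto
  ultimately show "c < nc \<and> j < n \<and> high (cl c div nb) (cl c mod nb) j" by simp
qed (auto simp: right_ones_def)

lemma group_right_correct:
  assumes s: "params s" "var s vslot < R" "var s vcols \<le> m"
    and labels: "\<forall>c<var s vcols. \<exists>k<n. \<exists>b. b * q < n \<and> arr s acol_label 0 c = k * nb + b"
  shows "ensures group_right s (m * (n + 1)) (\<lambda>s'. arr s' aguest =
    (arr s aguest)(var s vslot := set_ones (right_ones (arr s acol_label 0) (var s vcols) 0) (arr s aguest (var s vslot))))"
  unfolding group_right_def
proof (rule ensures_For_For[where m = "var s vcols" and l = n and b = 0 and I = "\<lambda>c j A. A aguest =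
    (arr s aguest)(var s vslot := set_ones (right_ones (arr s acol_label 0) c j) (arr s aguest (var s vslot)))"], goal_cases vars init row step exit time)
  case (step c j s1)
  let ?cl = "arr s acol_label 0"
  have params: "params s1" by (rule params_frame[OF s(1) step(6)]) auto
  have same: "var s1 vslot = var s vslot" "arr s1 acol_label = arr s acol_label" using step(6) by (auto simp: frame_def)
  obtain k b where label: "k < n" "b * q < n" "?cl c = k * nb + b" using labels step(1) by blast
  have div: "?cl c div nb = k" "?cl c mod nb = b" using block_less[OF label(2)] label(3) by auto
  have at: "col_at k (b * q) < R" using col_atD(1)[OF label(1,2)] dim_bounds by linarith
  have cj: "c < m" "j < m" using step(1,2) s(3) by auto
  note addresses = guest_address[OF cj] block_pos_less[OF block_less[OF label(2)], of 0]
  have ones: "set_ones (right_ones ?cl c (Suc j)) M =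
    (if high k b j then (set_ones (right_ones ?cl c j) M)(m * m + (c * m + j) := Suc 0) else set_ones (right_ones ?cl c j) M)" for M
    by (auto simp: right_ones_Suc[OF step(2)] div set_ones_def)
  show ?case using step(1-5) params same div label(1) at addresses q_ge_1 s(2) ones cj Q_bounds[OF label(1) step(2)] dim_bounds word_bounds
    by (auto simp: paramsD high_def block_min_def fun_eq_iff)
next
  case time
  then show ?case using mult_le_mono1[OF s(3), of "Suc n"] by simp
qed (use s dim_bounds in \<open>auto simp: paramsD right_ones_row\<close>)

text \<open>
  The guest multiplies the incidence matrix of the row and column blocks of the group by the matrix
  whose entry \<open>(c, j)\<close> tells whether the minimum of column block \<open>c\<close> is high for \<open>j\<close>.
\<close>

definition product_ready :: "(nat \<Rightarrow> nat) \<Rightarrow> (nat \<Rightarrow> nat) \<Rightarrow> nat \<Rightarrow> nat \<Rightarrow> nat set \<Rightarrow> (nat \<Rightarrow> nat) \<Rightarrow> store \<Rightarrow> bool" where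
  "product_ready rl cl np nc X M s \<longleftrightarrow> params s \<and> np \<le> m \<and> nc \<le> m \<and> incidence rl cl np nc X M \<and>
     arr s aguest (var s vslot) = set_ones (right_ones cl nc 0) M"

lemma right_ones_range: "nc \<le> m \<Longrightarrow> z \<in> right_ones cl nc 0 \<Longrightarrow> m * m \<le> z \<and> z < 2 * (m * m)"
proof -
  assume "nc \<le> m" "z \<in> right_ones cl nc 0"
  moreover from this obtain c j where "c < nc" "j < n" "z = m * m + (c * m + j)" by (auto simp: right_ones_def)
  ultimately show ?thesis using mult_add_less[of c m j m] by linarith
qed

lemma product_ready_cell_le:
  assumes "product_ready rl cl np nc X M s"
  shows "arr s aguest (var s vslot) z \<le> 1"
proof -
  have "M z \<le> 1" using assms unfolding product_ready_def incidence_def by blast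
  then show ?thesis using assms by (simp add: product_ready_def set_ones_def)
qed

lemma product_guest_halts:
  assumes ready: "product_ready rl cl np nc X M s"
  shows "\<exists>t\<le>Lq. halted P ((step ws P ^^ t) (guest_start s)) \<and>
    (\<forall>p<m. \<forall>j<n. mem ((step ws P ^^ t) (guest_start s)) (2 * (m * m) + (p * m + j)) =
      (\<Sum>c<m. M (p * m + c) * (if c < nc \<and> high (cl c div nb) (cl c mod nb) j then 1 else 0)))"
proof -
  let ?G = "arr s aguest (var s vslot)"
  define A where "A i j = M (i * m + j)" for i j
  define B where "B c j = (if c < nc \<and> j < n \<and> high (cl c div nb) (cl c mod nb) j then 1 else 0 :: nat)" for c j
  have inc: "incidence rl cl np nc X M" and nc: "nc \<le> m" and G: "?G = set_ones (right_ones cl nc 0) M" and params: "params s"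
    using ready by (auto simp: product_ready_def)
  have M: "M z \<le> 1" "m * m \<le> z \<Longrightarrow> M z = 0" for z using inc unfolding incidence_def by blast+
  have left: "?G (i * m + j) = A i j" if "i < m" "j < m" for i j
    using right_ones_range[OF nc, of "i * m + j" cl] mult_add_less[OF that] by (auto simp: G set_ones_def A_def)
  have right: "?G (m * m + (i * m + j)) = B i j" if "i < m" "j < m" for i j
    using right_ones_iff[OF that, of cl nc] M(2)[of "m * m + (i * m + j)"] by (simp add: G set_ones_def B_def)
  have rest: "?G z = 0" if "2 * (m * m) \<le> z" for z
    using right_ones_range[OF nc, of z cl] M(2)[of z] that by (auto simp: G set_ones_def)
  have binary: "\<forall>i<m. \<forall>j<m. A i j \<le> 1 \<and> B i j \<le> 1"
    using M(1) by (simp add: A_def B_def)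
  have "matmul_input ws m A B (guest_start s)"
    unfolding matmul_input_def guest_start_def using left right rest params by (auto simp: paramsD add.assoc mult.assoc)
  with multiplies binary obtain t where t: "t \<le> Lq" "halted P ((step ws P ^^ t) (guest_start s))"
    "matmul_output m (\<lambda>i j. \<Sum>k<m. A i k * B k j) ((step ws P ^^ t) (guest_start s))" unfolding multiplies_bits_def by blast
  have "mem ((step ws P ^^ t) (guest_start s)) (2 * (m * m) + (p * m + j)) =
      (\<Sum>c<m. M (p * m + c) * (if c < nc \<and> high (cl c div nb) (cl c mod nb) j then 1 else 0))" if "p < m" "j < n" for p j
  proof -
    have "mem ((step ws P ^^ t) (guest_start s)) (2 * m * m + p * m + j) = (\<Sum>k<m. A p k * B k j)"
      using t(3) that unfolding matmul_output_def by simp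
    then show ?thesis using that(2) unfolding A_def B_def by (simp add: add.assoc mult.assoc)
  qed
  then show ?thesis using t(1,2) by blast
qed

lemma guest_final_eq: "halted P ((step ws P ^^ t) (guest_start s)) \<Longrightarrow> t \<le> var s vbudget \<Longrightarrow> guest_final s = (step ws P ^^ t) (guest_start s)"
  and guest_final_eq': "halted P ((step ws P ^^ t) (guest_start s)) \<Longrightarrow> halted P (guest_final s) \<Longrightarrow> guest_final s = (step ws P ^^ t) (guest_start s)"
proof -
  have later: "(step ws P ^^ l) \<sigma> = (step ws P ^^ k) \<sigma>" if "k \<le> l" "halted P ((step ws P ^^ k) \<sigma>)" for k l \<sigma>
  proof -
    have "(step ws P ^^ l) \<sigma> = (step ws P ^^ (l - k)) ((step ws P ^^ k) \<sigma>)"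
      using that(1) by (metis funpow_add le_add_diff_inverse2 o_apply)
    then show ?thesis using funpow_step_halted[OF that(2)] by simp
  qed
  assume t: "halted P ((step ws P ^^ t) (guest_start s))"
  show "guest_final s = (step ws P ^^ t) (guest_start s)" if "t \<le> var s vbudget"
    unfolding guest_final_def using later[OF that t] .
  show "guest_final s = (step ws P ^^ t) (guest_start s)" if "halted P (guest_final s)"
    using that t later nat_le_linear unfolding guest_final_def by metis
qed

lemma product_halted:
  assumes ready: "product_ready rl cl np nc X M s" and "Lq \<le> n * q * q"
  shows "halted P (guest_final s)"
proof -
  obtain t where "t \<le> Lq" "halted P ((step ws P ^^ t) (guest_start s))" using product_guest_halts[OF ready] by metis
  moreover have "var s vbudget = n * q * q" using ready by (simp add: product_ready_def paramsD)
  ultimately show ?thesis using guest_final_eq assms(2) by (metis le_trans)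
qed

lemma product_nonzero:
  assumes ready: "product_ready rl cl np nc X M s" and "halted P (guest_final s)" "p < m" "j < n"
  shows "mem (guest_final s) (2 * (m * m) + (p * m + j)) \<noteq> 0 \<longleftrightarrow> (\<exists>c<nc. M (p * m + c) \<noteq> 0 \<and> high (cl c div nb) (cl c mod nb) j)"
proof -
  obtain t where t: "halted P ((step ws P ^^ t) (guest_start s))"
    "mem ((step ws P ^^ t) (guest_start s)) (2 * (m * m) + (p * m + j)) =
      (\<Sum>c<m. M (p * m + c) * (if c < nc \<and> high (cl c div nb) (cl c mod nb) j then 1 else 0))"
    using product_guest_halts[OF ready] assms(3,4) by blast
  note t(2)[folded guest_final_eq'[OF t(1) assms(2)]]
  moreover have "nc \<le> m" using ready by (simp add: product_ready_def)
  ultimately show ?thesis by (auto simp: sum_eq_0_iff)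
qed

definition product_marks :: "(nat \<Rightarrow> nat) \<Rightarrow> nat \<Rightarrow> state \<Rightarrow> (nat \<times> nat) set" where
  "product_marks rl np \<sigma> = {(rl p, j) |p j. p < np \<and> j < n \<and> mem \<sigma> (2 * (m * m) + (p * m + j)) \<noteq> 0}"

lemma labelled_div_mod:
  assumes "labelled rl cl p c i k" "i < n" "k < n"
  shows "rl p = i * nb + row_block i k" "cl c div nb = k" "cl c mod nb = col_block k i"
  using assms col_block_less(2)[of k i] by (auto simp: labelled_def)

lemma product_marks_sound:
  assumes ready: "product_ready rl cl np nc X M s" and halted: "halted P (guest_final s)"
  shows "product_marks rl np (guest_final s) \<subseteq> hits"
proof
  fix z assume "z \<in> product_marks rl np (guest_final s)"
  then obtain p j where z: "z = (rl p, j)" "p < np" "j < n" "mem (guest_final s) (2 * (m * m) + (p * m + j)) \<noteq> 0"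
    unfolding product_marks_def by blast
  have inc: "incidence rl cl np nc X M" "np \<le> m" "nc \<le> m" using ready by (auto simp: product_ready_def)
  then have p: "p < m" using z(2) by simp
  then obtain c where c: "c < nc" "M (p * m + c) \<noteq> 0" "high (cl c div nb) (cl c mod nb) j"
    using product_nonzero[OF ready halted _ z(3)] z(4) by blast
  then obtain i k where ik: "i < n" "k < n" "labelled rl cl p c i k"
    using inc p unfolding incidence_def by (meson order_less_le_trans)
  note label = labelled_div_mod[OF ik(3,1,2)]
  have "dominates i k j" using c(3) block_min_le[OF ik(1,2)] by (simp add: label high_def dominates_def)
  then show "z \<in> hits" using hit_mem[OF ik(1,2) z(3)] z(1) label(1) by (simp add: hit_def)
qed

lemma product_marks_complete:
  assumes ready: "product_ready rl cl np nc X M s" and halted: "halted P (guest_final s)" and x: "x \<in> X" "x < n * n"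
  shows "interior_hits x \<subseteq> product_marks rl np (guest_final s)"
proof
  fix z assume "z \<in> interior_hits x"
  then obtain j where z: "z = hit (entry_row x) (entry_col x) j" "j < n" "high (entry_col x) (col_block (entry_col x) (entry_row x)) j"
    unfolding interior_hits_def by blast
  have inc: "incidence rl cl np nc X M" "np \<le> m" using ready by (auto simp: product_ready_def)
  then obtain p c where pc: "p < np" "c < nc" "M (p * m + c) \<noteq> 0" "labelled rl cl p c (entry_row x) (entry_col x)"
    using x(1) unfolding incidence_def by blast
  note label = labelled_div_mod[OF pc(4) entry_less[OF x(2)]]
  have "mem (guest_final s) (2 * (m * m) + (p * m + j)) \<noteq> 0"
    using product_nonzero[OF ready halted _ z(2), of p] pc(1-3) z(3) inc(2) by (auto simp: label)
  then show "z \<in> product_marks rl np (guest_final s)"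
    using pc(1) z(1,2) unfolding product_marks_def hit_def label(1)[symmetric] by blast
qed

lemma group_out_correct:
  assumes s: "params s" "var s vslot < R" "var s vrows \<le> m" "arr s aguest (var s vslot) = mem \<sigma>"
    and labels: "\<forall>p<var s vrows. \<exists>i<n. \<exists>b. b * q < n \<and> arr s arow_label 0 p = i * nb + b"
  shows "ensures group_out s (m * (n + 1)) (\<lambda>s'. marks (arr s' amark) = marks (arr s amark) \<union> product_marks (arr s arow_label 0) (var s vrows) \<sigma>)"
  unfolding group_out_def
proof (rule ensures_For_For[where m = "var s vrows" and l = n and b = 0 and I = "\<lambda>p j A. marks (A amark) = marks (arr s amark) \<union>
    {(arr s arow_label 0 p', j') |p' j'. (p' < p \<or> p' = p \<and> j' < j) \<and> j' < n \<and> mem \<sigma> (2 * (m * m) + (p' * m + j')) \<noteq> 0}"],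
    goal_cases vars init row step exit time)
  case (row p A)
  then show ?case by (simp add: less_Suc_eq conj_commute) (metis (no_types, lifting))
next
  case (step p j s1)
  have params: "params s1" by (rule params_frame[OF s(1) step(6)]) auto
  have same: "var s1 vslot = var s vslot" "arr s1 arow_label = arr s arow_label" "arr s1 aguest = arr s aguest"
    using step(6) by (auto simp: frame_def)
  obtain i b where label: "i < n" "b * q < n" "arr s arow_label 0 p = i * nb + b" using labels step(1) by blast
  note address = row_block_address[OF label(1) block_less[OF label(2)], folded label(3)]
  have pj: "p < m" "j < m" using step(1,2) s(3) by auto
  show ?case
  proof (cases "mem \<sigma> (2 * (m * m) + (p * m + j)) = 0")
    case True
    then show ?thesis using step params same address s(2,4) guest_address[OF pj] pj dim_bounds word_bounds
      by (auto simp: paramsD less_Suc_eq)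
  next
    case False
    then show ?thesis using step params same address s(2,4) guest_address[OF pj] pj dim_bounds word_bounds
      by (auto simp: paramsD marks_insert less_Suc_eq)
  qed
next
  case time
  then show ?case using mult_le_mono1[OF s(3), of "Suc n"] by simp
qed (use s dim_bounds in \<open>auto simp: paramsD product_marks_def\<close>)

definition group_labels :: "nat set \<Rightarrow> (nat \<Rightarrow> nat) \<Rightarrow> store \<Rightarrow> bool" where
  "group_labels X M s \<longleftrightarrow> product_ready (arr s arow_label 0) (arr s acol_label 0) (var s vrows) (var s vcols) X M s \<and>
     (\<forall>p<var s vrows. \<exists>i<n. \<exists>b. b * q < n \<and> arr s arow_label 0 p = i * nb + b)"

lemma group_prepare_correct:
  assumes s: "params s" "var s vgroup = r" "r < nb" "var s vslot < R" "unused_slots (var s vslot) s"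
  shows "ensures group_prepare s (n + n * q + m * (n + 1)) (\<lambda>s'. unused_slots (Suc (var s vslot)) s' \<and>
    (\<exists>M. group_labels {r * (n * q)..<min (Suc r * (n * q)) (n * n)} M s'))" (is "ensures _ _ _ ?Q")
proof -
  let ?x0 = "r * (n * q)" and ?x1 = "min (Suc r * (n * q)) (n * n)"
  define s1 where "s1 = s\<lparr>var := (var s)(vrows := 0, vcols := 0)\<rparr>"
  have s1: "params s1" "var s1 vrows = 0" "var s1 vcols = 0" "unused_slots (var s1 vslot) s1"
    using s by (auto simp: s1_def params_def unused_slots_def)
  have "ensures (group_clear ;; group_fill ;; group_right) s1 (n + n * q + m * (n + 1)) ?Q"
  proof (rule ensures_Seq[OF group_clear_correct[of s1 ?x0, OF s1], where Tb = "n * q + m * (n + 1)"])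
    fix s2 assume inv2: "group_state ?x0 ?x0 s2" and fr2: "frame_of group_clear s1 s2"
    have s2: "params s2" by (rule params_frame[OF s1(1) fr2]) (auto simp: group_clear_def)
    have same2: "var s2 vgroup = r" "var s2 vslot = var s vslot" using fr2 s by (auto simp: frame_def group_clear_def s1_def)
    show "ensures (group_fill ;; group_right) s2 (n * q + m * (n + 1)) ?Q"
    proof (rule ensures_Seq[where Tb = "m * (n + 1)", OF group_fill_correct[OF s2 same2(1) s(3) _ inv2]])
      fix s3 assume inv3: "group_state ?x0 ?x1 s3" and fr3: "frame_of group_fill s2 s3"
      have s3: "params s3" by (rule params_frame[OF s2 fr3]) (auto simp: mark_group_defs)
      have slot3: "var s3 vslot = var s vslot" using fr3 same2 by (auto simp: frame_def mark_group_defs)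
      have "?x0 \<le> ?x1" "?x1 \<le> ?x0 + n * q" "?x1 \<le> n * n" using group_start_le[OF s(3)] by auto
      note num = group_state_le[OF inv3 this]
      let ?M = "arr s3 aguest (var s3 vslot)"
      have labels: "\<forall>c<var s3 vcols. \<exists>k<n. \<exists>b. b * q < n \<and> arr s3 acol_label 0 c = k * nb + b"
        using inv3 by (simp add: group_state_def blocks_numbered_def)
      show "ensures group_right s3 (m * (n + 1)) ?Q"
      proof (rule ensures_weaken[OF group_right_correct[OF s3 _ num(2) labels]])
        fix s4 assume right: "arr s4 aguest = (arr s3 aguest)(var s3 vslot := set_ones (right_ones (arr s3 acol_label 0) (var s3 vcols) 0) ?M)"
          and fr4: "frame_of group_right s3 s4"
        have "params s4" by (rule params_frame[OF s3 fr4]) (auto simp: mark_group_defs)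
        moreover have "var s4 vslot = var s3 vslot" "var s4 vrows = var s3 vrows" "var s4 vcols = var s3 vcols"
          "arr s4 arow_label = arr s3 arow_label" "arr s4 acol_label = arr s3 acol_label"
          using fr4 by (auto simp: frame_def group_right_def)
        ultimately have "group_labels {?x0..<?x1} ?M s4" "unused_slots (Suc (var s vslot)) s4"
          using inv3 num right slot3
          by (auto simp: group_labels_def product_ready_def group_state_def blocks_numbered_def unused_slots_def)
        then show "?Q s4" by blast
      qed (use slot3 s in auto)
    qed (use same2 s in auto)
  qed simp
  then show ?thesis using word_bounds unfolding group_prepare_def by (simp add: s1_def)
qed

definition group_marked :: "nat set \<Rightarrow> store \<Rightarrow> store \<Rightarrow> bool" where
  "group_marked X s s' \<longleftrightarrow> var s' vslot = Suc (var s vslot) \<and> unused_slots (var s' vslot) s' \<and> marks (arr s amark) \<subseteq> marks (arr s' amark) \<and>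
     (\<exists>finished. (Lq \<le> n * q * q \<longrightarrow> finished) \<and> var s' vok = (if finished then var s vok else 0) \<and>
       (finished \<longrightarrow> marks (arr s' amark) \<subseteq> marks (arr s amark) \<union> hits \<and> (\<forall>x\<in>X. interior_hits x \<subseteq> marks (arr s' amark))))"

lemma group_multiply_correct:
  assumes labels: "group_labels X M s" and X: "X \<subseteq> {..<n * n}" and slot: "var s vslot < R" "unused_slots (Suc (var s vslot)) s"
  shows "ensures group_multiply s (n * q * q + m * (n + 1)) (group_marked X s)"
proof -
  have ready: "product_ready (arr s arow_label 0) (arr s acol_label 0) (var s vrows) (var s vcols) X M s" and params: "params s"
    using labels by (auto simp: group_labels_def product_ready_def)
  let ?\<sigma> = "guest_final s" and ?rl = "arr s arow_label 0"
  define s1 where "s1 = guest_return P s ?\<sigma>"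
  define s2 where "s2 = (if halted P ?\<sigma> then s1 else s1\<lparr>var := (var s1)(vok := 0)\<rparr>)"
  have "guest_ready s" unfolding guest_ready_def using params slot(1) dim_bounds q_bounds word_bounds
      le_less_trans[OF product_ready_cell_le[OF ready]] by (auto simp: paramsD)
  then have sim: "ensures Simulate s (n * q * q) (\<lambda>s'. s' = s1)"
    by (rule ensures_Simulate) (use params in \<open>auto simp: s1_def paramsD\<close>)
  have "params s2" using params by (simp add: s2_def s1_def guest_return_def params_def)
  moreover have s2: "var s2 vslot = var s vslot" "var s2 vrows = var s vrows" "arr s2 arow_label = arr s arow_label" "arr s2 amark = arr s amark"
    "arr s2 aguest (var s2 vslot) = mem ?\<sigma>" "unused_slots (Suc (var s vslot)) s2" "var s2 vok = (if halted P ?\<sigma> then var s vok else 0)"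
    using slot(2) by (simp_all add: s2_def s1_def guest_return_def unused_slots_def)
  ultimately have out: "ensures group_out s2 (m * (n + 1)) (\<lambda>s'. marks (arr s' amark) = marks (arr s2 amark) \<union> product_marks (arr s2 arow_label 0) (var s2 vrows) ?\<sigma>)"
    using labels slot(1) by (intro group_out_correct) (auto simp: group_labels_def product_ready_def)
  have "ensures (group_out ;; vslot ::= V vslot \<oplus> N 1) s2 (m * (n + 1)) (group_marked X s)"
  proof (rule ensures_Seq[OF out, where Tb = 0])
    fix s3 assume marks: "marks (arr s3 amark) = marks (arr s2 amark) \<union> product_marks (arr s2 arow_label 0) (var s2 vrows) ?\<sigma>"
      and fr: "frame_of group_out s2 s3"
    have s3: "var s3 vslot = var s vslot" "arr s3 aguest = arr s2 aguest" "var s3 vok = var s2 vok" using fr s2 by (auto simp: frame_def group_out_def)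
    have "marks (arr s amark) \<subseteq> marks (arr s3 amark)" using marks s2 by simp
    moreover have "marks (arr s3 amark) \<subseteq> marks (arr s amark) \<union> hits" if "halted P ?\<sigma>"
      using marks s2 product_marks_sound[OF ready that] by auto
    moreover have "\<forall>x\<in>X. interior_hits x \<subseteq> marks (arr s3 amark)" if "halted P ?\<sigma>"
      using marks s2 product_marks_complete[OF ready that] X by auto
    ultimately have "group_marked X s (s3\<lparr>var := (var s3)(vslot := Suc (var s vslot))\<rparr>)"
      unfolding group_marked_def using s2 s3 product_halted[OF ready]
      by (intro conjI exI[of _ "halted P ?\<sigma>"]) (simp_all add: unused_slots_def)
    then show "ensures (vslot ::= V vslot \<oplus> N 1) s3 0 (group_marked X s)" using s3 slot(1) word_bounds by simp
  qed simp
  then have "ensures ((IF V vhalted \<prec> N 1 THEN vok ::= N 0 ELSE SKIP) ;; group_out ;; vslot ::= V vslot \<oplus> N 1) s1 (m * (n + 1)) (group_marked X s)"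
    using word_bounds by (cases "halted P ?\<sigma>") (simp_all add: s2_def s1_def guest_return_def)
  then show ?thesis unfolding group_multiply_def by (intro ensures_Seq[OF sim]) auto
qed

end

definition group_ticks :: "nat \<Rightarrow> nat \<Rightarrow> nat" where
  "group_ticks n q = n + n * q + 3 * n * (n + 1) + n * q * q + 3 * n * (n + 1)"

context dominance
begin

lemma mark_group_correct:
  assumes s: "params s" "var s vgroup = r" "r < nb" "var s vslot < R" "unused_slots (var s vslot) s"
  shows "ensures mark_group s (group_ticks n q) (group_marked {r * (n * q)..<min (Suc r * (n * q)) (n * n)} s)"
  unfolding mark_group_def
proof (rule ensures_Seq[OF group_prepare_correct[OF s], where Tb = "n * q * q + m * (n + 1)"])
  let ?X = "{r * (n * q)..<min (Suc r * (n * q)) (n * n)}"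
  fix s1 assume "unused_slots (Suc (var s vslot)) s1 \<and> (\<exists>M. group_labels ?X M s1)" and fr: "frame_of group_prepare s s1"
  then obtain M where ready: "group_labels ?X M s1" "unused_slots (Suc (var s vslot)) s1" by blast
  have same: "var s1 vslot = var s vslot" "var s1 vok = var s vok" "arr s1 amark = arr s amark" using fr by (auto simp: frame_def mark_group_defs)
  have "ensures group_multiply s1 (n * q * q + m * (n + 1)) (group_marked ?X s1)"
    by (rule group_multiply_correct[OF ready(1)]) (use ready(2) same s(4) in auto)
  moreover have "group_marked ?X s1 s' = group_marked ?X s s'" for s' by (simp only: group_marked_def same)
  ultimately show "ensures group_multiply s1 (n * q * q + m * (n + 1)) (group_marked ?X s)" by (simp add: ensures_def)
qed (simp add: group_ticks_def)

definition groups_marked :: "nat \<Rightarrow> store \<Rightarrow> nat \<Rightarrow> store \<Rightarrow> bool" where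
  "groups_marked r s x s' \<longleftrightarrow> var s' vslot = var s vslot + r \<and> unused_slots (var s' vslot) s' \<and> marks (arr s amark) \<subseteq> marks (arr s' amark) \<and>
     var s' vok \<le> 1 \<and> (Lq \<le> n * q * q \<longrightarrow> var s' vok = 1) \<and>
     (var s' vok \<noteq> 0 \<longrightarrow> marks (arr s' amark) \<subseteq> hits \<and> (\<forall>y<x. interior_hits y \<subseteq> marks (arr s' amark)))"

lemma groups_marked_step:
  assumes "groups_marked r s (min (r * (n * q)) (n * n)) s1" "group_marked {r * (n * q)..<min (Suc r * (n * q)) (n * n)} s1 s2"
  shows "groups_marked (Suc r) s (min (Suc r * (n * q)) (n * n)) s2"
proof -
  obtain finished where vok: "var s2 vok = (if finished then var s1 vok else 0)" "Lq \<le> n * q * q \<longrightarrow> finished"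
    and new: "finished \<longrightarrow> marks (arr s2 amark) \<subseteq> marks (arr s1 amark) \<union> hits \<and>
       (\<forall>x\<in>{r * (n * q)..<min (Suc r * (n * q)) (n * n)}. interior_hits x \<subseteq> marks (arr s2 amark))"
    using assms(2) by (auto simp: group_marked_def)
  have mono: "marks (arr s1 amark) \<subseteq> marks (arr s2 amark)" using assms(2) by (simp add: group_marked_def)
  have "marks (arr s2 amark) \<subseteq> hits \<and> (\<forall>y<min (Suc r * (n * q)) (n * n). interior_hits y \<subseteq> marks (arr s2 amark))" if "var s2 vok \<noteq> 0"
  proof -
    have finished: finished "var s1 vok \<noteq> 0" using vok(1) that by (auto split: if_splits)
    then have old: "marks (arr s1 amark) \<subseteq> hits" "\<forall>y<min (r * (n * q)) (n * n). interior_hits y \<subseteq> marks (arr s1 amark)"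
      using assms(1) by (auto simp: groups_marked_def)
    have "interior_hits y \<subseteq> marks (arr s2 amark)" if "y < min (Suc r * (n * q)) (n * n)" for y
    proof (cases "y < min (r * (n * q)) (n * n)")
      case False
      then have "y \<in> {r * (n * q)..<min (Suc r * (n * q)) (n * n)}" using that by auto
      then show ?thesis using new finished(1) by blast
    qed (use old(2) mono in blast)
    then show ?thesis using new finished(1) old(1) by blast
  qed
  then show ?thesis using assms vok mono unfolding groups_marked_def group_marked_def by (auto split: if_splits)
qed

lemma mark_groups_correct:
  assumes s: "params s" "var s vslot + nb \<le> R" "unused_slots (var s vslot) s" "var s vok = 1" "marks (arr s amark) \<subseteq> hits"
  shows "ensures mark_groups s (nb * Suc (group_ticks n q)) (groups_marked nb s (n * n))"
  unfolding mark_groups_def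
proof (rule ensures_For[where m = nb and b = "group_ticks n q" and I = "\<lambda>r. groups_marked r s (min (r * (n * q)) (n * n))"],
    goal_cases vars init step exit time)
  case (step r s1)
  have "params s1" by (rule params_frame[OF s(1) step(4)]) (auto simp: mark_group_defs)
  then have "ensures mark_group s1 (group_ticks n q) (group_marked {r * (n * q)..<min (Suc r * (n * q)) (n * n)} s1)"
    using step(1-3) s(2) by (intro mark_group_correct) (auto simp: groups_marked_def)
  then show ?case
  proof (rule ensures_weaken)
    fix s2 assume "group_marked {r * (n * q)..<min (Suc r * (n * q)) (n * n)} s1 s2"
    from groups_marked_step[OF step(3) this]
    show "groups_marked (Suc r) s (min (Suc r * (n * q)) (n * n)) (s2\<lparr>var := (var s2)(vgroup := Suc r)\<rparr>)"
      by (simp add: groups_marked_def unused_slots_def)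
  qed simp
next
  case (exit s1)
  have "n * n \<le> n * (nb * q)" using n_less_nb_mult_q by (intro mult_le_mono2) simp
  then have "min (nb * (n * q)) (n * n) = n * n" by (simp add: mult.left_commute)
  then show ?case using exit(1) by simp
qed (use s nb_bounds in \<open>auto simp: paramsD groups_marked_def unused_slots_def mark_group_defs\<close>)

end

definition find_marked :: com where
  "find_marked = FOR vblock \<prec> vblocks DO
     IF V vbest \<prec> V vblocks THEN SKIP
     ELSE (IF N 0 \<prec> amark\<langle>V vrow \<otimes> V vblocks \<oplus> V vblock, V vj\<rangle> THEN vbest ::= V vblock ELSE SKIP)"

definition search_block :: com where
  "search_block = FOR vy \<prec> vq DO (vpos ::= V vbest \<otimes> V vq \<oplus> V vy ;;
     IF V vpos \<prec> V vn
     THEN (vcol ::= arow_at\<langle>V vrow, V vpos\<rangle> ;;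
       IF aQ\<langle>V vrow, V vcol\<rangle> \<prec> aQ\<langle>V vcol, V vj\<rangle> \<oplus> V vshift THEN SKIP
       ELSE IF aQ\<langle>V vrow, V vcol\<rangle> \<prec> V vmin THEN vmin ::= aQ\<langle>V vrow, V vcol\<rangle> ELSE SKIP)
     ELSE SKIP)"

definition search :: com where
  "search = FOR vrow \<prec> vn DO FOR vj \<prec> vn DO (vbest ::= V vblocks ;; vmin ::= V vinf ;;
     (find_marked ;; (IF V vbest \<prec> V vblocks THEN search_block ELSE SKIP)) ;; aresult\<langle>V vrow, V vj\<rangle> \<leftarrow> V vmin)"

lemmas search_defs = find_marked_def search_block_def search_def

definition attempt :: com where
  "attempt = (clear_marks ;; mark_boundaries) ;; vok ::= N 1 ;; mark_groups ;; search"

definition attempt_ticks :: "nat \<Rightarrow> nat \<Rightarrow> nat" where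
  "attempt_ticks n q = n * num_blocks n q * (n + 1) + n * (n * (num_blocks n q + q + 1) + 1) +
     num_blocks n q * Suc (group_ticks n q) + n * (n * (num_blocks n q + q + 1) + 1)"

context dominance
begin

definition first_marked :: "matrix \<Rightarrow> nat \<Rightarrow> nat \<Rightarrow> nat \<Rightarrow> nat \<Rightarrow> bool" where
  "first_marked Z i j b best \<longleftrightarrow> best \<le> nb \<and> (best < nb \<longrightarrow> best < b \<and> Z (i * nb + best) j \<noteq> 0) \<and> (\<forall>b'<min b best. Z (i * nb + b') j = 0)"

lemma find_marked_correct:
  assumes s: "params s" "var s vrow = i" "i < n" "var s vj = j" "j < n" "var s vbest = nb"
  shows "ensures find_marked s nb (\<lambda>s'. first_marked (arr s amark) i j nb (var s' vbest))"
  unfolding find_marked_def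
proof (rule ensures_For[where m = nb and b = 0 and I = "\<lambda>b s'. first_marked (arr s amark) i j b (var s' vbest)"], goal_cases vars init step exit time)
  case (step b s1)
  have params: "params s1" by (rule params_frame[OF s(1) step(4)]) auto
  have same: "var s1 vrow = i" "var s1 vj = j" "arr s1 amark = arr s amark" using step(4) s by (auto simp: frame_def)
  show ?case using step(1-3) params same row_block_address[OF s(3) step(1)] s(5) dim_bounds word_bounds
    by (auto simp: paramsD first_marked_def less_Suc_eq)
qed (use s nb_bounds in \<open>auto simp: paramsD first_marked_def\<close>)

definition least_upto :: "nat \<Rightarrow> nat \<Rightarrow> nat \<Rightarrow> nat \<Rightarrow> nat \<Rightarrow> bool" where
  "least_upto i j b p x \<longleftrightarrow> (x = R \<or> (\<exists>k<n. dominates i k j \<and> x = Q i k)) \<and>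
     (\<forall>k<n. row_block i k = b \<and> row_pos i k < p \<and> dominates i k j \<longrightarrow> x \<le> Q i k)"

lemma least_upto_Suc:
  assumes "least_upto i j b p x" "i < n" and y: "y = (if p < n \<and> dominates i (row_at i p) j then min x (Q i (row_at i p)) else x)"
  shows "least_upto i j b (Suc p) y"
proof -
  have "y = R \<or> (\<exists>k<n. dominates i k j \<and> y = Q i k)"
    using assms(1) row_atD(1)[OF assms(2), of p] unfolding least_upto_def y by (auto simp: min_def)
  moreover have "y \<le> Q i k" if k: "k < n" "row_block i k = b" "row_pos i k < Suc p" "dominates i k j" for k
  proof (cases "row_pos i k = p")
    case True
    then have "p < n" "row_at i p = k" using row_posD[OF assms(2) k(1)] by auto
    then show ?thesis using k(4) y by simp
  next
    case False
    then have "x \<le> Q i k" using assms(1) k unfolding least_upto_def by auto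
    then show ?thesis using y by auto
  qed
  ultimately show ?thesis unfolding least_upto_def by blast
qed

lemma search_block_correct:
  assumes s: "params s" "var s vrow = i" "i < n" "var s vj = j" "j < n" "var s vbest = b" "b < nb" "var s vmin = R"
  shows "ensures search_block s q (\<lambda>s'. least_upto i j b (b * q + q) (var s' vmin))"
  unfolding search_block_def
proof (rule ensures_For[where m = q and b = 0 and I = "\<lambda>y s'. least_upto i j b (b * q + y) (var s' vmin)"], goal_cases vars init step exit time)
  case init
  then show ?case using s(8) by (auto simp: least_upto_def row_block_def simp flip: not_le)
next
  case (step y s1)
  let ?p = "b * q + y"
  let ?k = "row_at i ?p"
  have params: "params s1" by (rule params_frame[OF s(1) step(4)]) auto
  have same: "var s1 vrow = i" "var s1 vj = j" "var s1 vbest = b" using step(4) s by (auto simp: frame_def)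
  note p = block_pos_less[OF s(7) step(1)]
  note Suc = least_upto_Suc[OF step(3) s(3) refl]
  show ?case
  proof (cases "?p < n")
    case True
    have k: "?k < n" "?k < R" using row_atD(1)[OF s(3) True] dim_bounds by auto
    then show ?thesis using Suc step(2) params same p True s(3,5) Q_bounds[OF k(1) s(5)] dim_bounds word_bounds
      by (cases "dominates i ?k j") (auto simp: paramsD dominates_def min_def)
  next
    case False
    then show ?thesis using Suc step(2) params same p word_bounds by (auto simp: paramsD)
  qed
qed (use s q_bounds word_bounds in \<open>auto simp: paramsD\<close>)

lemma least_dominatingI:
  assumes marks: "marks Z = hits" and ij: "i < n" "j < n" and first: "first_marked Z i j nb b"
    and x: "if b < nb then least_upto i j b (b * q + q) x else x = R"
  shows "least_dominating R n l Q i j x"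
proof -
  have "x \<le> Q i k" if k: "k < n" "dominates i k j" for k
  proof -
    have block: "row_block i k < nb" by (rule row_block_less(2)[OF ij(1) k(1)])
    have "hit i k j \<in> marks Z" using hit_mem[OF ij(1) k(1) ij(2) k(2)] marks by simp
    then have "Z (i * nb + row_block i k) j \<noteq> 0" by (simp add: marks_def hit_def)
    then have b: "b \<le> row_block i k" "b < nb" using first block unfolding first_marked_def by (auto simp flip: not_less)
    then have least: "least_upto i j b (b * q + q) x" using x by simp
    have in_block: "row_pos i k' < b * q + q" if "row_block i k' = b" for k'
      using that q_ge_1 dividend_less_div_times[of q "row_pos i k'"] by (auto simp: row_block_def)
    show ?thesis
    proof (cases "row_block i k = b")
      case True
      then show ?thesis using least in_block k unfolding least_upto_def by blast
    next
      case False
      have "(i * nb + b, j) \<in> marks Z" using first b(2) ij row_block_address[OF ij(1) b(2)] unfolding first_marked_def marks_def by blast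
      then obtain i' k' where "i * nb + b = i' * nb + row_block i' k'" "i' < n" "k' < n" "dominates i' k' j"
        unfolding marks hits_def hit_def by auto
      then have k': "row_block i k' = b" "k' < n" "dominates i k' j"
        using mult_add_eq_iff[OF b(2) row_block_less(2)] by auto
      have "row_pos i k' \<le> row_pos i k" using b(1) False k'(1) unfolding row_block_def by (metis div_le_mono le_antisym nle_le)
      then have "Q i k' \<le> Q i k" by (rule row_sorted[OF ij(1) k'(2) k(1)])
      moreover have "x \<le> Q i k'" using least in_block k' unfolding least_upto_def by blast
      ultimately show ?thesis by linarith
    qed
  qed
  moreover have "x = R \<or> (\<exists>k<n. dominates i k j \<and> x = Q i k)" using x by (auto simp: least_upto_def split: if_splits)
  moreover from this have "x \<le> R" using Q_le_R[OF ij(1)] by auto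
  ultimately show ?thesis by (auto simp: least_dominating_def is_least_def dominates_def)
qed

lemma search_entry_correct:
  assumes s: "params s" "var s vrow = i" "i < n" "var s vj = j" "j < n" "var s vbest = nb" "var s vmin = R"
  shows "ensures (find_marked ;; IF V vbest \<prec> V vblocks THEN search_block ELSE SKIP) s (nb + q) (\<lambda>s'. marks (arr s amark) = hits \<longrightarrow> least_dominating R n l Q i j (var s' vmin))"
proof (rule ensures_Seq[OF find_marked_correct[OF s(1-6)], where Tb = q])
  fix s1 assume first: "first_marked (arr s amark) i j nb (var s1 vbest)" and fr: "frame_of find_marked s s1"
  have params: "params s1" by (rule params_frame[OF s(1) fr]) (auto simp: find_marked_def)
  have same: "var s1 vrow = i" "var s1 vj = j" "var s1 vmin = R" using fr s by (auto simp: frame_def find_marked_def)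
  note least = least_dominatingI[OF _ s(3,5) first]
  show "ensures (IF V vbest \<prec> V vblocks THEN search_block ELSE SKIP) s1 q (\<lambda>s'. marks (arr s amark) = hits \<longrightarrow> least_dominating R n l Q i j (var s' vmin))"
  proof (cases "var s1 vbest < nb")
    case True
    have "ensures search_block s1 q (\<lambda>s'. marks (arr s amark) = hits \<longrightarrow> least_dominating R n l Q i j (var s' vmin))"
      by (rule ensures_weaken[OF search_block_correct[OF params same(1) s(3) same(2) s(5) refl True same(3)]]) (use least True in auto)
    then show ?thesis using True params by (simp add: paramsD)
  qed (use least params same in \<open>auto simp: paramsD\<close>)
qed simp

lemma search_correct:
  assumes s: "params s"
  shows "ensures search s (n * (n * (nb + q + 1) + 1))
    (\<lambda>s'. marks (arr s amark) = hits \<longrightarrow> dominance_solution R n l Q (arr s' aresult))"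
  unfolding search_def
proof (rule ensures_For_For_cells[where m = n and l = n and b = "nb + q" and
    cell = "\<lambda>i j A. marks (arr s amark) = hits \<longrightarrow> least_dominating R n l Q i j (A aresult i j)"], goal_cases vars step exit time)
  case (step i j s1)
  let ?s = "s1\<lparr>var := (var s1)(vbest := nb, vmin := R)\<rparr>"
  let ?find = "find_marked ;; (IF V vbest \<prec> V vblocks THEN search_block ELSE SKIP)"
  let ?Q = "\<lambda>s'. (marks (arr s amark) = hits \<longrightarrow> least_dominating R n l Q i j (arr s' aresult i j)) \<and>
    (\<forall>i'<n. \<forall>j'<n. (i', j') \<noteq> (i, j) \<longrightarrow> (marks (arr s amark) = hits \<longrightarrow> least_dominating R n l Q i' j' (arr s1 aresult i' j')) \<longrightarrow>
      marks (arr s amark) = hits \<longrightarrow> least_dominating R n l Q i' j' (arr s' aresult i' j'))"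
  have "params s1" by (rule params_frame[OF s step(5)]) (auto simp: search_defs)
  then have params: "params s1" "params ?s" by (auto simp: params_def)
  have same: "arr s1 amark = arr s amark" using step(5) by (auto simp: frame_def search_defs)
  have "ensures ?find ?s (nb + q) (\<lambda>s'. marks (arr ?s amark) = hits \<longrightarrow> least_dominating R n l Q i j (var s' vmin))"
    using params step(1-4) by (intro search_entry_correct) auto
  then have "ensures (?find ;; aresult\<langle>V vrow, V vj\<rangle> \<leftarrow> V vmin) ?s (nb + q) ?Q"
  proof (rule ensures_Seq[where Tb = 0])
    fix s2 assume "marks (arr ?s amark) = hits \<longrightarrow> least_dominating R n l Q i j (var s2 vmin)" and fr: "frame_of ?find ?s s2"
    moreover have "var s2 vrow = i" "var s2 vj = j" "arr s2 aresult = arr s1 aresult" using fr step(3,4) by (auto simp: frame_def search_defs)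
    ultimately show "ensures (aresult\<langle>V vrow, V vj\<rangle> \<leftarrow> V vmin) s2 0 ?Q" using step(1,2) same dim_bounds by auto
  qed simp
  then show ?case using params(1) by (simp add: paramsD)
qed (use s dim_bounds in \<open>auto simp: paramsD search_defs\<close>)

lemma attempt_correct:
  assumes s: "params s" "var s vslot + nb \<le> R" "unused_slots (var s vslot) s"
  shows "ensures attempt s (attempt_ticks n q) (\<lambda>s'. var s' vslot = var s vslot + nb \<and> unused_slots (var s' vslot) s' \<and>
    var s' vok \<le> 1 \<and> (Lq \<le> n * q * q \<longrightarrow> var s' vok = 1) \<and> (var s' vok \<noteq> 0 \<longrightarrow> dominance_solution R n l Q (arr s' aresult)))"
    (is "ensures _ _ _ ?Q")
proof -
  let ?mark = "n * (n * (nb + q + 1) + 1)" and ?groups = "nb * Suc (group_ticks n q)"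
  have boundaries: "ensures (clear_marks ;; mark_boundaries) s (n * nb * (n + 1) + ?mark) boundaries_marked"
  proof (rule ensures_Seq[OF clear_marks_correct[OF s(1)], where Tb = ?mark])
    fix s1 assume "marks (arr s1 amark) = {}" and fr: "frame_of clear_marks s s1"
    moreover have "params s1" by (rule params_frame[OF s(1) fr]) (auto simp: clear_marks_def)
    ultimately show "ensures mark_boundaries s1 ?mark boundaries_marked"
      by (intro mark_boundaries_correct)
  qed simp
  have "ensures (vok ::= N 1 ;; mark_groups ;; search) s1 (?groups + ?mark) ?Q"
    if marked: "boundaries_marked s1"
      and fr: "frame_of (clear_marks ;; mark_boundaries) s s1" for s1
  proof -
    let ?s = "s1\<lparr>var := (var s1)(vok := 1)\<rparr>"
    have "params s1" by (rule params_frame[OF s(1) fr]) (auto simp: clear_marks_def mark_boundaries_defs)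
    then have params: "params ?s" by (auto simp: params_def)
    have same: "var s1 vslot = var s vslot" "arr s1 aguest = arr s aguest"
      using fr by (auto simp: frame_def clear_marks_def mark_boundaries_defs)
    have "ensures mark_groups ?s ?groups (groups_marked nb ?s (n * n))"
      by (rule mark_groups_correct[OF params]) (use s same marked in \<open>auto simp: unused_slots_def\<close>)
    then have "ensures (mark_groups ;; search) ?s (?groups + ?mark) ?Q"
    proof (rule ensures_Seq[where Tb = ?mark])
      fix s2 assume groups: "groups_marked nb ?s (n * n) s2" and fr2: "frame_of mark_groups ?s s2"
      have all: "marks (arr s2 amark) = hits" if "var s2 vok \<noteq> 0"
        using groups that marked hits_subset[of "marks (arr s2 amark)"] unfolding groups_marked_def by (simp add: subset_antisym) blast
      have "params s2" by (rule params_frame[OF params fr2]) (auto simp: mark_group_defs)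
      then show "ensures search s2 ?mark ?Q"
        by (rule ensures_weaken[OF search_correct])
          (use groups all same in \<open>auto simp: groups_marked_def unused_slots_def frame_def search_defs\<close>)
    qed simp
    then show ?thesis using word_bounds by simp
  qed
  then have "ensures ((clear_marks ;; mark_boundaries) ;; vok ::= N 1 ;; mark_groups ;; search) s (attempt_ticks n q) ?Q"
    by (intro ensures_Seq[OF boundaries]) (auto simp: attempt_ticks_def)
  then show ?thesis by (simp add: attempt_def)
qed

end

section \<open>One step of repeated squaring\<close>

abbreviation (input) "vsteps \<equiv> 10 :: nat"
abbreviation (input) "vslack \<equiv> 12 :: nat"
abbreviation (input) "vincr \<equiv> 27 :: nat"
abbreviation (input) "vt \<equiv> 50 :: nat"
abbreviation (input) "adist \<equiv> 3 :: nat"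
abbreviation (input) "anew \<equiv> 4 :: nat"
abbreviation (input) "aincr \<equiv> 24 :: nat"
abbreviation (input) "ashift \<equiv> 25 :: nat"

definition attempt_params :: com where
  "attempt_params = vblocks ::= V vn \<oslash> V vq \<oplus> N 1 ;; vgroup_size ::= V vn \<otimes> V vq ;; vrow_blocks ::= V vn \<otimes> V vblocks ;;
     vbudget ::= V vn \<otimes> V vq \<otimes> V vq"

text \<open>The time for a matrix product is not known in advance, so the budget \<open>n q\<^sup>2\<close> is increased until it suffices.\<close>

definition dominance_product :: com where
  "dominance_product = vok ::= N 0 ;;
     WHILE V vok \<prec> N 1 DO ((attempt_params ;; attempt) ;; IF V vok \<prec> N 1 THEN vq ::= V vq \<oplus> V vq ELSE SKIP)"

definition copy_matrix :: "bool \<Rightarrow> nat \<Rightarrow> nat \<Rightarrow> com" where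
  "copy_matrix tr a b = FOR vi \<prec> vn DO FOR vj \<prec> vn DO a\<langle>V vi, V vj\<rangle> \<leftarrow> (if tr then b\<langle>V vj, V vi\<rangle> else b\<langle>V vi, V vj\<rangle>)"

definition combine :: "bool \<Rightarrow> com" where
  "combine tr = FOR vi \<prec> vn DO FOR vj \<prec> vn DO
     (vmin ::= (if tr then aresult\<langle>V vj, V vi\<rangle> else aresult\<langle>V vi, V vj\<rangle>) \<oplus> V vincr ;;
      IF V vmin \<prec> anew\<langle>V vi, V vj\<rangle> THEN anew\<langle>V vi, V vj\<rangle> \<leftarrow> V vmin ELSE SKIP)"

definition relax_step :: "bool \<Rightarrow> com" where
  "relax_step tr = vshift ::= ashift\<langle>N 0, V vt \<oplus> N 1\<rangle> ;; vincr ::= aincr\<langle>N 0, V vt \<oplus> N 1\<rangle> \<oplus> V vslack ;; dominance_product ;; combine tr"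

definition half_square :: "bool \<Rightarrow> com" where
  "half_square tr = (copy_matrix tr aQ adist ;; sort_entries ;; rank_entries) ;; FOR vt \<prec> vsteps DO relax_step tr"

definition square :: com where
  "square = copy_matrix False anew adist ;; half_square False ;; half_square True ;; copy_matrix False adist anew"

text \<open>Numbers instead of names, because several names share a variable.\<close>

lemma assigned_copy_matrix [simp]: "assigned (copy_matrix tr a b) = {30, 31}" "written (copy_matrix tr a b) = {a}"
  and assigned_combine [simp]: "assigned (combine tr) = {30, 31, 41}" "written (combine tr) = {anew}"
  by (auto simp: copy_matrix_def combine_def)

lemma assigned_sort_entries [simp]: "assigned sort_entries = {23, 24, 30, 31, 32, 33, 34, 35}" "written sort_entries = {6, 7, 8}"
  and assigned_rank_entries [simp]: "assigned rank_entries = {30, 31, 32, 33, 34, 35}" "written rank_entries = {9, 10, 11, 12, 13, 14}"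
  by (auto simp: sort_defs rank_entries_def rank_clear_def rank_entry_def)

lemma assigned_attempt [simp]: "assigned attempt = {6, 8, 18, 21, 22, 30, 31, 32, 33} \<union> {36, 37, 38, 39, 40, 41, 42, 43, 44}"
    "written attempt = {2, 15, 16, 17, 18, 19, 20, 21, 22}"
  by (simp_all add: attempt_def clear_marks_def mark_boundaries_defs mark_group_defs search_defs) blast+

lemma assigned_dominance_product [simp]:
  "assigned dominance_product = {6, 7, 8, 15, 16, 18, 19, 20, 21, 22, 30, 31, 32, 33} \<union> {36, 37, 38, 39, 40, 41, 42, 43, 44}"
  "written dominance_product = {2, 15, 16, 17, 18, 19, 20, 21, 22}"
  unfolding dominance_product_def attempt_params_def by (simp_all, blast)

lemma assigned_half_square [simp]:
  "assigned (half_square tr) = {6, 7, 8, 15, 16, 17, 18, 19, 20, 21, 22, 23, 24, 27, 30, 31, 32, 33, 34, 35} \<union> {36, 37, 38, 39, 40, 41, 42, 43, 44, 50}"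
  "written (half_square tr) = {2, 4, 5, 6, 7, 8, 9, 10, 11, 12, 13, 14, 15, 16, 17, 18, 19, 20, 21, 22}"
  by (auto simp: half_square_def relax_step_def)

lemma assigned_square [simp]: "assigned square = assigned (half_square True)" "written square = insert adist (written (half_square True))"
  by (auto simp: square_def)

subsection \<open>Candidates\<close>

lemma is_least_Un: "is_least S x \<Longrightarrow> is_least T y \<Longrightarrow> is_least (S \<union> T) (min x y)"
  by (auto simp: is_least_def min_def intro: order_trans)

lemma is_least_insert_trans: "is_least S x \<Longrightarrow> is_least (insert x T) y \<Longrightarrow> is_least (S \<union> T) y"
  by (auto simp: is_least_def intro: order_trans)

lemma is_least_image_add: "is_least S x \<Longrightarrow> is_least ((\<lambda>y. y + a) ` S) (x + a)"
  by (auto simp: is_least_def)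

lemma is_least_remove: "is_least (insert y S) x \<Longrightarrow> z \<in> S \<Longrightarrow> z \<le> y \<Longrightarrow> is_least S x"
  by (auto simp: is_least_def)

text \<open>\<open>tr\<close> tells which summand of \<open>D i k + D k j\<close> is assumed to be the larger one.\<close>

definition smaller :: "bool \<Rightarrow> matrix \<Rightarrow> nat \<Rightarrow> nat \<Rightarrow> nat \<Rightarrow> nat" where
  "smaller tr D i j k = (if tr then D i k else D k j)"

definition larger :: "bool \<Rightarrow> matrix \<Rightarrow> nat \<Rightarrow> nat \<Rightarrow> nat \<Rightarrow> nat" where
  "larger tr D i j k = (if tr then D k j else D i k)"

definition dominant :: "bool \<Rightarrow> matrix \<Rightarrow> nat \<Rightarrow> nat \<Rightarrow> nat \<Rightarrow> nat \<Rightarrow> nat set" where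
  "dominant tr D n l i j = {larger tr D i j k |k. k < n \<and> smaller tr D i j k + l \<le> larger tr D i j k}"

definition candidates :: "bool \<Rightarrow> matrix \<Rightarrow> nat \<Rightarrow> (nat \<Rightarrow> nat) \<Rightarrow> (nat \<Rightarrow> nat) \<Rightarrow> nat \<Rightarrow> nat \<Rightarrow> nat \<Rightarrow> nat set" where
  "candidates tr D n shift incr T i j = (\<Union>t<T. (\<lambda>x. x + incr (Suc t)) ` dominant tr D n (shift (Suc t)) i j)"

lemma candidates_0 [simp]: "candidates tr D n shift incr 0 i j = {}"
  and candidates_Suc: "candidates tr D n shift incr (Suc T) i j =
    candidates tr D n shift incr T i j \<union> (\<lambda>x. x + incr (Suc T)) ` dominant tr D n (shift (Suc T)) i j"
  by (auto simp: candidates_def lessThan_Suc)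

lemma is_least_candidates_Suc:
  assumes "is_least (insert x (candidates tr D n shift incr T i j)) y" "is_least (insert R (dominant tr D n (shift (Suc T)) i j)) z" "x \<le> R"
  shows "is_least (insert x (candidates tr D n shift incr (Suc T) i j)) (min y (z + incr (Suc T)))"
proof -
  let ?S = "insert x (candidates tr D n shift incr (Suc T) i j)"
  have "is_least (insert x (candidates tr D n shift incr T i j) \<union> (\<lambda>y. y + incr (Suc T)) ` insert R (dominant tr D n (shift (Suc T)) i j))
      (min y (z + incr (Suc T)))" by (intro is_least_Un is_least_image_add assms)
  then have "is_least (insert (R + incr (Suc T)) ?S) (min y (z + incr (Suc T)))"
    by (simp add: candidates_Suc insert_commute)
  then show ?thesis by (rule is_least_remove[where z = x]) (use assms(3) in auto)
qed

lemma dominant_eq: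
  assumes "\<And>i j. i < n \<Longrightarrow> j < n \<Longrightarrow> Q i j = (if tr then D j i else D i j)" "i < n" "j < n"
  shows "dominant tr D n l i j =
    {Q (if tr then j else i) k |k. k < n \<and> Q k (if tr then i else j) + l \<le> Q (if tr then j else i) k}"
proof -
  have "smaller tr D i j k = Q k (if tr then i else j) \<and> larger tr D i j k = Q (if tr then j else i) k" if "k < n" for k
    using assms that by (auto simp: smaller_def larger_def)
  then show ?thesis unfolding dominant_def by (intro Collect_cong ex_cong1) auto
qed

definition squared :: "nat \<Rightarrow> matrix \<Rightarrow> (nat \<Rightarrow> nat) \<Rightarrow> (nat \<Rightarrow> nat) \<Rightarrow> nat \<Rightarrow> matrix \<Rightarrow> bool" where
  "squared n D shift incr T D' \<longleftrightarrow> (\<forall>i<n. \<forall>j<n.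
     is_least (insert (D i j) (candidates False D n shift incr T i j \<union> candidates True D n shift incr T i j)) (D' i j))"

subsection \<open>Correctness\<close>

locale squaring = ram_matrix w P W R ws n for w P W R ws n +
  fixes Lq F AT :: nat
  assumes Lq_less_R: "16 * Lq < R" and Lq_le: "Lq \<le> 4 ^ F"
    and attempt_le: "\<And>q. 1 \<le> q \<Longrightarrow> n \<le> q * q \<Longrightarrow> n * q * q \<le> 4 * Lq \<Longrightarrow> attempt_ticks n q \<le> AT"
    and multiplies: "multiplies_bits P ws (3 * n) Lq"
begin

definition ready :: "store \<Rightarrow> bool" where
  "ready s \<longleftrightarrow> var s vn = n \<and> var s vnn = n * n \<and> var s vinf = R \<and> var s vdim = 3 * n \<and> var s vws = ws \<and>
     1 \<le> var s vq \<and> n \<le> var s vq * var s vq \<and> n * var s vq * var s vq \<le> 4 * Lq \<and> unused_slots (var s vslot) s"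

lemma ready_frame: "ready s \<Longrightarrow> frame X A s s' \<Longrightarrow> X \<inter> {vn, vws, vinf, vdim, vslot, vnn, vq} = {} \<Longrightarrow> A \<inter> {aguest} = {} \<Longrightarrow> ready s'"
  unfolding ready_def frame_def unused_slots_def by auto

definition has_ranks :: "store \<Rightarrow> bool" where
  "has_ranks s \<longleftrightarrow> ranked n (arr s aQ) (arr s aord 0) (arr s arow_pos) (arr s arow_at) (arr s acol_pos) (arr s acol_at) \<and>
     (\<forall>i<n. \<forall>k<n. arr s aQ i k \<le> R)"

lemma has_ranks_frame: "has_ranks s \<Longrightarrow> frame X A s s' \<Longrightarrow> A \<inter> {aQ, aord, arow_at, acol_at, arow_pos, acol_pos} = {} \<Longrightarrow> has_ranks s'"
  unfolding has_ranks_def frame_def by auto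

lemma attempt_with_params_correct:
  assumes s: "ready s" "has_ranks s" "var s vshift \<le> R" "var s vslot + n + 1 \<le> R" and q: "var s vq = q"
  shows "ensures (attempt_params ;; attempt) s AT (\<lambda>s'. var s' vslot \<le> var s vslot + n + 1 \<and> unused_slots (var s' vslot) s' \<and>
    var s' vok \<le> 1 \<and> (Lq \<le> n * q * q \<longrightarrow> var s' vok = 1) \<and>
    (var s' vok \<noteq> 0 \<longrightarrow> dominance_solution R n (var s vshift) (arr s aQ) (arr s' aresult)))" (is "ensures _ _ _ ?Q")
proof -
  have q_ok: "1 \<le> q" "n \<le> q * q" "n * q * q \<le> 4 * Lq" using s(1) q by (auto simp: ready_def)
  interpret dominance w P W R ws n q "var s vshift" Lq "arr s aQ" "arr s aord 0" "arr s arow_pos" "arr s arow_at" "arr s acol_pos" "arr s acol_at"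
    by unfold_locales (use s q_ok Lq_less_R multiplies in \<open>auto simp: has_ranks_def\<close>)
  let ?s = "s\<lparr>var := (var s)(vblocks := nb, vgroup_size := n * q, vrow_blocks := n * nb, vbudget := n * q * q)\<rparr>"
  have "params ?s" using s(1) q by (auto simp: params_def ready_def)
  moreover have nb: "nb \<le> n + 1" by (simp add: num_blocks_def)
  ultimately have "ensures attempt ?s AT ?Q"
    by (intro ensures_weaken[OF attempt_correct attempt_le[OF q_ok]]) (use s nb in \<open>auto simp: ready_def unused_slots_def\<close>)
  then show ?thesis using s(1) q q_ok nb_bounds q_bounds word_bounds unfolding attempt_params_def
    by (simp add: ready_def num_blocks_def)
qed

definition slots :: nat where
  "slots = Suc F * (n + 1)"

definition doubling_state :: "store \<Rightarrow> nat \<Rightarrow> store \<Rightarrow> bool" where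
  "doubling_state s f s' \<longleftrightarrow> ready s' \<and> f \<le> Suc F \<and> var s' vslot + f * (n + 1) \<le> var s vslot + slots \<and>
     (if var s' vok = 0 then 0 < f \<and> Lq \<le> n * var s' vq * var s' vq * 4 ^ (f - 1)
      else var s' vok = 1 \<and> dominance_solution R n (var s vshift) (arr s aQ) (arr s' aresult))"

lemma doubling_state_double:
  assumes "ready s'" "f \<le> F" "var s' vslot + f * (n + 1) \<le> var s vslot + slots" "var s' vok = 0"
    and q: "var s' vq = q" "\<not> Lq \<le> n * q * q" "Lq \<le> n * q * q * 4 ^ f"
  shows "doubling_state s f (s'\<lparr>var := (var s')(vq := q + q)\<rparr>)" "q + q < W"
proof -
  have four: "n * (q + q) * (q + q) = 4 * (n * q * q)" by (simp add: algebra_simps)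
  have "q * q \<le> (q + q) * (q + q)" by (intro mult_le_mono) auto
  then have "n \<le> (q + q) * (q + q)" using assms(1) q(1) by (auto simp: ready_def)
  moreover have "n * (q + q) * (q + q) \<le> 4 * Lq" unfolding four using q(2) by linarith
  ultimately have "ready (s'\<lparr>var := (var s')(vq := q + q)\<rparr>)" using assms(1) q(1) by (simp add: ready_def unused_slots_def)
  moreover have "0 < f" using q(2,3) by (cases f) auto
  moreover from this have "Lq \<le> n * (q + q) * (q + q) * 4 ^ (f - 1)" using q(3) unfolding four by (cases f) auto
  ultimately show "doubling_state s f (s'\<lparr>var := (var s')(vq := q + q)\<rparr>)" using assms by (simp add: doubling_state_def)
  have "1 * q * 1 \<le> n * q * q" using n_ge_1 assms(1) q(1) by (intro mult_le_mono) (auto simp: ready_def)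
  then show "q + q < W" using q(2) Lq_less_R word_bounds by linarith
qed

lemma dominance_product_correct:
  assumes s: "ready s" "has_ranks s" "var s vshift \<le> R" "var s vslot + slots \<le> R"
  shows "ensures dominance_product s (Suc F * Suc AT) (\<lambda>s'. ready s' \<and> var s' vslot \<le> var s vslot + slots \<and>
    dominance_solution R n (var s vshift) (arr s aQ) (arr s' aresult))"
proof -
  let ?s = "s\<lparr>var := (var s)(vok := 0)\<rparr>"
  let ?body = "(attempt_params ;; attempt) ;; IF V vok \<prec> N 1 THEN vq ::= V vq \<oplus> V vq ELSE SKIP"
  have "1 \<le> n * var s vq * var s vq" using s(1) n_ge_1 by (simp add: ready_def)
  then have "Lq \<le> n * var s vq * var s vq * 4 ^ F" using Lq_le mult_le_mono1 by (metis mult_1 order_trans)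
  then have init: "doubling_state s (Suc F) ?s" using s(1) by (simp add: doubling_state_def ready_def unused_slots_def slots_def)
  have "ensures (WHILE V vok \<prec> N 1 DO ?body) ?s (Suc F * Suc AT) (\<lambda>s'. ready s' \<and> var s' vslot \<le> var s vslot + slots \<and>
    dominance_solution R n (var s vshift) (arr s aQ) (arr s' aresult))"
  proof (rule ensures_While[where I = "doubling_state s" and F = "Suc F" and b = AT], goal_cases init guard step exit time)
    case (step f s1)
    then obtain g where f: "f = Suc g" and inv: "ready s1" "g \<le> F" "var s1 vslot + Suc g * (n + 1) \<le> var s vslot + slots"
      "Lq \<le> n * var s1 vq * var s1 vq * 4 ^ g" by (cases f) (auto simp: doubling_state_def)
    have same: "var s1 vshift = var s vshift" "arr s1 aQ = arr s aQ" using step(2) by (auto simp: frame_def attempt_params_def)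
    have "has_ranks ?s" using s(2) by (simp add: has_ranks_def)
    then have "has_ranks s1" by (rule has_ranks_frame[OF _ step(2)]) (auto simp: attempt_params_def)
    then have attempt: "ensures (attempt_params ;; attempt) s1 AT (\<lambda>s'. var s' vslot \<le> var s1 vslot + n + 1 \<and> unused_slots (var s' vslot) s' \<and>
        var s' vok \<le> 1 \<and> (Lq \<le> n * var s1 vq * var s1 vq \<longrightarrow> var s' vok = 1) \<and>
        (var s' vok \<noteq> 0 \<longrightarrow> dominance_solution R n (var s1 vshift) (arr s1 aQ) (arr s' aresult)))"
      using inv s(3,4) same by (intro attempt_with_params_correct) auto
    show ?case
    proof (rule ensures_Seq[OF attempt, where Tb = 0])
      fix s2 assume post: "var s2 vslot \<le> var s1 vslot + n + 1 \<and> unused_slots (var s2 vslot) s2 \<and>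
        var s2 vok \<le> 1 \<and> (Lq \<le> n * var s1 vq * var s1 vq \<longrightarrow> var s2 vok = 1) \<and>
        (var s2 vok \<noteq> 0 \<longrightarrow> dominance_solution R n (var s1 vshift) (arr s1 aQ) (arr s2 aresult))"
        and fr: "frame_of (attempt_params ;; attempt) s1 s2"
      have q: "var s2 vq = var s1 vq" using fr by (auto simp: frame_def attempt_params_def)
      have ready: "ready s2" using inv(1) fr post by (auto simp: ready_def frame_def attempt_params_def)
      have slot: "var s2 vslot + g * (n + 1) \<le> var s vslot + slots" using post inv(3) by simp
      show "ensures (IF V vok \<prec> N 1 THEN vq ::= V vq \<oplus> V vq ELSE SKIP) s2 0 (\<lambda>s3. \<exists>f'<f. doubling_state s f' s3)"
      proof (cases "var s2 vok = 0")
        case True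
        then have "\<not> Lq \<le> n * var s1 vq * var s1 vq" using post by auto
        from doubling_state_double[OF ready inv(2) slot True q this inv(4)] show ?thesis using True f q word_bounds by auto
      next
        case False
        then have "doubling_state s g s2" using post ready slot inv(2) same by (simp add: doubling_state_def)
        then show ?thesis using False f word_bounds by auto
      qed
    qed simp
  qed (use init word_bounds in \<open>auto simp: doubling_state_def split: if_splits\<close>)
  then show ?thesis unfolding dominance_product_def using word_bounds by simp
qed

lemma copy_matrix_correct:
  assumes "var s vn = n" "a \<noteq> b" "a < 1000" "b < 1000"
  shows "ensures (copy_matrix tr a b) s (n * (n + 1)) (\<lambda>s'. \<forall>i<n. \<forall>j<n. arr s' a i j = (if tr then arr s b j i else arr s b i j))"
  unfolding copy_matrix_def
proof (rule ensures_For_For_cells[where m = n and l = n and b = 0 and cell = "\<lambda>i j A. A a i j = (if tr then arr s b j i else arr s b i j)"],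
    goal_cases vars step exit time)
  case (step i j s1)
  have "arr s1 b = arr s b" using step(5) assms(2) by (auto simp: frame_def)
  then show ?case using step(1-4) assms dim_bounds by (auto split: if_splits)
qed (use assms dim_bounds in auto)

lemma combine_correct:
  assumes s: "var s vn = n" "var s vincr = d" "d \<le> R" and le: "\<And>i j. i < n \<Longrightarrow> j < n \<Longrightarrow> arr s aresult i j \<le> R"
  shows "ensures (combine tr) s (n * (n + 1)) (\<lambda>s'. \<forall>i<n. \<forall>j<n. arr s' anew i j =
    min (arr s anew i j) (arr s aresult (if tr then j else i) (if tr then i else j) + d))"
  unfolding combine_def
proof (rule ensures_For_For[where m = n and l = n and b = 0 and I = "\<lambda>i j A. \<forall>i'<n. \<forall>j'<n. A anew i' j' = (if i' < i \<or> i' = i \<and> j' < j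
    then min (arr s anew i' j') (arr s aresult (if tr then j' else i') (if tr then i' else j') + d) else arr s anew i' j')"],
    goal_cases vars init row step exit time)
  case (step i j s1)
  have same: "arr s1 aresult = arr s aresult" "var s1 vincr = d" using step(6) s by (auto simp: frame_def)
  have "arr s aresult (if tr then j else i) (if tr then i else j) + d < W"
    using le[of "if tr then j else i" "if tr then i else j"] step(1,2) s(3) word_bounds by auto
  moreover have "arr s1 anew i j = arr s anew i j" using step(1,2,5) by simp
  ultimately show ?case using step same dim_bounds by (cases tr) (auto simp: less_Suc_eq min_def)
qed (use s dim_bounds in \<open>auto simp: less_Suc_eq\<close>)

definition tables_ok :: "nat \<Rightarrow> store \<Rightarrow> bool" where
  "tables_ok U s \<longleftrightarrow> var s vsteps = U \<and> U < R \<and> (\<forall>t\<le>U. arr s ashift 0 t \<le> R \<and> arr s aincr 0 t + var s vslack \<le> R)"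

definition dominance_ticks :: nat where
  "dominance_ticks = Suc F * Suc AT"

definition half_square_ticks :: "nat \<Rightarrow> nat \<Rightarrow> nat" where
  "half_square_ticks G U = n * (n + 1) + (n * n + Suc G * Suc (2 * (n * n))) + (n + n * n) + U * Suc (dominance_ticks + n * (n + 1))"

definition relaxed :: "bool \<Rightarrow> matrix \<Rightarrow> matrix \<Rightarrow> nat \<Rightarrow> store \<Rightarrow> matrix \<Rightarrow> bool" where
  "relaxed tr D X T s D' \<longleftrightarrow> (\<forall>i<n. \<forall>j<n.
     is_least (insert (X i j) (candidates tr D n (arr s ashift 0) (\<lambda>t. arr s aincr 0 t + var s vslack) T i j)) (D' i j))"

lemma relaxed_cong: "arr s ashift = arr s' ashift \<Longrightarrow> arr s aincr = arr s' aincr \<Longrightarrow> var s vslack = var s' vslack \<Longrightarrow>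
    relaxed tr D X T s D' = relaxed tr D X T s' D'"
  by (simp add: relaxed_def)

lemma relax_step_correct:
  assumes s: "ready s" "has_ranks s" "tables_ok U s" "var s vt = t" "t < U" "var s vslot + slots \<le> R"
    and Q: "\<And>i j. i < n \<Longrightarrow> j < n \<Longrightarrow> arr s aQ i j = (if tr then D j i else D i j)" and X: "\<And>i j. i < n \<Longrightarrow> j < n \<Longrightarrow> X i j \<le> R"
    and new: "relaxed tr D X t s (arr s anew)"
  shows "ensures (relax_step tr) s (dominance_ticks + n * (n + 1)) (\<lambda>s'. ready s' \<and> var s' vslot \<le> var s vslot + slots \<and>
    relaxed tr D X (Suc t) s (arr s' anew))" (is "ensures _ _ _ ?Q")
proof -
  let ?l = "arr s ashift 0 (Suc t)" and ?d = "arr s aincr 0 (Suc t) + var s vslack"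
  let ?s = "s\<lparr>var := (var s)(vshift := ?l, vincr := ?d)\<rparr>"
  have le: "?l \<le> R" "?d \<le> R" "Suc t < R" using s(3,5) by (auto simp: tables_ok_def)
  have "ensures dominance_product ?s (Suc F * Suc AT) (\<lambda>s'. ready s' \<and> var s' vslot \<le> var ?s vslot + slots \<and>
      dominance_solution R n (var ?s vshift) (arr ?s aQ) (arr s' aresult))"
    by (rule dominance_product_correct) (use s(1,2,6) le(1) in \<open>auto simp: ready_def has_ranks_def unused_slots_def\<close>)
  then have "ensures (dominance_product ;; combine tr) ?s (dominance_ticks + n * (n + 1)) ?Q"
  proof (rule ensures_Seq[where Tb = "n * (n + 1)"])
    fix s1 assume dom: "ready s1 \<and> var s1 vslot \<le> var ?s vslot + slots \<and>
        dominance_solution R n (var ?s vshift) (arr ?s aQ) (arr s1 aresult)"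
      and fr: "frame_of dominance_product ?s s1"
    have same: "var s1 vincr = ?d" "arr s1 anew = arr s anew" using fr by (auto simp: frame_def)
    have dominant: "is_least (insert R (dominant tr D n ?l i j)) (arr s1 aresult (if tr then j else i) (if tr then i else j))" if "i < n" "j < n" for i j
    proof -
      have "dominant tr D n ?l i j = {arr s aQ (if tr then j else i) k |k. k < n \<and> arr s aQ k (if tr then i else j) + ?l \<le> arr s aQ (if tr then j else i) k}"
        using Q that by (rule dominant_eq)
      then show ?thesis using dom that unfolding least_dominating_def by simp
    qed
    have "arr s1 aresult i j \<le> R" if "i < n" "j < n" for i j
      using dom that by (simp add: least_dominating_def is_least_def)
    then have "ensures (combine tr) s1 (n * (n + 1)) (\<lambda>s'. \<forall>i<n. \<forall>j<n. arr s' anew i j =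
        min (arr s1 anew i j) (arr s1 aresult (if tr then j else i) (if tr then i else j) + ?d))"
      using dom same le(2) by (intro combine_correct) (auto simp: ready_def)
    then show "ensures (combine tr) s1 (n * (n + 1)) ?Q"
    proof (rule ensures_weaken)
      fix s2 assume min: "\<forall>i<n. \<forall>j<n. arr s2 anew i j = min (arr s1 anew i j) (arr s1 aresult (if tr then j else i) (if tr then i else j) + ?d)"
        and fr2: "frame_of (combine tr) s1 s2"
      have "ready s2" by (rule ready_frame[OF _ fr2]) (use dom in auto)
      moreover have "var s2 vslot \<le> var s vslot + slots" using fr2 dom by (auto simp: frame_def)
      ultimately show "?Q s2" using min same is_least_candidates_Suc[OF new[unfolded relaxed_def, rule_format] dominant X] by (simp add: relaxed_def)
    qed simp
  qed (simp add: dominance_ticks_def)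
  then show ?thesis using s(4) le word_bounds unfolding relax_step_def by simp
qed

lemma rank_copy_correct:
  assumes s: "ready s" and D: "\<And>i j. i < n \<Longrightarrow> j < n \<Longrightarrow> arr s adist i j \<le> R" and G: "n * n \<le> 2 ^ G"
  shows "ensures (copy_matrix tr aQ adist ;; sort_entries ;; rank_entries) s (n * (n + 1) + (n * n + Suc G * Suc (2 * (n * n))) + (n + n * n))
    (\<lambda>s'. ready s' \<and> has_ranks s' \<and> (\<forall>i<n. \<forall>j<n. arr s' aQ i j = (if tr then arr s adist j i else arr s adist i j)))" (is "ensures _ _ _ ?Q")
proof -
  let ?sort = "n * n + Suc G * Suc (2 * (n * n))" and ?rank = "n + n * n"
  have n: "var s' vn = n" "var s' vnn = n * n" if "ready s'" for s' using that by (simp_all add: ready_def)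
  have small: "4 * (n * n) < R" using n_less_R by linarith
  show ?thesis
  proof (rule ensures_Seq[OF copy_matrix_correct[OF n(1)[OF s]], where Tb = "?sort + ?rank"])
    fix s1 assume copy: "\<forall>i<n. \<forall>j<n. arr s1 aQ i j = (if tr then arr s adist j i else arr s adist i j)"
      and fr1: "frame_of (copy_matrix tr aQ adist) s s1"
    have ready1: "ready s1" by (rule ready_frame[OF s fr1]) auto
    show "ensures (sort_entries ;; rank_entries) s1 (?sort + ?rank) ?Q"
    proof (rule ensures_Seq[OF sort_entries_correct[OF n[OF ready1] small G], where Tb = ?rank])
      fix s2 assume sorts: "sorts_entries n (arr s1 aQ) (arr s2 aord 0)" and fr2: "frame_of sort_entries s1 s2"
      have ready2: "ready s2" by (rule ready_frame[OF ready1 fr2]) auto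
      have Q2: "arr s2 aQ = arr s1 aQ" using fr2 by (auto simp: frame_def)
      show "ensures rank_entries s2 ?rank ?Q"
      proof (rule ensures_weaken[OF rank_entries_correct[OF n[OF ready2] small]])
        fix s3 assume ranked: "ranked n (arr s2 aQ) (arr s2 aord 0) (arr s3 arow_pos) (arr s3 arow_at) (arr s3 acol_pos) (arr s3 acol_at)"
          and fr3: "frame_of rank_entries s2 s3"
        have "ready s3" by (rule ready_frame[OF ready2 fr3]) auto
        moreover have "arr s3 aQ = arr s1 aQ" "arr s3 aord = arr s2 aord" using fr3 Q2 by (auto simp: frame_def)
        ultimately show "?Q s3" using ranked copy D Q2 by (simp add: has_ranks_def)
      qed (use sorts Q2 in auto)
    qed simp
  qed auto
qed

lemma half_square_correct:
  assumes s: "ready s" "tables_ok U s" "var s vslot + U * slots \<le> R" and G: "n * n \<le> 2 ^ G"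
    and D: "\<And>i j. i < n \<Longrightarrow> j < n \<Longrightarrow> arr s adist i j \<le> R" and X: "\<And>i j. i < n \<Longrightarrow> j < n \<Longrightarrow> arr s anew i j \<le> R"
  shows "ensures (half_square tr) s (half_square_ticks G U) (\<lambda>s'. ready s' \<and> var s' vslot \<le> var s vslot + U * slots \<and>
    relaxed tr (arr s adist) (arr s anew) U s (arr s' anew))" (is "ensures _ _ _ ?Q")
proof -
  let ?copy = "copy_matrix tr aQ adist ;; sort_entries ;; rank_entries"
  let ?relaxed = "relaxed tr (arr s adist) (arr s anew)"
  show ?thesis unfolding half_square_def
  proof (rule ensures_Seq[OF rank_copy_correct[OF s(1) D G], where Tb = "U * Suc (dominance_ticks + n * (n + 1))"])
    fix s1 assume copy: "ready s1 \<and> has_ranks s1 \<and> (\<forall>i<n. \<forall>j<n. arr s1 aQ i j = (if tr then arr s adist j i else arr s adist i j))"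
      and fr1: "frame_of ?copy s s1"
    have same1: "arr s1 ashift = arr s ashift" "arr s1 aincr = arr s aincr" "arr s1 anew = arr s anew" "var s1 vslack = var s vslack"
      "var s1 vslot = var s vslot" "var s1 vsteps = U" using fr1 s(2) by (auto simp: frame_def tables_ok_def)
    show "ensures (FOR vt \<prec> vsteps DO relax_step tr) s1 (U * Suc (dominance_ticks + n * (n + 1))) ?Q"
    proof (rule ensures_For[where m = U and b = "dominance_ticks + n * (n + 1)" and
          I = "\<lambda>t s'. ready s' \<and> var s' vslot \<le> var s vslot + t * slots \<and> ?relaxed t s (arr s' anew)"], goal_cases vars init step exit time)
      case (step t s2)
      have same2: "arr s2 ashift = arr s ashift" "arr s2 aincr = arr s aincr" "var s2 vslack = var s vslack" "var s2 vsteps = U" "arr s2 aQ = arr s1 aQ"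
        using step(4) same1 by (auto simp: frame_def relax_step_def)
      note cong = relaxed_cong[OF same2(1-3)]
      have "has_ranks s2" by (rule has_ranks_frame[OF _ step(4)]) (use copy in \<open>auto simp: relax_step_def\<close>)
      moreover have "Suc t * slots \<le> U * slots" using step(1) by (intro mult_le_mono1) simp
      ultimately have "ensures (relax_step tr) s2 (dominance_ticks + n * (n + 1)) (\<lambda>s'. ready s' \<and> var s' vslot \<le> var s2 vslot + slots \<and>
          ?relaxed (Suc t) s2 (arr s' anew))"
        using step(1-3) s copy X same2 by (intro relax_step_correct) (auto simp: tables_ok_def cong)
      then show ?case
        by (rule ensures_weaken) (use step(3) in \<open>auto simp: ready_def unused_slots_def cong\<close>)
    qed (use copy same1 s word_bounds in \<open>auto simp: tables_ok_def relaxed_def is_least_def ready_def unused_slots_def relax_step_def\<close>)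
  next
    show "n * (n + 1) + (n * n + Suc G * Suc (2 * (n * n))) + (n + n * n) + U * Suc (dominance_ticks + n * (n + 1)) \<le> half_square_ticks G U"
      unfolding half_square_ticks_def by (rule order_refl)
  qed
qed

lemma relaxed_twice:
  assumes "relaxed False D D U s A" "relaxed True D A U s B"
  shows "squared n D (arr s ashift 0) (\<lambda>t. arr s aincr 0 t + var s vslack) U B"
  unfolding squared_def
proof (intro allI impI)
  fix i j assume "i < n" "j < n"
  with is_least_insert_trans[OF assms(1)[unfolded relaxed_def, rule_format] assms(2)[unfolded relaxed_def, rule_format]]
  show "is_least (insert (D i j) (candidates False D n (arr s ashift 0) (\<lambda>t. arr s aincr 0 t + var s vslack) U i j \<union>
    candidates True D n (arr s ashift 0) (\<lambda>t. arr s aincr 0 t + var s vslack) U i j)) (B i j)" by simp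
qed

lemma square_correct:
  assumes s: "ready s" "tables_ok U s" "var s vslot + 2 * (U * slots) \<le> R" and G: "n * n \<le> 2 ^ G"
    and D: "\<And>i j. i < n \<Longrightarrow> j < n \<Longrightarrow> arr s adist i j \<le> R"
  shows "ensures square s (2 * (n * (n + 1)) + 2 * half_square_ticks G U) (\<lambda>s'. ready s' \<and> var s' vslot \<le> var s vslot + 2 * (U * slots) \<and>
    squared n (arr s adist) (arr s ashift 0) (\<lambda>t. arr s aincr 0 t + var s vslack) U (arr s' adist))" (is "ensures _ _ _ ?Q")
proof -
  let ?D = "arr s adist"
  have n: "var s' vn = n" if "ready s'" for s' using that by (simp add: ready_def)
  show ?thesis unfolding square_def
  proof (rule ensures_Seq[OF copy_matrix_correct[OF n[OF s(1)]], where Tb = "n * (n + 1) + 2 * half_square_ticks G U"])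
    fix s1 assume copy: "\<forall>i<n. \<forall>j<n. arr s1 anew i j = (if False then ?D j i else ?D i j)"
      and fr1: "frame_of (copy_matrix False anew adist) s s1"
    have ready1: "ready s1" by (rule ready_frame[OF s(1) fr1]) auto
    have same1: "arr s1 adist = ?D" "arr s1 ashift = arr s ashift" "arr s1 aincr = arr s aincr" "var s1 vslack = var s vslack"
      "var s1 vslot = var s vslot" "var s1 vsteps = var s vsteps" using fr1 by (auto simp: frame_def)
    have half1: "ensures (half_square False) s1 (half_square_ticks G U) (\<lambda>s'. ready s' \<and> var s' vslot \<le> var s1 vslot + U * slots \<and>
        relaxed False (arr s1 adist) (arr s1 anew) U s1 (arr s' anew))"
      by (rule half_square_correct[OF ready1 _ _ G]) (use s(2,3) D copy same1 in \<open>auto simp: tables_ok_def\<close>)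
    show "ensures (half_square False ;; half_square True ;; copy_matrix False adist anew) s1 (n * (n + 1) + 2 * half_square_ticks G U) ?Q"
    proof (rule ensures_Seq[OF half1, where Tb = "n * (n + 1) + half_square_ticks G U"])
      fix s2 assume post2: "ready s2 \<and> var s2 vslot \<le> var s1 vslot + U * slots \<and> relaxed False (arr s1 adist) (arr s1 anew) U s1 (arr s2 anew)"
        and fr2: "frame_of (half_square False) s1 s2"
      have same2: "arr s2 adist = ?D" "arr s2 ashift = arr s ashift" "arr s2 aincr = arr s aincr" "var s2 vslack = var s vslack" "var s2 vsteps = var s vsteps"
        using fr2 same1 by (auto simp: frame_def)
      have relaxed1: "relaxed False ?D ?D U s (arr s2 anew)" using post2 copy same1 by (simp add: relaxed_def)
      have "arr s2 anew i j \<le> R" if "i < n" "j < n" for i j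
        using relaxed1 D[OF that] that by (force simp: relaxed_def is_least_def)
      then have half2: "ensures (half_square True) s2 (half_square_ticks G U) (\<lambda>s'. ready s' \<and> var s' vslot \<le> var s2 vslot + U * slots \<and>
          relaxed True (arr s2 adist) (arr s2 anew) U s2 (arr s' anew))"
        using post2 by (intro half_square_correct[OF _ _ _ G]) (use s(2,3) D same1 same2 in \<open>auto simp: tables_ok_def\<close>)
      show "ensures (half_square True ;; copy_matrix False adist anew) s2 (n * (n + 1) + half_square_ticks G U) ?Q"
      proof (rule ensures_Seq[OF half2, where Tb = "n * (n + 1)"])
        fix s3 assume post3: "ready s3 \<and> var s3 vslot \<le> var s2 vslot + U * slots \<and> relaxed True (arr s2 adist) (arr s2 anew) U s2 (arr s3 anew)"
        then have "relaxed True ?D (arr s2 anew) U s (arr s3 anew)" using relaxed_cong[OF same2(2-4)] same2(1) by simp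
        note squared = relaxed_twice[OF relaxed1 this]
        show "ensures (copy_matrix False adist anew) s3 (n * (n + 1)) ?Q"
        proof (rule ensures_weaken[OF copy_matrix_correct[OF n]])
          fix s4 assume "\<forall>i<n. \<forall>j<n. arr s4 adist i j = (if False then arr s3 anew j i else arr s3 anew i j)"
            and fr4: "frame_of (copy_matrix False adist anew) s3 s4"
          moreover have "ready s4" by (rule ready_frame[OF _ fr4]) (use post3 in auto)
          moreover have "var s4 vslot = var s3 vslot" using fr4 by (auto simp: frame_def)
          ultimately show "?Q s4" using squared post2 post3 same1 by (simp add: squared_def)
        qed (use post3 in auto)
      qed simp
    qed simp
  qed auto
qed

end

section \<open>The main program\<close>

abbreviation (input) "voctave \<equiv> 11 :: nat"
abbreviation (input) "vlevels \<equiv> 13 :: nat"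
abbreviation (input) "vpow \<equiv> 51 :: nat"
abbreviation (input) "vtarget \<equiv> 52 :: nat"
abbreviation (input) "vcount \<equiv> 53 :: nat"
abbreviation (input) "vsquare \<equiv> 54 :: nat"
abbreviation (input) "vdouble \<equiv> 55 :: nat"
abbreviation (input) "vunit \<equiv> 56 :: nat"
abbreviation (input) "vlevel \<equiv> 58 :: nat"
abbreviation (input) "vaddr \<equiv> 59 :: nat"
abbreviation (input) "vmant \<equiv> 60 :: nat"
abbreviation (input) "vexpo \<equiv> 61 :: nat"
abbreviation (input) "vcode \<equiv> 62 :: nat"
abbreviation (input) "vrest \<equiv> 63 :: nat"
abbreviation (input) "vu \<equiv> 64 :: nat"

subsection \<open>Tables of logarithms\<close>

definition doublings :: "nat \<Rightarrow> nat \<Rightarrow> nat" where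
  "doublings j h = (LEAST s. h \<le> j * 2 ^ s)"

lemma doublings_le: "h \<le> j * 2 ^ s \<Longrightarrow> doublings j h \<le> s"
  unfolding doublings_def by (rule Least_le)

lemma doublings_ge: "1 \<le> j \<Longrightarrow> h \<le> j * 2 ^ doublings j h"
proof -
  assume "1 \<le> j"
  have "h \<le> 1 * 2 ^ h" by simp
  also have "\<dots> \<le> j * 2 ^ h" using \<open>1 \<le> j\<close> by (intro mult_right_mono) auto
  finally show ?thesis unfolding doublings_def by (rule LeastI[of "\<lambda>s. h \<le> j * 2 ^ s"])
qed

lemma less_doublings: "s < doublings j h \<Longrightarrow> j * 2 ^ s < h"
  using doublings_le[of h j s] by (meson not_le)

lemma doublings_less_double: "j \<le> h \<Longrightarrow> 1 \<le> h \<Longrightarrow> j * 2 ^ doublings j h < 2 * h"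
  using less_doublings[of "doublings j h - 1" j h] by (cases "doublings j h") auto

lemma doublings_le_self: "1 \<le> j \<Longrightarrow> doublings j h \<le> h"
  by (rule doublings_le, rule order_trans[of _ "1 * 2 ^ h"]) (simp, rule mult_right_mono, auto)

text \<open>
  \<open>scaled_ln U u\<close> approximates \<open>U\<^sup>2 ln (1 + u / U)\<close>, so \<open>scaled_ln U U\<close> is the length of one octave;
  \<open>scaled_ln_ratio U j\<close> approximates \<open>U\<^sup>2 ln (U / j)\<close>.
\<close>

definition scaled_ln :: "nat \<Rightarrow> nat \<Rightarrow> nat" where
  "scaled_ln U u = (\<Sum>v<u. (U * U) div (U + v))"

definition scaled_ln_ratio :: "nat \<Rightarrow> nat \<Rightarrow> nat" where
  "scaled_ln_ratio U j = doublings j U * scaled_ln U U - scaled_ln U (j * 2 ^ doublings j U - U)"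

lemma scaled_ln_le: "scaled_ln U u \<le> u * U"
proof -
  have "(U * U) div (U + v) \<le> U" for v by (cases "U = 0") (auto intro: order_trans[OF div_le_mono2[of U "U + v" "U * U"]])
  then have "scaled_ln U u \<le> (\<Sum>v<u. U)" unfolding scaled_ln_def by (intro sum_mono)
  then show ?thesis by simp
qed

lemma scaled_ln_mono: "u \<le> u' \<Longrightarrow> scaled_ln U u \<le> scaled_ln U u'"
  unfolding scaled_ln_def by (intro sum_mono2) auto

lemma scaled_ln_ratio_le: "1 \<le> j \<Longrightarrow> scaled_ln_ratio U j \<le> U * (U * U)"
  using mult_le_mono[OF doublings_le_self[of j U] scaled_ln_le[of U U]] by (simp add: scaled_ln_ratio_def)

lemma scaled_ln_le_doublings:
  assumes "1 \<le> j" "j \<le> U"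
  shows "scaled_ln U (j * 2 ^ doublings j U - U) \<le> doublings j U * scaled_ln U U"
proof (cases "doublings j U")
  case 0
  then have "j * 2 ^ doublings j U - U = 0" using assms(2) by simp
  then show ?thesis by (simp add: scaled_ln_def)
next
  case (Suc s)
  have "scaled_ln U (j * 2 ^ doublings j U - U) \<le> scaled_ln U U"
    using doublings_less_double[of j U] assms by (intro scaled_ln_mono) auto
  then show ?thesis using Suc by simp
qed

definition doubling :: "nat \<Rightarrow> nat \<Rightarrow> nat \<Rightarrow> com" where
  "doubling x c h = c ::= N 0 ;; WHILE V x \<prec> V h DO (x ::= V x \<oplus> V x ;; c ::= V c \<oplus> N 1)"

lemma assigned_doubling [simp]: "assigned (doubling x c h) = {x, c}" "written (doubling x c h) = {}" "\<not> loop_free (doubling x c h)"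
  by (auto simp: doubling_def)

definition log_table :: com where
  "log_table = aincr\<langle>N 0, N 0\<rangle> \<leftarrow> N 0 ;; FOR vt \<prec> vsteps DO
     aincr\<langle>N 0, V vt \<oplus> N 1\<rangle> \<leftarrow> aincr\<langle>N 0, V vt\<rangle> \<oplus> V vsquare \<oslash> (V vsteps \<oplus> V vt)"

definition ratio_table :: com where
  "ratio_table = ashift\<langle>N 0, N 0\<rangle> \<leftarrow> N 0 ;; voctave ::= aincr\<langle>N 0, V vsteps\<rangle> ;;
     FOR vt \<prec> vsteps DO (vpow ::= V vt \<oplus> N 1 ;; doubling vpow vcount vsteps ;;
       ashift\<langle>N 0, V vt \<oplus> N 1\<rangle> \<leftarrow> V vcount \<otimes> V voctave \<ominus> aincr\<langle>N 0, V vpow \<ominus> V vsteps\<rangle>)"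

context ram
begin

lemma doubling_correct:
  assumes vars: "distinct [x, c, h]" and s: "var s x = j" "1 \<le> j" "var s h = m" "m \<le> 2 ^ F" "2 * m < W"
  shows "ensures (doubling x c h) s F (\<lambda>s'. var s' x = j * 2 ^ doublings j m \<and> var s' c = doublings j m)"
proof -
  let ?s = "s\<lparr>var := (var s)(c := 0)\<rparr>" and ?d = "doublings j m"
  have "1 * 2 ^ F \<le> j * 2 ^ F" using s(2) by (rule mult_right_mono) simp
  then have "doublings j m \<le> F" using s(4) by (intro doublings_le) linarith
  then have time: "?d * Suc 0 \<le> F" by simp
  have "ensures (WHILE V x \<prec> V h DO (x ::= V x \<oplus> V x ;; c ::= V c \<oplus> N 1)) ?s F (\<lambda>s'. var s' x = j * 2 ^ ?d \<and> var s' c = ?d)"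
  proof (rule ensures_While[where F = ?d and b = 0 and I = "\<lambda>f s'. var s' c + f = ?d \<and> var s' x = j * 2 ^ var s' c"], goal_cases init guard step exit time)
    case (step f s1)
    have h: "var s1 h = m" using step(2) vars s by (auto simp: frame_def)
    then have "j * 2 ^ var s1 c < m" using step(1,3) by simp
    then have "var s1 c \<noteq> ?d" using doublings_ge[OF s(2), of m] by auto
    then have f: "0 < f" "Suc (var s1 c) + (f - 1) = ?d" using step(1) by auto
    have "var s1 c < 2 ^ var s1 c" by simp
    also have "\<dots> \<le> j * 2 ^ var s1 c" using s(2) by simp
    finally have "Suc (var s1 c) < W" "var s1 x + var s1 x < W" using \<open>j * 2 ^ var s1 c < m\<close> step(1) s(5) by auto
    then show ?case using step(1) f vars word_bounds by (auto intro!: exI[of _ "f - 1"])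
  next
    case (exit f s1)
    have "var s1 h = m" using exit(2) vars s by (auto simp: frame_def)
    then have "\<not> var s1 c < ?d" using exit(1,3) less_doublings by auto
    then show ?case using exit(1) by auto
  qed (use vars s time in auto)
  then show ?thesis using vars word_bounds unfolding doubling_def by simp
qed

lemma cube_bounds: "100 * (U * U * U) < R \<Longrightarrow> 100 * U < R \<and> 100 * (U * U) < R" for U :: nat
proof (cases "U = 0")
  case False
  assume "100 * (U * U * U) < R"
  moreover have "U * 1 * 1 \<le> U * U * U" "U * U * 1 \<le> U * U * U" using False by (intro mult_le_mono; simp)+
  ultimately show ?thesis by linarith
qed simp

lemma log_table_correct:
  assumes U: "var s vsteps = U" "100 * (U * U * U) < R" "var s vsquare = U * U"
  shows "ensures log_table s U (\<lambda>s'. \<forall>u\<le>U. arr s' aincr 0 u = scaled_ln U u)"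
proof -
  note small = cube_bounds[OF U(2)]
  let ?s = "s\<lparr>arr := arr_upd (arr s) aincr 0 0 0\<rparr>"
  have "ensures (FOR vt \<prec> vsteps DO aincr\<langle>N 0, V vt \<oplus> N 1\<rangle> \<leftarrow> aincr\<langle>N 0, V vt\<rangle> \<oplus> V vsquare \<oslash> (V vsteps \<oplus> V vt)) ?s U
      (\<lambda>s'. \<forall>u\<le>U. arr s' aincr 0 u = scaled_ln U u)"
  proof (rule ensures_For[where m = U and b = 0 and I = "\<lambda>v s'. \<forall>u\<le>v. arr s' aincr 0 u = scaled_ln U u"], goal_cases vars init step exit time)
    case (step v s1)
    have same: "var s1 vsquare = U * U" "var s1 vsteps = U" using step(4) U by (auto simp: frame_def)
    have "scaled_ln U v \<le> U * U" using scaled_ln_le[of U v] mult_le_mono1[of v U U] step(1) by linarith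
    then have "scaled_ln U v + U * U div (U + v) < W" using div_le_dividend[of "U * U" "U + v"] small word_bounds by linarith
    then show ?case using step(1-3) same small word_bounds by (auto simp: le_Suc_eq scaled_ln_def)
  qed (use U small word_bounds in \<open>auto simp: scaled_ln_def\<close>)
  then show ?thesis using word_bounds unfolding log_table_def by simp
qed

lemma ratio_table_correct:
  assumes U: "var s vsteps = U" "100 * (U * U * U) < R" "U \<le> 2 ^ F" and table: "\<forall>u\<le>U. arr s aincr 0 u = scaled_ln U u"
  shows "ensures ratio_table s (U * Suc F) (\<lambda>s'. var s' voctave = scaled_ln U U \<and> arr s' ashift 0 0 = 0 \<and>
    (\<forall>j. 1 \<le> j \<longrightarrow> j \<le> U \<longrightarrow> arr s' ashift 0 j = scaled_ln_ratio U j))" (is "ensures _ _ _ ?Q")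
proof -
  note small = cube_bounds[OF U(2)]
  let ?s = "s\<lparr>var := (var s)(voctave := scaled_ln U U), arr := arr_upd (arr s) ashift 0 0 0\<rparr>"
  let ?write = "ashift\<langle>N 0, V vt \<oplus> N 1\<rangle> \<leftarrow> V vcount \<otimes> V voctave \<ominus> aincr\<langle>N 0, V vpow \<ominus> V vsteps\<rangle>"
  have "ensures (FOR vt \<prec> vsteps DO (vpow ::= V vt \<oplus> N 1 ;; doubling vpow vcount vsteps ;; ?write)) ?s (U * Suc F) ?Q"
  proof (rule ensures_For[where m = U and b = F and I = "\<lambda>t s'. arr s' ashift 0 0 = 0 \<and> (\<forall>j. 1 \<le> j \<longrightarrow> j \<le> t \<longrightarrow> arr s' ashift 0 j = scaled_ln_ratio U j)"],
      goal_cases vars init step exit time)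
    case (step t s1)
    let ?j = "Suc t"
    let ?s1 = "s1\<lparr>var := (var s1)(vpow := ?j)\<rparr>"
    have same: "var s1 vsteps = U" "var s1 voctave = scaled_ln U U" "arr s1 aincr = arr s aincr" using step(4) U(1) by (auto simp: frame_def)
    have j: "1 \<le> ?j" "?j \<le> U" using step(1) by auto
    have "ensures (doubling vpow vcount vsteps) ?s1 F (\<lambda>s'. var s' vpow = ?j * 2 ^ doublings ?j U \<and> var s' vcount = doublings ?j U)"
      by (rule doubling_correct) (use same U small word_bounds in auto)
    then have "ensures (doubling vpow vcount vsteps ;; ?write) ?s1 F (\<lambda>s2. arr (s2\<lparr>var := (var s2)(vt := ?j)\<rparr>) ashift 0 0 = 0 \<and>
        (\<forall>j. 1 \<le> j \<longrightarrow> j \<le> Suc t \<longrightarrow> arr (s2\<lparr>var := (var s2)(vt := ?j)\<rparr>) ashift 0 j = scaled_ln_ratio U j))"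
    proof (rule ensures_Seq[where Tb = 0])
      fix s2 assume post: "var s2 vpow = ?j * 2 ^ doublings ?j U \<and> var s2 vcount = doublings ?j U"
        and fr: "frame_of (doubling vpow vcount vsteps) ?s1 s2"
      have same2: "var s2 vsteps = U" "var s2 voctave = scaled_ln U U" "arr s2 aincr = arr s aincr" "var s2 vt = t" "arr s2 ashift = arr s1 ashift"
        using fr same step(2) by (auto simp: frame_def)
      let ?z = "?j * 2 ^ doublings ?j U - U"
      have z: "U \<le> ?j * 2 ^ doublings ?j U" "?z < U" using doublings_ge[OF j(1), of U] doublings_less_double[OF j(2)] j by auto
      then have read: "arr s aincr 0 ?z = scaled_ln U ?z" "?z < R" using table small by auto
      have "doublings ?j U * scaled_ln U U \<le> U * (U * U)" by (intro mult_le_mono doublings_le_self j scaled_ln_le)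
      then have "doublings ?j U * scaled_ln U U < W" using U(2) word_bounds by (simp add: mult.assoc)
      then show "ensures ?write s2 0 (\<lambda>s2. arr (s2\<lparr>var := (var s2)(vt := ?j)\<rparr>) ashift 0 0 = 0 \<and>
        (\<forall>j. 1 \<le> j \<longrightarrow> j \<le> Suc t \<longrightarrow> arr (s2\<lparr>var := (var s2)(vt := ?j)\<rparr>) ashift 0 j = scaled_ln_ratio U j))"
        using post same2 z read scaled_ln_le_doublings[OF j] step(1,3) small word_bounds by (auto simp: scaled_ln_ratio_def le_Suc_eq)
    qed simp
    then show ?case using step(1,2) small word_bounds by simp
  next
    case (exit s1)
    then show ?case by (auto simp: frame_def)
  qed (use U small word_bounds in auto)
  then show ?thesis using U(1) small table word_bounds unfolding ratio_table_def by simp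
qed

end

subsection \<open>Initialisation, encoding and decoding\<close>

definition init_sizes :: com where
  "init_sizes = vnn ::= V vn \<otimes> V vn ;; vdim ::= N 3 \<otimes> V vn ;; vpow ::= N 1"

definition init_steps :: com where
  "init_steps = vq ::= Bin Shl (N 1) ((V vlevels \<oplus> N 1) \<oslash> N 2) ;; vsteps ::= Bin Shl (N 64 \<otimes> V vpow) (V vexp) ;;
     vsquare ::= V vsteps \<otimes> V vsteps ;; vdouble ::= V vsteps \<oplus> V vsteps ;; vslack ::= V vdouble \<oplus> V vdouble ;;
     vunit ::= Bin Shl (N 1) (V vwidth \<ominus> N 1) \<oslash> V vsteps"

definition init :: com where
  "init = init_sizes ;; doubling vpow vlevels vn ;; (vpow ::= N 1 ;; vtarget ::= V vlevels \<oplus> N 2) ;; doubling vpow vcount vtarget ;;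
     init_steps ;; log_table ;; ratio_table"

definition encode :: com where
  "encode = FOR vi \<prec> vn DO FOR vj \<prec> vn DO (vaddr ::= N 2 \<otimes> (V vi \<otimes> V vn \<oplus> V vj) ;;
     vmant ::= aio\<langle>N 0, V vaddr\<rangle> ;; vexpo ::= aio\<langle>N 0, V vaddr \<oplus> N 1\<rangle> ;;
     IF V vmant \<prec> N 1 THEN adist\<langle>V vi, V vj\<rangle> \<leftarrow> V vinf
     ELSE adist\<langle>V vi, V vj\<rangle> \<leftarrow> V vexpo \<otimes> V voctave \<oplus> aincr\<langle>N 0, V vmant \<oslash> V vunit \<ominus> V vsteps \<oplus> N 1\<rangle> \<oplus> V vdouble)"

definition find_log :: com where
  "find_log = vu ::= N 0 ;; WHILE aincr\<langle>N 0, V vu\<rangle> \<prec> V vrest DO vu ::= V vu \<oplus> N 1"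

definition decode_code :: com where
  "decode_code = (vcode ::= adist\<langle>V vi, V vj\<rangle> \<oplus> V vdouble ;; vexpo ::= V vcode \<oslash> V voctave ;; vrest ::= V vcode \<odot> V voctave) ;;
     find_log ;; IF V vu \<prec> V vsteps THEN vmant ::= (V vsteps \<oplus> V vu) \<otimes> V vunit
     ELSE (vmant ::= V vsteps \<otimes> V vunit ;; vexpo ::= V vexpo \<oplus> N 1)"

definition decode_entry :: com where
  "decode_entry = (vmant ::= N 0 ;; vexpo ::= N 0 ;; vcode ::= N 0 ;; (IF V vi \<prec> V vj THEN vcode ::= N 1 ELSE SKIP) ;;
       IF V vj \<prec> V vi THEN vcode ::= N 1 ELSE SKIP) ;;
     IF V vcode \<prec> N 1 THEN SKIP
     ELSE IF adist\<langle>V vi, V vj\<rangle> \<prec> V vinf THEN decode_code ELSE vexpo ::= N 1"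

definition decode :: com where
  "decode = FOR vi \<prec> vn DO FOR vj \<prec> vn DO (decode_entry ;; vaddr ::= N 2 \<otimes> (V vi \<otimes> V vn \<oplus> V vj) ;;
     aio\<langle>N 0, V vaddr\<rangle> \<leftarrow> V vmant ;; aio\<langle>N 0, V vaddr \<oplus> N 1\<rangle> \<leftarrow> V vexpo)"

definition main :: com where
  "main = init ;; encode ;; (FOR vlevel \<prec> vlevels DO square) ;; decode"

lemma assigned_log_table [simp]: "assigned log_table = {50}" "written log_table = {24}"
  and assigned_ratio_table [simp]: "assigned ratio_table = {11, 50, 51, 53}" "written ratio_table = {25}"
  and assigned_encode [simp]: "assigned encode = {30, 31, 59, 60, 61}" "written encode = {3}"
  and assigned_decode_entry [simp]: "assigned decode_entry = {60, 61, 62, 63, 64}" "written decode_entry = {}"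
  by (auto simp: log_table_def ratio_table_def encode_def decode_entry_def decode_code_def find_log_def)

fun squarings :: "nat \<Rightarrow> (nat \<Rightarrow> nat) \<Rightarrow> (nat \<Rightarrow> nat) \<Rightarrow> nat \<Rightarrow> nat \<Rightarrow> matrix \<Rightarrow> matrix \<Rightarrow> bool" where
  "squarings n shift incr U 0 D D' \<longleftrightarrow> (\<forall>i<n. \<forall>j<n. D' i j = D i j)"
| "squarings n shift incr U (Suc l) D D' \<longleftrightarrow> (\<exists>E. squarings n shift incr U l D E \<and> squared n E shift incr U D')"

abbreviation "log_squared n U D \<equiv> squared n D (scaled_ln_ratio U) (\<lambda>t. scaled_ln U t + 4 * U) U"
abbreviation "log_squarings n U \<equiv> squarings n (scaled_ln_ratio U) (\<lambda>t. scaled_ln U t + 4 * U) U"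

lemma squared_cong:
  assumes "\<And>t. 1 \<le> t \<Longrightarrow> t \<le> U \<Longrightarrow> shift t = shift' t \<and> incr t = incr' t"
  shows "squared n D shift incr U D' \<longleftrightarrow> squared n D shift' incr' U D'"
proof -
  have "candidates tr D n shift incr U i j = candidates tr D n shift' incr' U i j" for tr i j
    unfolding candidates_def using assms by (intro SUP_cong) auto
  then show ?thesis by (simp add: squared_def)
qed

definition levels :: "nat \<Rightarrow> nat" where
  "levels n = doublings 1 n"

definition steps_exponent :: "nat \<Rightarrow> nat \<Rightarrow> nat" where
  "steps_exponent n e = 6 + doublings 1 (levels n + 2) + e"

definition num_steps :: "nat \<Rightarrow> nat \<Rightarrow> nat" where
  "num_steps n e = 2 ^ steps_exponent n e"

text \<open>
  A distance \<open>x\<close> is represented by approximately \<open>U\<^sup>2 ln x\<close>. The mantissa \<open>m\<close> of a number in the input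
  is in \<open>{U * E..<2 * U * E}\<close>, and \<open>m = 0\<close> stands for \<open>\<infinity>\<close>, or for \<open>0\<close> if the exponent is \<open>0\<close>.
\<close>

definition encoded :: "nat \<Rightarrow> nat \<Rightarrow> nat \<Rightarrow> nat \<Rightarrow> nat \<Rightarrow> nat" where
  "encoded R U E m x = (if m = 0 then R else x * scaled_ln U U + scaled_ln U (m div E - U + 1) + 2 * U)"

definition decoded :: "nat \<Rightarrow> nat \<Rightarrow> nat \<Rightarrow> nat \<Rightarrow> nat \<Rightarrow> nat \<Rightarrow> bool" where
  "decoded R U E d m x \<longleftrightarrow> (if R \<le> d then m = 0 \<and> x = 1 else
     (\<exists>u\<le>U. (d + 2 * U) mod scaled_ln U U \<le> scaled_ln U u \<and> (\<forall>u'<u. scaled_ln U u' < (d + 2 * U) mod scaled_ln U U) \<and>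
       (if u < U then m = (U + u) * E \<and> x = (d + 2 * U) div scaled_ln U U else m = U * E \<and> x = (d + 2 * U) div scaled_ln U U + 1)))"

lemma mantissa_div:
  fixes U E m :: nat
  assumes unit_bounds: "U * E = 2 ^ (w - 1)" "1 \<le> w" and m: "2 ^ (w - 1) \<le> m" "m < 2 ^ w"
  shows "U \<le> m div E" "m div E - U + 1 \<le> U"
proof -
  have "E \<noteq> 0" using unit_bounds(1) by (cases E) auto
  then have "U = (U * E) div E" by simp
  also have "\<dots> \<le> m div E" using m(1) unit_bounds(1) by (intro div_le_mono) simp
  finally show "U \<le> m div E" .
  have "2 * U * E = 2 ^ w" using unit_bounds by (cases w) auto
  then have "m div E < 2 * U" using m(2) by (simp add: less_mult_imp_div_less)
  with \<open>U \<le> m div E\<close> show "m div E - U + 1 \<le> U" by linarith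
qed

locale solver = squaring w P W R ws n Lq F AT for w P W R ws n Lq F AT +
  fixes e :: nat and input :: "nat \<Rightarrow> nat"
  assumes n_sq_le_Lq: "n * n \<le> Lq" and steps_less_R: "100 * (num_steps n e * num_steps n e * num_steps n e) < R"
    and slots_le_R: "2 * (levels n * (num_steps n e * slots)) \<le> R"
    and input_ok: "\<And>i j. i < n \<Longrightarrow> j < n \<Longrightarrow> input (2 * (i * n + j)) \<noteq> 0 \<Longrightarrow>
       2 ^ (w - 1) \<le> input (2 * (i * n + j)) \<and> input (2 * (i * n + j)) < 2 ^ w \<and>
       (input (2 * (i * n + j) + 1) + 1) * (num_steps n e * num_steps n e) + 2 * num_steps n e \<le> R"
begin

abbreviation "L \<equiv> levels n"
abbreviation "U \<equiv> num_steps n e"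

definition "E = 2 ^ (w - 1) div U"

lemma U_eq: "U = 64 * 2 ^ doublings 1 (L + 2) * 2 ^ e"
  by (simp add: num_steps_def steps_exponent_def power_add)

lemma L_less_U: "64 * L + 128 \<le> U"
proof -
  have "L + 2 \<le> 2 ^ doublings 1 (L + 2)" using doublings_ge[of 1 "L + 2"] by simp
  moreover have "64 * 2 ^ doublings 1 (L + 2) \<le> U" unfolding U_eq by simp
  ultimately show ?thesis by linarith
qed

lemma U_bounds: "100 * U < R" "100 * (U * U) < R" "64 \<le> U" "L + 2 < R"
  using cube_bounds[OF steps_less_R] L_less_U by linarith+

lemma octave_ge: "U \<le> scaled_ln U U"
proof -
  have "scaled_ln U 1 \<le> scaled_ln U U" using U_bounds(3) by (intro scaled_ln_mono) linarith
  then show ?thesis using U_bounds(3) by (simp add: scaled_ln_def)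
qed

lemma scaled_ln_le_square: "u \<le> U \<Longrightarrow> scaled_ln U u \<le> U * U"
  using scaled_ln_le[of U u] mult_le_mono1[of u U U] by linarith

lemma unit_bounds: "U * E = 2 ^ (w - 1)" "2 * U * E = W" "1 \<le> E" "1 \<le> w"
proof -
  have "2 ^ steps_exponent n e * 2 \<le> W" using U_bounds(1) word_bounds unfolding num_steps_def by linarith
  then have "(2::nat) ^ Suc (steps_exponent n e) \<le> 2 ^ w" unfolding W_def by (simp only: power_Suc mult.commute)
  then have "Suc (steps_exponent n e) \<le> w" by (rule power_le_imp_le_exp[rotated]) simp
  then have "steps_exponent n e \<le> w - 1" and w: "1 \<le> w" by linarith+
  then have "U dvd 2 ^ (w - 1)" unfolding num_steps_def by (intro le_imp_power_dvd)
  then show unit_bounds: "U * E = 2 ^ (w - 1)" by (simp add: E_def)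
  then show "2 * U * E = W" using w W_def by (cases w) (auto simp: mult.assoc)
  show "1 \<le> E" using unit_bounds by (cases E) auto
  show "1 \<le> w" by (rule w)
qed

definition tables :: "store \<Rightarrow> bool" where
  "tables s \<longleftrightarrow> var s vsteps = U \<and> var s voctave = scaled_ln U U \<and> var s vdouble = 2 * U \<and> var s vslack = 4 * U \<and> var s vunit = E \<and>
     var s vlevels = L \<and> (\<forall>u\<le>U. arr s aincr 0 u = scaled_ln U u) \<and> arr s ashift 0 0 = 0 \<and>
     (\<forall>j. 1 \<le> j \<longrightarrow> j \<le> U \<longrightarrow> arr s ashift 0 j = scaled_ln_ratio U j)"

lemma tables_frame: "tables s \<Longrightarrow> frame X A s s' \<Longrightarrow> X \<inter> {vsteps, voctave, vslack, vlevels, vdouble, vunit} = {} \<Longrightarrow>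
    A \<inter> {aincr, ashift} = {} \<Longrightarrow> tables s'"
  unfolding tables_def frame_def by auto

lemma first_q_bounds: "n \<le> 2 ^ ((L + 1) div 2) * 2 ^ ((L + 1) div 2)" "2 ^ ((L + 1) div 2) * 2 ^ ((L + 1) div 2) \<le> 4 * n"
proof -
  let ?h = "(L + 1) div 2"
  have "L \<le> ?h + ?h" "?h + ?h \<le> L + 1" by linarith+
  then have "2 ^ L \<le> (2::nat) ^ (?h + ?h)" "2 ^ (?h + ?h) \<le> (2::nat) ^ (L + 1)" by (intro power_increasing; simp)+
  moreover have "n \<le> 2 ^ L" using doublings_ge[of 1 n] by (simp add: levels_def)
  moreover have "2 ^ L < 2 * n" using doublings_less_double[of 1 n] n_ge_1 by (simp add: levels_def)
  ultimately show "n \<le> 2 ^ ?h * 2 ^ ?h" "2 ^ ?h * 2 ^ ?h \<le> 4 * n" by (simp_all add: power_add)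
qed

definition init_ticks :: nat where
  "init_ticks = n + (L + 2) + U + U * Suc (steps_exponent n e)"

definition initialised :: "store \<Rightarrow> bool" where
  "initialised s \<longleftrightarrow> ready s \<and> tables s \<and> var s vslot = 0 \<and> arr s aio 0 = input"

lemma init_tables_correct:
  assumes s: "var s vn = n" "var s vnn = n * n" "var s vinf = R" "var s vdim = 3 * n" "var s vws = ws" "var s vslot = 0"
    "var s vwidth = w" "var s vexp = e" "var s vlevels = L" "var s vpow = 2 ^ doublings 1 (L + 2)" "arr s aguest = (\<lambda>_ _. 0)" "arr s aio 0 = input"
  shows "ensures (init_steps ;; log_table ;; ratio_table) s (U + U * Suc (steps_exponent n e)) initialised"
proof -
  let ?q = "2 ^ ((L + 1) div 2) :: nat"
  define s1 where "s1 = s\<lparr>var := (var s)(vq := ?q, vsteps := U, vsquare := U * U, vdouble := 2 * U, vslack := 4 * U, vunit := E)\<rparr>"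
  have "n * (?q * ?q) \<le> n * (4 * n)" using first_q_bounds(2) by (rule mult_le_mono2)
  then have "n * ?q * ?q \<le> 4 * Lq" using n_sq_le_Lq by (simp only: mult.assoc mult.left_commute[of n 4])
  then have ready: "ready s1" using s first_q_bounds(1) by (simp add: ready_def s1_def unused_slots_def)
  have "64 * 2 ^ doublings 1 (L + 2) \<le> U" unfolding U_eq by simp
  moreover have "2 ^ (w - Suc 0) < W" using unit_bounds(4) by (simp add: W_def)
  moreover have "?q \<le> ?q * ?q" by (rule le_square)
  moreover have "4 * n < W" using n_less_R word_bounds dim_bounds by linarith
  ultimately have small: "64 * 2 ^ doublings 1 (L + 2) < W" "?q < W" "2 ^ (w - Suc 0) < W" "4 * U < W" "U * U < W" "L + 1 < W"
    using U_bounds word_bounds first_q_bounds(2) by linarith+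
  have tables: "ensures (log_table ;; ratio_table) s1 (U + U * Suc (steps_exponent n e)) initialised"
  proof (rule ensures_Seq[OF log_table_correct[OF _ steps_less_R], where Tb = "U * Suc (steps_exponent n e)"])
    fix s2 assume log: "\<forall>u\<le>U. arr s2 aincr 0 u = scaled_ln U u" and fr2: "frame_of log_table s1 s2"
    have steps: "var s2 vsteps = U" using fr2 by (auto simp: frame_def s1_def)
    show "ensures ratio_table s2 (U * Suc (steps_exponent n e)) initialised"
    proof (rule ensures_weaken[OF ratio_table_correct[OF steps steps_less_R _ log]])
      fix s3 assume ratio: "var s3 voctave = scaled_ln U U \<and> arr s3 ashift 0 0 = 0 \<and> (\<forall>j. 1 \<le> j \<longrightarrow> j \<le> U \<longrightarrow> arr s3 ashift 0 j = scaled_ln_ratio U j)"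
        and fr3: "frame_of ratio_table s2 s3"
      have "ready s3" by (rule ready_frame[OF ready_frame[OF ready fr2] fr3]) auto
      then show "initialised s3" using fr2 fr3 ratio log s by (auto simp: initialised_def tables_def frame_def s1_def)
    qed (auto simp: num_steps_def)
  qed (auto simp: s1_def)
  have "2 ^ (w - Suc 0) div U = E" by (simp add: E_def)
  then show ?thesis using tables small s U_eq unit_bounds(4) word_bounds unfolding init_steps_def
    by (simp add: s1_def mult.commute)
qed

lemma init_correct: "ensures init (initial_store w n e input) init_ticks initialised"
proof -
  let ?s = "(initial_store w n e input)\<lparr>var := (var (initial_store w n e input))(vnn := n * n, vdim := 3 * n, vpow := 1)\<rparr>"
  let ?tables = "init_steps ;; log_table ;; ratio_table"
  have s: "var ?s vn = n" "var ?s vnn = n * n" "var ?s vinf = R" "var ?s vdim = 3 * n" "var ?s vws = ws" "var ?s vslot = 0"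
    "var ?s vwidth = w" "var ?s vexp = e" "arr ?s aguest = (\<lambda>_ _. 0)" "arr ?s aio 0 = input" "var ?s vpow = 1"
    by (auto simp: initial_store_def ws_def R_def)
  have "ensures (doubling vpow vlevels vn) ?s n (\<lambda>s'. var s' vpow = 1 * 2 ^ doublings 1 n \<and> var s' vlevels = doublings 1 n)"
    by (rule doubling_correct) (use s dim_bounds word_bounds less_exp in \<open>auto intro: less_imp_le\<close>)
  then have "ensures (doubling vpow vlevels vn ;; (vpow ::= N 1 ;; vtarget ::= V vlevels \<oplus> N 2) ;; doubling vpow vcount vtarget ;; ?tables) ?s init_ticks initialised"
  proof (rule ensures_Seq[where Tb = "(L + 2) + (U + U * Suc (steps_exponent n e))"])
    fix s1 assume post1: "var s1 vpow = 1 * 2 ^ doublings 1 n \<and> var s1 vlevels = doublings 1 n"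
      and fr1: "frame_of (doubling vpow vlevels vn) ?s s1"
    let ?s1 = "s1\<lparr>var := (var s1)(vpow := 1, vtarget := L + 2)\<rparr>"
    have "ensures (doubling vpow vcount vtarget) ?s1 (L + 2) (\<lambda>s'. var s' vpow = 1 * 2 ^ doublings 1 (L + 2) \<and> var s' vcount = doublings 1 (L + 2))"
      by (rule doubling_correct) (use U_bounds(4) word_bounds less_exp[of "L + 2"] in auto)
    then have "ensures (doubling vpow vcount vtarget ;; ?tables) ?s1 ((L + 2) + (U + U * Suc (steps_exponent n e))) initialised"
    proof (rule ensures_Seq)
      fix s2 assume "var s2 vpow = 1 * 2 ^ doublings 1 (L + 2) \<and> var s2 vcount = doublings 1 (L + 2)"
        and "frame_of (doubling vpow vcount vtarget) ?s1 s2"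
      then show "ensures ?tables s2 (U + U * Suc (steps_exponent n e)) initialised"
        using fr1 post1 s by (intro init_tables_correct) (auto simp: frame_def levels_def)
    qed simp
    then show "ensures ((vpow ::= N 1 ;; vtarget ::= V vlevels \<oplus> N 2) ;; doubling vpow vcount vtarget ;; ?tables) s1 ((L + 2) + (U + U * Suc (steps_exponent n e))) initialised"
      using post1 U_bounds(4) word_bounds by (simp add: levels_def)
  qed (simp add: init_ticks_def)
  then show ?thesis using s(1) dim_bounds word_bounds unfolding init_def init_sizes_def by (simp add: initial_store_def)
qed

lemma io_address: "i < n \<Longrightarrow> j < n \<Longrightarrow> 2 * (i * n + j) + 1 < R \<and> 2 * (i * n + j) + 1 < W \<and> i * n + j < W \<and> i * n < W \<and> i < R \<and> j < R"
proof -
  assume ij: "i < n" "j < n"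
  then have "i * n + j < n * n" by (rule mult_add_less)
  then have "2 * (i * n + j) + 1 < R" using n_less_R unfolding add_mult_distrib2 by linarith
  then show ?thesis using ij dim_bounds word_bounds by auto
qed

lemma io_address_eq:
  assumes "j < n" "j' < n" "(i, j) \<noteq> (i', j')"
  shows "2 * (i * n + j) \<noteq> 2 * (i' * n + j')" "2 * (i * n + j) \<noteq> Suc (2 * (i' * n + j'))" "Suc (2 * (i * n + j)) \<noteq> 2 * (i' * n + j')"
proof -
  show "2 * (i * n + j) \<noteq> 2 * (i' * n + j')" using mult_add_eq_iff[OF assms(1,2), of i i'] assms(3) by (metis mult_left_cancel zero_neq_numeral)
  show "2 * (i * n + j) \<noteq> Suc (2 * (i' * n + j'))" "Suc (2 * (i * n + j)) \<noteq> 2 * (i' * n + j')" by presburger+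
qed

definition input_dist :: "nat \<Rightarrow> nat \<Rightarrow> nat" where
  "input_dist i j = encoded R U E (input (2 * (i * n + j))) (input (2 * (i * n + j) + 1))"

lemma input_dist_le:
  assumes ij: "i < n" "j < n"
  shows "input_dist i j \<le> R"
proof (cases "input (2 * (i * n + j)) = 0")
  case False
  let ?m = "input (2 * (i * n + j))" and ?x = "input (2 * (i * n + j) + 1)"
  have ok: "2 ^ (w - 1) \<le> ?m" "?m < 2 ^ w" "(?x + 1) * (U * U) + 2 * U \<le> R" using input_ok[OF ij False] by auto
  have "?x * scaled_ln U U \<le> ?x * (U * U)" using scaled_ln_le_square[of U] by (intro mult_le_mono2) simp
  moreover have "scaled_ln U (?m div E - U + 1) \<le> U * U" using mantissa_div[OF unit_bounds(1,4) ok(1,2)] by (intro scaled_ln_le_square)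
  moreover have "(?x + 1) * (U * U) = ?x * (U * U) + U * U" by simp
  ultimately show ?thesis using ok(3) unfolding input_dist_def encoded_def if_not_P[OF False] by linarith
qed (simp add: input_dist_def encoded_def)

lemma encode_correct:
  assumes s: "initialised s"
  shows "ensures encode s (n * (n + 1)) (\<lambda>s'. \<forall>i<n. \<forall>j<n. arr s' adist i j = input_dist i j)"
  unfolding encode_def
proof (rule ensures_For_For_cells[where m = n and l = n and b = 0 and cell = "\<lambda>i j A. A adist i j = input_dist i j"], goal_cases vars step exit time)
  case (step i j s1)
  have ready: "ready s1" by (rule ready_frame[OF _ step(5)]) (use s in \<open>auto simp: initialised_def\<close>)
  have tables: "tables s1" by (rule tables_frame[OF _ step(5)]) (use s in \<open>auto simp: initialised_def\<close>)
  have same: "arr s1 aio 0 = input" using step(5) s by (auto simp: frame_def initialised_def)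
  let ?m = "input (2 * (i * n + j))" and ?x = "input (2 * (i * n + j) + 1)"
  note io = io_address[OF step(1,2)]
  show ?case
  proof (cases "?m = 0")
    case True
    then have "input_dist i j = R" by (simp add: input_dist_def encoded_def)
    then show ?thesis using True step same io ready word_bounds by (auto simp: ready_def)
  next
    case False
    have "2 ^ (w - 1) \<le> ?m" "?m < 2 ^ w" using input_ok[OF step(1,2) False] by auto
    note m = mantissa_div[OF unit_bounds(1,4) this]
    have dist: "input_dist i j = ?x * scaled_ln U U + scaled_ln U (?m div E - U + 1) + 2 * U" using False by (simp add: input_dist_def encoded_def)
    then have "?x * scaled_ln U U < W" "?x * scaled_ln U U + scaled_ln U (?m div E - U + 1) < W" "?x * scaled_ln U U + scaled_ln U (?m div E - U + 1) + 2 * U < W"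
      using input_dist_le[OF step(1,2)] word_bounds by linarith+
    moreover have "?m div E - U + 1 < R" "?m div E - U + 1 < W" using m(2) U_bounds(1) word_bounds by linarith+
    ultimately show ?thesis using False step same io ready tables m dist word_bounds by (auto simp: ready_def tables_def)
  qed
qed (use s dim_bounds in \<open>auto simp: initialised_def ready_def\<close>)

lemma find_log_correct:
  assumes s: "tables s" "var s vrest = y" "y < scaled_ln U U"
  shows "ensures find_log s U (\<lambda>s'. var s' vu \<le> U \<and> y \<le> scaled_ln U (var s' vu) \<and> (\<forall>u'<var s' vu. scaled_ln U u' < y))"
proof -
  let ?s = "s\<lparr>var := (var s)(vu := 0)\<rparr>"
  have "ensures (WHILE aincr\<langle>N 0, V vu\<rangle> \<prec> V vrest DO vu ::= V vu \<oplus> N 1) ?s U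
    (\<lambda>s'. var s' vu \<le> U \<and> y \<le> scaled_ln U (var s' vu) \<and> (\<forall>u'<var s' vu. scaled_ln U u' < y))"
  proof (rule ensures_While[where I = "\<lambda>f s'. var s' vu + f = U \<and> (\<forall>u'<var s' vu. scaled_ln U u' < y)" and F = U and b = 0], goal_cases init guard step exit time)
    case (guard f s1)
    then show ?case using U_bounds(1) word_bounds by auto
  next
    case (step f s1)
    have "var s1 vrest = y" "arr s1 aincr = arr s aincr" using step(2) s by (auto simp: frame_def)
    then have less: "scaled_ln U (var s1 vu) < y" using step(1,3) s(1) by (simp add: tables_def)
    then have "0 < f" using step(1) s(3) by (cases f) auto
    then show ?case using less step(1) U_bounds(1) word_bounds by (auto simp: less_Suc_eq intro!: exI[of _ "f - 1"])
  next
    case (exit f s1)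
    have "var s1 vrest = y" "arr s1 aincr = arr s aincr" using exit(2) s by (auto simp: frame_def)
    then show ?case using exit(1,3) s(1) by (auto simp: tables_def)
  qed auto
  then show ?thesis unfolding find_log_def using word_bounds by simp
qed

definition output_ok :: "nat \<Rightarrow> nat \<Rightarrow> nat \<Rightarrow> nat \<Rightarrow> nat \<Rightarrow> bool" where
  "output_ok d i j m x \<longleftrightarrow> (if i = j then m = 0 \<and> x = 0 else decoded R U E d m x)"

lemma decode_code_correct:
  assumes s: "tables s" "var s vi = i" "var s vj = j" "i < R" "j < R" and d: "arr s adist i j = d" "d < R"
  shows "ensures decode_code s U (\<lambda>s'. decoded R U E d (var s' vmant) (var s' vexpo))"
proof -
  let ?x = "d + 2 * U" and ?S = "scaled_ln U U"
  let ?s = "s\<lparr>var := (var s)(vcode := ?x, vexpo := ?x div ?S, vrest := ?x mod ?S)\<rparr>"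
  let ?write = "IF V vu \<prec> V vsteps THEN vmant ::= (V vsteps \<oplus> V vu) \<otimes> V vunit
     ELSE (vmant ::= V vsteps \<otimes> V vunit ;; vexpo ::= V vexpo \<oplus> N 1)"
  have params: "var s vsteps = U" "var s voctave = ?S" "var s vdouble = 2 * U" "var s vunit = E" using s(1) by (auto simp: tables_def)
  have "?x mod ?S < ?S" using octave_ge U_bounds(3) by (intro mod_less_divisor) linarith
  then have "ensures find_log ?s U (\<lambda>s'. var s' vu \<le> U \<and> ?x mod ?S \<le> scaled_ln U (var s' vu) \<and> (\<forall>u'<var s' vu. scaled_ln U u' < ?x mod ?S))"
    using s(1) by (intro find_log_correct) (auto simp: tables_def)
  then have "ensures (find_log ;; ?write) ?s U (\<lambda>s'. decoded R U E d (var s' vmant) (var s' vexpo))"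
  proof (rule ensures_Seq[where Tb = 0])
    fix s1 assume u: "var s1 vu \<le> U \<and> ?x mod ?S \<le> scaled_ln U (var s1 vu) \<and> (\<forall>u'<var s1 vu. scaled_ln U u' < ?x mod ?S)"
      and fr: "frame_of find_log ?s s1"
    have same: "var s1 vsteps = U" "var s1 vunit = E" "var s1 vexpo = ?x div ?S" using fr params by (auto simp: frame_def find_log_def)
    have "?x div ?S + 1 < W" using div_le_dividend[of ?x ?S] d(2) U_bounds(1) word_bounds by linarith
    moreover have "U * E < W" using unit_bounds(1,4) W_def by simp
    moreover have "(U + var s1 vu) * E < W" if "var s1 vu < U"
      using mult_strict_right_mono[of "U + var s1 vu" "2 * U" E] that unit_bounds(2,3) by simp
    ultimately show "ensures ?write s1 0 (\<lambda>s'. decoded R U E d (var s' vmant) (var s' vexpo))"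
      using u same d(2) U_bounds(1) word_bounds unfolding decoded_def by (auto intro!: exI[of _ "var s1 vu"])
  qed simp
  then show ?thesis using params s d U_bounds(1) word_bounds unfolding decode_code_def by simp
qed

lemma decode_entry_correct:
  assumes s: "ready s" "tables s" "var s vi = i" "var s vj = j" "i < R" "j < R" and d: "arr s adist i j \<le> R"
  shows "ensures decode_entry s U (\<lambda>s'. output_ok (arr s adist i j) i j (var s' vmant) (var s' vexpo))"
proof -
  let ?s = "s\<lparr>var := (var s)(vmant := 0, vexpo := 0, vcode := 1)\<rparr>"
  show ?thesis
  proof (cases "i = j \<or> arr s adist i j = R")
    case True
    then show ?thesis using s word_bounds unfolding decode_entry_def by (auto simp: output_ok_def decoded_def ready_def)
  next
    case False
    then have d': "i \<noteq> j" "arr s adist i j < R" using d by auto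
    have "ensures decode_code ?s U (\<lambda>s'. decoded R U E (arr s adist i j) (var s' vmant) (var s' vexpo))"
      using s d' by (intro decode_code_correct) (auto simp: tables_def)
    then show ?thesis using s d' word_bounds unfolding decode_entry_def
      by (cases "i < j") (simp_all add: output_ok_def ready_def)
  qed
qed

lemma decode_correct:
  assumes s: "ready s" "tables s" and d: "\<And>i j. i < n \<Longrightarrow> j < n \<Longrightarrow> arr s adist i j \<le> R"
  shows "ensures decode s (n * (n * (U + 1) + 1)) (\<lambda>s'. \<forall>i<n. \<forall>j<n.
    output_ok (arr s adist i j) i j (arr s' aio 0 (2 * (i * n + j))) (arr s' aio 0 (2 * (i * n + j) + 1)))"
  unfolding decode_def
proof (rule ensures_For_For_cells[where m = n and l = n and b = U and
    cell = "\<lambda>i j A. output_ok (arr s adist i j) i j (A aio 0 (2 * (i * n + j))) (A aio 0 (2 * (i * n + j) + 1))"], goal_cases vars step exit time)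
  case (step i j s1)
  have ready: "ready s1" by (rule ready_frame[OF s(1) step(5)]) auto
  have tables: "tables s1" by (rule tables_frame[OF s(2) step(5)]) auto
  have same: "arr s1 adist = arr s adist" using step(5) by (auto simp: frame_def)
  note io = io_address[OF step(1,2)]
  have "ensures decode_entry s1 U (\<lambda>s'. output_ok (arr s1 adist i j) i j (var s' vmant) (var s' vexpo))"
    using ready tables step(3,4) io same d[OF step(1,2)] by (intro decode_entry_correct) auto
  then show ?case
  proof (rule ensures_Seq[where Tb = 0])
    fix s2 assume "output_ok (arr s1 adist i j) i j (var s2 vmant) (var s2 vexpo)" and fr: "frame_of decode_entry s1 s2"
    moreover have "var s2 vi = i" "var s2 vj = j" "var s2 vn = n" "arr s2 aio = arr s1 aio" using fr step(3,4) ready by (auto simp: frame_def ready_def)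
    ultimately show "ensures (vaddr ::= N 2 \<otimes> (V vi \<otimes> V vn \<oplus> V vj) ;; aio\<langle>N 0, V vaddr\<rangle> \<leftarrow> V vmant ;; aio\<langle>N 0, V vaddr \<oplus> N 1\<rangle> \<leftarrow> V vexpo) s2 0
        (\<lambda>s2. output_ok (arr s adist i j) i j (arr s2 aio 0 (2 * (i * n + j))) (arr s2 aio 0 (2 * (i * n + j) + 1)) \<and>
         (\<forall>i'<n. \<forall>j'<n. (i', j') \<noteq> (i, j) \<longrightarrow> output_ok (arr s adist i' j') i' j' (arr s1 aio 0 (2 * (i' * n + j'))) (arr s1 aio 0 (2 * (i' * n + j') + 1)) \<longrightarrow>
           output_ok (arr s adist i' j') i' j' (arr s2 aio 0 (2 * (i' * n + j'))) (arr s2 aio 0 (2 * (i' * n + j') + 1))))"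
      using io same io_address_eq[OF _ step(2)] word_bounds by auto
  qed simp
qed (use s dim_bounds in \<open>auto simp: ready_def\<close>)

definition main_ticks :: nat where
  "main_ticks = init_ticks + n * (n + 1) + L * Suc (2 * (n * (n + 1)) + 2 * half_square_ticks (2 * L) U) + n * (n * (U + 1) + 1)"

lemma tables_imp_tables_ok: "tables s \<Longrightarrow> tables_ok U s"
proof -
  assume tables: "tables s"
  have "arr s ashift 0 t \<le> R" if "t \<le> U" for t
  proof (cases "t = 0")
    case False
    then show ?thesis using tables that scaled_ln_ratio_le[of t U] steps_less_R by (simp add: tables_def mult.assoc)
  qed (use tables in \<open>simp add: tables_def\<close>)
  moreover have "arr s aincr 0 t + var s vslack \<le> R" if "t \<le> U" for t
  proof -
    have "4 * U \<le> U * U" using U_bounds(3) by (intro mult_le_mono1) linarith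
    then have "scaled_ln U t + 4 * U \<le> R" using scaled_ln_le_square[OF that] U_bounds(2) by linarith
    then show ?thesis using tables that by (simp add: tables_def)
  qed
  ultimately show ?thesis using tables U_bounds(1) by (auto simp: tables_ok_def tables_def)
qed

lemma square_loop_correct:
  assumes s: "ready s" "tables s" "var s vslot = 0" "\<And>i j. i < n \<Longrightarrow> j < n \<Longrightarrow> arr s adist i j = input_dist i j"
  shows "ensures (FOR vlevel \<prec> vlevels DO square) s (L * Suc (2 * (n * (n + 1)) + 2 * half_square_ticks (2 * L) U)) (\<lambda>s'. ready s' \<and> tables s' \<and>
    log_squarings n U L input_dist (arr s' adist) \<and> (\<forall>i<n. \<forall>j<n. arr s' adist i j \<le> R))"
proof (rule ensures_For[where m = L and b = "2 * (n * (n + 1)) + 2 * half_square_ticks (2 * L) U" and I = "\<lambda>l s'. ready s' \<and> tables s' \<and>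
    var s' vslot \<le> 2 * (l * (U * slots)) \<and> log_squarings n U l input_dist (arr s' adist) \<and>
    (\<forall>i<n. \<forall>j<n. arr s' adist i j \<le> R)"], goal_cases vars init step exit time)
  case (step l s1)
  have "n \<le> 2 ^ L" using doublings_ge[of 1 n] by (simp add: levels_def)
  then have "n * n \<le> 2 ^ L * 2 ^ L" by (intro mult_le_mono)
  then have G: "n * n \<le> 2 ^ (2 * L)" by (simp add: mult_2 power_add)
  have "Suc l * (U * slots) \<le> L * (U * slots)" using step(1) by (intro mult_right_mono) auto
  then have slots: "var s1 vslot + 2 * (U * slots) \<le> R" using step(3) slots_le_R by simp
  have table: "arr s1 aincr 0 t = scaled_ln U t" "arr s1 ashift 0 t = scaled_ln_ratio U t" "var s1 vslack = 4 * U" if "1 \<le> t" "t \<le> U" for t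
    using step(3) that by (auto simp: tables_def)
  have "ensures square s1 (2 * (n * (n + 1)) + 2 * half_square_ticks (2 * L) U) (\<lambda>s'. ready s' \<and> var s' vslot \<le> var s1 vslot + 2 * (U * slots) \<and>
    squared n (arr s1 adist) (arr s1 ashift 0) (\<lambda>t. arr s1 aincr 0 t + var s1 vslack) U (arr s' adist))"
    by (rule square_correct) (use step(3) slots G tables_imp_tables_ok in auto)
  then show ?case
  proof (rule ensures_weaken)
    fix s2 assume post: "ready s2 \<and> var s2 vslot \<le> var s1 vslot + 2 * (U * slots) \<and>
      squared n (arr s1 adist) (arr s1 ashift 0) (\<lambda>t. arr s1 aincr 0 t + var s1 vslack) U (arr s2 adist)"
      and fr: "frame_of square s1 s2"
    have sq: "log_squared n U (arr s1 adist) (arr s2 adist)"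
      using post squared_cong[of U "arr s1 ashift 0" "scaled_ln_ratio U" "\<lambda>t. arr s1 aincr 0 t + var s1 vslack" "\<lambda>t. scaled_ln U t + 4 * U"] table by auto
    moreover have "arr s2 adist i j \<le> R" if "i < n" "j < n" for i j
      using sq that step(3) by (force simp: squared_def is_least_def)
    moreover have "tables s2" by (rule tables_frame[OF _ fr]) (use step(3) in auto)
    ultimately show "ready (s2\<lparr>var := (var s2)(vlevel := Suc l)\<rparr>) \<and> tables (s2\<lparr>var := (var s2)(vlevel := Suc l)\<rparr>) \<and>
      var (s2\<lparr>var := (var s2)(vlevel := Suc l)\<rparr>) vslot \<le> 2 * (Suc l * (U * slots)) \<and>
      log_squarings n U (Suc l) input_dist (arr (s2\<lparr>var := (var s2)(vlevel := Suc l)\<rparr>) adist) \<and>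
      (\<forall>i<n. \<forall>j<n. arr (s2\<lparr>var := (var s2)(vlevel := Suc l)\<rparr>) adist i j \<le> R)"
      using post step(3) by (auto simp: ready_def tables_def unused_slots_def)
  qed simp
qed (use s input_dist_le U_bounds(4) word_bounds in \<open>auto simp: ready_def tables_def unused_slots_def\<close>)

lemma main_correct:
  "ensures main (initial_store w n e input) main_ticks (\<lambda>s'. \<exists>D. log_squarings n U L input_dist D \<and>
     (\<forall>i<n. \<forall>j<n. output_ok (D i j) i j (arr s' aio 0 (2 * (i * n + j))) (arr s' aio 0 (2 * (i * n + j) + 1))))" (is "ensures _ _ _ ?Q")
proof -
  let ?loop = "L * Suc (2 * (n * (n + 1)) + 2 * half_square_ticks (2 * L) U)" and ?decode = "n * (n * (U + 1) + 1)"
  show ?thesis unfolding main_def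
  proof (rule ensures_Seq[OF init_correct, where Tb = "n * (n + 1) + (?loop + ?decode)"])
    fix s1 assume init: "initialised s1"
    show "ensures (encode ;; (FOR vlevel \<prec> vlevels DO square) ;; decode) s1 (n * (n + 1) + (?loop + ?decode)) ?Q"
    proof (rule ensures_Seq[OF encode_correct[OF init]])
      fix s2 assume dist: "\<forall>i<n. \<forall>j<n. arr s2 adist i j = input_dist i j" and fr: "frame_of encode s1 s2"
      have "ready s2" by (rule ready_frame[OF _ fr]) (use init in \<open>auto simp: initialised_def\<close>)
      moreover have "tables s2" by (rule tables_frame[OF _ fr]) (use init in \<open>auto simp: initialised_def\<close>)
      moreover have "var s2 vslot = 0" using fr init by (auto simp: frame_def initialised_def)
      ultimately show "ensures ((FOR vlevel \<prec> vlevels DO square) ;; decode) s2 (?loop + ?decode) ?Q"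
        using dist by (intro ensures_Seq[OF square_loop_correct]) (auto intro!: ensures_weaken[OF decode_correct])
    qed simp
  qed (simp add: main_ticks_def)
qed

end

section \<open>Walks\<close>

lemma walk_weight_simps [simp]:
  "walk_weight G [u] = 0"
  "walk_weight G (u # v # p) = G u v + walk_weight G (v # p)"
  by (simp_all add: walk_weight_def sum.lessThan_Suc_shift del: sum.lessThan_Suc)

lemma walk_weight_append: "walk_weight G (p @ k # q) = walk_weight G (p @ [k]) + walk_weight G (k # q)"
proof (induction p)
  case (Cons u p)
  then show ?case by (cases p) (auto simp: add.assoc)
qed simp

lemma append_in_walks: "p @ k # q \<in> walks n i j \<longleftrightarrow> p @ [k] \<in> walks n i k \<and> k # q \<in> walks n k j"
  by (cases p) (auto simp: walks_def)

lemma edge_in_walks: "i < n \<Longrightarrow> j < n \<Longrightarrow> [i, j] \<in> walks n i j"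
  by (simp add: walks_def)

lemma weighted_digraph_cases:
  assumes "weighted_digraph n G" "u < n" "v < n"
  obtains "G u v = \<infinity>" | x where "G u v = ereal x" "1 \<le> x"
proof -
  have "1 \<le> G u v" using assms by (simp add: weighted_digraph_def)
  then show ?thesis using that by (cases "G u v") auto
qed

lemma walk_weight_nonneg: "weighted_digraph n G \<Longrightarrow> set p \<subseteq> {..<n} \<Longrightarrow> 0 \<le> walk_weight G p"
proof (induction p rule: induct_list012)
  case (3 u v p)
  have "0 \<le> G u v" by (rule weighted_digraph_cases[OF 3(3), of u v]) (use 3(4) in auto)
  then show ?case using 3 by simp
qed (simp_all add: walk_weight_def)

lemma max_weight_ge:
  shows "u < n \<Longrightarrow> v < n \<Longrightarrow> G u v = ereal x \<Longrightarrow> x \<le> max_weight n G" "1 \<le> max_weight n G"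
proof -
  have "{real_of_ereal (G u v) |u v. u < n \<and> v < n \<and> G u v \<noteq> \<infinity>} \<subseteq> (\<lambda>(u, v). real_of_ereal (G u v)) ` ({..<n} \<times> {..<n})" by auto
  then have "finite {real_of_ereal (G u v) |u v. u < n \<and> v < n \<and> G u v \<noteq> \<infinity>}" by (rule finite_subset) auto
  then show "u < n \<Longrightarrow> v < n \<Longrightarrow> G u v = ereal x \<Longrightarrow> x \<le> max_weight n G" "1 \<le> max_weight n G"
    unfolding max_weight_def by (auto intro!: Max_ge) (metis PInfty_neq_ereal(1) real_of_ereal.simps(1))
qed

lemma walk_weight_le_max:
  assumes "weighted_digraph n G" "set p \<subseteq> {..<n}" "walk_weight G p = ereal x"
  shows "x \<le> real (length p - 1) * max_weight n G"
  using assms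
proof (induction p arbitrary: x rule: induct_list012)
  case (3 u v p)
  have uv: "u < n" "v < n" and p: "set (v # p) \<subseteq> {..<n}" using 3(4) by auto
  from 3(3) uv show ?case
  proof (cases rule: weighted_digraph_cases)
    case (2 y)
    then obtain z where z: "walk_weight G (v # p) = ereal z" "x = y + z" using 3(5) by (cases "walk_weight G (v # p)") auto
    then have "z \<le> real (length p) * max_weight n G" using 3(2)[OF 3(3) p] by simp
    then show ?thesis using max_weight_ge(1)[of u n v G y] uv 2(1) z(2) by (simp add: algebra_simps)
  qed (use 3(5) walk_weight_nonneg[OF 3(3) p] in auto)
qed (simp_all add: walk_weight_def)

lemma walk_halves:
  assumes G: "weighted_digraph n G" and p: "p \<in> walks n i j" "Suc h < length p" "length p \<le> Suc (2 * h)" "walk_weight G p = ereal x"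
  obtains k q r y z where "k < n" "q \<in> walks n i k" "2 \<le> length q" "length q \<le> Suc h" "walk_weight G q = ereal y"
    "r \<in> walks n k j" "2 \<le> length r" "length r \<le> Suc h" "walk_weight G r = ereal z" "x = y + z"
proof -
  define k q r where "k = p ! h" and "q = take h p" and "r = drop (Suc h) p"
  have split: "p = q @ k # r" unfolding k_def q_def r_def using p(2) by (intro id_take_nth_drop) simp
  have nodes: "set p \<subseteq> {..<n}" using p(1) by (simp add: walks_def)
  have "length q = h" using p(2) by (simp add: q_def)
  then have len: "2 \<le> length (q @ [k])" "length (q @ [k]) \<le> Suc h" "2 \<le> length (k # r)" "length (k # r) \<le> Suc h"
    using p(2,3) split by (cases r; auto)+
  have walks: "q @ [k] \<in> walks n i k" "k # r \<in> walks n k j" "k < n" using p(1) append_in_walks[of q k r] nodes split by auto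
  have nn: "0 \<le> walk_weight G (q @ [k])" "0 \<le> walk_weight G (k # r)" using nodes split by (auto intro!: walk_weight_nonneg[OF G])
  have "walk_weight G (q @ [k]) + walk_weight G (k # r) = ereal x" using p(4) walk_weight_append[of G q k r] split by simp
  then obtain y z where "walk_weight G (q @ [k]) = ereal y" "walk_weight G (k # r) = ereal z" "x = y + z"
    using nn by (cases "walk_weight G (q @ [k])"; cases "walk_weight G (k # r)") auto
  then show ?thesis using that[of k "q @ [k]" y "k # r" z] len walks by blast
qed

lemma short_walk:
  assumes G: "weighted_digraph n G"
  shows "p \<in> walks n i j \<Longrightarrow> \<exists>q\<in>walks n i j. length q \<le> n \<and> walk_weight G q \<le> walk_weight G p"
proof (induction "length p" arbitrary: p rule: less_induct)
  case less
  have nodes: "set p \<subseteq> {..<n}" using less(2) by (simp add: walks_def)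
  show ?case
  proof (cases "distinct p")
    case True
    then have "length p \<le> n" using nodes card_mono[of "{..<n}" "set p"] distinct_card by fastforce
    then show ?thesis using less(2) by auto
  next
    case False
    then obtain xs k ys zs where p: "p = xs @ k # ys @ k # zs" using not_distinct_decomp[of p] by auto
    have "xs @ k # zs \<in> walks n i j" using less(2) append_in_walks[of "k # ys" k zs] unfolding p
      by (subst (asm) append_in_walks, subst append_in_walks) auto
    moreover have "0 \<le> walk_weight G (k # ys @ [k])" using nodes p by (intro walk_weight_nonneg[OF G]) auto
    then have "walk_weight G (xs @ k # zs) \<le> walk_weight G p"
      using walk_weight_append[of G "k # ys" k zs] unfolding p walk_weight_append[of G xs k "ys @ k # zs"] walk_weight_append[of G xs k zs]
      by (simp add: add_left_mono ereal_le_add_self2)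
    ultimately show ?thesis using less(1)[of "xs @ k # zs"] p by (force intro: order_trans)
  qed
qed

lemma distance_le: "p \<in> walks n i j \<Longrightarrow> distance n G i j \<le> walk_weight G p"
  unfolding distance_def by (rule INF_lower)

lemma distance_attained:
  assumes G: "weighted_digraph n G" and ij: "i < n" "j < n"
  obtains p where "p \<in> walks n i j" "length p \<le> n" "walk_weight G p = distance n G i j"
proof -
  let ?short = "{p \<in> walks n i j. length p \<le> n}"
  have "finite ?short" by (rule finite_subset[OF _ finite_lists_length_le[of "{..<n}" n]]) (auto simp: walks_def)
  moreover have "?short \<noteq> {}" using short_walk[OF G edge_in_walks[OF ij]] by auto
  ultimately obtain p where p: "p \<in> ?short" "\<And>q. q \<in> ?short \<Longrightarrow> walk_weight G p \<le> walk_weight G q"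
    by (meson arg_min_if_finite not_le)
  have "walk_weight G p \<le> walk_weight G q" if "q \<in> walks n i j" for q using short_walk[OF G that] p(2) order_trans by blast
  then have "walk_weight G p = distance n G i j" using p(1) by (intro antisym distance_le) (auto simp: distance_def intro: INF_greatest)
  then show ?thesis using p(1) by (intro that) auto
qed

lemma distance_triangle:
  assumes "weighted_digraph n G" "i < n" "j < n" "k < n"
  shows "distance n G i j \<le> distance n G i k + distance n G k j"
proof -
  obtain p where p: "p \<in> walks n i k" "walk_weight G p = distance n G i k" using distance_attained assms by metis
  obtain q where q: "q \<in> walks n k j" "walk_weight G q = distance n G k j" using distance_attained assms by metis
  obtain p' q' where split: "p = p' @ [k]" "q = k # q'"
    using p(1) q(1) by (cases p rule: rev_cases; cases q) (auto simp: walks_def)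
  have "distance n G i j \<le> walk_weight G (p' @ k # q')" using p(1) q(1) split append_in_walks by (intro distance_le) blast
  also have "\<dots> = distance n G i k + distance n G k j" using p(2) q(2) split walk_weight_append by metis
  finally show ?thesis .
qed

lemma distance_nonneg: "weighted_digraph n G \<Longrightarrow> 0 \<le> distance n G u v"
  unfolding distance_def by (intro INF_greatest walk_weight_nonneg[of n G]) (simp_all add: walks_def)

lemma distance_self:
  assumes "weighted_digraph n G" "u < n"
  shows "distance n G u u = 0"
proof (rule antisym)
  show "distance n G u u \<le> 0" using assms distance_le[of "[u]" n u u G] by (simp add: walks_def)
  show "0 \<le> distance n G u u" by (rule distance_nonneg[OF assms(1)])
qed

section \<open>Accuracy of the logarithmic scale\<close>

lemma nat_div_bounds: "real (x div y) \<le> real x / real y" "real x / real y \<le> real (x div y) + 1"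
  using floor_divide_of_nat_eq[where 'a = real, of x y] by linarith+

lemma ln_2_bounds: "7 / 12 \<le> ln (2::real)" "ln (2::real) \<le> 1"
proof -
  have "ln (2::real) = - ln (3 / 4) - ln (2 / 3)" using ln_mult[of "3 / 4" "2 / 3 :: real"] ln_inverse[of "2::real"] by (simp add: inverse_eq_divide)
  then show "7 / 12 \<le> ln (2::real)" using ln_le_minus_one[of "3 / 4 :: real"] ln_le_minus_one[of "2 / 3 :: real"] by simp
  show "ln (2::real) \<le> 1" using ln_le_minus_one[of "2::real"] by simp
qed

lemma scaled_ln_Suc: "scaled_ln U (Suc u) = scaled_ln U u + (U * U) div (U + u)"
  by (simp add: scaled_ln_def)

lemma fl_exponent_bounds:
  assumes "0 < x"
  shows "2 powr fl_exponent x \<le> x" "x < 2 * 2 powr fl_exponent x"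
proof -
  have "fl_exponent x \<le> log 2 x" "log 2 x < 1 + fl_exponent x" unfolding fl_exponent_def by linarith+
  then have "2 powr fl_exponent x \<le> x" "x < 2 powr (1 + fl_exponent x)" using assms by (simp_all add: le_log_iff log_less_iff)
  then show "2 powr fl_exponent x \<le> x" "x < 2 * 2 powr fl_exponent x" by (simp_all add: powr_add)
qed

lemma fl_exponent_nat:
  assumes "1 \<le> x"
  shows "real_of_int (fl_exponent x) = real (nat (fl_exponent x))" "2 powr fl_exponent x = 2 ^ nat (fl_exponent x)"
proof -
  have "0 \<le> fl_exponent x" using assms by (simp add: fl_exponent_def)
  then show "real_of_int (fl_exponent x) = real (nat (fl_exponent x))" by simp
  then show "2 powr fl_exponent x = 2 ^ nat (fl_exponent x)" by (simp only: powr_realpow zero_less_numeral)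
qed

lemma fl_mantissa_bounds:
  assumes "1 \<le> x" "1 \<le> w" and z: "x = z * 2 ^ nat (fl_exponent x)"
  shows "real (fl_mantissa w x) \<le> z * 2 ^ (w - 1)" "z * 2 ^ (w - 1) < real (fl_mantissa w x) + 1"
    "2 ^ (w - 1) \<le> fl_mantissa w x" "fl_mantissa w x < 2 ^ w" "1 \<le> z"
proof -
  define k where "k = nat (fl_exponent x)"
  note exponent = fl_exponent_nat[OF assms(1), folded k_def]
  have x: "x = z * 2 ^ k" using z unfolding k_def .
  have "2 ^ k \<le> x" "x < 2 * 2 ^ k" using fl_exponent_bounds[of x] exponent(2) assms(1) by auto
  then have "1 * 2 ^ k \<le> z * 2 ^ k" "z * 2 ^ k < 2 * 2 ^ k" by (simp_all only: x mult_1)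
  then have "1 \<le> z" "z < 2" by simp_all
  then show "1 \<le> z" by blast
  have "real w - 1 - fl_exponent x = real (w - 1) - real k" using assms(2) exponent(1) by (simp add: of_nat_diff)
  then have "2 powr (real w - 1 - fl_exponent x) = 2 ^ (w - 1) / 2 ^ k" by (simp only: powr_diff powr_realpow zero_less_numeral)
  then have m: "fl_mantissa w x = nat \<lfloor>z * 2 ^ (w - 1)\<rfloor>" unfolding fl_mantissa_def by (simp add: x)
  have "0 \<le> z * 2 ^ (w - 1)" using \<open>1 \<le> z\<close> by simp
  then show bounds: "real (fl_mantissa w x) \<le> z * 2 ^ (w - 1)" "z * 2 ^ (w - 1) < real (fl_mantissa w x) + 1" unfolding m by linarith+
  have "2 ^ (w - 1) \<le> z * 2 ^ (w - 1)" "z * 2 ^ (w - 1) < 2 * 2 ^ (w - 1)" using \<open>1 \<le> z\<close> \<open>z < 2\<close> by simp_all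
  then have "2 ^ (w - 1) < real (fl_mantissa w x) + 1" "real (fl_mantissa w x) < 2 * 2 ^ (w - 1)" using bounds by linarith+
  then have "real (2 ^ (w - 1)) < real (fl_mantissa w x + 1)" "real (fl_mantissa w x) < real (2 * 2 ^ (w - 1))" by (simp_all del: One_nat_def)
  then have "2 ^ (w - 1) < fl_mantissa w x + 1" "fl_mantissa w x < 2 * 2 ^ (w - 1)" by (simp_all only: of_nat_less_iff)
  then show "2 ^ (w - 1) \<le> fl_mantissa w x" "fl_mantissa w x < 2 ^ w" using assms(2) by (cases w; simp)+
qed

locale log_scale =
  fixes U E w :: nat
  assumes steps_ge: "64 \<le> U" and unit_eq: "U * E = 2 ^ (w - 1)" and width_ge: "1 \<le> w"
begin

abbreviation octave :: real where "octave \<equiv> real (scaled_ln U U)"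

definition val :: "real \<Rightarrow> real" where "val x = 2 powr (x / octave)"

lemma steps_real: "0 < real U" "64 \<le> real U"
  using steps_ge by auto

lemma ln_step: "ln (1 + real (Suc u) / real U) = ln (1 + real u / real U) + ln (1 + 1 / (real U + real u))"
proof -
  have pos: "0 < 1 + real u / real U" "0 < 1 + 1 / (real U + real u)" using steps_real by (auto intro!: add_pos_nonneg)
  have "real U + real u \<noteq> 0" using steps_real by linarith
  then have "1 + real (Suc u) / real U = (1 + real u / real U) * (1 + 1 / (real U + real u))"
    using steps_real by (simp add: divide_simps)
  then show ?thesis by (simp only: ln_mult_pos[OF pos])
qed

lemma scaled_ln_lower: "real U * real U * ln (1 + real u / real U) - real u \<le> real (scaled_ln U u)"
proof (induction u)
  case (Suc u)
  have "ln (1 + 1 / (real U + real u)) \<le> 1 / (real U + real u)" by (intro ln_add_one_self_le_self) simp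
  then have "real U * real U * ln (1 + 1 / (real U + real u)) \<le> real U * real U * (1 / (real U + real u))"
    by (rule mult_left_mono) simp
  also have "\<dots> \<le> real ((U * U) div (U + u)) + 1" using nat_div_bounds(2)[of "U * U" "U + u"] by simp
  finally show ?case using Suc unfolding ln_step scaled_ln_Suc by (simp add: algebra_simps)
qed (simp add: scaled_ln_def)

lemma scaled_ln_telescope:
  "real (scaled_ln U u) \<le> real U * real U * ln (1 + real u / real U) + real U * real U * (1 / real U - 1 / (real U + real u))"
proof (induction u)
  case (Suc u)
  let ?x = "real U + real u"
  have "1 / (?x + 1) \<le> ln (1 + 1 / ?x)" using ln_add1_ge[of "1 / ?x"] steps_real by (simp add: field_simps)
  then have "real U * real U * (1 / (?x + 1)) \<le> real U * real U * ln (1 + 1 / ?x)" by (rule mult_left_mono) simp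
  moreover have "real ((U * U) div (U + u)) \<le> real U * real U * (1 / ?x)" using nat_div_bounds(1)[of "U * U" "U + u"] by simp
  ultimately show ?case using Suc unfolding ln_step scaled_ln_Suc by (simp add: algebra_simps)
qed (simp add: scaled_ln_def)

lemma scaled_ln_upper:
  assumes "u \<le> U"
  shows "real (scaled_ln U u) \<le> real U * real U * ln (1 + real u / real U) + real U / 2"
proof -
  have "real U * real U * (1 / (2 * real U)) \<le> real U * real U * (1 / (real U + real u))"
    using assms steps_real by (intro mult_left_mono divide_left_mono) auto
  then have "real U * real U * (1 / real U - 1 / (real U + real u)) \<le> real U / 2" using steps_real by (simp add: algebra_simps)
  then show ?thesis using scaled_ln_telescope[of u] by linarith
qed

lemma octave_bounds: "real U * real U / 2 \<le> octave" "0 < octave"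
proof -
  have "real U * real U * ln 2 - real U \<le> octave" using scaled_ln_lower[of U] steps_real by simp
  moreover have "real U * real U * (7 / 12) \<le> real U * real U * ln 2" using ln_2_bounds by (intro mult_left_mono) auto
  moreover have "64 * real U \<le> real U * real U" using steps_real by (intro mult_right_mono) auto
  ultimately show "real U * real U / 2 \<le> octave" using steps_real by linarith
  moreover have "0 < real U * real U" using steps_real by simp
  ultimately show "0 < octave" by linarith
qed

lemma scaled_ln_log:
  assumes "u \<le> U"
  shows "\<bar>real (scaled_ln U u) - octave * log 2 (1 + real u / real U)\<bar> \<le> 2 * real U"
proof -
  define r where "r = log 2 (1 + real u / real U)"
  define h where "h = real U * real U * ln 2"
  have arg: "1 + real u / real U \<le> 2" "1 \<le> 1 + real u / real U" using assms steps_real by auto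
  then have "r \<le> log 2 2" unfolding r_def by (intro log_mono) linarith+
  moreover have "0 \<le> r" unfolding r_def using arg(2) by (subst zero_le_log_cancel_iff) linarith+
  ultimately have r: "0 \<le> r" "r \<le> 1" by simp_all
  have ln: "real U * real U * ln (1 + real u / real U) = r * h" by (simp add: r_def h_def log_def)
  have "h - real U \<le> octave" "octave \<le> h + real U / 2" using scaled_ln_lower[of U] scaled_ln_upper[of U] steps_real by (auto simp: h_def)
  then have "r * (h - real U) \<le> r * octave" "r * octave \<le> r * (h + real U / 2)" using r by (intro mult_left_mono; simp)+
  then have "r * h - r * real U \<le> r * octave" "r * octave \<le> r * h + r * real U / 2" by (auto simp: algebra_simps)
  moreover have "r * real U \<le> real U" using r steps_real by (simp add: mult_left_le_one_le)
  moreover have "r * h - real u \<le> real (scaled_ln U u)" "real (scaled_ln U u) \<le> r * h + real U / 2"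
    using scaled_ln_lower[of u] scaled_ln_upper[OF assms] ln by auto
  moreover have "real u \<le> real U" using assms by simp
  ultimately have "real (scaled_ln U u) - r * octave \<le> 2 * real U" "r * octave - real (scaled_ln U u) \<le> 2 * real U" using steps_real by linarith+
  then show ?thesis unfolding r_def[symmetric] by (simp add: abs_le_iff mult.commute)
qed

lemma val_add: "val (x + y) = val x * val y"
  by (simp add: val_def add_divide_distrib powr_add)

lemma val_mono: "x \<le> y \<Longrightarrow> val x \<le> val y"
  using octave_bounds by (simp add: val_def divide_right_mono)

lemma val_pos: "0 < val x"
  by (simp add: val_def)

lemma val_log: "0 < x \<Longrightarrow> val (octave * log 2 x) = x"
  using octave_bounds by (simp add: val_def)

lemma val_octaves: "val (real k * octave) = 2 ^ k"
  using octave_bounds by (simp add: val_def powr_realpow)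

text \<open>
  \<open>\<beta>\<close> bounds the relative error of one table lookup, and \<open>\<gamma>\<close> that of one squaring step, in which
  four lookup errors and the step width of the tables add up.
\<close>

definition \<beta> :: real where "\<beta> = val (2 * real U)"

definition \<gamma> :: real where "\<gamma> = \<beta> ^ 4 * (1 + 1 / real U)"

lemma \<beta>_ge_1: "1 \<le> \<beta>"
  unfolding \<beta>_def val_def using octave_bounds steps_real by (intro ge_one_powr_ge_zero) auto

lemma \<gamma>_ge: "\<beta>\<^sup>2 * (1 + 1 / real U) \<le> \<gamma>" "1 \<le> \<gamma>"
proof -
  have "\<beta>\<^sup>2 \<le> \<beta> ^ 4" using \<beta>_ge_1 by (intro power_increasing) auto
  then show "\<beta>\<^sup>2 * (1 + 1 / real U) \<le> \<gamma>" unfolding \<gamma>_def by (intro mult_right_mono) auto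
  moreover have "1 * 1 \<le> \<beta>\<^sup>2 * (1 + 1 / real U)" using \<beta>_ge_1 by (intro mult_mono one_le_power) auto
  ultimately show "1 \<le> \<gamma>" by linarith
qed

lemma \<gamma>_le: "\<gamma> \<le> exp (17 / real U)"
proof -
  have "2 * real U / octave \<le> 2 * real U / (real U * real U / 2)" using octave_bounds steps_real by (intro divide_left_mono) auto
  also have "\<dots> = 4 / real U" using steps_real by (simp add: field_simps)
  finally have "2 * real U / octave * ln 2 \<le> 4 / real U * 1" using ln_2_bounds by (intro mult_mono) auto
  then have "\<beta> \<le> exp (4 / real U)" by (simp add: \<beta>_def val_def powr_def)
  then have "\<beta> ^ 4 \<le> exp (4 / real U) ^ 4" using \<beta>_ge_1 by (intro power_mono) auto
  then have "\<gamma> \<le> exp (4 / real U) ^ 4 * exp (1 / real U)" unfolding \<gamma>_def using \<beta>_ge_1 by (intro mult_mono exp_ge_add_one_self) auto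
  also have "\<dots> = exp (17 / real U)" by (simp add: exp_of_nat_mult[symmetric] exp_add[symmetric] add_divide_distrib[symmetric])
  finally show ?thesis .
qed

lemma val_between:
  assumes "\<bar>y - octave * log 2 x\<bar> \<le> 2 * real U" "0 < x"
  shows "val y \<le> x * \<beta>" "x \<le> val y * \<beta>"
proof -
  have "val y \<le> val (octave * log 2 x + 2 * real U)" "val (octave * log 2 x) \<le> val (y + 2 * real U)"
    using assms(1) by (intro val_mono; linarith)+
  then show "val y \<le> x * \<beta>" "x \<le> val y * \<beta>" unfolding val_add val_log[OF assms(2)] \<beta>_def .
qed

lemma val_scaled_ln:
  assumes "u \<le> U"
  shows "val (real (scaled_ln U u)) \<le> (1 + real u / real U) * \<beta>" "1 + real u / real U \<le> val (real (scaled_ln U u)) * \<beta>"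
  using val_between[OF scaled_ln_log[OF assms]] steps_real by (simp_all add: add_pos_nonneg)

lemma val_scaled_ln_ratio:
  assumes "1 \<le> j" "j \<le> U"
  shows "val (- real (scaled_ln_ratio U j)) \<le> real j / real U * \<beta>" "real j / real U \<le> val (- real (scaled_ln_ratio U j)) * \<beta>"
proof -
  let ?s = "doublings j U"
  let ?y = "j * 2 ^ ?s - U"
  have y: "?y \<le> U" "real ?y = real j * 2 ^ ?s - real U"
    using doublings_ge[OF assms(1), of U] doublings_less_double[of j U] assms by (auto simp: of_nat_diff)
  have ratio: "- real (scaled_ln_ratio U j) = real (scaled_ln U ?y) - real ?s * octave"
    using scaled_ln_le_doublings[OF assms] by (simp add: scaled_ln_ratio_def of_nat_diff)
  have pos: "0 < real j / real U" using assms steps_real by simp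
  have "1 + real ?y / real U = real j / real U * 2 ^ ?s" using y(2) steps_real by (simp add: field_simps)
  then have "log 2 (1 + real ?y / real U) = log 2 (real j / real U) + real ?s"
    using log_mult_pos[OF pos, of "2 ^ ?s" 2] by (simp only: log_nat_power) simp
  then have "octave * log 2 (1 + real ?y / real U) = octave * log 2 (real j / real U) + real ?s * octave" by (simp add: algebra_simps)
  then have "\<bar>- real (scaled_ln_ratio U j) - octave * log 2 (real j / real U)\<bar> \<le> 2 * real U" using scaled_ln_log[OF y(1)] ratio by linarith
  from val_between[OF this pos] show "val (- real (scaled_ln_ratio U j)) \<le> real j / real U * \<beta>"
    "real j / real U \<le> val (- real (scaled_ln_ratio U j)) * \<beta>" .
qed

lemma scaled_ln_ratio_self: "scaled_ln_ratio U U = 0"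
  using doublings_le[of U U 0] by (simp add: scaled_ln_ratio_def scaled_ln_def)

lemma val_slack: "val (real (a + (scaled_ln U t + 4 * U))) = val (real a) * (val (real (scaled_ln U t)) * (\<beta> * \<beta>))"
proof -
  have "real (a + (scaled_ln U t + 4 * U)) = real a + (real (scaled_ln U t) + (2 * real U + 2 * real U))" by simp
  then show ?thesis by (simp only: val_add \<beta>_def)
qed

lemma candidate_sound:
  assumes t: "1 \<le> t" "t \<le> U" and "b + scaled_ln_ratio U t \<le> a"
  shows "val (real a) + val (real b) \<le> val (real (a + (scaled_ln U t + 4 * U)))"
proof -
  let ?A = "val (real a)"
  have A: "0 \<le> ?A" "?A * 1 \<le> ?A * \<beta>" using val_pos[of "real a"] \<beta>_ge_1 by auto
  have "real b \<le> real a + - real (scaled_ln_ratio U t)" using assms(3) by linarith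
  then have "val (real b) \<le> ?A * val (- real (scaled_ln_ratio U t))" using val_mono val_add by metis
  also have "\<dots> \<le> ?A * (real t / real U * \<beta>)" using val_scaled_ln_ratio(1)[OF t] A by (intro mult_left_mono) auto
  finally have "?A + val (real b) \<le> ?A * ((1 + real t / real U) * \<beta>)" using A by (simp add: algebra_simps)
  also have "\<dots> \<le> ?A * ((val (real (scaled_ln U t)) * \<beta>) * \<beta>)"
    using val_scaled_ln(2)[OF t(2)] \<beta>_ge_1 A by (intro mult_left_mono mult_right_mono) auto
  finally show ?thesis by (simp only: val_slack mult.assoc)
qed

lemma least_ratio_step:
  assumes "b \<le> a"
  obtains t where "t < U" "b + scaled_ln_ratio U (Suc t) \<le> a" "val (real a) * (real t / real U) \<le> \<beta> * val (real b)"
proof -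
  define t where "t = (LEAST t. b + scaled_ln_ratio U (Suc t) \<le> a)"
  have last: "b + scaled_ln_ratio U (Suc (U - 1)) \<le> a" using scaled_ln_ratio_self assms steps_ge by simp
  have t: "b + scaled_ln_ratio U (Suc t) \<le> a" "t \<le> U - 1"
    unfolding t_def using LeastI[of "\<lambda>t. b + scaled_ln_ratio U (Suc t) \<le> a", OF last] Least_le[of "\<lambda>t. b + scaled_ln_ratio U (Suc t) \<le> a", OF last] .
  then have "t < U" using steps_ge by linarith
  have "val (real a) * (real t / real U) \<le> \<beta> * val (real b)"
  proof (cases t)
    case 0
    then show ?thesis using val_pos[of "real b"] \<beta>_ge_1 by simp
  next
    case (Suc k)
    then have "\<not> b + scaled_ln_ratio U (Suc k) \<le> a" unfolding t_def by (intro not_less_Least) simp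
    then have "real a + - real (scaled_ln_ratio U t) \<le> real b" using Suc by simp
    then have le: "val (real a) * val (- real (scaled_ln_ratio U t)) \<le> val (real b)" using val_mono val_add by metis
    have "val (real a) * (real t / real U) \<le> val (real a) * (val (- real (scaled_ln_ratio U t)) * \<beta>)"
      using val_scaled_ln_ratio(2)[of t] Suc \<open>t < U\<close> val_pos[of "real a"] by (intro mult_left_mono) auto
    also have "\<dots> \<le> \<beta> * val (real b)" using mult_left_mono[OF le, of \<beta>] \<beta>_ge_1 by (simp add: algebra_simps)
    finally show ?thesis .
  qed
  with \<open>t < U\<close> t(1) show ?thesis by (rule that)
qed

lemma candidate_complete:
  assumes "b \<le> a"
  obtains t where "t < U" "b + scaled_ln_ratio U (Suc t) \<le> a"
    "val (real (a + (scaled_ln U (Suc t) + 4 * U))) \<le> \<gamma> * (val (real a) + val (real b))"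
proof -
  let ?A = "val (real a)" and ?B = "val (real b)" and ?\<delta> = "1 + 1 / real U"
  obtain t where t: "t < U" "b + scaled_ln_ratio U (Suc t) \<le> a" "?A * (real t / real U) \<le> \<beta> * ?B"
    using least_ratio_step[OF assms] .
  have pos: "0 < ?A" "0 < ?B" by (rule val_pos)+
  have "?A * (1 + real (Suc t) / real U) \<le> ?A * ?\<delta> + \<beta> * ?B" using t(3) by (simp add: algebra_simps add_divide_distrib)
  also have "\<dots> \<le> \<beta> * ?\<delta> * ?A + \<beta> * ?\<delta> * ?B"
  proof (rule add_mono)
    have "1 * ?\<delta> \<le> \<beta> * ?\<delta>" "\<beta> * 1 \<le> \<beta> * ?\<delta>" using \<beta>_ge_1 by (intro mult_mono; simp)+
    then show "?A * ?\<delta> \<le> \<beta> * ?\<delta> * ?A" "\<beta> * ?B \<le> \<beta> * ?\<delta> * ?B"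
      using pos by (auto simp: mult.commute[of ?A] intro!: mult_right_mono)
  qed
  finally have sum: "?A * (1 + real (Suc t) / real U) \<le> \<beta> * ?\<delta> * (?A + ?B)" by (simp add: algebra_simps)
  have "val (real (a + (scaled_ln U (Suc t) + 4 * U))) \<le> ?A * (((1 + real (Suc t) / real U) * \<beta>) * (\<beta> * \<beta>))"
    unfolding val_slack using val_scaled_ln(1)[of "Suc t"] t(1) pos \<beta>_ge_1 by (intro mult_left_mono mult_right_mono) auto
  also have "\<dots> = (\<beta> * \<beta> * \<beta>) * (?A * (1 + real (Suc t) / real U))" by simp
  also have "\<dots> \<le> (\<beta> * \<beta> * \<beta>) * (\<beta> * ?\<delta> * (?A + ?B))" using sum \<beta>_ge_1 by (intro mult_left_mono) auto
  also have "\<dots> = \<gamma> * (?A + ?B)" by (simp add: \<gamma>_def power4_eq_xxxx)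
  finally show ?thesis using t by (intro that)
qed

lemma unit_real: "(2::real) ^ (w - 1) = real U * real E" "E \<noteq> 0"
proof -
  show "(2::real) ^ (w - 1) = real U * real E" using unit_eq by (metis of_nat_mult of_nat_numeral of_nat_power)
  show "E \<noteq> 0" using unit_eq by (cases E) auto
qed

lemma mantissa_steps:
  assumes "U \<le> m div E" and m: "real m \<le> z * 2 ^ (w - 1)" "z * 2 ^ (w - 1) < real m + 1" and "1 \<le> z"
  shows "z \<le> 1 + real (m div E - U + 1) / real U" "1 + real (m div E - U + 1) / real U \<le> z * (1 + 1 / real U)"
proof -
  let ?u = "m div E - U + 1"
  have u: "real (m div E) + 1 = real U + real ?u" using assms(1) by (simp add: of_nat_diff)
  have "m + 1 \<le> (m div E + 1) * E" using dividend_less_div_times[of E m] unit_real(2) by (simp add: algebra_simps)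
  then have "real (m + 1) \<le> real ((m div E + 1) * E)" by (simp only: of_nat_le_iff)
  then have "real m + 1 \<le> (real U + real ?u) * real E" using u by (simp only: of_nat_add of_nat_mult of_nat_1)
  then have "z * real U * real E \<le> (real U + real ?u) * real E" using m(2) unfolding unit_real mult.assoc by linarith
  then have "z * real U \<le> real U + real ?u" using unit_real(2) by simp
  then show "z \<le> 1 + real ?u / real U" using steps_real by (simp add: field_simps)
  have "real (m div E) * real E \<le> real m" by (metis div_times_less_eq_dividend of_nat_le_iff of_nat_mult)
  then have "real (m div E) * real E \<le> z * real U * real E" using m(1) unfolding unit_real by simp
  then have "real (m div E) \<le> z * real U" using unit_real(2) by simp
  then have "(real U + real ?u) / real U \<le> (z * real U + 1) / real U" using u by (intro divide_right_mono) linarith+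
  then have "1 + real ?u / real U \<le> z + 1 / real U" using steps_real by (simp add: add_divide_distrib)
  also have "\<dots> \<le> z + z * (1 / real U)" using assms(4) by (simp add: divide_right_mono)
  finally show "1 + real ?u / real U \<le> z * (1 + 1 / real U)" by (simp add: algebra_simps)
qed

lemma val_encoded:
  assumes "1 \<le> x" and m: "m = fl_mantissa w x" "k = nat (fl_exponent x)"
  shows "x \<le> val (real (encoded R U E m k))" "val (real (encoded R U E m k)) \<le> \<gamma> * x"
proof -
  define z where "z = x / 2 ^ k"
  have x: "x = z * 2 ^ k" by (simp add: z_def)
  note mantissa = fl_mantissa_bounds[OF assms(1) width_ge x[unfolded m(2)], folded m]
  let ?u = "m div E - U + 1"
  note range = mantissa_div[OF unit_eq width_ge mantissa(3,4)]
  note steps = mantissa_steps[OF range(1) mantissa(1,2,5)]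
  have "m \<noteq> 0" using mantissa(3) by (metis le_zero_eq power_not_zero zero_neq_numeral)
  then have "real (encoded R U E m k) = real k * octave + (real (scaled_ln U ?u) + 2 * real U)" by (simp add: encoded_def)
  then have val: "val (real (encoded R U E m k)) = val (real (scaled_ln U ?u)) * \<beta> * 2 ^ k" by (simp only: val_add val_octaves \<beta>_def mult.commute)
  have "z \<le> val (real (scaled_ln U ?u)) * \<beta>" using steps(1) val_scaled_ln(2)[OF range(2)] by linarith
  then show "x \<le> val (real (encoded R U E m k))" unfolding val x by simp
  have "val (real (scaled_ln U ?u)) * \<beta> \<le> (z * (1 + 1 / real U) * \<beta>) * \<beta>"
    using val_scaled_ln(1)[OF range(2)] mult_right_mono[OF steps(2), of \<beta>] \<beta>_ge_1 by (intro mult_right_mono) linarith+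
  also have "\<dots> = (\<beta>\<^sup>2 * (1 + 1 / real U)) * z" by (simp add: power2_eq_square)
  also have "\<dots> \<le> \<gamma> * z" using \<gamma>_ge(1) mantissa(5) by (intro mult_right_mono) auto
  finally show "val (real (encoded R U E m k)) \<le> \<gamma> * x" unfolding val x by simp
qed

lemma least_scaled_ln_bounds:
  assumes u: "u \<le> U" "r \<le> scaled_ln U u" "\<And>u'. u' < u \<Longrightarrow> scaled_ln U u' < r"
  shows "val (real r) \<le> (1 + real u / real U) * \<beta>" "1 + real u / real U \<le> (1 + 1 / real U) * (val (real r) * \<beta>)"
proof -
  have "val (real r) \<le> val (real (scaled_ln U u))" using u(2) by (intro val_mono) simp
  also have "\<dots> \<le> (1 + real u / real U) * \<beta>" by (rule val_scaled_ln(1)[OF u(1)])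
  finally show "val (real r) \<le> (1 + real u / real U) * \<beta>" .
  show "1 + real u / real U \<le> (1 + 1 / real U) * (val (real r) * \<beta>)"
  proof (cases u)
    case 0
    have "val 0 \<le> val (real r)" by (rule val_mono) simp
    then have "1 * 1 * 1 \<le> (1 + 1 / real U) * (val (real r) * \<beta>)" unfolding mult.assoc using \<beta>_ge_1 by (intro mult_mono) (auto simp: val_def)
    then show ?thesis using 0 by simp
  next
    case (Suc k)
    have "val (real (scaled_ln U k)) \<le> val (real r)" using u(3)[of k] Suc by (intro val_mono) simp
    then have "1 + real k / real U \<le> val (real r) * \<beta>"
      using val_scaled_ln(2)[of k] u(1) Suc mult_right_mono[of "val (real (scaled_ln U k))" "val (real r)" \<beta>] \<beta>_ge_1 by linarith
    then have "(1 + 1 / real U) * (1 + real k / real U) \<le> (1 + 1 / real U) * (val (real r) * \<beta>)" by (intro mult_left_mono) auto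
    moreover have "(1 + 1 / real U) * (1 + real k / real U) = 1 + real u / real U + real k / (real U * real U)" using Suc by (simp add: algebra_simps add_divide_distrib)
    moreover have "0 \<le> real k / (real U * real U)" by simp
    ultimately show ?thesis by linarith
  qed
qed

lemma val_decoded:
  assumes d: "d < R" "decoded R U E d m x"
  shows "m \<noteq> 0" "val (real d) \<le> real m * 2 ^ x / 2 ^ (w - 1)" "real m * 2 ^ x / 2 ^ (w - 1) \<le> \<gamma> * val (real d)"
proof -
  let ?o = "real m * 2 ^ x / 2 ^ (w - 1)"
  define X where "X = (d + 2 * U) div scaled_ln U U"
  define r where "r = (d + 2 * U) mod scaled_ln U U"
  obtain u where u: "u \<le> U" "r \<le> scaled_ln U u" "\<And>u'. u' < u \<Longrightarrow> scaled_ln U u' < r"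
    "if u < U then m = (U + u) * E \<and> x = X else m = U * E \<and> x = X + 1"
    using d unfolding decoded_def X_def[symmetric] r_def[symmetric] by auto
  show "m \<noteq> 0" using u(4) unit_real(2) steps_ge by (auto split: if_splits)
  have out: "?o = (1 + real u / real U) * 2 ^ X"
    using u(1,4) unit_real(2) steps_real unfolding unit_real(1) by (auto split: if_splits simp: field_simps)
  have "X * scaled_ln U U + r = d + 2 * U" unfolding X_def r_def by (rule div_mult_mod_eq)
  then have "real X * octave + real r = real d + 2 * real U" by (metis of_nat_add of_nat_mult of_nat_numeral)
  then have val: "val (real d) * \<beta> = 2 ^ X * val (real r)" unfolding \<beta>_def val_add[symmetric] val_octaves[symmetric] by simp
  note bounds = least_scaled_ln_bounds[OF u(1-3)]
  have "val (real d) * \<beta> \<le> ?o * \<beta>" unfolding val out using bounds(1) by simp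
  then show "val (real d) \<le> ?o" by (rule mult_right_le_imp_le) (use \<beta>_ge_1 in simp)
  have "?o \<le> (1 + 1 / real U) * (val (real r) * \<beta>) * 2 ^ X" unfolding out using bounds(2) by (intro mult_right_mono zero_le_power zero_le_numeral)
  also have "\<dots> = (1 + 1 / real U) * ((2 ^ X * val (real r)) * \<beta>)" by (simp only: mult_ac)
  also have "\<dots> = (\<beta>\<^sup>2 * (1 + 1 / real U)) * val (real d)" unfolding val[symmetric] by (simp only: power2_eq_square mult_ac)
  also have "\<dots> \<le> \<gamma> * val (real d)" using \<gamma>_ge(1) val_pos[of "real d"] by (intro mult_right_mono) auto
  finally show "?o \<le> \<gamma> * val (real d)" .
qed

lemma squarings_sound:
  assumes G: "weighted_digraph n G"
    and D0: "\<And>i j. i < n \<Longrightarrow> j < n \<Longrightarrow> D0 i j < R \<Longrightarrow> distance n G i j \<le> ereal (val (real (D0 i j)))"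
    and "log_squarings n U l D0 D" "i < n" "j < n" "D i j < R"
  shows "distance n G i j \<le> ereal (val (real (D i j)))"
  using assms(3-)
proof (induction l arbitrary: D i j)
  case 0
  then show ?case using D0 by simp
next
  case (Suc l)
  from Suc.prems(1) obtain E where E: "log_squarings n U l D0 E"
    and step: "log_squared n U E D" by auto
  note IH = Suc.IH[OF E]
  note ij = Suc.prems(2,3)
  consider "D i j = E i j" | tr t k where "t < U" "k < n" "smaller tr E i j k + scaled_ln_ratio U (Suc t) \<le> larger tr E i j k"
      "D i j = larger tr E i j k + (scaled_ln U (Suc t) + 4 * U)"
    using step ij unfolding squared_def is_least_def candidates_def dominant_def by blast
  then show ?case
  proof cases
    case 1
    then show ?thesis using IH[OF ij] Suc.prems(4) by simp
  next
    case 2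
    have "larger tr E i j k < R" "smaller tr E i j k < R" using Suc.prems(4) 2(3,4) by linarith+
    then have "E i k < R" "E k j < R" by (auto simp: smaller_def larger_def split: if_splits)
    then have "distance n G i k \<le> ereal (val (real (E i k)))" "distance n G k j \<le> ereal (val (real (E k j)))"
      using IH ij 2(2) by blast+
    then have "distance n G i j \<le> ereal (val (real (E i k))) + ereal (val (real (E k j)))"
      using distance_triangle[OF G ij 2(2)] by (meson add_mono order_trans)
    also have "\<dots> = ereal (val (real (larger tr E i j k)) + val (real (smaller tr E i j k)))" by (simp add: smaller_def larger_def)
    also have "\<dots> \<le> ereal (val (real (D i j)))" unfolding 2(4) using candidate_sound[of "Suc t"] 2(1,3) by simp
    finally show ?thesis .
  qed
qed

lemma squared_le:
  assumes step: "log_squared n U D D'" and ij: "i < n" "j < n"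
  shows "D' i j \<le> D i j" "k < n \<Longrightarrow> val (real (D' i j)) \<le> \<gamma> * (val (real (D i k)) + val (real (D k j)))"
proof -
  show "D' i j \<le> D i j" using step ij unfolding squared_def is_least_def by blast
  assume "k < n"
  define tr where "tr \<longleftrightarrow> D i k \<le> D k j"
  let ?a = "larger tr D i j k" and ?b = "smaller tr D i j k"
  have "?b \<le> ?a" by (auto simp: tr_def smaller_def larger_def)
  then obtain t where t: "t < U" "?b + scaled_ln_ratio U (Suc t) \<le> ?a"
    "val (real (?a + (scaled_ln U (Suc t) + 4 * U))) \<le> \<gamma> * (val (real ?a) + val (real ?b))" by (rule candidate_complete)
  have "?a + (scaled_ln U (Suc t) + 4 * U) \<in> candidates tr D n (scaled_ln_ratio U) (\<lambda>t. scaled_ln U t + 4 * U) U i j"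
    using t(1,2) \<open>k < n\<close> unfolding candidates_def dominant_def by blast
  then have "D' i j \<le> ?a + (scaled_ln U (Suc t) + 4 * U)" using step ij unfolding squared_def is_least_def by (cases tr) auto
  then have "val (real (D' i j)) \<le> val (real (?a + (scaled_ln U (Suc t) + 4 * U)))" by (intro val_mono) (simp only: of_nat_le_iff)
  also note t(3)
  also have "val (real ?a) + val (real ?b) = val (real (D i k)) + val (real (D k j))" by (simp add: smaller_def larger_def)
  finally show "val (real (D' i j)) \<le> \<gamma> * (val (real (D i k)) + val (real (D k j)))" .
qed

lemma squarings_complete:
  assumes G: "weighted_digraph n G" and D0: "\<And>i j x. i < n \<Longrightarrow> j < n \<Longrightarrow> G i j = ereal x \<Longrightarrow> val (real (D0 i j)) \<le> \<gamma> * x"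
    and "log_squarings n U l D0 D" "p \<in> walks n i j" "2 \<le> length p" "length p \<le> Suc (2 ^ l)" "walk_weight G p = ereal x"
  shows "val (real (D i j)) \<le> \<gamma> ^ Suc l * x"
  using assms(3-)
proof (induction l arbitrary: D i j p x)
  case 0
  then have "length p = 2" by simp
  then obtain u v where "p = [u, v]" by (auto simp: numeral_2_eq_2 length_Suc_conv)
  then show ?case using 0 D0[of i j x] by (auto simp: walks_def)
next
  case (Suc l)
  from Suc.prems(1) obtain E where E: "log_squarings n U l D0 E"
    and step: "log_squared n U E D" by auto
  note IH = Suc.IH[OF E]
  note p = Suc.prems(2-5)
  have nodes: "set p \<subseteq> {..<n}" using p(1) by (simp add: walks_def)
  then have ij: "i < n" "j < n" using p(1) hd_in_set[of p] last_in_set[of p] by (auto simp: walks_def)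
  show ?case
  proof (cases "length p \<le> Suc (2 ^ l)")
    case True
    have "val (real (D i j)) \<le> val (real (E i j))" using squared_le(1)[OF step ij] by (intro val_mono) simp
    also have "\<dots> \<le> \<gamma> ^ Suc l * x" by (rule IH[OF p(1,2) True p(4)])
    also have "\<dots> \<le> \<gamma> ^ Suc (Suc l) * x"
      using \<gamma>_ge(2) walk_weight_nonneg[OF G nodes] p(4) by (intro mult_right_mono power_increasing) auto
    finally show ?thesis .
  next
    case False
    obtain k q r y z where "k < n" and q: "q \<in> walks n i k" "2 \<le> length q" "length q \<le> Suc (2 ^ l)" "walk_weight G q = ereal y"
      and r: "r \<in> walks n k j" "2 \<le> length r" "length r \<le> Suc (2 ^ l)" "walk_weight G r = ereal z" and x: "x = y + z"
      by (rule walk_halves[OF G p(1) _ _ p(4), of "2 ^ l"]) (use False p(3) in auto)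
    have "val (real (D i j)) \<le> \<gamma> * (val (real (E i k)) + val (real (E k j)))" by (rule squared_le(2)[OF step ij \<open>k < n\<close>])
    also have "\<dots> \<le> \<gamma> * (\<gamma> ^ Suc l * y + \<gamma> ^ Suc l * z)" using IH[OF q] IH[OF r] \<gamma>_ge(2) by (intro mult_left_mono add_mono) auto
    also have "\<dots> = \<gamma> ^ Suc (Suc l) * x" by (simp add: x algebra_simps)
    finally show ?thesis .
  qed
qed

end

locale apsp_solver = solver w P W R ws n Lq F AT e input for w P W R ws n Lq F AT e input +
  fixes H :: "nat \<Rightarrow> nat \<Rightarrow> ereal" and \<epsilon> :: real
  assumes graph: "weighted_digraph n H" and eps: "1 / 2 ^ e \<le> \<epsilon>" "\<epsilon> < 1 / 10"
    and input_encodes: "\<And>i j. i < n \<Longrightarrow> j < n \<Longrightarrow> (input (2 * (i * n + j)), input (2 * (i * n + j) + 1)) = fl_encode w (H i j)"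
    and code_range: "real U * real U * (1 + log 2 (real n * max_weight n H)) < real R"
begin

sublocale log_scale U E w
  by standard (rule U_bounds(3), rule unit_bounds(1), rule unit_bounds(4))

lemma \<gamma>_power: "\<gamma> ^ Suc L * \<gamma> \<le> 1 + \<epsilon>"
proof -
  define y where "y = 17 * real (L + 2) / real U"
  have "L + 2 \<le> 2 ^ doublings 1 (L + 2)" using doublings_ge[of 1 "L + 2"] by simp
  then have "real (L + 2) \<le> real (2 ^ doublings 1 (L + 2))" by (simp only: of_nat_le_iff)
  then have "real (L + 2) * 64 * 2 ^ e \<le> real U" unfolding U_eq by (simp add: mult.commute)
  then have "y \<le> 17 / 64 * (1 / 2 ^ e)" using steps_real by (simp add: y_def field_simps)
  moreover have "0 \<le> y" "0 < 1 / (2::real) ^ e" by (simp_all add: y_def)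
  ultimately have y: "0 \<le> y" "y \<le> \<epsilon> / 2" "y \<le> 1 / 20" using eps by linarith+
  have "\<gamma> ^ (L + 2) \<le> exp (17 / real U) ^ (L + 2)" using \<gamma>_le \<gamma>_ge(2) by (intro power_mono) auto
  also have "\<dots> = exp y" by (simp only: exp_of_nat_mult[symmetric]) (simp add: y_def algebra_simps)
  also have "\<dots> \<le> 1 + y + y\<^sup>2" using y by (intro exp_bound) auto
  also have "\<dots> \<le> 1 + y + y * 1" using y by (simp add: power2_eq_square mult_left_le)
  finally show ?thesis using y by (simp add: mult_ac)
qed

lemma \<gamma>_power_le_2: "\<gamma> ^ Suc L \<le> 2"
proof -
  have "\<gamma> ^ Suc L * 1 \<le> \<gamma> ^ Suc L * \<gamma>" using \<gamma>_ge(2) by (intro mult_left_mono) auto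
  then show ?thesis using \<gamma>_power eps(2) by linarith
qed

lemma val_input_dist:
  assumes "i < n" "j < n" "H i j = ereal x"
  shows "x \<le> val (real (input_dist i j))" "val (real (input_dist i j)) \<le> \<gamma> * x"
proof -
  have "1 \<le> x" by (rule weighted_digraph_cases[OF graph assms(1,2)]) (use assms(3) in auto)
  have "input (2 * (i * n + j)) = fl_mantissa w x" "input (2 * (i * n + j) + 1) = nat (fl_exponent x)"
    using input_encodes[OF assms(1,2)] assms(3) by (auto simp: fl_encode_def)
  from val_encoded[OF \<open>1 \<le> x\<close> this] show "x \<le> val (real (input_dist i j))" "val (real (input_dist i j)) \<le> \<gamma> * x"
    unfolding input_dist_def .
qed

lemma input_dist_sound:
  assumes ij: "i < n" "j < n" and "input_dist i j < R"
  shows "distance n H i j \<le> ereal (val (real (input_dist i j)))"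
proof (rule weighted_digraph_cases[OF graph ij])
  assume "H i j = \<infinity>"
  then have "input_dist i j = R" using input_encodes[OF ij] by (simp add: input_dist_def encoded_def fl_encode_def)
  then show ?thesis using assms(3) by simp
next
  fix x assume x: "H i j = ereal x"
  have "distance n H i j \<le> ereal x" using distance_le[OF edge_in_walks[OF ij], of H] x by simp
  also have "\<dots> \<le> ereal (val (real (input_dist i j)))" using val_input_dist(1)[OF ij x] by simp
  finally show ?thesis .
qed

lemma val_le_distance:
  assumes sq: "log_squarings n U L input_dist D" and ij: "i < n" "j < n" "i \<noteq> j" and x: "distance n H i j = ereal x"
  shows "val (real (D i j)) \<le> \<gamma> ^ Suc L * x" "0 \<le> x" "x \<le> real n * max_weight n H"
proof -
  obtain p where p: "p \<in> walks n i j" "length p \<le> n" "walk_weight H p = ereal x"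
    using distance_attained[OF graph ij(1,2)] unfolding x .
  then have nodes: "set p \<subseteq> {..<n}" and "p \<noteq> []" "hd p = i" "last p = j" by (auto simp: walks_def)
  then have "2 \<le> length p" using ij(3) by (cases p; cases "tl p") auto
  moreover have "length p \<le> Suc (2 ^ L)" using p(2) doublings_ge[of 1 n] by (simp add: levels_def)
  ultimately show "val (real (D i j)) \<le> \<gamma> ^ Suc L * x" using val_input_dist(2) p sq by (intro squarings_complete[OF graph])
  show "0 \<le> x" using walk_weight_nonneg[OF graph nodes] p(3) by simp
  have "x \<le> real (length p - 1) * max_weight n H" by (rule walk_weight_le_max[OF graph nodes p(3)])
  also have "\<dots> \<le> real n * max_weight n H" using p(2) max_weight_ge(2)[of n H] by (intro mult_right_mono) auto
  finally show "x \<le> real n * max_weight n H" .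
qed

lemma unreachable:
  assumes sq: "log_squarings n U L input_dist D" and ij: "i < n" "j < n" "i \<noteq> j" and "R \<le> D i j"
  shows "distance n H i j = \<infinity>"
proof (rule ccontr)
  let ?M = "real n * max_weight n H"
  assume "distance n H i j \<noteq> \<infinity>"
  then obtain x where "distance n H i j = ereal x" using distance_nonneg[OF graph, of i j] by (cases "distance n H i j") auto
  note x = val_le_distance[OF sq ij this]
  have M: "1 * 1 \<le> ?M" using n_ge_1 max_weight_ge(2)[of n H] by (intro mult_mono) auto
  have "val (real R) \<le> val (real (D i j))" using assms(5) by (intro val_mono) simp
  also have "\<dots> \<le> \<gamma> ^ Suc L * x" by (rule x(1))
  also have "\<dots> \<le> 2 * ?M" using \<gamma>_power_le_2 x(2,3) by (intro mult_mono) auto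
  finally have "real R / octave \<le> log 2 (2 * ?M)" using M by (subst le_log_iff) (auto simp: val_def)
  also have "\<dots> = 1 + log 2 ?M" using M by (subst log_mult_pos) auto
  finally have "real R \<le> octave * (1 + log 2 ?M)" using octave_bounds by (simp add: field_simps)
  also have "\<dots> \<le> real U * real U * (1 + log 2 ?M)"
  proof (rule mult_right_mono)
    show "octave \<le> real U * real U" using scaled_ln_le_square[of U] by (metis of_nat_le_iff of_nat_mult order_refl)
    show "0 \<le> 1 + log 2 ?M" using M zero_le_log_cancel_iff[of 2 ?M] by linarith
  qed
  finally show False using code_range by simp
qed

lemma output_accurate:
  assumes sq: "log_squarings n U L input_dist D" and ij: "i < n" "j < n" and out: "output_ok (D i j) i j m x"
  shows "distance n H i j \<le> fl_decode w (m, x)" "fl_decode w (m, x) \<le> ereal (1 + \<epsilon>) * distance n H i j"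
proof -
  have "0 < \<epsilon>" using eps(1) by (rule less_le_trans[rotated]) simp
  have "distance n H i j \<le> fl_decode w (m, x) \<and> fl_decode w (m, x) \<le> ereal (1 + \<epsilon>) * distance n H i j"
  proof (cases "i = j")
    case True
    then show ?thesis using out distance_self[OF graph ij(1)] by (simp add: output_ok_def fl_decode_def)
  next
    case ne: False
    then have decoded: "decoded R U E (D i j) m x" using out by (simp add: output_ok_def)
    show ?thesis
    proof (cases "R \<le> D i j")
      case True
      then show ?thesis using unreachable[OF sq ij ne] decoded \<open>0 < \<epsilon>\<close> by (simp add: decoded_def fl_decode_def)
    next
      case False
      then have "D i j < R" by simp
      let ?o = "real m * 2 ^ x / 2 ^ (w - 1)"
      note val = val_decoded[OF \<open>D i j < R\<close> decoded]
      have lower: "distance n H i j \<le> ereal (val (real (D i j)))"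
        using \<open>D i j < R\<close> input_dist_sound by (intro squarings_sound[OF graph _ sq ij])
      have "ereal ?o \<le> ereal (1 + \<epsilon>) * distance n H i j"
      proof (cases "distance n H i j")
        case (real y)
        note y = val_le_distance[OF sq ij ne real]
        have "?o \<le> \<gamma> * val (real (D i j))" by (rule val(3))
        also have "\<dots> \<le> \<gamma> * (\<gamma> ^ Suc L * y)" using y(1) \<gamma>_ge(2) by (intro mult_left_mono) auto
        also have "\<dots> = (\<gamma> ^ Suc L * \<gamma>) * y" by simp
        also have "\<dots> \<le> (1 + \<epsilon>) * y" using \<gamma>_power y(2) by (rule mult_right_mono)
        finally show ?thesis using real by simp
      qed (use lower distance_nonneg[OF graph, of i j] in auto)
      then show ?thesis using val(1,2) order_trans[OF lower, of "ereal ?o"] by (simp add: fl_decode_def)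
    qed
  qed
  then show "distance n H i j \<le> fl_decode w (m, x)" "fl_decode w (m, x) \<le> ereal (1 + \<epsilon>) * distance n H i j" by blast+
qed

end

section \<open>Running time\<close>

lemma doublings_le_log:
  assumes "1 \<le> x"
  shows "real (doublings 1 x) \<le> 1 + log 2 (real x)"
proof -
  have "1 * 2 ^ doublings 1 x < 2 * x" using assms by (intro doublings_less_double)
  then have "real (2 ^ doublings 1 x) < real (2 * x)" by (simp only: mult_1 of_nat_less_iff)
  then have "2 powr real (doublings 1 x) \<le> 2 * real x" by (simp add: powr_realpow)
  then have "real (doublings 1 x) \<le> log 2 (2 * real x)" using assms by (subst le_log_iff) auto
  then show ?thesis using assms by (simp add: log_mult_pos)
qed

lemma num_blocks_bounds:
  assumes "1 \<le> q" "n \<le> q * q"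
  shows "num_blocks n q \<le> 2 * q" "num_blocks n q * q \<le> n + q"
proof -
  have "n div q \<le> q * q div q" using assms(2) by (rule div_le_mono)
  then show "num_blocks n q \<le> 2 * q" using assms(1) by (simp add: num_blocks_def)
  have "n div q * q \<le> n" by simp
  then show "num_blocks n q * q \<le> n + q" by (simp add: num_blocks_def)
qed

lemma all_group_ticks_le:
  assumes "1 \<le> n" "1 \<le> q" "n \<le> q * q"
  shows "num_blocks n q * Suc (group_ticks n q) \<le> 30 * (n * n * q) + 2 * (n * q * q)"
proof -
  let ?b = "num_blocks n q"
  note b = num_blocks_bounds[OF assms(2,3)]
  have "n * (n + 1) = n * n + n" "n \<le> n * n" "1 \<le> n * n" using assms(1) by auto
  then have "1 + n + 6 * (n * (n + 1)) \<le> 14 * (n * n)" by linarith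
  then have "?b * (1 + n + 6 * (n * (n + 1))) \<le> (2 * q) * (14 * (n * n))" using b by (intro mult_le_mono) auto
  moreover have "?b * q * (n + n * q) \<le> (n + q) * (2 * (n * q))" using b assms(2) by (intro mult_le_mono) auto
  moreover have "?b * Suc (group_ticks n q) = ?b * (1 + n + 6 * (n * (n + 1))) + ?b * q * (n + n * q)"
    unfolding group_ticks_def by (simp add: algebra_simps)
  ultimately show ?thesis by (simp add: algebra_simps)
qed

lemma attempt_ticks_le:
  assumes "1 \<le> n" "1 \<le> q" "n \<le> q * q"
  shows "attempt_ticks n q \<le> 44 * (n * n * q) + 2 * (n * q * q)"
proof -
  let ?b = "num_blocks n q"
  have b: "?b \<le> 2 * q" "?b + q + 1 \<le> 4 * q" using num_blocks_bounds(1)[OF assms(2,3)] assms(2) by linarith+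
  have "n * ?b * (n + 1) \<le> n * (2 * q) * (2 * n)" using b assms by (intro mult_le_mono) auto
  moreover have "n * (n * (?b + q + 1)) \<le> n * (n * (4 * q))" using b by (intro mult_le_mono) auto
  moreover have "n * 1 * 1 \<le> n * n * q" using assms by (intro mult_le_mono) auto
  moreover have "n * (2 * q) * (2 * n) = 4 * (n * n * q)" "n * (n * (4 * q)) = 4 * (n * n * q)"
    "n * (n * (?b + q + 1) + 1) = n * (n * (?b + q + 1)) + n" by simp_all
  ultimately show ?thesis using all_group_ticks_le[OF assms] unfolding attempt_ticks_def by linarith
qed

lemma attempt_ticks_le_sqrt:
  assumes "1 \<le> n" "1 \<le> q" "n \<le> q * q" "n * q * q \<le> 4 * Lq"
  shows "real (attempt_ticks n q) \<le> 44 * sqrt (4 * (real n ^ 3 * real Lq)) + 8 * real Lq"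
proof -
  have q: "real n * real q * real q \<le> 4 * real Lq" using assms(4) by (metis of_nat_le_iff of_nat_mult of_nat_numeral)
  have "(real n * real n * real q)\<^sup>2 = real n ^ 3 * (real n * real q * real q)" by (simp add: power2_eq_square power3_eq_cube)
  also have "\<dots> \<le> real n ^ 3 * (4 * real Lq)" using q by (rule mult_left_mono) simp
  finally have "real n * real n * real q \<le> sqrt (4 * (real n ^ 3 * real Lq))" by (intro real_le_rsqrt) simp
  moreover have "real (attempt_ticks n q) \<le> real (44 * (n * n * q) + 2 * (n * q * q))" using attempt_ticks_le[OF assms(1-3)] by (simp only: of_nat_le_iff)
  ultimately show ?thesis using q by simp
qed

locale solver_cost = solver w P W R ws n Lq F AT e input for w P W R ws n Lq F AT e input +
  fixes l T \<epsilon> c1 c2 :: real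
  assumes l_ge_1: "1 \<le> l" and eps: "0 < \<epsilon>" "\<epsilon> < 1" and n_sq_le: "real n * real n \<le> T" and factors: "1 \<le> c1" "1 \<le> c2"
    and U_le: "real U \<le> 1280 * l / \<epsilon>" and exponent_le: "real (steps_exponent n e) \<le> 12 * l"
    and L_le: "real L + 2 \<le> 5 * l" and F_le: "real F + 1 \<le> c1 * l" and AT_le: "real AT + 1 \<le> c2 * T"
begin

definition Z :: real where "Z = T / \<epsilon>"

lemma T_bounds: "real n \<le> T" "1 \<le> T" "1 \<le> Z"
proof -
  have n: "1 \<le> real n" using n_ge_1 by simp
  then have "real n * 1 \<le> real n * real n" by (intro mult_left_mono) auto
  then show "real n \<le> T" "1 \<le> T" using n_sq_le n by linarith+
  then show "1 \<le> Z" using eps by (simp add: Z_def field_simps)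
qed

lemma monomials: "T \<le> l * T" "l * T \<le> l ^ 2 * Z" "l \<le> l * T"
proof -
  have "T * \<epsilon> \<le> T * 1" using T_bounds eps by (intro mult_left_mono) auto
  then have "T \<le> Z" using eps by (simp add: Z_def field_simps)
  moreover have "l \<le> l ^ 2" using l_ge_1 power_increasing[of 1 2 l] by auto
  ultimately show "l * T \<le> l ^ 2 * Z" using l_ge_1 T_bounds by (intro mult_mono) auto
  show "T \<le> l * T" "l \<le> l * T" using mult_right_mono[OF l_ge_1, of T] mult_left_mono[OF T_bounds(2), of l] T_bounds l_ge_1 by simp_all
qed

lemma le_cube: "x \<le> y * (l ^ 2 * Z) \<Longrightarrow> 0 \<le> y \<Longrightarrow> x \<le> y * (l ^ 3 * Z)"
  using l_ge_1 T_bounds(3) by (elim order_trans) (intro mult_left_mono mult_right_mono power_increasing, auto)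

lemma times_U_le:
  assumes "0 \<le> x" "x \<le> y * (l * T)"
  shows "real U * x \<le> 1280 * y * (l ^ 2 * Z)"
proof -
  have "real U * x \<le> (1280 * l / \<epsilon>) * (y * (l * T))" using U_le assms l_ge_1 eps by (intro mult_mono) auto
  also have "\<dots> = 1280 * y * (l ^ 2 * Z)" by (simp add: Z_def power2_eq_square)
  finally show ?thesis .
qed

lemma half_square_ticks_le: "real (half_square_ticks (2 * L) U) \<le> (1280 * (c1 * c2) + 3878) * (l ^ 2 * Z)"
proof -
  have "(real F + 1) * (real AT + 1) \<le> (c1 * l) * (c2 * T)"
    using F_le AT_le factors l_ge_1 T_bounds by (intro mult_mono) auto
  then have "real dominance_ticks \<le> c1 * c2 * (l * T)" by (simp add: dominance_ticks_def algebra_simps)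
  then have "1 + real dominance_ticks + (real n * real n + real n) \<le> (c1 * c2 + 3) * (l * T)"
    using n_sq_le T_bounds monomials(1) by (simp only: distrib_right)
  then have products: "real U * (1 + real dominance_ticks + (real n * real n + real n)) \<le> 1280 * (c1 * c2 + 3) * (l ^ 2 * Z)"
    by (intro times_U_le) auto
  have "(1 + 2 * real L) * (1 + 2 * (real n * real n)) \<le> (11 * l) * (3 * T)"
    using L_le l_ge_1 n_sq_le T_bounds by (intro mult_mono) auto
  moreover have "real (half_square_ticks (2 * L) U) = 3 * (real n * real n) + 2 * real n + (1 + 2 * real L) * (1 + 2 * (real n * real n)) +
      real U * (1 + real dominance_ticks + (real n * real n + real n))"
    unfolding half_square_ticks_def by (simp add: algebra_simps)
  ultimately have "real (half_square_ticks (2 * L) U) \<le> 38 * (l ^ 2 * Z) + 1280 * (c1 * c2 + 3) * (l ^ 2 * Z)"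
    using products n_sq_le T_bounds monomials by linarith
  then show ?thesis by (simp add: algebra_simps)
qed

lemma squaring_ticks_le:
  "real (L * Suc (2 * (n * (n + 1)) + 2 * half_square_ticks (2 * L) U)) \<le> (12800 * (c1 * c2) + 38805) * (l ^ 3 * Z)"
proof -
  have "real (Suc (2 * (n * (n + 1)) + 2 * half_square_ticks (2 * L) U)) = 1 + 2 * (real n * real n) + 2 * real n + 2 * real (half_square_ticks (2 * L) U)"
    by (simp add: algebra_simps)
  then have "real (Suc (2 * (n * (n + 1)) + 2 * half_square_ticks (2 * L) U)) \<le> 5 * (l ^ 2 * Z) + 2 * ((1280 * (c1 * c2) + 3878) * (l ^ 2 * Z))"
    using half_square_ticks_le n_sq_le T_bounds monomials by linarith
  then have "real L * real (Suc (2 * (n * (n + 1)) + 2 * half_square_ticks (2 * L) U))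
      \<le> (5 * l) * (5 * (l ^ 2 * Z) + 2 * ((1280 * (c1 * c2) + 3878) * (l ^ 2 * Z)))"
    using L_le l_ge_1 by (intro mult_mono) auto
  also have "\<dots> = (12800 * (c1 * c2) + 38805) * (l ^ 3 * Z)" by (simp add: algebra_simps power2_eq_square power3_eq_cube)
  finally show ?thesis by (simp only: of_nat_mult)
qed

lemma init_ticks_le: "real init_ticks \<le> 17926 * (l ^ 3 * Z)"
proof -
  have "l * 1 \<le> l * T" using T_bounds l_ge_1 by (intro mult_left_mono) auto
  then have "real U * (real (steps_exponent n e) + 2) \<le> 1280 * 14 * (l ^ 2 * Z)"
    using exponent_le l_ge_1 by (intro times_U_le) linarith+
  moreover have "real init_ticks = real n + 2 + real L + real U * (real (steps_exponent n e) + 2)"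
    unfolding init_ticks_def by (simp add: algebra_simps)
  ultimately have "real init_ticks \<le> 17926 * (l ^ 2 * Z)" using T_bounds monomials L_le l_ge_1 by linarith
  then show ?thesis by (rule le_cube) simp
qed

lemma decode_ticks_le: "real (n * (n * (U + 1) + 1)) \<le> 1282 * (l ^ 3 * Z)"
proof -
  have "real U * (real n * real n) \<le> 1280 * (l ^ 2 * Z)" using times_U_le[of "real n * real n" 1] n_sq_le monomials(1) by simp
  moreover have "real (n * (n * (U + 1) + 1)) = real U * (real n * real n) + real n * real n + real n" by (simp add: algebra_simps)
  ultimately have "real (n * (n * (U + 1) + 1)) \<le> 1282 * (l ^ 2 * Z)" using n_sq_le T_bounds monomials by linarith
  then show ?thesis by (rule le_cube) simp
qed

lemma main_ticks_le: "real main_ticks \<le> (12800 * (c1 * c2) + 58015) * (T / \<epsilon> * l ^ 3)"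
proof -
  have "real main_ticks = real init_ticks + (real n * real n + real n) +
      real (L * Suc (2 * (n * (n + 1)) + 2 * half_square_ticks (2 * L) U)) + real (n * (n * (U + 1) + 1))"
    unfolding main_ticks_def by (simp only: of_nat_add of_nat_mult of_nat_1 distrib_left mult_1_right)
  moreover have "real n * real n + real n \<le> 2 * (l ^ 2 * Z)" using n_sq_le T_bounds monomials by linarith
  then have "real n * real n + real n \<le> 2 * (l ^ 3 * Z)" by (rule le_cube) simp
  ultimately have "real main_ticks \<le> 17926 * (l ^ 3 * Z) + 2 * (l ^ 3 * Z) + (12800 * (c1 * c2) + 38805) * (l ^ 3 * Z) + 1282 * (l ^ 3 * Z)"
    using init_ticks_le squaring_ticks_le decode_ticks_le by linarith
  then show ?thesis unfolding Z_def by (simp add: algebra_simps)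
qed

end

section \<open>Shortest paths from matrix multiplication\<close>

locale matmul_program =
  fixes P :: prog and C0 c0 \<tau> :: real
  assumes c0_pos: "0 < c0" and exponent: "2 \<le> \<tau>" "\<tau> \<le> 3"
    and multiplication: "\<And>n w K A B s. 1 \<le> n \<Longrightarrow> (\<forall>i<n. \<forall>j<n. A i j \<le> K \<and> B i j \<le> K) \<Longrightarrow>
      c0 * log 2 (real n + real K + 1) \<le> real w \<Longrightarrow> matmul_input w n A B s \<Longrightarrow>
      \<exists>s'. halts_within w P (C0 * real n powr \<tau>) s s' \<and> matmul_output n (\<lambda>i j. \<Sum>k<n. A i k * B k j) s'"
begin

definition matmul_const :: nat where "matmul_const = nat \<lceil>max C0 1\<rceil>"

definition \<kappa> :: real where "\<kappa> = 54 * real matmul_const"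

definition range_const :: nat where "range_const = 10 ^ 11 * matmul_const"

definition word_factor :: real where "word_factor = real (4 * (8 + range_const) + 4) + 4 * c0 + 4"

definition depth_factor :: real where "depth_factor = 8 + log 2 \<kappa>"

definition attempt_factor :: real where "attempt_factor = 98 * \<kappa>"

definition tick_factor :: real where "tick_factor = 12800 * (depth_factor * attempt_factor) + 58015"

definition time_factor :: real where "time_factor = 8 + real (step_factor P main) * (tick_factor + 1)"

definition matmul_ticks :: "nat \<Rightarrow> nat" where
  "matmul_ticks n = matmul_const * nat \<lceil>real (3 * n) powr \<tau>\<rceil>"

definition attempt_limit :: "nat \<Rightarrow> nat" where
  "attempt_limit n = nat \<lceil>44 * sqrt (4 * (real n ^ 3 * real (matmul_ticks n))) + 8 * real (matmul_ticks n)\<rceil>"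

definition work :: "nat \<Rightarrow> real" where
  "work n = real n powr ((\<tau> + 3) / 2)"

lemma matmul_const_ge: "C0 \<le> real matmul_const" "1 \<le> real matmul_const"
  unfolding matmul_const_def by linarith+

lemma \<kappa>_ge: "54 \<le> \<kappa>"
  using matmul_const_ge by (simp add: \<kappa>_def)

lemma factors_ge_1: "1 \<le> depth_factor" "1 \<le> attempt_factor"
  using \<kappa>_ge zero_le_log_cancel_iff[of 2 \<kappa>] by (auto simp: depth_factor_def attempt_factor_def)

context
  fixes n :: nat
  assumes n_ge_1: "1 \<le> n"
begin

lemma n_real: "1 \<le> real n" "1 \<le> real n * real n"
  using n_ge_1 mult_mono[of 1 "real n" 1 "real n"] by simp_all

lemma dim_powr_bounds: "real n * real n \<le> real (3 * n) powr \<tau>" "real (3 * n) powr \<tau> \<le> 27 * real n powr \<tau>"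
proof -
  have "real n * real n \<le> real (3 * n) powr 2" using n_real by (simp add: powr_numeral power2_eq_square)
  also have "\<dots> \<le> real (3 * n) powr \<tau>" using exponent n_real by (intro powr_mono) auto
  finally show "real n * real n \<le> real (3 * n) powr \<tau>" .
  have "(3::real) powr \<tau> \<le> 3 powr 3" using exponent by (intro powr_mono) auto
  then show "real (3 * n) powr \<tau> \<le> 27 * real n powr \<tau>" by (simp add: powr_mult powr_numeral mult_right_mono)
qed

lemma matmul_ticks_ge: "C0 * real (3 * n) powr \<tau> \<le> real (matmul_ticks n)" "n * n \<le> matmul_ticks n" "1 \<le> matmul_ticks n"
proof -
  let ?y = "real (3 * n) powr \<tau>"
  have y: "1 \<le> ?y" "?y \<le> real (nat \<lceil>?y\<rceil>)" using dim_powr_bounds(1) n_real by linarith+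
  have "x * ?y \<le> real (matmul_ticks n)" if "x \<le> real matmul_const" for x
    unfolding matmul_ticks_def of_nat_mult using that y matmul_const_ge by (intro mult_mono) auto
  from this[of C0] this[of 1] show "C0 * ?y \<le> real (matmul_ticks n)" and "n * n \<le> matmul_ticks n" "1 \<le> matmul_ticks n"
    using matmul_const_ge dim_powr_bounds(1) y(1) by (auto simp del: of_nat_mult simp add: of_nat_mult[symmetric])
qed

lemma matmul_ticks_le: "real (matmul_ticks n) \<le> \<kappa> * real n powr \<tau>" "real (matmul_ticks n) \<le> \<kappa> * real n ^ 3"
proof -
  have "real (nat \<lceil>real (3 * n) powr \<tau>\<rceil>) \<le> 54 * real n powr \<tau>" using dim_powr_bounds n_real by linarith
  then have "real matmul_const * real (nat \<lceil>real (3 * n) powr \<tau>\<rceil>) \<le> real matmul_const * (54 * real n powr \<tau>)" by (rule mult_left_mono) simp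
  then show le: "real (matmul_ticks n) \<le> \<kappa> * real n powr \<tau>" by (simp add: matmul_ticks_def \<kappa>_def)
  have "real n powr \<tau> \<le> real n powr 3" using exponent n_real by (intro powr_mono) auto
  then have "\<kappa> * real n powr \<tau> \<le> \<kappa> * real n ^ 3" using \<kappa>_ge n_real by (intro mult_left_mono) (auto simp: powr_numeral)
  with le show "real (matmul_ticks n) \<le> \<kappa> * real n ^ 3" by linarith
qed

lemma work_bounds: "real n * real n \<le> work n" "real n powr \<tau> \<le> work n" "(work n)\<^sup>2 = real n ^ 3 * real n powr \<tau>"
proof -
  have "real n powr 2 \<le> work n" unfolding work_def using exponent n_real by (intro powr_mono) auto
  then show "real n * real n \<le> work n" using n_real by (simp add: powr_numeral power2_eq_square)
  show "real n powr \<tau> \<le> work n" unfolding work_def using exponent n_real by (intro powr_mono) auto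
  have "(work n)\<^sup>2 = real n powr (\<tau> + 3)" unfolding work_def by (simp add: power2_eq_square powr_add[symmetric])
  also have "\<dots> = real n powr \<tau> * real n powr 3" by (rule powr_add)
  finally show "(work n)\<^sup>2 = real n ^ 3 * real n powr \<tau>" using n_real by (simp add: powr_numeral)
qed

lemma attempt_limit_le: "real (attempt_limit n) + 1 \<le> attempt_factor * work n"
proof -
  let ?root = "sqrt (4 * (real n ^ 3 * real (matmul_ticks n)))"
  have "4 * (real n ^ 3 * real (matmul_ticks n)) \<le> 4 * (real n ^ 3 * (\<kappa> * real n powr \<tau>))" using matmul_ticks_le(1) by (intro mult_left_mono) auto
  also have "\<dots> = 4 * \<kappa> * (work n)\<^sup>2" by (simp add: work_bounds(3))
  also have "\<dots> \<le> 4 * \<kappa>\<^sup>2 * (work n)\<^sup>2" using \<kappa>_ge by (intro mult_right_mono) (auto simp: power2_eq_square)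
  also have "\<dots> = (2 * \<kappa> * work n)\<^sup>2" by (simp add: power_mult_distrib)
  finally have "?root \<le> 2 * \<kappa> * work n" using \<kappa>_ge work_bounds(1) n_real by (intro real_le_lsqrt) auto
  moreover have "0 \<le> ?root" by simp
  then have "real (attempt_limit n) \<le> 44 * ?root + 8 * real (matmul_ticks n) + 1" unfolding attempt_limit_def by linarith
  moreover have "real (matmul_ticks n) \<le> \<kappa> * work n" using matmul_ticks_le(1) mult_left_mono[OF work_bounds(2), of \<kappa>] \<kappa>_ge by linarith
  moreover have "2 \<le> 2 * \<kappa> * work n" using mult_mono[of 1 \<kappa> 1 "work n"] \<kappa>_ge work_bounds(1) n_real by simp
  ultimately show ?thesis by (simp add: attempt_factor_def)
qed

lemma attempt_ticks_le_limit: "1 \<le> q \<Longrightarrow> n \<le> q * q \<Longrightarrow> n * q * q \<le> 4 * matmul_ticks n \<Longrightarrow> attempt_ticks n q \<le> attempt_limit n"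
  unfolding attempt_limit_def using attempt_ticks_le_sqrt[OF n_ge_1, of q "matmul_ticks n"] by linarith

lemma matmul_program_multiplies_bits:
  assumes "c0 * log 2 (3 * real n + 2) \<le> real v"
  shows "multiplies_bits P v (3 * n) (matmul_ticks n)"
  unfolding multiplies_bits_def
proof (intro allI impI)
  fix A B s assume bits: "\<forall>i<3 * n. \<forall>j<3 * n. A i j \<le> 1 \<and> B i j \<le> 1" and input: "matmul_input v (3 * n) A B s"
  have "\<exists>s'. halts_within v P (C0 * real (3 * n) powr \<tau>) s s' \<and> matmul_output (3 * n) (\<lambda>i j. \<Sum>k<3 * n. A i k * B k j) s'"
    by (rule multiplication[OF _ bits _ input]) (use n_ge_1 assms in \<open>simp_all add: add.assoc\<close>)
  then obtain t where t: "real t \<le> C0 * real (3 * n) powr \<tau>" "halted P ((step v P ^^ t) s)"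
    "matmul_output (3 * n) (\<lambda>i j. \<Sum>k<3 * n. A i k * B k j) ((step v P ^^ t) s)" unfolding halts_within_def by blast
  have "t \<le> matmul_ticks n" using t(1) matmul_ticks_ge(1) by linarith
  then show "\<exists>t\<le>matmul_ticks n. halted P ((step v P ^^ t) s) \<and> matmul_output (3 * n) (\<lambda>i j. \<Sum>k<3 * n. A i k * B k j) ((step v P ^^ t) s)"
    using t by blast
qed

end

end

locale apsp_instance = matmul_program P C0 c0 \<tau> for P C0 c0 \<tau> +
  fixes n :: nat and H :: "nat \<Rightarrow> nat \<Rightarrow> ereal" and \<epsilon> :: real and w :: nat and s :: state
  assumes digraph: "weighted_digraph n H" and eps_bounds: "0 < \<epsilon>" "\<epsilon> < 1 / 10"
    and word_size: "word_factor * (log 2 (real n / \<epsilon>) + log 2 (2 + log 2 (max_weight n H))) \<le> real w"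
    and input: "apsp_input w n H \<epsilon> s"
begin

abbreviation "M \<equiv> max_weight n H"
abbreviation "e \<equiv> nat (- fl_exponent \<epsilon>)"
abbreviation "steps \<equiv> num_steps n e"
abbreviation "search_depth \<equiv> doublings 1 (matmul_ticks n)"

definition X :: real where "X = real n / \<epsilon>"

definition input_size :: real where "input_size = X * (2 + log 2 M)"

definition l :: real where "l = ln X"

lemma n_pos: "1 \<le> n"
  using digraph by (simp add: weighted_digraph_def)

lemma M_ge_1: "1 \<le> M"
  by (rule max_weight_ge(2))

lemma input_size_bounds: "10 \<le> X" "X \<le> input_size" "2 + log 2 M \<le> input_size" "5 * real n \<le> input_size" "10 \<le> input_size"
proof -
  have "real n * (10 * \<epsilon>) \<le> real n * 1" using eps_bounds by (intro mult_left_mono) auto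
  then have "10 * real n \<le> X" unfolding X_def using eps_bounds by (simp add: field_simps)
  then show X: "10 \<le> X" using n_pos by linarith
  have M: "2 \<le> 2 + log 2 M" using M_ge_1 by simp
  then have "X * 1 \<le> X * (2 + log 2 M)" "1 * (2 + log 2 M) \<le> X * (2 + log 2 M)"
    using X by (intro mult_left_mono mult_right_mono; simp)+
  then show "X \<le> input_size" "2 + log 2 M \<le> input_size" by (simp_all only: input_size_def mult_1 mult_1_right)
  then show "5 * real n \<le> input_size" "10 \<le> input_size" using \<open>10 * real n \<le> X\<close> X by linarith+
qed

lemma word_size_ge: "word_factor * log 2 input_size \<le> real w"
proof -
  have "0 < 2 + log 2 M" using M_ge_1 zero_le_log_cancel_iff[of 2 M] by linarith
  then have "log 2 input_size = log 2 X + log 2 (2 + log 2 M)" unfolding input_size_def using input_size_bounds(1) by (intro log_mult_pos) auto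
  then show ?thesis using word_size by (simp add: X_def)
qed

lemma range_less_modulus: "real range_const * input_size ^ 7 < 2 ^ (w div 4)"
proof -
  have "1 \<le> log 2 input_size" using input_size_bounds(5) by simp
  then have "real (4 * (8 + range_const) + 4) * log 2 input_size \<le> word_factor * log 2 input_size"
    unfolding word_factor_def using c0_pos by (intro mult_right_mono) auto
  then have "input_size ^ (8 + range_const) \<le> 2 ^ (w div 4)" using word_size_ge input_size_bounds(5) by (intro power_le_guest_modulus) linarith+
  moreover have "real range_const < 2 ^ range_const" using of_nat_less_two_power[of range_const] by simp
  then have "real range_const < input_size ^ range_const"
    using input_size_bounds(5) power_mono[of 2 input_size range_const] by linarith
  then have "real range_const * input_size ^ 7 < input_size ^ range_const * input_size ^ 8"
    using input_size_bounds(5) power_increasing[of 7 8 input_size] by (intro mult_less_le_imp_less) auto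
  ultimately show ?thesis by (simp add: power_add mult.commute)
qed

lemma less_modulus:
  assumes "real x \<le> b * input_size ^ j" "b \<le> 10 ^ 11 * real matmul_const" "j \<le> 7"
  shows "x < 2 ^ (w div 4)"
proof -
  have "b * input_size ^ j \<le> real range_const * input_size ^ j"
    using assms(2) input_size_bounds(5) by (intro mult_right_mono) (auto simp: range_const_def)
  also have "\<dots> \<le> real range_const * input_size ^ 7" using assms(3) input_size_bounds(5) by (intro mult_left_mono power_increasing) auto
  finally have "real x < 2 ^ (w div 4)" using assms(1) range_less_modulus by linarith
  then show ?thesis by simp
qed

lemma log_le_l: "1 \<le> l" "log 2 X \<le> 2 * l" "log 2 (real n) \<le> 2 * l"
proof -
  have "exp 1 \<le> X" using exp_le input_size_bounds(1) by linarith
  then show "1 \<le> l" unfolding l_def using input_size_bounds(1) by (subst ln_ge_iff) auto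
  have "log 2 X * (1 / 2) \<le> log 2 X * ln 2" using ln_2_bounds(1) input_size_bounds(1) by (intro mult_left_mono) auto
  then show X: "log 2 X \<le> 2 * l" by (simp add: l_def log_def)
  have "real n \<le> X" unfolding X_def using eps_bounds n_pos by (simp add: field_simps)
  then have "log 2 (real n) \<le> log 2 X" using n_pos by (intro log_mono) auto
  with X show "log 2 (real n) \<le> 2 * l" by linarith
qed

lemma eps_exponent: "1 / 2 ^ e \<le> \<epsilon>" "2 ^ e \<le> 2 / \<epsilon>"
proof -
  have "fl_exponent \<epsilon> < 0" using eps_bounds by (simp add: fl_exponent_def)
  then have "2 powr fl_exponent \<epsilon> = 1 / 2 ^ e" by (simp add: powr_real_of_int inverse_eq_divide)
  from fl_exponent_bounds[OF eps_bounds(1), unfolded this] show "1 / 2 ^ e \<le> \<epsilon>" "2 ^ e \<le> 2 / \<epsilon>"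
    using eps_bounds(1) by (simp_all add: field_simps)
qed

lemma levels_le: "real (levels n) + 2 \<le> 5 * l" "levels n \<le> n"
  using doublings_le_log[OF n_pos] log_le_l doublings_le_self[of 1 n] by (simp_all add: levels_def)

lemma steps_le: "real steps \<le> 1280 * l / \<epsilon>" "real steps \<le> 768 * X" "real steps \<le> 768 * input_size"
proof -
  let ?L = "real (levels n) + 2"
  have "1 * 2 ^ doublings 1 (levels n + 2) < 2 * (levels n + 2)" by (rule doublings_less_double) auto
  then have "real (2 ^ doublings 1 (levels n + 2)) \<le> real (2 * (levels n + 2))" by (simp only: of_nat_le_iff mult_1 less_imp_le)
  then have "2 ^ doublings 1 (levels n + 2) * 2 ^ e \<le> (2 * ?L) * (2 / \<epsilon>)" using eps_exponent(2) eps_bounds by (intro mult_mono) auto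
  then have "64 * (2 ^ doublings 1 (levels n + 2) * 2 ^ e) \<le> 64 * ((2 * ?L) * (2 / \<epsilon>))" by (rule mult_left_mono) simp
  moreover have "64 * ((2 * ?L) * (2 / \<epsilon>)) = 256 * ?L / \<epsilon>" by simp
  moreover have "real steps = 64 * (2 ^ doublings 1 (levels n + 2) * 2 ^ e)" by (simp add: num_steps_def steps_exponent_def power_add)
  ultimately have U: "real steps \<le> 256 * ?L / \<epsilon>" by linarith
  have "256 * ?L / \<epsilon> \<le> 256 * (5 * l) / \<epsilon>" using levels_le(1) eps_bounds by (intro divide_right_mono mult_left_mono) auto
  then show "real steps \<le> 1280 * l / \<epsilon>" using U by simp
  have "256 * ?L / \<epsilon> \<le> 256 * (3 * real n) / \<epsilon>" using levels_le(2) n_pos eps_bounds by (intro divide_right_mono mult_left_mono) auto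
  then show "real steps \<le> 768 * X" using U by (simp add: X_def)
  then show "real steps \<le> 768 * input_size" using input_size_bounds(2) by linarith
qed

lemma steps_exponent_le: "real (steps_exponent n e) \<le> 12 * l"
proof -
  have "real (steps_exponent n e) = log 2 (real steps)" by (simp add: num_steps_def log_nat_power)
  also have "\<dots> \<le> log 2 (2 ^ 10 * X)" using steps_le(2) input_size_bounds(1) by (intro log_mono) (auto simp: num_steps_def)
  also have "\<dots> = 10 + log 2 X" using input_size_bounds(1) log_nat_power[of 2 2 10] by (subst log_mult_pos) auto
  finally show ?thesis using log_le_l by linarith
qed

lemma search_depth_le: "real search_depth + 1 \<le> depth_factor * l" "search_depth \<le> matmul_ticks n" "matmul_ticks n \<le> 4 ^ search_depth"
proof -
  note ticks = matmul_ticks_ge(3)[OF n_pos]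
  have "log 2 (real (matmul_ticks n)) \<le> log 2 (\<kappa> * real n ^ 3)" using matmul_ticks_le(2)[OF n_pos] ticks by (intro log_mono) auto
  also have "\<dots> = log 2 \<kappa> + 3 * log 2 (real n)" using \<kappa>_ge n_pos by (subst log_mult_pos) (auto simp: log_nat_power)
  finally have "real search_depth + 1 \<le> 2 + log 2 \<kappa> + 6 * l" using doublings_le_log[OF ticks] log_le_l(3) by linarith
  moreover have "(2 + log 2 \<kappa>) * 1 \<le> (2 + log 2 \<kappa>) * l" using log_le_l(1) \<kappa>_ge by (intro mult_left_mono) (auto intro: add_nonneg_nonneg)
  ultimately show "real search_depth + 1 \<le> depth_factor * l" by (simp add: depth_factor_def algebra_simps)
  show "search_depth \<le> matmul_ticks n" by (rule doublings_le_self) simp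
  have "matmul_ticks n \<le> 2 ^ search_depth" using doublings_ge[of 1 "matmul_ticks n"] by simp
  then show "matmul_ticks n \<le> 4 ^ search_depth" using power_mono[of "2::nat" 4 search_depth] by simp
qed

lemma matmul_ticks_le_size: "real (matmul_ticks n) \<le> \<kappa> * input_size ^ 3"
proof -
  have "real n ^ 3 \<le> input_size ^ 3" using input_size_bounds(4) by (intro power_mono) auto
  then have "\<kappa> * real n ^ 3 \<le> \<kappa> * input_size ^ 3" using \<kappa>_ge by (intro mult_left_mono) auto
  then show ?thesis using matmul_ticks_le(2)[OF n_pos] by linarith
qed

lemma capacity: "1000 \<le> (2::nat) ^ (w div 4)" "100 * (n * n) + 100 < 2 ^ (w div 4)" "16 * matmul_ticks n < 2 ^ (w div 4)"
  "100 * (steps * steps * steps) < 2 ^ (w div 4)"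
proof -
  have "1000 < (2::nat) ^ (w div 4)" by (rule less_modulus[of _ 1000 0]) (use matmul_const_ge in auto)
  then show "1000 \<le> (2::nat) ^ (w div 4)" by simp
  have "real n ^ 2 \<le> input_size ^ 2" "1 \<le> input_size ^ 2"
    using input_size_bounds(4,5) by (auto intro!: power_mono one_le_power)
  then have "real (100 * (n * n) + 100) \<le> 200 * input_size ^ 2" by (simp add: power2_eq_square)
  then show "100 * (n * n) + 100 < 2 ^ (w div 4)" by (intro less_modulus[of _ 200 2]) (use matmul_const_ge in auto)
  show "16 * matmul_ticks n < 2 ^ (w div 4)"
    by (rule less_modulus[of _ "16 * \<kappa>" 3]) (use matmul_ticks_le_size matmul_const_ge in \<open>auto simp: \<kappa>_def\<close>)
  have "real steps ^ 3 \<le> (768 * input_size) ^ 3" using steps_le(3) by (intro power_mono) auto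
  then have "real steps ^ 3 \<le> 452984832 * input_size ^ 3" by (simp add: power_mult_distrib)
  then show "100 * (steps * steps * steps) < 2 ^ (w div 4)"
    by (intro less_modulus[of _ 45298483200 3]) (use matmul_const_ge in \<open>auto simp: power3_eq_cube\<close>)
qed

lemma slot_capacity: "2 * (levels n * (steps * (Suc search_depth * (n + 1)))) \<le> 2 ^ (w div 4)"
proof -
  let ?V = input_size
  have "\<kappa> * 1 \<le> \<kappa> * ?V ^ 3" using input_size_bounds(5) \<kappa>_ge by (intro mult_left_mono one_le_power) auto
  then have "real search_depth + 1 \<le> 2 * \<kappa> * ?V ^ 3" using search_depth_le(2) matmul_ticks_le_size \<kappa>_ge by linarith
  then have "(real search_depth + 1) * (real n + 1) \<le> (2 * \<kappa> * ?V ^ 3) * ?V" using input_size_bounds(4,5) \<kappa>_ge by (intro mult_mono) auto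
  then have per_level: "real steps * ((real search_depth + 1) * (real n + 1)) \<le> (768 * ?V) * ((2 * \<kappa> * ?V ^ 3) * ?V)"
    by (rule mult_mono[OF steps_le(3)]) (use input_size_bounds(5) in auto)
  have "real (levels n) \<le> ?V" using levels_le(2) input_size_bounds(4) by linarith
  then have "real (levels n) * (real steps * ((real search_depth + 1) * (real n + 1))) \<le> ?V * ((768 * ?V) * ((2 * \<kappa> * ?V ^ 3) * ?V))"
    by (rule mult_mono[OF _ per_level]) (use input_size_bounds(5) in auto)
  also have "\<dots> = 1536 * \<kappa> * ?V ^ 6" by (simp add: power_def numeral_eq_Suc)
  finally have "2 * (levels n * (steps * (Suc search_depth * (n + 1)))) < 2 ^ (w div 4)"
    by (intro less_modulus[of _ "3072 * \<kappa>" 6]) (use matmul_const_ge in \<open>auto simp: \<kappa>_def algebra_simps\<close>)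
  then show ?thesis by simp
qed

lemma steps_squared_le: "real steps * real steps \<le> 589824 * (input_size * input_size)"
  using mult_mono[OF steps_le(3) steps_le(3)] input_size_bounds(5) by simp

lemma input_encodes: "i < n \<Longrightarrow> j < n \<Longrightarrow> (mem s (2 * (i * n + j)), mem s (2 * (i * n + j) + 1)) = fl_encode w (H i j)"
  using input unfolding apsp_input_def by blast

lemma width_ge: "1 \<le> w"
  using capacity(1) by (cases w) auto

lemma finite_input:
  assumes ij: "i < n" "j < n" and "mem s (2 * (i * n + j)) \<noteq> 0"
  shows "2 ^ (w - 1) \<le> mem s (2 * (i * n + j))" "mem s (2 * (i * n + j)) < 2 ^ w"
    "(mem s (2 * (i * n + j) + 1) + 1) * (steps * steps) + 2 * steps \<le> 2 ^ (w div 4)"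
proof -
  let ?V = input_size and ?k = "mem s (2 * (i * n + j) + 1)"
  have "H i j \<noteq> \<infinity>" using input_encodes[OF ij] assms(3) by (auto simp: fl_encode_def)
  then obtain x where x: "H i j = ereal x" "1 \<le> x" using weighted_digraph_cases[OF digraph ij] by metis
  have code: "mem s (2 * (i * n + j)) = fl_mantissa w x" "?k = nat (fl_exponent x)" using input_encodes[OF ij] x by (auto simp: fl_encode_def)
  have "x = x / 2 ^ ?k * 2 ^ nat (fl_exponent x)" unfolding code(2) by simp
  from fl_mantissa_bounds(3,4)[OF x(2) width_ge this]
  show "2 ^ (w - 1) \<le> mem s (2 * (i * n + j))" "mem s (2 * (i * n + j)) < 2 ^ w" unfolding code(1) .
  have "0 < x" using x(2) by simp
  from fl_exponent_bounds(1)[OF this] have "2 powr real ?k \<le> x" unfolding code(2) fl_exponent_nat(1)[OF x(2)] .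
  also have "x \<le> M" using max_weight_ge(1)[of i n j H x] ij x(1) by simp
  finally have "real ?k \<le> log 2 M" using M_ge_1 by (subst le_log_iff) auto
  then have "(real ?k + 1) * (real steps * real steps) \<le> ?V * (589824 * (?V * ?V))"
    using input_size_bounds(3,5) by (intro mult_mono steps_squared_le) auto
  also have "\<dots> = 589824 * ?V ^ 3" by (simp add: power3_eq_cube)
  finally have "(real ?k + 1) * (real steps * real steps) \<le> 589824 * ?V ^ 3" .
  moreover have "?V \<le> ?V ^ 3" using power_increasing[of 1 3 ?V] input_size_bounds(5) by simp
  ultimately have "(real ?k + 1) * (real steps * real steps) + 2 * real steps \<le> 591360 * ?V ^ 3" using steps_le(3) by linarith
  then have "real ((?k + 1) * (steps * steps) + 2 * steps) \<le> 591360 * ?V ^ 3" by (simp only: of_nat_add of_nat_mult of_nat_1 of_nat_numeral)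
  then have "(?k + 1) * (steps * steps) + 2 * steps < 2 ^ (w div 4)" by (rule less_modulus) (use matmul_const_ge in auto)
  then show "(?k + 1) * (steps * steps) + 2 * steps \<le> 2 ^ (w div 4)" by simp
qed

lemma code_capacity: "real steps * real steps * (1 + log 2 (real n * M)) < real (2 ^ (w div 4))"
proof -
  have "log 2 (real n) \<le> log 2 (2 ^ n)" using n_pos by (intro log_mono) (auto simp: less_imp_le)
  then have "log 2 (real n) \<le> real n" by (simp add: log_nat_power)
  moreover have "log 2 (real n * M) = log 2 (real n) + log 2 M" using n_pos M_ge_1 by (intro log_mult_pos) auto
  ultimately have "1 + log 2 (real n * M) \<le> 2 * input_size" using input_size_bounds by linarith
  then have "real steps * real steps * (1 + log 2 (real n * M)) \<le> real steps * real steps * (2 * input_size)" by (rule mult_left_mono) simp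
  also have "\<dots> \<le> 589824 * (input_size * input_size) * (2 * input_size)"
    using input_size_bounds(5) by (intro mult_right_mono steps_squared_le) auto
  also have "\<dots> = 1179648 * input_size ^ 3" by (simp add: power3_eq_cube)
  also have "\<dots> \<le> real range_const * input_size ^ 7"
    using input_size_bounds(5) matmul_const_ge by (intro mult_mono power_increasing) (auto simp: range_const_def)
  finally show ?thesis using range_less_modulus by simp
qed

lemma guest_word_size: "c0 * log 2 (3 * real n + 2) \<le> real (w div 4)"
proof -
  have "1 \<le> log 2 input_size" using input_size_bounds(5) by simp
  then have "(4 * c0 + 4) * log 2 input_size \<le> word_factor * log 2 input_size" unfolding word_factor_def by (intro mult_right_mono) auto
  then have "4 * (c0 * log 2 input_size) + 4 * 1 \<le> real w" using word_size_ge \<open>1 \<le> log 2 input_size\<close> by (simp add: algebra_simps)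
  moreover have "real w \<le> real (4 * (w div 4) + 3)" by (simp only: of_nat_le_iff)
  moreover have "3 * real n + 2 \<le> input_size" using input_size_bounds(4) n_pos by linarith
  then have "log 2 (3 * real n + 2) \<le> log 2 input_size" by (intro log_mono) auto
  then have "c0 * log 2 (3 * real n + 2) \<le> c0 * log 2 input_size" using c0_pos by (intro mult_left_mono) auto
  ultimately show ?thesis by simp
qed

sublocale ram w P "2 ^ w" "2 ^ (w div 4)" "w div 4"
  by standard (use capacity(1) in auto)

sublocale squaring w P "2 ^ w" "2 ^ (w div 4)" "w div 4" n "matmul_ticks n" search_depth "attempt_limit n"
  by standard (use n_pos capacity search_depth_le(3) attempt_ticks_le_limit[OF n_pos] matmul_program_multiplies_bits[OF n_pos guest_word_size] in auto)

sublocale apsp_solver w P "2 ^ w" "2 ^ (w div 4)" "w div 4" n "matmul_ticks n" search_depth "attempt_limit n" e "mem s" H \<epsilon>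
proof (unfold_locales, goal_cases)
  case 3
  then show ?case using slot_capacity by (simp only: slots_def)
qed (use matmul_ticks_ge(2)[OF n_pos] capacity(4) finite_input digraph eps_exponent(1) eps_bounds(2) input_encodes code_capacity in auto)

sublocale solver_cost w P "2 ^ w" "2 ^ (w div 4)" "w div 4" n "matmul_ticks n" search_depth "attempt_limit n" e "mem s"
  l "work n" \<epsilon> depth_factor attempt_factor
  by standard (use log_le_l(1) eps_bounds work_bounds(1)[OF n_pos] factors_ge_1 steps_le(1) steps_exponent_le levels_le(1)
      search_depth_le(1) attempt_limit_le[OF n_pos] in auto)

lemma runtime_le:
  assumes "t \<le> main_ticks"
  shows "real (8 + step_factor P main * Suc t) \<le> time_factor * (work n / \<epsilon>) * l ^ 3"
proof -
  define Q where "Q = work n / \<epsilon> * l ^ 3"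
  have "1 * 1 \<le> Q" using T_bounds(3) log_le_l(1) unfolding Z_def Q_def by (intro mult_mono one_le_power) auto
  then have Q: "1 \<le> Q" by simp
  have "real t \<le> real main_ticks" using assms by simp
  then have "real t + 1 \<le> (tick_factor + 1) * Q"
    using main_ticks_le Q unfolding tick_factor_def distrib_right Q_def[symmetric] by linarith
  then have "real (step_factor P main) * (real t + 1) \<le> real (step_factor P main) * ((tick_factor + 1) * Q)" by (rule mult_left_mono) simp
  then have "real (8 + step_factor P main * Suc t) \<le> 8 * Q + real (step_factor P main) * ((tick_factor + 1) * Q)"
    using Q by (simp add: algebra_simps)
  also have "\<dots> = time_factor * Q" by (simp add: time_factor_def algebra_simps)
  finally show ?thesis by (simp add: Q_def mult.assoc)
qed

lemma program_correct:
  "\<exists>s'. halts_within w (program P main) (time_factor * (work n / \<epsilon>) * l ^ 3) s s' \<and>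
     (\<forall>u<n. \<forall>v<n. distance n H u v \<le> apsp_output w n s' u v \<and> apsp_output w n s' u v \<le> ereal (1 + \<epsilon>) * distance n H u v)"
proof -
  obtain t st D where big: "big_step main (initial_store w n e (mem s)) t st" "t \<le> main_ticks"
    and sq: "log_squarings n U L input_dist D"
    and out: "\<And>i j. i < n \<Longrightarrow> j < n \<Longrightarrow> output_ok (D i j) i j (arr st aio 0 (2 * (i * n + j))) (arr st aio 0 (2 * (i * n + j) + 1))"
    using main_correct unfolding ensures_def by blast
  have regs: "pc s = 0" "reg s 0 = w" "reg s 1 = n" "reg s 3 = e" "\<And>r. 4 \<le> r \<Longrightarrow> reg s r = 0"
    using input by (auto simp: apsp_input_def)
  have mem: "mem s a = 0" if "2 ^ (w div 4) \<le> a" for a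
  proof -
    have "2 * n * n \<le> a" using that capacity(2) by simp
    then show ?thesis using input unfolding apsp_input_def by blast
  qed
  obtain s' where run: "halts_within w (program P main) (real (8 + step_factor P main * Suc t)) s s'"
    and copy: "\<forall>j<2 ^ (w div 4). mem s' j = arr st aio 0 j" using program_run[OF regs mem big(1)] by blast
  have "distance n H u v \<le> apsp_output w n s' u v \<and> apsp_output w n s' u v \<le> ereal (1 + \<epsilon>) * distance n H u v" if "u < n" "v < n" for u v
  proof -
    have "apsp_output w n s' u v = fl_decode w (arr st aio 0 (2 * (u * n + v)), arr st aio 0 (2 * (u * n + v) + 1))"
      using copy io_address[OF that] by (simp add: apsp_output_def)
    then show ?thesis using output_accurate[OF sq that out[OF that]] by simp
  qed
  then show ?thesis using halts_within_mono[OF run runtime_le[OF big(2)]] by blast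
qed

end

theorem apsp_from_matmul:
  assumes "matmul_in_time \<tau>" and \<tau>: "2 \<le> \<tau>" "\<tau> \<le> 3"
  shows "approx_apsp_in_soft_time (\<lambda>n \<epsilon>. real n powr ((\<tau> + 3) / 2) / \<epsilon>)"
proof -
  obtain P C0 c0 where "matmul_program P C0 c0 \<tau>" using assms unfolding matmul_in_time_def matmul_program_def by blast
  then interpret matmul_program P C0 c0 \<tau> .
  have "\<exists>s'. halts_within w (program P main) (time_factor * (real n powr ((\<tau> + 3) / 2) / \<epsilon>) * ln (real n / \<epsilon>) ^ 3) s s' \<and>
      (\<forall>u<n. \<forall>v<n. distance n H u v \<le> apsp_output w n s' u v \<and> apsp_output w n s' u v \<le> ereal (1 + \<epsilon>) * distance n H u v)"
    if "weighted_digraph n H" "0 < \<epsilon>" "\<epsilon> < 1 / 10" "apsp_input w n H \<epsilon> s"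
      "word_factor * (log 2 (real n / \<epsilon>) + log 2 (2 + log 2 (max_weight n H))) \<le> real w" for n H \<epsilon> w s
  proof -
    interpret apsp_instance P C0 c0 \<tau> n H \<epsilon> w s by standard (use that in auto)
    show ?thesis using program_correct unfolding work_def l_def X_def .
  qed
  moreover have "0 < word_factor" unfolding word_factor_def using c0_pos by (intro add_nonneg_pos) auto
  ultimately show ?thesis unfolding approx_apsp_in_soft_time_def
    by (intro exI[of _ "program P main"] exI[of _ time_factor] exI[of _ 3] exI[of _ word_factor]) blast
qed

lemma approx_apsp_mono:
  assumes "approx_apsp_in_soft_time (\<lambda>n \<epsilon>. real n powr x / \<epsilon>)" "x \<le> y"
  shows "approx_apsp_in_soft_time (\<lambda>n \<epsilon>. real n powr y / \<epsilon>)"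
proof -
  let ?accurate = "\<lambda>n G \<epsilon> w s'. \<forall>u<n. \<forall>v<n. distance n G u v \<le> apsp_output w n s' u v \<and> apsp_output w n s' u v \<le> ereal (1 + \<epsilon>) * distance n G u v"
  obtain P C k c where "c > 0" and solves: "\<And>n G \<epsilon> w s. weighted_digraph n G \<Longrightarrow> 0 < \<epsilon> \<Longrightarrow> \<epsilon> < 1 / 10 \<Longrightarrow>
      c * (log 2 (real n / \<epsilon>) + log 2 (2 + log 2 (max_weight n G))) \<le> real w \<Longrightarrow> apsp_input w n G \<epsilon> s \<Longrightarrow>
      \<exists>s'. halts_within w P (C * (real n powr x / \<epsilon>) * ln (real n / \<epsilon>) ^ k) s s' \<and> ?accurate n G \<epsilon> w s'"
    using assms(1) unfolding approx_apsp_in_soft_time_def by blast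
  have "\<exists>s'. halts_within w P (max C 0 * (real n powr y / \<epsilon>) * ln (real n / \<epsilon>) ^ k) s s' \<and> ?accurate n G \<epsilon> w s'"
    if G: "weighted_digraph n G" "0 < \<epsilon>" "\<epsilon> < 1 / 10"
      "c * (log 2 (real n / \<epsilon>) + log 2 (2 + log 2 (max_weight n G))) \<le> real w" "apsp_input w n G \<epsilon> s" for n G \<epsilon> w s
  proof -
    have n: "1 \<le> real n" using G(1) by (simp add: weighted_digraph_def)
    have "C * (real n powr x / \<epsilon>) \<le> max C 0 * (real n powr y / \<epsilon>)"
      using assms(2) n G(2) by (intro mult_mono divide_right_mono powr_mono) auto
    moreover have "1 \<le> real n / \<epsilon>" using n G(2,3) by (simp add: field_simps)
    ultimately have "C * (real n powr x / \<epsilon>) * ln (real n / \<epsilon>) ^ k \<le> max C 0 * (real n powr y / \<epsilon>) * ln (real n / \<epsilon>) ^ k"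
      by (intro mult_right_mono) auto
    then show ?thesis using solves[OF G] halts_within_mono by blast
  qed
  then show ?thesis using \<open>c > 0\<close> unfolding approx_apsp_in_soft_time_def
    by (intro exI[of _ P] exI[of _ "max C 0"] exI[of _ k] exI[of _ c]) blast
qed

theorem theorem3:
  "(\<forall>\<delta>>0. approx_apsp_in_soft_time (\<lambda>n \<epsilon>. real n powr ((\<omega> + \<delta> + 3) / 2) / \<epsilon>)) \<and>
   (matmul_in_time \<omega> \<longrightarrow> approx_apsp_in_soft_time (\<lambda>n \<epsilon>. real n powr ((\<omega> + 3) / 2) / \<epsilon>))"
proof (intro conjI allI impI)
  fix \<delta> :: real assume "0 < \<delta>"
  then have "Inf {\<tau>. matmul_in_time \<tau>} < \<omega> + \<delta>" by (simp add: omega_def)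
  then obtain \<tau> where \<tau>: "matmul_in_time \<tau>" "\<tau> < \<omega> + \<delta>" using cInf_lessD[of "{\<tau>. matmul_in_time \<tau>}"] matmul_in_time_3 by auto
  define \<sigma> where "\<sigma> = min \<tau> 3"
  have "matmul_in_time \<sigma>" using \<tau>(1) matmul_in_time_3 by (simp add: \<sigma>_def min_def)
  moreover have "2 \<le> \<sigma>" "\<sigma> \<le> 3" using matmul_in_time_ge_2[OF \<tau>(1)] by (auto simp: \<sigma>_def)
  ultimately have "approx_apsp_in_soft_time (\<lambda>n \<epsilon>. real n powr ((\<sigma> + 3) / 2) / \<epsilon>)" by (rule apsp_from_matmul)
  then show "approx_apsp_in_soft_time (\<lambda>n \<epsilon>. real n powr ((\<omega> + \<delta> + 3) / 2) / \<epsilon>)"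
    by (rule approx_apsp_mono) (use \<tau>(2) in \<open>auto simp: \<sigma>_def\<close>)
next
  assume attained: "matmul_in_time \<omega>"
  have "bdd_below {\<tau>. matmul_in_time \<tau>}" using matmul_in_time_ge_2 by (auto intro!: bdd_belowI[of _ 2])
  then have "\<omega> \<le> 3" unfolding omega_def using matmul_in_time_3 by (intro cInf_lower) auto
  then show "approx_apsp_in_soft_time (\<lambda>n \<epsilon>. real n powr ((\<omega> + 3) / 2) / \<epsilon>)"
    using apsp_from_matmul[OF attained matmul_in_time_ge_2[OF attained]] by blast
qed

end
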